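(* Let $X$ be a Banach lattice with a directed bounded generating system $\Pi$ such that $\{\sigma(X):\sigma\in\Pi\}\subseteq\mathfrak F_X^{\star,\mu}$ for some $\mu\ge1$. For each $\sigma\in\Pi$, let $(x_i^{(\sigma)})$ be a basis for $\sigma(X)$ satisfying $(\star)$ with constant $\mu$ in each summand, and let $(e_n^{(\sigma)})$ be the corresponding sequence of natural projections. Let $\mathcal A$ be a closed Riesz algebra ideal of $\mathcal L^r(X)$ and let $\mathfrak X$ be a Banach lattice $\mathcal A$-module. Suppose that, for each $\sigma\in\Pi$: (a) $(x_i^{(\sigma)})$ is shrinking; (b) $\mathcal A_\sigma\mathcal A_\sigma=\mathcal A_\sigma$; (c) the linear maps $E_\sigma,F_\sigma:\mathfrak X'\to\mathfrak X'$ defined by $E_\sigma x'=\sup_ne_n^{(\sigma)}x'$ and $F_\sigma x'=\sup_nx'e_n^{(\sigma)}$ $(x'\in\mathfrak X'_+)$ have weak*-closed ranges; (d) $\sup_ne_n^{(\sigma)}ax'=ax'$ and $\sup_nx'ae_n^{(\sigma)}=x'a$ for all $a\in(\mathcal A_\sigma)_+$, $x'\in(\mathfrak X_\sigma')_+$; and suppose at least one of the following holds: (A) for each $\sigma\in\Pi$, at least one of the following two conditions is satisfied, where $q_i^{(\sigma)}:=(x_i^{(\sigma)})^*\otimes x_i^{(\sigma)}\in\mathcal A_\sigma$ and $((x_i^{(\sigma)})^* )$ are the functionals biorthogonal to $(x_i^{(\sigma)})$: (i) for each $i\in\mathbb N$, if $(\xi_n)\subset\mathfrak X'_\sigma$ is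 such that either $\xi_n\in q_n^{(\sigma)}\mathfrak X_\sigma'q_i^{(\sigma)}$ for all $n$ or $\xi_n\in q_i^{(\sigma)}\mathfrak X_\sigma'q_n^{(\sigma)}$ for all $n$, then $(\xi_n)$ has no subsequence equivalent to the unit vector basis of $c_0$; or (ii) $\sigma(X)$ is reflexive and $\dim(q_i^{(\sigma)}\mathfrak X_\sigma'q_j^{(\sigma)})<\infty$ for some (hence every) pair $i,j\in\mathbb N$; (B) every bounded derivation from $\mathcal A^r(X)$ to $\mathfrak X'$ is inner. Then every bounded derivation $D:\mathcal A\to\mathfrak X'$ such that $w^*\text{-}\lim_\sigma D(\sigma a\sigma)=D(a)$ for every $a\in\mathcal A$ is regular.
   Context: The underlying field is $\mathbb R$ or $\mathbb C$ (complex Banach lattices are complexifications of real ones, with $\|x\|=\|\,|x|\,\|$). Primes denote topological duals. A linear map between Riesz spaces is positive if it maps positive cone into positive cone, regular if it is a linear combination of positive linear maps. For a Banach lattice $X$, $\mathcal L^r(X)$ is the algebra of regular operators on $X$ with the norm $\|T\|_r=\inf\{\|S\|:S\text{ bounded},\ |Tx|\le S|x|\ (x\in X)\}$. $\mathcal F(X)$ is the space of continuous finite-rank operators and $\mathcal A^r(X)$ its closure in $\mathcal L^r(X)$. For $\lambda\in X'$, $\xi\in X$, $\lambda\otimes\xi$ is the operator $x\mapsto\lambda(x)\xi$. A Riesz algebra is an associative algebra which is a Riesz space with $ab\ge0$ for $a,b\ge0$; a Banach lattice algebra is a Riesz algebra with a norm making it both a Banach lattice and a Banach algebra. A Riesz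 algebra ideal is a (two-sided) algebra ideal which is also a Riesz subspace; for an algebra $\mathcal B$, $\mathcal B\mathcal B:=\{ab:a,b\in\mathcal B\}$. A Banach lattice $\mathcal A$-module is an $\mathcal A$-(bi)module $\mathfrak X$ which is a Banach lattice, with $ax,xa\in\mathfrak X_+$ for $a\in\mathcal A_+,x\in\mathfrak X_+$, and with a constant $M$ such that $\|ax\|,\|xa\|\le M\|a\|\|x\|$. Its dual $\mathfrak X'$ is a Banach lattice $\mathcal A$-module with $(ax')(x):=x'(xa)$, $(x'a)(x):=x'(ax)$ and the dual order. A derivation is a linear map $D$ with $D(ab)=aD(b)+D(a)b$; it is inner if $D(a)=ax'-x'a$ for all $a$, for some fixed $x'\in\mathfrak X'$. The ideal $\mathcal A$ is tacitly nonzero, so it contains $\mathcal F(X)$ and $\mathcal A^r(X)$, and $\mathfrak X'$ is an $\mathcal A^r(X)$-module by restriction. Sequences $(x_i),(y_i)$ (or finite sequences of the same length) are $L$-equivalent, $(x_i)\overset{L}{\sim}(y_i)$, if $L^{-1}\|\sum_i\alpha_ix_i\|\le\|\sum_i\alpha_iy_i\|\le L\|\sum_i\alpha_ix_i\|$ for all finitely supported scalar sequences; equivalent means $L$-equivalent for some $L>0$. Property $(\star)$ (with constant $\mu$): a separable purely atomic Banach lattice satisfies $(\star)$ if for some $\mu\ge0$ there are $(\mu_n)\subset[1,\mu]$ and a sequential arrangement $(x_i)_{i\in\mathbb N}$ of its normalized atoms such that, for every $n$, if $l_1<\dots<l_n$ satisfy $(x_i)_{i=1}^n\overset{\mu_n}{\sim}(x_{l_i})_{i=1}^n$,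 then for every $k\in\mathbb N$ there is $l_{n+1}\ge l_n+k$ with $(x_i)_{i=1}^{n+1}\overset{\mu_{n+1}}{\sim}(x_{l_i})_{i=1}^{n+1}$. For a 1-unconditional basis $\mathbf e=(e_i)_{i=1}^{\mathfrak m}$ ($\mathfrak m\in\mathbb N\cup\{\infty\}$) of a Banach space $E$, $(\bigoplus_iF_i)_{\mathbf e}:=\{(x_i)\in\prod_iF_i:\sum_i\|x_i\|e_i\in E\}$ with norm $\|\sum_i\|x_i\|e_i\|_E$ and coordinatewise order. $\mathfrak F_X^{\star,\mu}$ is the collection of all vector sublattices of $X$ that are isometrically lattice isomorphic to some $(\bigoplus_{i=1}^{\mathfrak m}F_i)_{\mathbf e}$, where $(F_i)_{i=1}^{\mathfrak m}$ is a sequence of infinite dimensional separable purely atomic Banach lattices satisfying $(\star)$ for the same constant $\mu$ and $\mathbf e$ is a 1-unconditional basis with $\mathfrak m$ elements. A basis for such a space satisfying $(\star)$ with constant $\mu$ in each summand is obtained thus (via the isomorphism): let $I$ be the index set of $\mathbf e$; for each $n\in I$ choose an arrangement $(x_{n,i})_{i\in\mathbb N}$ of the normalized atoms of $F_n$ witnessing $(\star)$ with constant $\mu$; choose a bijection $\phi:I\times\mathbb N\to\mathbb N$ order preserving on each $\{n\}\times\mathbb N$; put $x_i:=x_{\phi^{-1}(i)}$. Its natural projections are $e_n:=\sum_{i=1}^nx_i^*\otimes x_i$. A bounded generating system for $X$ is a bounded family $\Pi\subset\mathcal L^r(X)$ of positive projections such that $\sigma(X)$ is a Riesz subspace of $X$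 for every $\sigma\in\Pi$ and $\overline{\bigcup_{\sigma\in\Pi}\sigma(X)}=X$. It is directed if $\{\sigma(X):\sigma\in\Pi\}$ is directed by inclusion; $\Pi$ is then viewed as a directed set via $\sigma_1\preccurlyeq\sigma_2\iff\sigma_1(X)\subseteq\sigma_2(X)$, and limits over $\sigma$ are with respect to this. For $\sigma\in\Pi$, $p_\sigma:X\to\sigma(X)$ is the corestriction of $\sigma$ and $\imath_\sigma:\sigma(X)\to X$ the inclusion. $\mathcal A_\sigma:=\{a\in\mathcal L^r(\sigma(X)):\imath_\sigma ap_\sigma\in\mathcal A\}$, a closed Riesz algebra ideal of $\mathcal L^r(\sigma(X))$. $\mathfrak X_\sigma$ is the Banach lattice $\mathcal A_\sigma$-module whose underlying space is $\mathfrak X$ with products $ax:=(\imath_\sigma ap_\sigma)x$, $xa:=x(\imath_\sigma ap_\sigma)$ $(a\in\mathcal A_\sigma)$; $\mathfrak X'_\sigma:=(\mathfrak X_\sigma)'$ is its dual module (underlying space $\mathfrak X'$). Products such as $e_n^{(\sigma)}x'$, for $x'\in\mathfrak X'$, are taken in this sense. *)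

theory Defs
  imports "HOL-Analysis.Analysis" "HOL-Library.Function_Algebras"
begin

section \<open>Scalars and ambient vector spaces\<close>

text \<open>The scalar field is a set \<open>K\<close> of complex numbers, either \<open>\<real>\<close> or \<open>UNIV\<close>.  All spaces over \<open>K\<close> are
  \<open>K\<close>-subspaces of types of class \<open>complex_vector\<close>.  If \<open>K = \<real>\<close> they need only be real subspaces, and
  this is no restriction, since every real vector space is a real subspace of its complexification.\<close>

class scaleC =
  fixes scaleC :: "complex \<Rightarrow> 'a \<Rightarrow> 'a" (infixr "*\<^sub>C" 75)

class complex_vector = ab_group_add + scaleC +
  assumes scaleC_add_right: "c *\<^sub>C (x + y) = c *\<^sub>C x + c *\<^sub>C y"
    and scaleC_add_left: "(c + d) *\<^sub>C x = c *\<^sub>C x + d *\<^sub>C x"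
    and scaleC_scaleC: "c *\<^sub>C d *\<^sub>C x = (c * d) *\<^sub>C x"
    and scaleC_one: "1 *\<^sub>C x = x"

instantiation complex :: complex_vector
begin

definition scaleC_complex :: "complex \<Rightarrow> complex \<Rightarrow> complex" where
  "scaleC_complex c x = c * x"

instance
  by standard (simp_all add: scaleC_complex_def algebra_simps)

end

instantiation "fun" :: (type, complex_vector) complex_vector
begin

definition scaleC_fun :: "complex \<Rightarrow> ('a \<Rightarrow> 'b) \<Rightarrow> 'a \<Rightarrow> 'b" where
  "scaleC_fun c f = (\<lambda>x. c *\<^sub>C f x)"

instance
  by standard (simp_all add: scaleC_fun_def fun_eq_iff scaleC_add_right scaleC_add_left
      scaleC_scaleC scaleC_one)

end

definition ksubspace :: "complex set \<Rightarrow> 'a::complex_vector set \<Rightarrow> bool" where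
  "ksubspace K S \<longleftrightarrow> 0 \<in> S \<and> (\<forall>x\<in>S. \<forall>y\<in>S. x + y \<in> S) \<and> (\<forall>c\<in>K. \<forall>x\<in>S. c *\<^sub>C x \<in> S)"

definition kspan :: "complex set \<Rightarrow> 'a::complex_vector set \<Rightarrow> 'a set" where
  "kspan K B = {(\<Sum>b\<in>F. c b *\<^sub>C b) | F c. finite F \<and> F \<subseteq> B \<and> range c \<subseteq> K}"

definition finite_dim :: "complex set \<Rightarrow> 'a::complex_vector set \<Rightarrow> bool" where
  "finite_dim K S \<longleftrightarrow> (\<exists>B. finite B \<and> S \<subseteq> kspan K B)"

definition linear_over :: "complex set \<Rightarrow> 'a::complex_vector set \<Rightarrow> ('a \<Rightarrow> 'b::complex_vector) \<Rightarrow> bool"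
  where "linear_over K S f \<longleftrightarrow>
    (\<forall>x\<in>S. \<forall>y\<in>S. f (x + y) = f x + f y) \<and> (\<forall>c\<in>K. \<forall>x\<in>S. f (c *\<^sub>C x) = c *\<^sub>C f x)"


section \<open>Banach spaces, bases\<close>

record 'a nspace =
  carr :: "'a set"
  nrm :: "'a \<Rightarrow> real"

definition tends_in :: "('a::complex_vector, 'z) nspace_scheme \<Rightarrow> (nat \<Rightarrow> 'a) \<Rightarrow> 'a \<Rightarrow> bool" where
  "tends_in B u y \<longleftrightarrow> y \<in> carr B \<and> (\<lambda>n. nrm B (y - u n)) \<longlonglongrightarrow> 0"

definition nclosure :: "('a::complex_vector, 'z) nspace_scheme \<Rightarrow> 'a set \<Rightarrow> 'a set" where
  "nclosure B S = {x \<in> carr B. \<forall>\<epsilon>>0. \<exists>y\<in>S. nrm B (x - y) < \<epsilon>}"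

definition banach_space :: "complex set \<Rightarrow> ('a::complex_vector, 'z) nspace_scheme \<Rightarrow> bool" where
  "banach_space K B \<longleftrightarrow>
     ksubspace K (carr B) \<and>
     (\<forall>x\<in>carr B. nrm B x = 0 \<longleftrightarrow> x = 0) \<and>
     (\<forall>x\<in>carr B. \<forall>y\<in>carr B. nrm B (x + y) \<le> nrm B x + nrm B y) \<and>
     (\<forall>c\<in>K. \<forall>x\<in>carr B. nrm B (c *\<^sub>C x) = cmod c * nrm B x) \<and>
     (\<forall>u. range u \<subseteq> carr B \<and> (\<forall>\<epsilon>>0. \<exists>N. \<forall>m\<ge>N. \<forall>n\<ge>N. nrm B (u m - u n) < \<epsilon>)
        \<longrightarrow> (\<exists>y. tends_in B u y))"

definition separable_space :: "('a::complex_vector, 'z) nspace_scheme \<Rightarrow> bool" where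
  "separable_space B \<longleftrightarrow> (\<exists>S. countable S \<and> S \<subseteq> carr B \<and> carr B \<subseteq> nclosure B S)"

text \<open>The basis is indexed by \<open>I\<close>, an initial segment of \<open>nat\<close> (possibly all of it).\<close>

definition is_expansion ::
  "complex set \<Rightarrow> ('a::complex_vector, 'z) nspace_scheme \<Rightarrow> nat set \<Rightarrow> (nat \<Rightarrow> 'a) \<Rightarrow> 'a \<Rightarrow> (nat \<Rightarrow> complex) \<Rightarrow> bool"
  where "is_expansion K B I e y \<alpha> \<longleftrightarrow>
    range \<alpha> \<subseteq> K \<and> (\<forall>i. i \<notin> I \<longrightarrow> \<alpha> i = 0) \<and> tends_in B (\<lambda>n. \<Sum>i\<in>{..<n} \<inter> I. \<alpha> i *\<^sub>C e i) y"

definition schauder_basis ::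
  "complex set \<Rightarrow> ('a::complex_vector, 'z) nspace_scheme \<Rightarrow> nat set \<Rightarrow> (nat \<Rightarrow> 'a) \<Rightarrow> bool" where
  "schauder_basis K B I e \<longleftrightarrow> e ` I \<subseteq> carr B \<and> (\<forall>y\<in>carr B. \<exists>!\<alpha>. is_expansion K B I e y \<alpha>)"

definition one_unconditional_basis ::
  "complex set \<Rightarrow> ('a::complex_vector, 'z) nspace_scheme \<Rightarrow> nat set \<Rightarrow> (nat \<Rightarrow> 'a) \<Rightarrow> bool" where
  "one_unconditional_basis K B I e \<longleftrightarrow> schauder_basis K B I e \<and>
     (\<forall>J \<alpha> \<theta>. finite J \<and> J \<subseteq> I \<and> range \<alpha> \<subseteq> K \<and> range \<theta> \<subseteq> K \<and> (\<forall>i. cmod (\<theta> i) = 1) \<longrightarrow>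
        nrm B (\<Sum>i\<in>J. (\<theta> i * \<alpha> i) *\<^sub>C e i) = nrm B (\<Sum>i\<in>J. \<alpha> i *\<^sub>C e i))"

definition biorth ::
  "complex set \<Rightarrow> ('a::complex_vector, 'z) nspace_scheme \<Rightarrow> (nat \<Rightarrow> 'a) \<Rightarrow> nat \<Rightarrow> 'a \<Rightarrow> complex" where
  "biorth K B x i = (\<lambda>y. if y \<in> carr B then (THE \<alpha>. is_expansion K B UNIV x y \<alpha>) i else 0)"

definition seq_equiv ::
  "complex set \<Rightarrow> real \<Rightarrow> nat set \<Rightarrow> ('a::complex_vector, 'z) nspace_scheme \<Rightarrow> (nat \<Rightarrow> 'a) \<Rightarrow>
    ('b::complex_vector, 'w) nspace_scheme \<Rightarrow> (nat \<Rightarrow> 'b) \<Rightarrow> bool" where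
  "seq_equiv K L I B x C y \<longleftrightarrow> 0 < L \<and>
     (\<forall>J \<alpha>. finite J \<and> J \<subseteq> I \<and> range \<alpha> \<subseteq> K \<longrightarrow>
        inverse L * nrm B (\<Sum>i\<in>J. \<alpha> i *\<^sub>C x i) \<le> nrm C (\<Sum>i\<in>J. \<alpha> i *\<^sub>C y i) \<and>
        nrm C (\<Sum>i\<in>J. \<alpha> i *\<^sub>C y i) \<le> L * nrm B (\<Sum>i\<in>J. \<alpha> i *\<^sub>C x i))"

definition c0_space :: "complex set \<Rightarrow> (nat \<Rightarrow> complex) nspace" where
  "c0_space K = \<lparr>carr = {a. range a \<subseteq> K \<and> a \<longlonglongrightarrow> 0}, nrm = (\<lambda>a. SUP n. cmod (a n))\<rparr>"

definition unit_vec :: "nat \<Rightarrow> nat \<Rightarrow> complex" where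
  "unit_vec n = (\<lambda>i. if i = n then 1 else 0)"


section \<open>Banach lattices\<close>

record 'a onspace = "'a nspace" +
  pos :: "'a set"

definition le_in :: "('a::complex_vector, 'z) onspace_scheme \<Rightarrow> 'a \<Rightarrow> 'a \<Rightarrow> bool" where
  "le_in B x y \<longleftrightarrow> y - x \<in> pos B"

definition is_sup_in :: "('a::complex_vector, 'z) onspace_scheme \<Rightarrow> 'a set \<Rightarrow> 'a \<Rightarrow> bool" where
  "is_sup_in B S s \<longleftrightarrow> s \<in> carr B \<and> (\<forall>x\<in>S. le_in B x s) \<and>
     (\<forall>u\<in>carr B. (\<forall>x\<in>S. le_in B x u) \<longrightarrow> le_in B s u)"

text \<open>The elements of a Banach lattice over \<open>K\<close> have unique decompositions \<open>x + \<i> y\<close> with \<open>x\<close> in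
  \<open>real_part B\<close>, the underlying real Banach lattice, and \<open>y\<close> in \<open>imag_part K B\<close>, which is trivial if
  \<open>K = \<real>\<close>.\<close>

definition real_part :: "('a::complex_vector, 'z) onspace_scheme \<Rightarrow> 'a set" where
  "real_part B = {p - q | p q. p \<in> pos B \<and> q \<in> pos B}"

definition imag_part :: "complex set \<Rightarrow> ('a::complex_vector, 'z) onspace_scheme \<Rightarrow> 'a set" where
  "imag_part K B = (if K = \<real> then {0} else real_part B)"

text \<open>The modulus of \<open>z\<close> is the supremum of the real parts of \<open>c z\<close> over the scalars \<open>c\<close> of absolute
  value one; for real scalars this is the supremum of \<open>z\<close> and \<open>- z\<close>.\<close>

definition is_modulus :: "complex set \<Rightarrow> ('a::complex_vector, 'z) onspace_scheme \<Rightarrow> 'a \<Rightarrow> 'a \<Rightarrow> bool" where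
  "is_modulus K B z m \<longleftrightarrow>
     is_sup_in B {x \<in> real_part B. \<exists>c\<in>K. cmod c = 1 \<and> (\<exists>y\<in>imag_part K B. c *\<^sub>C z = x + \<i> *\<^sub>C y)} m"

definition modulus :: "complex set \<Rightarrow> ('a::complex_vector, 'z) onspace_scheme \<Rightarrow> 'a \<Rightarrow> 'a" where
  "modulus K B z = (THE m. is_modulus K B z m)"

definition banach_lattice :: "complex set \<Rightarrow> ('a::complex_vector, 'z) onspace_scheme \<Rightarrow> bool" where
  "banach_lattice K B \<longleftrightarrow>
     banach_space K B \<and>
     pos B \<subseteq> carr B \<and> 0 \<in> pos B \<and>
     (\<forall>x\<in>pos B. \<forall>y\<in>pos B. x + y \<in> pos B) \<and>
     (\<forall>t\<ge>0. \<forall>x\<in>pos B. of_real t *\<^sub>C x \<in> pos B) \<and>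
     (\<forall>x. x \<in> pos B \<and> - x \<in> pos B \<longrightarrow> x = 0) \<and>
     (\<forall>x\<in>real_part B. \<forall>y\<in>real_part B. \<exists>s. is_sup_in B {x, y} s) \<and>
     (\<forall>z\<in>carr B. \<exists>!(x, y). x \<in> real_part B \<and> y \<in> imag_part K B \<and> z = x + \<i> *\<^sub>C y) \<and>
     (\<forall>x\<in>pos B. \<forall>y\<in>pos B. le_in B x y \<longrightarrow> nrm B x \<le> nrm B y) \<and>
     (\<forall>z\<in>carr B. \<exists>m. is_modulus K B z m \<and> nrm B z = nrm B m)"

text \<open>\<open>B\<close> itself need not be a lattice here: the moduli of the elements of \<open>S\<close> have to exist in \<open>B\<close> and
  to belong to \<open>S\<close>.  Over the complex numbers, \<open>S\<close> has to be the complexification of a real subspace.\<close>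

definition riesz_subspace :: "complex set \<Rightarrow> ('a::complex_vector, 'z) onspace_scheme \<Rightarrow> 'a set \<Rightarrow> bool" where
  "riesz_subspace K B S \<longleftrightarrow> ksubspace K S \<and> S \<subseteq> carr B \<and>
     (\<forall>x\<in>real_part B. \<forall>y\<in>imag_part K B. x + \<i> *\<^sub>C y \<in> S \<longrightarrow> x \<in> S \<and> y \<in> S) \<and>
     (\<forall>z\<in>S. \<exists>m\<in>S. is_modulus K B z m)"

definition sub :: "'a onspace \<Rightarrow> 'a set \<Rightarrow> 'a onspace" where
  "sub B S = \<lparr>carr = S, nrm = nrm B, pos = pos B \<inter> S\<rparr>"

definition isometric_lattice_iso ::
  "complex set \<Rightarrow> ('a::complex_vector, 'z) onspace_scheme \<Rightarrow> ('b::complex_vector, 'w) onspace_scheme \<Rightarrow> ('a \<Rightarrow> 'b) \<Rightarrow> bool"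
  where "isometric_lattice_iso K B C f \<longleftrightarrow>
    bij_betw f (carr B) (carr C) \<and> linear_over K (carr B) f \<and>
    (\<forall>x\<in>carr B. nrm C (f x) = nrm B x) \<and> (\<forall>x\<in>carr B. f x \<in> pos C \<longleftrightarrow> x \<in> pos B)"


section \<open>Operators, dual spaces\<close>

definition linear_map ::
  "complex set \<Rightarrow> ('a::complex_vector, 'z) nspace_scheme \<Rightarrow> ('b::complex_vector, 'w) nspace_scheme \<Rightarrow> ('a \<Rightarrow> 'b) \<Rightarrow> bool"
  where "linear_map K B C f \<longleftrightarrow> f ` carr B \<subseteq> carr C \<and> linear_over K (carr B) f"

definition bounded_map ::
  "complex set \<Rightarrow> ('a::complex_vector, 'z) nspace_scheme \<Rightarrow> ('b::complex_vector, 'w) nspace_scheme \<Rightarrow> ('a \<Rightarrow> 'b) \<Rightarrow> bool"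
  where "bounded_map K B C f \<longleftrightarrow> linear_map K B C f \<and> (\<exists>c. \<forall>x\<in>carr B. nrm C (f x) \<le> c * nrm B x)"

definition op_norm ::
  "('a, 'z) nspace_scheme \<Rightarrow> ('b, 'w) nspace_scheme \<Rightarrow> ('a \<Rightarrow> 'b) \<Rightarrow> real" where
  "op_norm B C f = Inf {c. 0 \<le> c \<and> (\<forall>x\<in>carr B. nrm C (f x) \<le> c * nrm B x)}"

definition positive_map ::
  "complex set \<Rightarrow> ('a::complex_vector, 'z) onspace_scheme \<Rightarrow> ('b::complex_vector, 'w) onspace_scheme \<Rightarrow> ('a \<Rightarrow> 'b) \<Rightarrow> bool"
  where "positive_map K B C f \<longleftrightarrow> linear_map K B C f \<and> f ` pos B \<subseteq> pos C"

definition regular_map ::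
  "complex set \<Rightarrow> ('a::complex_vector, 'z) onspace_scheme \<Rightarrow> ('b::complex_vector, 'w) onspace_scheme \<Rightarrow> ('a \<Rightarrow> 'b) \<Rightarrow> bool"
  where "regular_map K B C f \<longleftrightarrow>
    (\<exists>(n::nat) c T. (\<forall>j<n. c j \<in> K \<and> positive_map K B C (T j)) \<and>
       (\<forall>x\<in>carr B. f x = (\<Sum>j<n. c j *\<^sub>C T j x)))"

text \<open>Operators on \<open>B\<close> and functionals on \<open>B\<close> are represented by functions that vanish off
  \<open>carr B\<close>.  This makes the representation unique and is preserved by linear combinations and by
  composition.\<close>

definition supported :: "('a, 'z) nspace_scheme \<Rightarrow> ('a \<Rightarrow> 'b::zero) \<Rightarrow> bool" where
  "supported B f \<longleftrightarrow> (\<forall>x. x \<notin> carr B \<longrightarrow> f x = 0)"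

definition regular_ops :: "complex set \<Rightarrow> 'a::complex_vector onspace \<Rightarrow> ('a \<Rightarrow> 'a) onspace" where
  "regular_ops K B =
     \<lparr>carr = {T. regular_map K B B T \<and> supported B T},
      nrm = (\<lambda>T. Inf {op_norm B B S | S. bounded_map K B B S \<and>
                   (\<forall>x\<in>carr B. le_in B (modulus K B (T x)) (S (modulus K B x)))}),
      pos = {T. positive_map K B B T \<and> supported B T}\<rparr>"

definition finite_rank_ops :: "complex set \<Rightarrow> 'a::complex_vector onspace \<Rightarrow> ('a \<Rightarrow> 'a) set" where
  "finite_rank_ops K B = {T. bounded_map K B B T \<and> supported B T \<and> finite_dim K (T ` carr B)}"

definition approximable_ops :: "complex set \<Rightarrow> 'a::complex_vector onspace \<Rightarrow> ('a \<Rightarrow> 'a) set" where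
  "approximable_ops K B = nclosure (regular_ops K B) (finite_rank_ops K B)"

definition rank_one :: "('a \<Rightarrow> complex) \<Rightarrow> 'a \<Rightarrow> 'a::complex_vector \<Rightarrow> 'a" where
  "rank_one l v = (\<lambda>x. l x *\<^sub>C v)"

definition scalar_space :: "complex set \<Rightarrow> complex onspace" where
  "scalar_space K = \<lparr>carr = K, nrm = cmod, pos = \<real>\<^sub>\<ge>\<^sub>0\<rparr>"

definition dual :: "complex set \<Rightarrow> 'a::complex_vector onspace \<Rightarrow> ('a \<Rightarrow> complex) onspace" where
  "dual K B =
     \<lparr>carr = {f. bounded_map K B (scalar_space K) f \<and> supported B f},
      nrm = op_norm B (scalar_space K),
      pos = {f. bounded_map K B (scalar_space K) f \<and> supported B f \<and> f ` pos B \<subseteq> \<real>\<^sub>\<ge>\<^sub>0}\<rparr>"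

definition reflexive :: "complex set \<Rightarrow> 'a::complex_vector onspace \<Rightarrow> bool" where
  "reflexive K B \<longleftrightarrow>
     (\<forall>\<Phi>\<in>carr (dual K (dual K B)). \<exists>x\<in>carr B. \<forall>f\<in>carr (dual K B). \<Phi> f = f x)"

definition shrinking :: "complex set \<Rightarrow> 'a::complex_vector onspace \<Rightarrow> (nat \<Rightarrow> 'a) \<Rightarrow> bool" where
  "shrinking K B x \<longleftrightarrow> schauder_basis K B UNIV x \<and>
     carr (dual K B) \<subseteq> nclosure (dual K B) (kspan K (range (biorth K B x)))"

text \<open>The functions in \<open>carr (dual K B)\<close> vanish off \<open>carr B\<close>, so that the topology of pointwise
  convergence (the product topology of the function type) induces the weak* topology on it.\<close>

definition weak_star_closed :: "complex set \<Rightarrow> 'a::complex_vector onspace \<Rightarrow> ('a \<Rightarrow> complex) set \<Rightarrow> bool" where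
  "weak_star_closed K B S \<longleftrightarrow> closedin (top_of_set (carr (dual K B))) S"


section \<open>Property \<open>(\<star>)\<close> and the collection of sublattices\<close>

definition atom :: "('a::complex_vector, 'z) onspace_scheme \<Rightarrow> 'a \<Rightarrow> bool" where
  "atom B a \<longleftrightarrow> a \<in> pos B \<and> a \<noteq> 0 \<and> (\<forall>y\<in>pos B. le_in B y a \<longrightarrow> (\<exists>t. y = of_real t *\<^sub>C a))"

definition purely_atomic :: "('a::complex_vector, 'z) onspace_scheme \<Rightarrow> bool" where
  "purely_atomic B \<longleftrightarrow> (\<forall>x\<in>pos B. x \<noteq> 0 \<longrightarrow> (\<exists>a. atom B a \<and> le_in B a x))"

text \<open>Sequences are indexed from \<open>0\<close>, so that the first \<open>n\<close> terms are those with index in \<open>{..<n}\<close>.\<close>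

definition star_arrangement ::
  "complex set \<Rightarrow> ('a::complex_vector, 'z) onspace_scheme \<Rightarrow> real \<Rightarrow> (nat \<Rightarrow> 'a) \<Rightarrow> bool" where
  "star_arrangement K B \<mu> x \<longleftrightarrow>
     bij_betw x UNIV {a. atom B a \<and> nrm B a = 1} \<and>
     (\<exists>m :: nat \<Rightarrow> real. range m \<subseteq> {1..\<mu>} \<and>
        (\<forall>n\<ge>1. \<forall>l. strict_mono_on {..<n} l \<and> seq_equiv K (m n) {..<n} B x B (x \<circ> l) \<longrightarrow>
           (\<forall>k. \<exists>l'\<ge>l (n - 1) + k.
              seq_equiv K (m (Suc n)) {..<Suc n} B x B (x \<circ> l(n := l')))))"

definition star_property :: "complex set \<Rightarrow> ('a::complex_vector, 'z) onspace_scheme \<Rightarrow> real \<Rightarrow> bool" where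
  "star_property K B \<mu> \<longleftrightarrow> separable_space B \<and> purely_atomic B \<and> (\<exists>x. star_arrangement K B \<mu> x)"

definition direct_sum ::
  "nat set \<Rightarrow> (nat \<Rightarrow> 'a::complex_vector onspace) \<Rightarrow> 'b::complex_vector nspace \<Rightarrow> (nat \<Rightarrow> 'b) \<Rightarrow> (nat \<Rightarrow> 'a) onspace"
  where "direct_sum I F E e =
    (let S = (\<lambda>x y. tends_in E (\<lambda>n. \<Sum>i\<in>{..<n} \<inter> I. of_real (nrm (F i) (x i)) *\<^sub>C e i) y);
         V = {x. (\<forall>i\<in>I. x i \<in> carr (F i)) \<and> (\<forall>i. i \<notin> I \<longrightarrow> x i = 0) \<and> (\<exists>y. S x y)}
     in \<lparr>carr = V, nrm = (\<lambda>x. nrm E (THE y. S x y)), pos = {x \<in> V. \<forall>i\<in>I. x i \<in> pos (F i)}\<rparr>)"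

abbreviation index_set :: "enat \<Rightarrow> nat set" where
  "index_set m \<equiv> {i. enat i < m}"

definition star_summands ::
  "complex set \<Rightarrow> real \<Rightarrow> enat \<Rightarrow> (nat \<Rightarrow> 'a::complex_vector onspace) \<Rightarrow> 'b::complex_vector nspace \<Rightarrow> (nat \<Rightarrow> 'b) \<Rightarrow> bool"
  where "star_summands K \<mu> m F E e \<longleftrightarrow>
    1 \<le> m \<and> banach_space K E \<and> one_unconditional_basis K E (index_set m) e \<and>
    (\<forall>i\<in>index_set m. banach_lattice K (F i) \<and> \<not> finite_dim K (carr (F i)) \<and> star_property K (F i) \<mu>)"

text \<open>The summands are taken on subsets of the type of \<open>X\<close>, and \<open>E\<close> is taken to be a space of
  sequences.  Up to isomorphism this is no restriction: each summand embeds in the direct sum, hence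
  in \<open>X\<close>, and \<open>E\<close> can be replaced by the space of coefficient sequences with respect to \<open>e\<close>.\<close>

definition star_sublattices :: "complex set \<Rightarrow> 'a::complex_vector onspace \<Rightarrow> real \<Rightarrow> 'a set set" where
  "star_sublattices K X \<mu> = {S. riesz_subspace K X S \<and>
     (\<exists>m (F :: nat \<Rightarrow> 'a onspace) (E :: (nat \<Rightarrow> complex) nspace) e f.
        star_summands K \<mu> m F E e \<and>
        isometric_lattice_iso K (sub X S) (direct_sum (index_set m) F E e) f)}"

text \<open>With the present notion of a purely atomic Banach lattice the normalized atoms need not span a
  dense subspace, hence the explicit requirement that \<open>x\<close> is a Schauder basis.\<close>

definition star_basis :: "complex set \<Rightarrow> 'a::complex_vector onspace \<Rightarrow> real \<Rightarrow> (nat \<Rightarrow> 'a) \<Rightarrow> bool" where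
  "star_basis K Y \<mu> x \<longleftrightarrow> schauder_basis K Y UNIV x \<and>
     (\<exists>m (F :: nat \<Rightarrow> 'a onspace) (E :: (nat \<Rightarrow> complex) nspace) e f a \<phi>.
        star_summands K \<mu> m F E e \<and>
        isometric_lattice_iso K Y (direct_sum (index_set m) F E e) f \<and>
        (\<forall>n\<in>index_set m. star_arrangement K (F n) \<mu> (a n)) \<and>
        bij_betw \<phi> (index_set m \<times> UNIV) (UNIV :: nat set) \<and>
        (\<forall>n\<in>index_set m. strict_mono (\<lambda>k. \<phi> (n, k))) \<and>
        (\<forall>n\<in>index_set m. \<forall>k. f (x (\<phi> (n, k))) = (\<lambda>j. if j = n then a n k else 0)))"


section \<open>Ideals, modules, derivations\<close>

definition closed_riesz_algebra_ideal ::
  "complex set \<Rightarrow> 'a::complex_vector onspace \<Rightarrow> ('a \<Rightarrow> 'a) set \<Rightarrow> bool" where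
  "closed_riesz_algebra_ideal K X \<A> \<longleftrightarrow>
     riesz_subspace K (regular_ops K X) \<A> \<and>
     (\<forall>a\<in>\<A>. \<forall>t\<in>carr (regular_ops K X). a \<circ> t \<in> \<A> \<and> t \<circ> a \<in> \<A>) \<and>
     nclosure (regular_ops K X) \<A> \<subseteq> \<A>"

text \<open>In what follows the algebra consists of operators, its product is composition, and it is given
  together with its norm and its positive cone.\<close>

type_synonym ('x, 'm) left_action = "('x \<Rightarrow> 'x) \<Rightarrow> 'm \<Rightarrow> 'm"
type_synonym ('x, 'm) right_action = "'m \<Rightarrow> ('x \<Rightarrow> 'x) \<Rightarrow> 'm"

definition banach_lattice_module ::
  "complex set \<Rightarrow> ('x \<Rightarrow> 'x::complex_vector) onspace \<Rightarrow> 'm::complex_vector onspace \<Rightarrow>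
    ('x, 'm) left_action \<Rightarrow> ('x, 'm) right_action \<Rightarrow> bool" where
  "banach_lattice_module K \<A> M lm rm \<longleftrightarrow>
     banach_lattice K M \<and>
     (\<forall>a\<in>carr \<A>. linear_map K M M (lm a) \<and> linear_map K M M (\<lambda>x. rm x a)) \<and>
     (\<forall>x\<in>carr M. linear_over K (carr \<A>) (\<lambda>a. lm a x) \<and> linear_over K (carr \<A>) (rm x)) \<and>
     (\<forall>a\<in>carr \<A>. \<forall>b\<in>carr \<A>. \<forall>x\<in>carr M.
        lm (a \<circ> b) x = lm a (lm b x) \<and> rm x (a \<circ> b) = rm (rm x a) b \<and> rm (lm a x) b = lm a (rm x b)) \<and>
     (\<forall>a\<in>pos \<A>. \<forall>x\<in>pos M. lm a x \<in> pos M \<and> rm x a \<in> pos M) \<and>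
     (\<exists>C. \<forall>a\<in>carr \<A>. \<forall>x\<in>carr M.
        nrm M (lm a x) \<le> C * nrm \<A> a * nrm M x \<and> nrm M (rm x a) \<le> C * nrm \<A> a * nrm M x)"

definition dual_left :: "'m onspace \<Rightarrow> ('x, 'm) right_action \<Rightarrow> ('x, 'm \<Rightarrow> complex) left_action" where
  "dual_left M rm a f = (\<lambda>x. if x \<in> carr M then f (rm x a) else 0)"

definition dual_right :: "'m onspace \<Rightarrow> ('x, 'm) left_action \<Rightarrow> ('x, 'm \<Rightarrow> complex) right_action" where
  "dual_right M lm f a = (\<lambda>x. if x \<in> carr M then f (lm a x) else 0)"

definition bounded_derivation ::
  "complex set \<Rightarrow> ('x \<Rightarrow> 'x::complex_vector) onspace \<Rightarrow> 'm::complex_vector onspace \<Rightarrow>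
    ('x, 'm) left_action \<Rightarrow> ('x, 'm) right_action \<Rightarrow> (('x \<Rightarrow> 'x) \<Rightarrow> 'm \<Rightarrow> complex) \<Rightarrow> bool" where
  "bounded_derivation K \<A> M lm rm D \<longleftrightarrow> bounded_map K \<A> (dual K M) D \<and>
     (\<forall>a\<in>carr \<A>. \<forall>b\<in>carr \<A>. D (a \<circ> b) = dual_left M rm a (D b) + dual_right M lm (D a) b)"

definition inner_derivation ::
  "complex set \<Rightarrow> ('x \<Rightarrow> 'x::complex_vector) onspace \<Rightarrow> 'm::complex_vector onspace \<Rightarrow>
    ('x, 'm) left_action \<Rightarrow> ('x, 'm) right_action \<Rightarrow> (('x \<Rightarrow> 'x) \<Rightarrow> 'm \<Rightarrow> complex) \<Rightarrow> bool" where
  "inner_derivation K \<A> M lm rm D \<longleftrightarrow>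
     (\<exists>f\<in>carr (dual K M). \<forall>a\<in>carr \<A>. D a = dual_left M rm a f - dual_right M lm f a)"


section \<open>Generating systems and localization\<close>

definition directed_bounded_generating_system ::
  "complex set \<Rightarrow> 'a::complex_vector onspace \<Rightarrow> ('a \<Rightarrow> 'a) set \<Rightarrow> bool" where
  "directed_bounded_generating_system K X P \<longleftrightarrow>
     P \<subseteq> pos (regular_ops K X) \<and>
     (\<forall>\<sigma>\<in>P. \<sigma> \<circ> \<sigma> = \<sigma> \<and> riesz_subspace K X (\<sigma> ` carr X)) \<and>
     (\<exists>C. \<forall>\<sigma>\<in>P. nrm (regular_ops K X) \<sigma> \<le> C) \<and>
     nclosure X (\<Union>\<sigma>\<in>P. \<sigma> ` carr X) = carr X \<and>
     (\<forall>\<sigma>\<in>P. \<forall>\<tau>\<in>P. \<exists>\<rho>\<in>P. \<sigma> ` carr X \<subseteq> \<rho> ` carr X \<and> \<tau> ` carr X \<subseteq> \<rho> ` carr X)"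

definition system_filter :: "'a onspace \<Rightarrow> ('a \<Rightarrow> 'a) set \<Rightarrow> ('a \<Rightarrow> 'a) filter" where
  "system_filter X P = (INF \<sigma>\<in>P. principal {\<tau> \<in> P. \<sigma> ` carr X \<subseteq> \<tau> ` carr X})"

definition range_lattice :: "'a onspace \<Rightarrow> ('a \<Rightarrow> 'a) \<Rightarrow> 'a onspace" where
  "range_lattice X \<sigma> = sub X (\<sigma> ` carr X)"

text \<open>For an operator \<open>a\<close> on the range of \<open>\<sigma>\<close>, the composition of \<open>a\<close> with the corestriction of \<open>\<sigma>\<close>
  and the inclusion of the range of \<open>\<sigma>\<close> is \<open>a \<circ> \<sigma>\<close>.\<close>

definition local_ideal ::
  "complex set \<Rightarrow> 'a::complex_vector onspace \<Rightarrow> ('a \<Rightarrow> 'a) set \<Rightarrow> ('a \<Rightarrow> 'a) \<Rightarrow> ('a \<Rightarrow> 'a) set" where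
  "local_ideal K X \<A> \<sigma> = {a \<in> carr (regular_ops K (range_lattice X \<sigma>)). a \<circ> \<sigma> \<in> \<A>}"

definition local_left :: "('x, 'm) left_action \<Rightarrow> ('x \<Rightarrow> 'x) \<Rightarrow> ('x, 'm) left_action" where
  "local_left lm \<sigma> a x = lm (a \<circ> \<sigma>) x"

definition local_right :: "('x, 'm) right_action \<Rightarrow> ('x \<Rightarrow> 'x) \<Rightarrow> ('x, 'm) right_action" where
  "local_right rm \<sigma> x a = rm x (a \<circ> \<sigma>)"

definition local_dual_left ::
  "'m onspace \<Rightarrow> ('x, 'm) right_action \<Rightarrow> ('x \<Rightarrow> 'x) \<Rightarrow> ('x, 'm \<Rightarrow> complex) left_action" where
  "local_dual_left M rm \<sigma> = dual_left M (local_right rm \<sigma>)"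

definition local_dual_right ::
  "'m onspace \<Rightarrow> ('x, 'm) left_action \<Rightarrow> ('x \<Rightarrow> 'x) \<Rightarrow> ('x, 'm \<Rightarrow> complex) right_action" where
  "local_dual_right M lm \<sigma> = dual_right M (local_left lm \<sigma>)"

definition coord_proj :: "complex set \<Rightarrow> 'a::complex_vector onspace \<Rightarrow> (nat \<Rightarrow> 'a) \<Rightarrow> nat \<Rightarrow> 'a \<Rightarrow> 'a" where
  "coord_proj K Y x i = rank_one (biorth K Y x i) (x i)"

definition natural_proj :: "complex set \<Rightarrow> 'a::complex_vector onspace \<Rightarrow> (nat \<Rightarrow> 'a) \<Rightarrow> nat \<Rightarrow> 'a \<Rightarrow> 'a" where
  "natural_proj K Y x n = (\<Sum>i\<le>n. coord_proj K Y x i)"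

text \<open>A linear map is determined by its values on the positive cone, which spans \<open>carr B\<close>.\<close>

definition sup_map ::
  "complex set \<Rightarrow> 'a::complex_vector onspace \<Rightarrow> (nat \<Rightarrow> 'a \<Rightarrow> 'a) \<Rightarrow> 'a \<Rightarrow> 'a" where
  "sup_map K B T = (THE E. linear_map K B B E \<and> supported B E \<and>
     (\<forall>f\<in>pos B. is_sup_in B (range (\<lambda>n. T n f)) (E f)))"

text \<open>The set of all \<open>p f q\<close> with \<open>f\<close> in the dual space, for left and right actions \<open>dl\<close> and \<open>dr\<close> on it.\<close>

definition corner ::
  "complex set \<Rightarrow> 'm::complex_vector onspace \<Rightarrow> ('x, 'm \<Rightarrow> complex) left_action \<Rightarrow>
    ('x, 'm \<Rightarrow> complex) right_action \<Rightarrow> ('x \<Rightarrow> 'x) \<Rightarrow> ('x \<Rightarrow> 'x) \<Rightarrow> ('m \<Rightarrow> complex) set" where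
  "corner K M dl dr p q = {dl p (dr f q) | f. f \<in> carr (dual K M)}"

definition no_c0_subsequences ::
  "complex set \<Rightarrow> 'm::complex_vector onspace \<Rightarrow> ('x, 'm \<Rightarrow> complex) left_action \<Rightarrow>
    ('x, 'm \<Rightarrow> complex) right_action \<Rightarrow> (nat \<Rightarrow> 'x \<Rightarrow> 'x) \<Rightarrow> bool" where
  "no_c0_subsequences K M dl dr q \<longleftrightarrow>
     (\<forall>i \<xi>. (\<forall>n. \<xi> n \<in> corner K M dl dr (q n) (q i)) \<or> (\<forall>n. \<xi> n \<in> corner K M dl dr (q i) (q n)) \<longrightarrow>
        \<not> (\<exists>r L. strict_mono r \<and> seq_equiv K L UNIV (dual K M) (\<xi> \<circ> r) (c0_space K) unit_vec))"

end

theory Submission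
  imports Defs
begin

text \<open>
  Fix \<open>\<sigma>\<close>, write \<open>E i j\<close> for the matrix units of the basis of the range of \<open>\<sigma>\<close> and \<open>P n\<close> for its
  natural projections.  Averaging the functionals \<open>D(g) g\<close> over the diagonal matrices \<open>g\<close> with
  entries \<open>\<plusminus> 1\<close> gives a bounded functional \<open>w\<close> whose inner derivation agrees with \<open>D\<close> on the diagonal.  Inner derivations
  are regular, because positive elements act positively and \<open>w\<close> is a combination of positive
  functionals, so one may assume that \<open>D\<close> vanishes on the diagonal.  Then \<open>D (E i j)\<close> lies in the
  corner \<open>E i i f E j j\<close> of the dual.  Different corners are disjoint, so replacing each \<open>D (E i j)\<close> by
  its positive part defines a positive map on finite matrices without increasing the bound:
  on finite matrices \<open>D\<close> is regular for free.  The basis being shrinking, together with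
  the factorization in (b) and the order continuity in (d), shows that \<open>D a\<close> is the iterated weak* limit
  of \<open>D (P n a P m)\<close>, so that \<open>D\<close> is regular on the localized algebra, with bounds independent of
  \<open>\<sigma>\<close>.  A compactness argument then passes to the limit in \<open>\<sigma>\<close>.  To avoid extending maps at each
  stage, positive operators into the dual are handled as biadditive functions on the product of the
  positive cones, and are extended by linearity only at the end.
\<close>


section \<open>Scalars and limits along subfilters\<close>

text \<open>The obstacle is that a bounded map between Banach lattices need not be regular. Two
  points get around it. First, the sign matrices lie between \<open>- \<sigma>\<close> and
  \<open>\<sigma>\<close>, so they are bounded independently of their size; this is why the averages
  stay bounded. Once \<open>D\<close> vanishes on the diagonal, the positive parts of its entries on
  a positive compression add up to at most the positive part of one functional, whose norm is
  controlled by the bound of \<open>D\<close>. Second, compressions have to determine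
  \<open>D a\<close>. Norm convergence holds only for one row (by shrinking) or one column (by
  expansion in the basis) at a time; the full limits are weak*, and \<open>D\<close> need not
  respect them. Writing \<open>a = s \<circ> t\<close>, the Leibniz rule gives
  \<open>D a z = D t (rm z s) + D s (lm t z)\<close>, and (d) controls each summand on one side
  only. The other side is reached by interchanging iterated limits, which is legitimate because the
  double sequence is a combination of doubly monotone ones. The factors 4 count positive parts: a
  bound on the cone costs a factor 4 on the whole space.\<close>

interpretation cv: vector_space "scaleC :: complex \<Rightarrow> 'a \<Rightarrow> 'a::complex_vector"
  by standard (simp_all add: scaleC_add_right scaleC_add_left scaleC_scaleC scaleC_one)

lemma scaleC_fun_apply [simp]: "(c *\<^sub>C f) x = c *\<^sub>C f x"
  by (simp add: scaleC_fun_def)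

lemma scaleC_complex_eq [simp]: "c *\<^sub>C (x::complex) = c * x"
  by (simp add: scaleC_complex_def)

lemma sum_fun_apply: "(\<Sum>i\<in>A. f i) x = (\<Sum>i\<in>A. f i x)"
  for f :: "'i \<Rightarrow> 'a \<Rightarrow> 'b::complex_vector"
  by (induction A rule: infinite_finite_induct) auto

lemma tendsto_fun_apply:
  fixes f :: "'i \<Rightarrow> 'a \<Rightarrow> 'b::topological_space"
  assumes "(f \<longlongrightarrow> l) F"
  shows "((\<lambda>i. f i x) \<longlongrightarrow> l x) F"
proof (rule topological_tendstoI)
  fix S assume S: "open S" "l x \<in> S"
  have "open ((\<lambda>f. f x) -` S)"
    using continuous_on_open_vimage[OF open_UNIV] continuous_on_product_coordinates[of x] S(1)
    by (metis inf_top.right_neutral)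
  with S(2) have "eventually (\<lambda>i. f i \<in> (\<lambda>f. f x) -` S) F"
    using assms by (intro topological_tendstoD) auto
  then show "eventually (\<lambda>i. f i x \<in> S) F" by simp
qed

text \<open>A substitute for an ultrafilter finer than \<open>F\<close>. All bounded functions
  together map the index set into a product of closed discs, which is compact; \<open>G\<close> is
  \<open>F\<close> restricted to the preimages of the neighbourhoods of a cluster point.\<close>

lemma universal_subfilter:
  fixes F :: "'a filter"
  assumes "F \<noteq> bot"
  obtains G where "G \<le> F" "G \<noteq> bot" "\<And>h::'a \<Rightarrow> complex. Bfun h F \<Longrightarrow> \<exists>l. (h \<longlongrightarrow> l) G"
proof -
  define c where "c h = (SOME c. 0 \<le> c \<and> eventually (\<lambda>x. norm (h x) \<le> c) F)" for h :: "'a \<Rightarrow> complex"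
  have c: "eventually (\<lambda>x. norm (h x) \<le> c h) F" if "Bfun h F" for h
  proof -
    have "\<exists>c. 0 \<le> c \<and> eventually (\<lambda>x. norm (h x) \<le> c) F"
      using that unfolding Bfun_def by (auto intro: less_imp_le)
    then show ?thesis
      unfolding c_def by (rule someI2_ex) blast
  qed
  \<comment> \<open>A function is only eventually below its bound, so its values are cut to 0
    elsewhere; this changes nothing along \<open>F\<close> and puts every \<open>R x\<close> into
    the compact product.\<close>
  define R where "R x h = (if norm (h x) \<le> c h then h x else 0)" for x and h :: "'a \<Rightarrow> complex"
  define S where "S = (\<Pi>\<^sub>E h\<in>UNIV. cball (0::complex) \<bar>c h\<bar>)"
  have "compact S"
    using compactin_PiE[of "\<lambda>_. euclidean" UNIV "\<lambda>h. cball (0::complex) \<bar>c h\<bar>"]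
    by (simp add: S_def euclidean_product_topology)
  moreover have "eventually (\<lambda>x. x \<in> S) (filtermap R F)"
    by (auto simp: eventually_filtermap S_def R_def intro!: always_eventually)
  moreover have "filtermap R F \<noteq> bot"
    using assms by (simp add: filtermap_bot_iff)
  ultimately obtain y where y: "inf (nhds y) (filtermap R F) \<noteq> bot"
    unfolding compact_filter by blast
  define G where "G = inf F (filtercomap R (nhds y))"
  have "G \<noteq> bot"
  proof
    assume "G = bot"
    then have "eventually (\<lambda>_. False) G" by simp
    then obtain Q1 Q2 where Q: "eventually Q1 F" "eventually Q2 (nhds y)" "\<And>x. Q1 x \<Longrightarrow> Q2 (R x) \<Longrightarrow> False"
      unfolding G_def eventually_inf eventually_filtercomap by blast
    have "eventually (\<lambda>z. \<not> Q2 z) (filtermap R F)"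
      using Q(1,3) by (auto simp: eventually_filtermap elim!: eventually_mono)
    then have "eventually (\<lambda>_. False) (inf (nhds y) (filtermap R F))"
      using Q(2) unfolding eventually_inf by blast
    then show False using y by (simp add: trivial_limit_def)
  qed
  moreover have "G \<le> F" by (simp add: G_def)
  moreover have "\<exists>l. (h \<longlongrightarrow> l) G" if h: "Bfun h F" for h :: "'a \<Rightarrow> complex"
  proof -
    have "(R \<longlongrightarrow> y) G"
      unfolding filterlim_def G_def
      by (meson filtermap_filtercomap filtermap_mono inf.cobounded2 order_trans)
    then have "((\<lambda>x. R x h) \<longlongrightarrow> y h) G" by (rule tendsto_fun_apply)
    moreover have "eventually (\<lambda>x. R x h = h x) G"
      using c[OF h] \<open>G \<le> F\<close> unfolding le_filter_def by (auto simp: R_def elim!: eventually_mono)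
    ultimately have "(h \<longlongrightarrow> y h) G" by (rule Lim_transform_eventually)
    then show ?thesis by blast
  qed
  ultimately show thesis using that by blast
qed

locale scalar_field =
  fixes K :: "complex set"
  assumes scalars: "K = \<real> \<or> K = UNIV"
begin

lemma K_of_real [simp]: "of_real t \<in> K"
  using scalars by auto

lemma K_0 [simp]: "0 \<in> K" and K_1 [simp]: "1 \<in> K" and K_neg1 [simp]: "-1 \<in> K"
  using K_of_real[of 0] K_of_real[of 1] K_of_real[of "-1"] by simp_all

lemma K_mult: "a \<in> K \<Longrightarrow> b \<in> K \<Longrightarrow> a * b \<in> K"
  and K_add: "a \<in> K \<Longrightarrow> b \<in> K \<Longrightarrow> a + b \<in> K"
  and K_minus: "a \<in> K \<Longrightarrow> - a \<in> K"
  using scalars by auto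

lemma K_sum: "(\<And>i. i \<in> I \<Longrightarrow> f i \<in> K) \<Longrightarrow> sum f I \<in> K"
  by (induction I rule: infinite_finite_induct) (auto intro: K_add)

text \<open>Elements of a complex Banach lattice are combinations of four positive elements with
  coefficients \<open>\<i> ^ k\<close>; over the reals two elements and the coefficients \<open>1, -1\<close> suffice.\<close>

definition units :: nat where
  "units = (if K = \<real> then 2 else 4)"

definition cunit :: "nat \<Rightarrow> complex" where
  "cunit k = (if K = \<real> then (-1) ^ k else \<i> ^ k)"

lemma not_real: "K \<noteq> \<real> \<Longrightarrow> K = UNIV"
  using scalars by blast

lemma cunit_K [simp]: "cunit k \<in> K"
  using scalars by (auto simp: cunit_def)

lemma norm_cunit [simp]: "cmod (cunit k) = 1"
  by (simp add: cunit_def norm_power)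

lemma sum_cunit:
  fixes p :: "nat \<Rightarrow> 'b::complex_vector"
  shows "(\<Sum>k<units. cunit k *\<^sub>C p k) =
    (if K = \<real> then p 0 - p (Suc 0) else (p 0 - p 2) + \<i> *\<^sub>C (p (Suc 0) - p 3))"
proof -
  have 4: "{..<4::nat} = {0, 1, 2, 3}" and 2: "{..<2::nat} = {0, 1}" by auto
  show ?thesis
    by (simp add: units_def cunit_def 4 2 power3_eq_cube cv.scale_right_diff_distrib)
qed

end

lemma ksubspace_sum:
  assumes "ksubspace K S" "\<And>i. i \<in> I \<Longrightarrow> f i \<in> S"
  shows "sum f I \<in> S"
  using assms(2) by (induction I rule: infinite_finite_induct) (use assms(1) in \<open>auto simp: ksubspace_def\<close>)

lemma linear_over_sum:
  assumes "ksubspace K S" "linear_over K S f" "finite I" "\<And>i. i \<in> I \<Longrightarrow> c i \<in> K \<and> x i \<in> S"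
  shows "f (\<Sum>i\<in>I. c i *\<^sub>C x i) = (\<Sum>i\<in>I. c i *\<^sub>C f (x i))"
  using assms(3,4)
proof (induction I rule: finite_induct)
  case empty
  have "f (0 + 0) = f 0 + f 0" using assms(1,2) unfolding linear_over_def ksubspace_def by blast
  then show ?case by simp
next
  case (insert i I)
  have "(\<Sum>i\<in>I. c i *\<^sub>C x i) \<in> S"
    by (rule ksubspace_sum[OF assms(1)]) (use insert assms(1) in \<open>auto simp: ksubspace_def\<close>)
  moreover have "c i *\<^sub>C x i \<in> S" using insert assms(1) by (auto simp: ksubspace_def)
  ultimately show ?case using insert assms(2) by (auto simp: linear_over_def)
qed

lemma linear_over_0:
  assumes "ksubspace K S" "linear_over K S f" shows "f 0 = 0"
  using linear_over_sum[OF assms finite.emptyI] by simp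

lemma linear_over_diff:
  assumes "ksubspace K S" "linear_over K S f" "-1 \<in> K" "x \<in> S" "y \<in> S" 
  shows "f (x - y) = f x - f y"
proof -
  have "-1 *\<^sub>C y \<in> S" using assms unfolding ksubspace_def by blast
  then have "f (x + -1 *\<^sub>C y) = f x + -1 *\<^sub>C f y"
    using assms unfolding linear_over_def by metis
  then show ?thesis by simp
qed

lemma ksubspace_diff:
  assumes "ksubspace K S" "-1 \<in> K" "x \<in> S" "y \<in> S" 
  shows "x - y \<in> S"
proof -
  have "x + -1 *\<^sub>C y \<in> S" using assms unfolding ksubspace_def by blast
  then show ?thesis by simp
qed


section \<open>Ordered spaces and complexification\<close>

locale ordered_space = scalar_field K for K +
  fixes B :: "'a::complex_vector onspace"
  assumes carr_sub: "ksubspace K (carr B)"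
    and pos_carr: "pos B \<subseteq> carr B"
    and pos_0 [simp]: "0 \<in> pos B"
    and pos_add: "x \<in> pos B \<Longrightarrow> y \<in> pos B \<Longrightarrow> x + y \<in> pos B"
    and pos_scale: "0 \<le> t \<Longrightarrow> x \<in> pos B \<Longrightarrow> of_real t *\<^sub>C x \<in> pos B"
begin

lemma carr_0 [simp]: "0 \<in> carr B" and carr_add: "x \<in> carr B \<Longrightarrow> y \<in> carr B \<Longrightarrow> x + y \<in> carr B"
  and carr_scale: "c \<in> K \<Longrightarrow> x \<in> carr B \<Longrightarrow> c *\<^sub>C x \<in> carr B"
  using carr_sub by (auto simp: ksubspace_def)

lemma carr_diff: "x \<in> carr B \<Longrightarrow> y \<in> carr B \<Longrightarrow> x - y \<in> carr B"
  using ksubspace_diff[OF carr_sub] by simp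

lemma carr_minus: "x \<in> carr B \<Longrightarrow> - x \<in> carr B"
  using carr_diff[of 0 x] by simp

lemma carr_sum: "(\<And>i. i \<in> I \<Longrightarrow> f i \<in> carr B) \<Longrightarrow> sum f I \<in> carr B"
  by (rule ksubspace_sum[OF carr_sub])

lemma pos_sum: "(\<And>i. i \<in> I \<Longrightarrow> f i \<in> pos B) \<Longrightarrow> sum f I \<in> pos B"
  by (induction I rule: infinite_finite_induct) (auto intro: pos_add)

lemma pos_in_carr: "x \<in> pos B \<Longrightarrow> x \<in> carr B"
  using pos_carr by blast

lemma pos_trans: "y - x \<in> pos B \<Longrightarrow> z - y \<in> pos B \<Longrightarrow> z - x \<in> pos B"
  using pos_add[of "y - x" "z - y"] by simp

lemma half_sum: "of_real (1/2) *\<^sub>C (x + x) = (x::'a)"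
  by (simp add: cv.scale_right_distrib flip: cv.scale_left_distrib)

lemma half_double: "of_real (1/2) *\<^sub>C x + of_real (1/2) *\<^sub>C x = (x::'a)"
  by (simp flip: cv.scale_left_distrib)

lemma pos_half: "x + x \<in> pos B \<Longrightarrow> x \<in> pos B"
  using pos_scale[of "1/2" "x + x"] by (simp only: half_sum)

lemma real_partI: "p \<in> pos B \<Longrightarrow> q \<in> pos B \<Longrightarrow> p - q \<in> real_part B"
  by (auto simp: real_part_def)

lemma pos_real: "p \<in> pos B \<Longrightarrow> p \<in> real_part B"
  using real_partI[of p 0] by simp

lemma real_part_0 [simp]: "0 \<in> real_part B"
  by (simp add: pos_real)

lemma real_add: "x \<in> real_part B \<Longrightarrow> y \<in> real_part B \<Longrightarrow> x + y \<in> real_part B"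
  unfolding real_part_def
  by (clarsimp, rename_tac p p' q q', rule_tac x="p + p'" in exI, rule_tac x="q + q'" in exI)
    (auto intro: pos_add)

lemma real_minus: "x \<in> real_part B \<Longrightarrow> - x \<in> real_part B"
  unfolding real_part_def by auto (metis minus_diff_eq)

lemma real_diff: "x \<in> real_part B \<Longrightarrow> y \<in> real_part B \<Longrightarrow> x - y \<in> real_part B"
  using real_add[of x "- y"] real_minus[of y] by simp

lemma real_scale: assumes "x \<in> real_part B" shows "of_real t *\<^sub>C x \<in> real_part B"
proof -
  from assms obtain p q where pq: "x = p - q" "p \<in> pos B" "q \<in> pos B"
    by (auto simp: real_part_def)
  show ?thesis
  proof (cases "0 \<le> t")
    case True
    then show ?thesis
      using pq by (auto simp: cv.scale_right_diff_distrib intro!: real_partI pos_scale)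
  next
    case False
    then have "of_real t *\<^sub>C x = of_real (- t) *\<^sub>C q - of_real (- t) *\<^sub>C p"
      using pq by (simp add: cv.scale_right_diff_distrib)
    moreover have "of_real (- t) *\<^sub>C q \<in> pos B" "of_real (- t) *\<^sub>C p \<in> pos B"
      using False pq by (auto intro!: pos_scale simp del: of_real_minus)
    ultimately show ?thesis using real_partI by metis
  qed
qed

lemma real_carr: "x \<in> real_part B \<Longrightarrow> x \<in> carr B"
  by (auto simp: real_part_def intro: carr_diff pos_in_carr)

lemma imag_real: "y \<in> imag_part K B \<Longrightarrow> y \<in> real_part B"
  by (auto simp: imag_part_def split: if_splits)

lemma imag_0 [simp]: "0 \<in> imag_part K B"
  by (simp add: imag_part_def)

lemma imag_diff: "x \<in> imag_part K B \<Longrightarrow> y \<in> imag_part K B \<Longrightarrow> x - y \<in> imag_part K B"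
  by (auto simp: imag_part_def real_diff split: if_splits)

lemma imag_add: "x \<in> imag_part K B \<Longrightarrow> y \<in> imag_part K B \<Longrightarrow> x + y \<in> imag_part K B"
  by (auto simp: imag_part_def real_add split: if_splits)

lemma imag_scale: "x \<in> imag_part K B \<Longrightarrow> of_real t *\<^sub>C x \<in> imag_part K B"
  by (auto simp: imag_part_def real_scale split: if_splits)

lemma imag_minus: "x \<in> imag_part K B \<Longrightarrow> - x \<in> imag_part K B"
  using imag_diff[of 0 x] by simp

text \<open>The supremum defining the modulus is tested at the scalars 1 and -1, and for the bounds
  on \<open>y\<close> also at \<open>- \<i>\<close> and \<open>\<i>\<close>.\<close>

lemma is_modulus_bounds:
  assumes m: "is_modulus K B (x + \<i> *\<^sub>C y) m" and x: "x \<in> real_part B" and y: "y \<in> imag_part K B"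
  shows "m - x \<in> pos B" "m + x \<in> pos B" "m - y \<in> pos B" "m + y \<in> pos B" "m \<in> pos B"
proof -
  have *: "m - u \<in> pos B" if "u \<in> real_part B" "c \<in> K" "cmod c = 1" "v \<in> imag_part K B"
    "c *\<^sub>C (x + \<i> *\<^sub>C y) = u + \<i> *\<^sub>C v" for u c v
    using m that unfolding is_modulus_def is_sup_in_def le_in_def by blast
  show 1: "m - x \<in> pos B"
    using *[of x 1 y] x y by simp
  have "m - (- x) \<in> pos B"
    using *[of "- x" "-1" "- y"] x y real_minus imag_minus by (simp add: cv.scale_right_distrib)
  then show 2: "m + x \<in> pos B" by simp
  show "m \<in> pos B"
    using pos_add[OF 1 2] by (rule_tac pos_half) simp
  have "m - y \<in> pos B \<and> m + y \<in> pos B"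
  proof (cases "K = \<real>")
    case True
    then show ?thesis using y \<open>m \<in> pos B\<close> by (simp add: imag_part_def)
  next
    case False
    then have K: "K = UNIV" using scalars by blast
    have yr: "y \<in> real_part B" using y imag_real by blast
    have xi: "x \<in> imag_part K B" using x False by (simp add: imag_part_def)
    \<comment> \<open>Multiplication by \<open>- \<i>\<close> turns \<open>x + \<i> y\<close> into
      \<open>y - \<i> x\<close>, which has real part \<open>y\<close>.\<close>
    have "m - y \<in> pos B"
      using *[of y "-\<i>" "- x"] yr xi imag_minus K by (simp add: cv.scale_right_distrib)
    moreover have "m - (- y) \<in> pos B"
      using *[of "- y" "\<i>" "x"] yr xi real_minus K by (simp add: cv.scale_right_distrib)
    ultimately show ?thesis by simp
  qed
  then show "m - y \<in> pos B" "m + y \<in> pos B" by auto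
qed

text \<open>The four parts of \<open>x + \<i> y\<close> are \<open>(m \<plusminus> x) / 2\<close> and \<open>(m' \<plusminus> y) / 2\<close>, with \<open>m\<close> and \<open>m'\<close> the moduli.\<close>

lemma riesz_decomposition:
  assumes S: "riesz_subspace K B S" and z: "z \<in> S" "z = x + \<i> *\<^sub>C y"
    and xy: "x \<in> real_part B" "y \<in> imag_part K B"
  obtains p m m' where "\<And>k. k < units \<Longrightarrow> p k \<in> pos B \<inter> S" "z = (\<Sum>k<units. cunit k *\<^sub>C p k)"
    "is_modulus K B x m" "is_modulus K B y m'" 
    "\<And>k. k < units \<Longrightarrow> m - p k \<in> pos B \<or> m' - p k \<in> pos B"
proof -
  have Ssub: "ksubspace K S" and xyS: "x \<in> S" "y \<in> S"
    using S z xy by (auto simp: riesz_subspace_def)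
  obtain m where m: "m \<in> S" "is_modulus K B x m"
    using S xyS unfolding riesz_subspace_def by blast
  obtain m' where m': "m' \<in> S" "is_modulus K B y m'"
    using S xyS unfolding riesz_subspace_def by blast
  have halfS: "of_real (1/2) *\<^sub>C u \<in> S" if "u \<in> S" for u
    using Ssub that K_of_real[of "1/2"] unfolding ksubspace_def by blast
  have mx: "m - x \<in> pos B" "m + x \<in> pos B"
    using is_modulus_bounds[of x 0 m] m xy by simp_all
  have my: "m' - y \<in> pos B" "m' + y \<in> pos B"
    using is_modulus_bounds[of y 0 m'] m' xy imag_real by simp_all
  have H: "of_real (1/2) *\<^sub>C (m + x) - of_real (1/2) *\<^sub>C (m - x) = x" for m x :: 'a
    using half_double[of x] by (simp add: cv.scale_right_distrib cv.scale_right_diff_distrib)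
  have L: "m - of_real (1/2) *\<^sub>C (m + x) = of_real (1/2) *\<^sub>C (m - x)" 
          "m - of_real (1/2) *\<^sub>C (m - x) = of_real (1/2) *\<^sub>C (m + x)" for m x :: 'a
    using half_double[of m] by (auto simp: cv.scale_right_distrib cv.scale_right_diff_distrib algebra_simps)
  define h where "h u = of_real (1/2) *\<^sub>C u" for u :: 'a
  \<comment> \<open>The numbering follows the coefficients of \<open>cunit\<close>: over the complex
    numbers 0 and 2 belong to \<open>x\<close>, 1 and 3 to \<open>y\<close>.\<close>
  define p where "p k = (if K = \<real> then if k = 0 then h (m + x) else h (m - x)
     else if k = 0 then h (m + x) else if k = 2 then h (m - x) else if k = 1 then h (m' + y)
     else h (m' - y))" for k :: nat
  have hp: "h u \<in> pos B" if "u \<in> pos B" for u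
    using pos_scale[of "1/2" u] that by (simp add: h_def)
  have hS: "h u \<in> S" if "u \<in> S" for u
    using halfS that by (simp add: h_def)
  have addS: "u + v \<in> S" "u - v \<in> S" if "u \<in> S" "v \<in> S" for u v
    using Ssub that ksubspace_diff[OF Ssub] by (auto simp: ksubspace_def)
  have hh: "h (m + x) - h (m - x) = x" "h (m' + y) - h (m' - y) = y"
    using H by (simp_all add: h_def)
  have "p k \<in> pos B \<inter> S" for k
    using mx my m(1) m'(1) xyS by (auto simp: p_def intro!: hp hS addS)
  moreover have "z = (\<Sum>k<units. cunit k *\<^sub>C p k)"
  proof (cases "K = \<real>")
    case True
    then have "y = 0" using xy by (simp add: imag_part_def)
    moreover have "p 0 = h (m + x)" "p (Suc 0) = h (m - x)" using True by (simp_all add: p_def)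
    ultimately show ?thesis
      unfolding sum_cunit if_P[OF True] using z hh by simp
  next
    case False
    then have "p 0 = h (m + x)" "p 2 = h (m - x)" "p (Suc 0) = h (m' + y)" "p 3 = h (m' - y)"
      by (simp_all add: p_def)
    then show ?thesis
      unfolding sum_cunit if_not_P[OF False] using z hh by simp
  qed
  moreover have "m - p k \<in> pos B \<or> m' - p k \<in> pos B" for k
    using hp[OF mx(1)] hp[OF mx(2)] hp[OF my(1)] hp[OF my(2)] L
    unfolding p_def h_def by presburger
  ultimately show thesis using that[of p m m'] m(2) m'(2) by simp
qed

end

text \<open>Weaker than a Banach lattice on purpose: the regular operators decompose into real and
  imaginary parts, but need not form a lattice.\<close>

locale complexified_space = ordered_space +
  assumes decomp: "z \<in> carr B \<Longrightarrow> \<exists>x\<in>real_part B. \<exists>y\<in>imag_part K B. z = x + \<i> *\<^sub>C y"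
    and decomp_0: "x \<in> real_part B \<Longrightarrow> y \<in> imag_part K B \<Longrightarrow> x + \<i> *\<^sub>C y = 0 \<Longrightarrow> x = 0 \<and> y = 0"
begin

lemma decomp_unique:
  assumes "x + \<i> *\<^sub>C y = x' + \<i> *\<^sub>C y'" "x \<in> real_part B" "y \<in> imag_part K B" 
    "x' \<in> real_part B" "y' \<in> imag_part K B"
  shows "x = x'" "y = y'"
proof -
  have "(x - x') + \<i> *\<^sub>C (y - y') = 0"
    using assms(1) by (simp add: cv.scale_right_diff_distrib algebra_simps)
  from decomp_0[OF _ _ this] assms show "x = x'" "y = y'"
    by (simp_all add: real_diff imag_diff)
qed

lemma i_imag_carr: "y \<in> imag_part K B \<Longrightarrow> \<i> *\<^sub>C y \<in> carr B"
  using scalars by (auto simp: imag_part_def intro: carr_scale real_carr split: if_splits)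

text \<open>Additivity makes the extension to differences of positive elements well defined, and
  uniqueness of the decomposition \<open>x + \<i> y\<close> then gives the extension to the whole
  space. It allows positive maps to be built and compared on cones only; the value 0 off
  \<open>carr B\<close> matches the representation of operators.\<close>

lemma linear_extension:
  fixes \<phi> :: "'a \<Rightarrow> 'v::complex_vector"
  assumes add: "\<And>x y. x \<in> pos B \<Longrightarrow> y \<in> pos B \<Longrightarrow> \<phi> (x + y) = \<phi> x + \<phi> y"
    and scale: "\<And>t x. 0 \<le> t \<Longrightarrow> x \<in> pos B \<Longrightarrow> \<phi> (of_real t *\<^sub>C x) = of_real t *\<^sub>C \<phi> x"
  obtains f where "linear_over K (carr B) f" "\<And>x. x \<in> pos B \<Longrightarrow> f x = \<phi> x" 
    "\<And>x. x \<notin> carr B \<Longrightarrow> f x = 0"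
proof -
  define g where "g r = (THE v. \<exists>p\<in>pos B. \<exists>q\<in>pos B. r = p - q \<and> v = \<phi> p - \<phi> q)" for r
  have g: "g (p - q) = \<phi> p - \<phi> q" if "p \<in> pos B" "q \<in> pos B" for p q
    unfolding g_def
  proof (rule the_equality)
    fix v assume "\<exists>p'\<in>pos B. \<exists>q'\<in>pos B. p - q = p' - q' \<and> v = \<phi> p' - \<phi> q'"
    then obtain p' q' where *: "p' \<in> pos B" "q' \<in> pos B" "p - q = p' - q'" "v = \<phi> p' - \<phi> q'" by blast
    then have "p + q' = p' + q" by (simp add: algebra_simps)
    then have "\<phi> p + \<phi> q' = \<phi> p' + \<phi> q" using add * that by metis
    then show "v = \<phi> p - \<phi> q" unfolding *(4) by (metis add_diff_cancel_right' add_diff_eq diff_add_eq)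
  qed (use that in blast)
  have \<phi>0: "\<phi> 0 = 0" using scale[of 0 0] by simp
  have g_pos: "g p = \<phi> p" if "p \<in> pos B" for p
    using g[of p 0] that \<phi>0 by simp
  have g_add: "g (r + s) = g r + g s" if "r \<in> real_part B" "s \<in> real_part B" for r s
  proof -
    obtain p q p' q' where *: "p \<in> pos B" "q \<in> pos B" "p' \<in> pos B" "q' \<in> pos B" "r = p - q" "s = p' - q'"
      using \<open>r \<in> _\<close> \<open>s \<in> _\<close> by (auto simp: real_part_def)
    have "r + s = (p + p') - (q + q')" using * by simp
    then have "g (r + s) = \<phi> (p + p') - \<phi> (q + q')" using g * pos_add by metis
    then show ?thesis using * by (simp add: add g)
  qed
  have g_minus: "g (- r) = - g r" if "r \<in> real_part B" for r
    using g_add[of r "- r"] real_minus that g_pos[of 0] \<phi>0 by (simp add: minus_unique)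
  have g_scale: "g (of_real t *\<^sub>C r) = of_real t *\<^sub>C g r" if "r \<in> real_part B" for t r
  proof -
    have pos: "g (of_real t *\<^sub>C r) = of_real t *\<^sub>C g r" if "0 \<le> t" "r \<in> real_part B" for t r
    proof -
      obtain p q where *: "p \<in> pos B" "q \<in> pos B" "r = p - q"
        using \<open>r \<in> _\<close> by (auto simp: real_part_def)
      then show ?thesis
        using that g[of "of_real t *\<^sub>C p" "of_real t *\<^sub>C q"] 
        by (simp add: cv.scale_right_diff_distrib pos_scale scale g)
    qed
    show ?thesis
    proof (cases "0 \<le> t")
      case False
      then have "g (of_real (- t) *\<^sub>C r) = of_real (- t) *\<^sub>C g r" by (intro pos that) simp
      then show ?thesis using g_minus[OF real_scale[OF that, of t]] by simp
    qed (simp add: pos that)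
  qed
  define re where "re z = (THE x. x \<in> real_part B \<and> (\<exists>y\<in>imag_part K B. z = x + \<i> *\<^sub>C y))" for z
  define im where "im z = (THE y. y \<in> imag_part K B \<and> (\<exists>x\<in>real_part B. z = x + \<i> *\<^sub>C y))" for z
  have re: "re (x + \<i> *\<^sub>C y) = x" and im: "im (x + \<i> *\<^sub>C y) = y"
    if "x \<in> real_part B" "y \<in> imag_part K B" for x y
    unfolding re_def im_def
    by (rule the_equality; use that decomp_unique in blast)+
  define f where "f z = (if z \<in> carr B then g (re z) + \<i> *\<^sub>C g (im z) else 0)" for z
  have f: "f (x + \<i> *\<^sub>C y) = g x + \<i> *\<^sub>C g y" if "x \<in> real_part B" "y \<in> imag_part K B" for x y
    using that by (simp add: f_def re im carr_add real_carr i_imag_carr)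
  have "f (z + w) = f z + f w" if "z \<in> carr B" "w \<in> carr B" for z w
  proof -
    from decomp that obtain x y x' y' where *: "x \<in> real_part B" "y \<in> imag_part K B" 
      "x' \<in> real_part B" "y' \<in> imag_part K B" "z = x + \<i> *\<^sub>C y" "w = x' + \<i> *\<^sub>C y'" by metis
    then have "z + w = (x + x') + \<i> *\<^sub>C (y + y')" by (simp add: cv.scale_right_distrib)
    then have "f (z + w) = g (x + x') + \<i> *\<^sub>C g (y + y')"
      using * by (simp only: f real_add imag_add)
    then show ?thesis using * by (simp add: f g_add imag_real cv.scale_right_distrib)
  qed
  moreover have "f (c *\<^sub>C z) = c *\<^sub>C f z" if c: "c \<in> K" and "z \<in> carr B" for c z
  proof -
    from decomp that obtain x y where *: "x \<in> real_part B" "y \<in> imag_part K B" "z = x + \<i> *\<^sub>C y" by metis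
    show ?thesis
    proof (cases "K = \<real>")
      case True
      then obtain t where t: "c = of_real t" using c by (auto elim: Reals_cases)
      have "c *\<^sub>C z = of_real t *\<^sub>C x + \<i> *\<^sub>C of_real t *\<^sub>C y" 
        using * t by (simp add: cv.scale_right_distrib mult.commute)
      then have "f (c *\<^sub>C z) = g (of_real t *\<^sub>C x) + \<i> *\<^sub>C g (of_real t *\<^sub>C y)"
        using f real_scale imag_scale * by metis
      then show ?thesis
        using * t by (simp add: f g_scale imag_real cv.scale_right_distrib mult.commute)
    next
      case False
      have yr: "y \<in> real_part B" using * imag_real by blast
      have im: "u \<in> imag_part K B" if "u \<in> real_part B" for u using that False by (simp add: imag_part_def)
      define a b where "a = Re c" and "b = Im c"
      have c: "c = of_real a + \<i> * of_real b" by (simp add: a_def b_def complex_eq)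
      have "c *\<^sub>C z = (of_real a *\<^sub>C x - of_real b *\<^sub>C y) + \<i> *\<^sub>C (of_real b *\<^sub>C x + of_real a *\<^sub>C y)"
        using * by (simp add: c cv.scale_right_distrib cv.scale_left_distrib algebra_simps)
      moreover have r: "of_real a *\<^sub>C x \<in> real_part B" "of_real b *\<^sub>C y \<in> real_part B" 
         "of_real b *\<^sub>C x \<in> real_part B" "of_real a *\<^sub>C y \<in> real_part B"
        using * yr real_scale by auto
      ultimately have "f (c *\<^sub>C z) = g (of_real a *\<^sub>C x - of_real b *\<^sub>C y) + \<i> *\<^sub>C g (of_real b *\<^sub>C x + of_real a *\<^sub>C y)"
        using f real_diff im real_add by metis
      also have "\<dots> = (of_real a *\<^sub>C g x - of_real b *\<^sub>C g y) + \<i> *\<^sub>C (of_real b *\<^sub>C g x + of_real a *\<^sub>C g y)"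
        using g_add[of "of_real a *\<^sub>C x" "- (of_real b *\<^sub>C y)"] g_add[of "of_real b *\<^sub>C x" "of_real a *\<^sub>C y"] 
          g_minus r real_minus * yr by (simp add: g_scale)
      also have "\<dots> = c *\<^sub>C f z"
        using * f by (simp add: c cv.scale_right_distrib cv.scale_left_distrib algebra_simps)
      finally show ?thesis .
    qed
  qed
  ultimately have "linear_over K (carr B) f" by (simp add: linear_over_def)
  moreover have "f x = \<phi> x" if "x \<in> pos B" for x
    using f[of x 0] that g_pos \<phi>0 pos_0 by (simp add: pos_real)
  moreover have "f x = 0" if "x \<notin> carr B" for x
    using that by (simp add: f_def)
  ultimately show thesis using that by blast
qed

end


section \<open>Banach lattices\<close>

lemma op_norm_nonneg: "0 \<le> op_norm B C f"
  if "\<exists>c. \<forall>x\<in>carr B. nrm C (f x) \<le> c * nrm B x" "\<And>x. x \<in> carr B \<Longrightarrow> 0 \<le> nrm B x"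
proof -
  from that obtain c where c: "\<forall>x\<in>carr B. nrm C (f x) \<le> c * nrm B x" by blast
  have "nrm C (f x) \<le> max 0 c * nrm B x" if "x \<in> carr B" for x
    using c that \<open>\<And>x. x \<in> carr B \<Longrightarrow> 0 \<le> nrm B x\<close>[OF that]
    by (meson max.cobounded2 mult_right_mono order_trans)
  then have "{c. 0 \<le> c \<and> (\<forall>x\<in>carr B. nrm C (f x) \<le> c * nrm B x)} \<noteq> {}"
    by (auto intro!: exI[of _ "max 0 c"])
  then show ?thesis unfolding op_norm_def by (intro cInf_greatest) auto
qed

lemma op_norm_le:
  assumes "0 \<le> c" "\<And>x. x \<in> carr B \<Longrightarrow> nrm C (f x) \<le> c * nrm B x"
  shows "op_norm B C f \<le> c"
  unfolding op_norm_def using assms by (intro cInf_lower) (auto intro!: bdd_belowI[of _ 0])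

lemma op_norm_bound:
  assumes "\<exists>c. \<forall>x\<in>carr B. nrm C (f x) \<le> c * nrm B x" "\<And>x. x \<in> carr B \<Longrightarrow> 0 \<le> nrm B x"
    and x: "x \<in> carr B"
  shows "nrm C (f x) \<le> op_norm B C f * nrm B x"
proof -
  from assms obtain c where c: "\<forall>x\<in>carr B. nrm C (f x) \<le> c * nrm B x" by blast
  have *: "nrm C (f y) \<le> max 0 c * nrm B y" if "y \<in> carr B" for y
    using c that assms(2)[OF that]
    by (meson max.cobounded2 mult_right_mono order_trans)
  show ?thesis
  proof (cases "nrm B x = 0")
    case True
    then show ?thesis using *[OF x] by simp
  next
    case False
    then have pos: "0 < nrm B x" using assms(2)[OF x] by simp
    have "nrm C (f x) / nrm B x \<le> op_norm B C f"
      unfolding op_norm_def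
    proof (rule cInf_greatest)
      show "{c. 0 \<le> c \<and> (\<forall>x\<in>carr B. nrm C (f x) \<le> c * nrm B x)} \<noteq> {}"
        using * by (auto intro!: exI[of _ "max 0 c"])
    qed (use x pos in \<open>auto simp: field_simps\<close>)
    then show ?thesis using pos by (simp add: field_simps)
  qed
qed

locale blattice = scalar_field K for K +
  fixes B :: "'a::complex_vector onspace"
  assumes lattice: "banach_lattice K B"
begin

lemma banach: "banach_space K B"
  using lattice by (simp add: banach_lattice_def)

lemma decomp_ex1: "z \<in> carr B \<Longrightarrow> \<exists>!(x, y). x \<in> real_part B \<and> y \<in> imag_part K B \<and> z = x + \<i> *\<^sub>C y"
  using lattice by (simp only: banach_lattice_def)

sublocale complexified_space K B
proof -
  interpret ordered_space K B
    using lattice by unfold_locales (auto simp: banach_lattice_def banach_space_def)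
  show "complexified_space K B"
  proof
    fix z assume "z \<in> carr B"
    then show "\<exists>x\<in>real_part B. \<exists>y\<in>imag_part K B. z = x + \<i> *\<^sub>C y"
      using decomp_ex1 by blast
  next
    fix x y assume *: "x \<in> real_part B" "y \<in> imag_part K B" "x + \<i> *\<^sub>C y = 0"
    have ex1: "a = b" if "\<exists>!q. Q q" "Q a" "Q b" for Q and a b :: "'a \<times> 'a" using that by blast
    have "(x, y) = (0, 0)"
      by (rule ex1[OF decomp_ex1[OF carr_0]]) (use * in simp_all)
    then show "x = 0 \<and> y = 0" by auto
  qed
qed

lemma pos_antisym: "x \<in> pos B \<Longrightarrow> - x \<in> pos B \<Longrightarrow> x = 0"
  using lattice by (auto simp: banach_lattice_def)

lemma nrm_0_iff: "x \<in> carr B \<Longrightarrow> nrm B x = 0 \<longleftrightarrow> x = 0"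
  and nrm_triangle: "x \<in> carr B \<Longrightarrow> y \<in> carr B \<Longrightarrow> nrm B (x + y) \<le> nrm B x + nrm B y"
  and nrm_scale: "c \<in> K \<Longrightarrow> x \<in> carr B \<Longrightarrow> nrm B (c *\<^sub>C x) = cmod c * nrm B x"
  using banach unfolding banach_space_def by blast+

lemma nrm_0 [simp]: "nrm B 0 = 0"
  using nrm_0_iff by simp

lemma nrm_minus: "x \<in> carr B \<Longrightarrow> nrm B (- x) = nrm B x"
  using nrm_scale[of "-1" x] by simp

lemma nrm_nonneg: "x \<in> carr B \<Longrightarrow> 0 \<le> nrm B x"
  using nrm_triangle[of x "- x"] nrm_minus carr_minus by force

lemma nrm_triangle_diff: "x \<in> carr B \<Longrightarrow> y \<in> carr B \<Longrightarrow> nrm B (x - y) \<le> nrm B x + nrm B y"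
  using nrm_triangle[of x "- y"] nrm_minus carr_minus by force

lemma nrm_sum: "(\<And>i. i \<in> I \<Longrightarrow> f i \<in> carr B) \<Longrightarrow> nrm B (\<Sum>i\<in>I. f i) \<le> (\<Sum>i\<in>I. nrm B (f i))"
proof (induction I rule: infinite_finite_induct)
  case (insert i I)
  then show ?case
    using nrm_triangle[of "f i" "sum f I"] by (simp add: carr_sum)
qed simp_all

lemma nrm_mono: "x \<in> pos B \<Longrightarrow> y - x \<in> pos B \<Longrightarrow> nrm B x \<le> nrm B y"
  using lattice pos_add[of x "y - x"] by (auto simp: banach_lattice_def le_in_def)

lemma complete:
  assumes "range u \<subseteq> carr B" "\<And>e. e > 0 \<Longrightarrow> \<exists>N. \<forall>m\<ge>N. \<forall>n\<ge>N. nrm B (u m - u n) < e"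
  shows "\<exists>y. tends_in B u y"
  using assms banach unfolding banach_space_def by blast

lemma is_sup_unique: "is_sup_in B S m \<Longrightarrow> is_sup_in B S m' \<Longrightarrow> m = m'"
  using pos_antisym[of "m - m'"] by (auto simp: is_sup_in_def le_in_def)

lemma is_modulus_unique: "is_modulus K B z m \<Longrightarrow> is_modulus K B z m' \<Longrightarrow> m = m'"
  unfolding is_modulus_def by (rule is_sup_unique)

lemma modulus:
  assumes "z \<in> carr B"
  shows "is_modulus K B z (modulus K B z)" "nrm B (modulus K B z) = nrm B z"
proof -
  obtain m where m: "is_modulus K B z m" "nrm B z = nrm B m"
    using lattice assms unfolding banach_lattice_def by blast
  then have "modulus K B z = m"
    unfolding modulus_def using is_modulus_unique by blast
  with m show "is_modulus K B z (modulus K B z)" "nrm B (modulus K B z) = nrm B z" by simp_all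
qed

lemma modulus_bounds:
  assumes "x \<in> real_part B" "y \<in> imag_part K B"
  shows "modulus K B (x + \<i> *\<^sub>C y) - x \<in> pos B" "modulus K B (x + \<i> *\<^sub>C y) + x \<in> pos B"
    "modulus K B (x + \<i> *\<^sub>C y) - y \<in> pos B" "modulus K B (x + \<i> *\<^sub>C y) + y \<in> pos B"
  using is_modulus_bounds[OF modulus(1) assms] assms by (auto simp: carr_add real_carr i_imag_carr)

lemma modulus_pos: "z \<in> carr B \<Longrightarrow> modulus K B z \<in> pos B"
  using is_modulus_bounds(5) modulus(1) decomp by metis

text \<open>For real \<open>x\<close> the real part of \<open>c x\<close> is \<open>Re c\<close>
  times \<open>x\<close> with \<open>\<bar>Re c\<bar> \<le> 1\<close>, so \<open>u\<close> minus it
  is a convex combination of \<open>u - x\<close> and \<open>u + x\<close>.\<close>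

lemma modulus_real_least:
  assumes x: "x \<in> real_part B" and u: "u - x \<in> pos B" "u + x \<in> pos B" "u \<in> carr B"
  shows "u - modulus K B x \<in> pos B"
proof -
  have *: "u - of_real t *\<^sub>C x \<in> pos B" if "\<bar>t\<bar> \<le> 1" for t
  proof -
    have "of_real ((1 + t)/2) *\<^sub>C (u - x) + of_real ((1 - t)/2) *\<^sub>C (u + x) 
       = of_real ((1 + t)/2 + (1 - t)/2) *\<^sub>C u - of_real ((1 + t)/2 - (1 - t)/2) *\<^sub>C x"
      unfolding of_real_add of_real_diff
      by (simp only: cv.scale_right_diff_distrib cv.scale_right_distrib cv.scale_left_distrib cv.scale_left_diff_distrib) simp
    also have "\<dots> = u - of_real t *\<^sub>C x" by (simp add: field_simps)
    finally show ?thesis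
      using u that pos_add pos_scale by (metis abs_le_iff add_le_same_cancel2 diff_ge_0_iff_ge
        divide_nonneg_nonneg le_add_same_cancel1 minus_le_iff real_0_le_add_iff zero_le_numeral)
  qed
  have "u - r \<in> pos B" if r: "r \<in> real_part B" "c \<in> K" "cmod c = 1" "y \<in> imag_part K B" "c *\<^sub>C x = r + \<i> *\<^sub>C y" for r c y
  proof -
    have "c *\<^sub>C x = of_real (Re c) *\<^sub>C x + \<i> *\<^sub>C of_real (Im c) *\<^sub>C x"
      by (simp flip: cv.scale_left_distrib complex_eq)
    moreover have "of_real (Im c) *\<^sub>C x \<in> imag_part K B"
      using r(2) real_scale[OF x] by (auto simp: imag_part_def complex_is_Real_iff)
    ultimately have "r = of_real (Re c) *\<^sub>C x"
      using r decomp_unique real_scale[OF x] by metis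
    then show ?thesis using *[of "Re c"] abs_Re_le_cmod[of c] r by simp
  qed
  then show ?thesis
    using modulus(1)[OF real_carr[OF x]] u(3) by (auto simp: is_modulus_def is_sup_in_def le_in_def)
qed

lemma nrm_parts_le:
  assumes "x \<in> real_part B" "y \<in> imag_part K B"
  shows "nrm B x \<le> nrm B (x + \<i> *\<^sub>C y)" "nrm B y \<le> nrm B (x + \<i> *\<^sub>C y)"
proof -
  have c: "x + \<i> *\<^sub>C y \<in> carr B" using assms by (simp add: carr_add real_carr i_imag_carr)
  have "modulus K B (x + \<i> *\<^sub>C y) - modulus K B x \<in> pos B"
    "modulus K B (x + \<i> *\<^sub>C y) - modulus K B y \<in> pos B"
    using modulus_bounds[OF assms] assms modulus_pos[OF c]
    by (auto intro!: modulus_real_least simp: imag_real pos_in_carr)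
  then show "nrm B x \<le> nrm B (x + \<i> *\<^sub>C y)" "nrm B y \<le> nrm B (x + \<i> *\<^sub>C y)"
    using nrm_mono modulus modulus_pos assms c by (metis imag_real real_carr)+
qed

lemma riesz_carr: "riesz_subspace K B (carr B)"
  unfolding riesz_subspace_def
  using carr_sub modulus(1) modulus_pos pos_in_carr imag_real real_carr by blast

lemma positive_parts:
  assumes S: "riesz_subspace K B S" and z: "z \<in> S"
  obtains p where "\<And>k. k < units \<Longrightarrow> p k \<in> pos B \<inter> S" "z = (\<Sum>k<units. cunit k *\<^sub>C p k)"
    "\<And>k. k < units \<Longrightarrow> nrm B (p k) \<le> nrm B z"
proof -
  have "z \<in> carr B" using assms by (auto simp: riesz_subspace_def)
  from decomp[OF this] obtain x y where xy: "x \<in> real_part B" "y \<in> imag_part K B" "z = x + \<i> *\<^sub>C y" by blast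
  obtain p m m' where p: "\<And>k. k < units \<Longrightarrow> p k \<in> pos B \<inter> S" "z = (\<Sum>k<units. cunit k *\<^sub>C p k)"
    "is_modulus K B x m" "is_modulus K B y m'" 
    "\<And>k. k < units \<Longrightarrow> m - p k \<in> pos B \<or> m' - p k \<in> pos B"
    using riesz_decomposition[OF S z xy(3,1,2)] by blast
  have "m = modulus K B x" "m' = modulus K B y"
    using is_modulus_unique[OF p(3) modulus(1)] is_modulus_unique[OF p(4) modulus(1)] xy imag_real real_carr
    by blast+
  then have "nrm B m \<le> nrm B z" "nrm B m' \<le> nrm B z"
    using xy modulus imag_real real_carr nrm_parts_le by metis+
  then have "nrm B (p k) \<le> nrm B z" if "k < units" for k
    using p(1,5)[OF that] nrm_mono by fastforce
  with p show thesis using that by blast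
qed

text \<open>The witness is \<open>(m + x) / 2\<close>, where \<open>m\<close> is the modulus of
  \<open>x\<close>. It stays in \<open>S\<close> because the modulus that \<open>S\<close> provides
  is, by uniqueness, the one taken in \<open>B\<close>.\<close>

lemma pos_part:
  assumes S: "riesz_subspace K B S" and x: "x \<in> real_part B" "x \<in> S"
  obtains s where "s \<in> pos B" "s \<in> S" "s - x \<in> pos B" 
    "\<And>u. u \<in> pos B \<Longrightarrow> u - x \<in> pos B \<Longrightarrow> u - s \<in> pos B"
proof -
  let ?m = "modulus K B x"
  define s where "s = of_real (1/2) *\<^sub>C (?m + x)"
  have mS: "?m \<in> S"
    using S x is_modulus_unique[OF modulus(1)[OF real_carr[OF x(1)]]] unfolding riesz_subspace_def by metis
  have m: "?m - x \<in> pos B" "?m + x \<in> pos B" using modulus_bounds[OF x(1) imag_0] by simp_all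
  have ss: "s + s = ?m + x" unfolding s_def by (rule half_double)
  show thesis
  proof (rule that[of s])
    show "s \<in> pos B" unfolding s_def by (intro pos_scale m) simp
    have "?m + x \<in> S" using S mS x(2) by (auto simp: riesz_subspace_def ksubspace_def)
    then show "s \<in> S" using S K_of_real[of "1/2"] unfolding s_def riesz_subspace_def ksubspace_def by blast
    have "(s - x) + (s - x) = ?m - x" using ss by (simp add: algebra_simps)
    then show "s - x \<in> pos B" using m(1) pos_half[of "s - x"] by (simp only:)
    fix u assume u: "u \<in> pos B" "u - x \<in> pos B"
    have "(u + u - x) - ?m \<in> pos B"
    proof (rule modulus_real_least[OF x(1)])
      show "u + u - x - x \<in> pos B" using pos_add[OF u(2) u(2)] by (simp add: algebra_simps)
      show "u + u - x + x \<in> pos B" using pos_add[OF u(1) u(1)] by simp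
      show "u + u - x \<in> carr B" using u x real_carr pos_in_carr by (intro carr_diff carr_add) auto
    qed
    moreover have "(u - s) + (u - s) = (u + u - x) - ?m" using ss by (simp add: algebra_simps)
    ultimately show "u - s \<in> pos B" using pos_half[of "u - s"] by (simp only:)
  qed
qed

text \<open>The Riesz decomposition property, with the two pieces kept in \<open>S\<close>: if
  \<open>s\<close> is the positive part of \<open>u - z1\<close>, then \<open>u - s\<close> lies
  below \<open>z1\<close> and \<open>s\<close> below \<open>z2\<close>.\<close>

lemma riesz_property:
  assumes S: "riesz_subspace K B S" and mem: "u \<in> S" "z1 \<in> S" 
    and *: "u \<in> pos B" "z1 \<in> pos B" "z2 \<in> pos B" "z1 + z2 - u \<in> pos B"
  obtains u1 u2 where "u1 \<in> pos B" "u2 \<in> pos B" "u1 \<in> S" "u2 \<in> S" "u = u1 + u2" "z1 - u1 \<in> pos B" "z2 - u2 \<in> pos B"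
proof -
  have Ssub: "ksubspace K S" using S by (simp add: riesz_subspace_def)
  have uz: "u - z1 \<in> S" using ksubspace_diff[OF Ssub K_neg1 mem] .
  obtain s where s: "s \<in> pos B" "s \<in> S" "s - (u - z1) \<in> pos B" 
    "\<And>v. v \<in> pos B \<Longrightarrow> v - (u - z1) \<in> pos B \<Longrightarrow> v - s \<in> pos B"
    using pos_part[OF S real_partI[OF *(1,2)] uz] by metis
  show thesis
  proof (rule that[of "u - s" s])
    show "u - s \<in> pos B" using s(4)[of u] * by simp
    show "z2 - s \<in> pos B" using s(4)[of z2] * by (simp add: algebra_simps)
    show "z1 - (u - s) \<in> pos B" using s(3) by (simp add: algebra_simps)
    show "u - s \<in> S" by (rule ksubspace_diff[OF Ssub K_neg1 mem(1) s(2)])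
  qed (use s in auto)
qed

text \<open>The imaginary part of the limit is bounded in norm by the distance to every
  \<open>u n\<close>, hence vanishes. As \<open>u n\<close> is positive, the negative part of the
  real part is below the modulus of \<open>x - u n\<close>, so it vanishes as well.\<close>

lemma pos_closed:
  assumes u: "\<And>n. u n \<in> pos B" and z: "tends_in B u z"
  shows "z \<in> pos B"
proof -
  have zc: "z \<in> carr B" and lim: "(\<lambda>n. nrm B (z - u n)) \<longlonglongrightarrow> 0" using z by (auto simp: tends_in_def)
  obtain x y where xy: "x \<in> real_part B" "y \<in> imag_part K B" "z = x + \<i> *\<^sub>C y" using decomp zc by blast
  have diff: "z - u n = (x - u n) + \<i> *\<^sub>C y" for n using xy by simp
  have re: "x - u n \<in> real_part B" for n using xy u real_diff pos_real by blast
  have small: "a \<le> 0" if "\<And>n. a \<le> nrm B (z - u n)" for a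
    using LIMSEQ_le_const[OF lim] that by blast
  have "nrm B y \<le> 0" using small nrm_parts_le[OF re xy(2)] diff by metis
  then have "y = 0" using nrm_nonneg nrm_0_iff xy imag_real real_carr by (metis antisym)
  obtain s where s: "s \<in> pos B" "s - (- x) \<in> pos B" 
    "\<And>v. v \<in> pos B \<Longrightarrow> v - (- x) \<in> pos B \<Longrightarrow> v - s \<in> pos B"
    using pos_part[OF riesz_carr real_minus[OF xy(1)] carr_minus[OF real_carr[OF xy(1)]]] by metis
  have "nrm B s \<le> nrm B (z - u n)" for n
  proof -
    let ?m = "modulus K B (x - u n)"
    have c: "x - u n \<in> carr B" using re real_carr by blast
    have "?m + (x - u n) \<in> pos B" using modulus_bounds(2)[OF re imag_0] by simp
    then have "?m + x \<in> pos B" using pos_add[OF _ u[of n]] by force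
    then have "?m - s \<in> pos B" using s(3)[of ?m] modulus_pos[OF c] by simp
    then have "nrm B s \<le> nrm B (x - u n)" using nrm_mono s(1) modulus(2)[OF c] by metis
    then show ?thesis using diff \<open>y = 0\<close> by simp
  qed
  then have "nrm B s \<le> 0" using small by blast
  then have "s = 0" using nrm_nonneg nrm_0_iff s pos_in_carr by (metis antisym)
  then show ?thesis using s \<open>y = 0\<close> xy by simp
qed

lemma tends_in_unique:
  assumes "\<And>n. u n \<in> carr B" "tends_in B u x" "tends_in B u y" shows "x = y"
proof -
  have "(\<lambda>n. nrm B (x - u n) + nrm B (y - u n)) \<longlonglongrightarrow> 0 + 0"
    using assms by (intro tendsto_add) (auto simp: tends_in_def)
  moreover have "nrm B (x - y) \<le> nrm B (x - u n) + nrm B (y - u n)" for n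
    using nrm_triangle_diff[of "x - u n" "y - u n"] assms carr_diff by (simp add: tends_in_def)
  ultimately have "nrm B (x - y) \<le> 0" by (intro LIMSEQ_le_const[of _ 0]) auto
  then show ?thesis
    using nrm_nonneg nrm_0_iff carr_diff assms by (metis antisym eq_iff_diff_eq_0 tends_in_def)
qed

text \<open>If \<open>T\<close> is unbounded, normalize positive vectors whose images are large and sum them up.\<close>

lemma positive_bounded_pos:
  fixes T :: "'a \<Rightarrow> 'b::complex_vector" and C :: "'b onspace"
  assumes C: "banach_lattice K C" and T: "positive_map K B C T"
  shows "\<exists>c\<ge>0. \<forall>x\<in>pos B. nrm C (T x) \<le> c * nrm B x"
proof (rule ccontr)
  interpret C: blattice K C by unfold_locales (rule C)
  assume "\<not> ?thesis"
  then have "\<forall>n::nat. \<exists>x\<in>pos B. 4 ^ n * nrm B x < nrm C (T x)" 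
    by (meson linorder_not_le zero_le_numeral zero_le_power)
  then obtain x where x: "\<And>n. x n \<in> pos B" "\<And>n. 4 ^ n * nrm B (x n) < nrm C (T (x n))" by metis
  have lin: "linear_over K (carr B) T" and Tpos: "T ` pos B \<subseteq> pos C"
    using T by (auto simp: positive_map_def linear_map_def)
  have T0: "T 0 = 0" by (rule linear_over_0[OF carr_sub lin])
  have xn: "0 < nrm B (x n)" for n
  proof -
    have "x n \<noteq> 0" using x(2)[of n] T0 by auto
    then show ?thesis using nrm_nonneg nrm_0_iff x(1) pos_in_carr by (metis order_le_less)
  qed
  \<comment> \<open>With this scaling \<open>y n\<close> has norm \<open>(1/2) ^ n\<close>, while
    the factor \<open>4 ^ n\<close> leaves an image of norm above \<open>2 ^ n\<close>.\<close>
  define t where "t n = 1 / (2 ^ n * nrm B (x n))" for n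
  have t: "0 < t n" for n using xn by (simp add: t_def)
  define y where "y n = of_real (t n) *\<^sub>C x n" for n
  have y: "y n \<in> pos B" for n using x(1) t by (auto simp: y_def intro!: pos_scale less_imp_le)
  have ny: "nrm B (y n) = (1/2) ^ n" for n
  proof -
    have "nrm B (y n) = t n * nrm B (x n)"
      using nrm_scale[OF K_of_real pos_in_carr[OF x(1)], of "t n" n] t[of n] by (simp add: y_def)
    then show ?thesis using xn[of n] by (simp add: t_def power_one_over field_simps)
  qed
  have Ty: "2 ^ n < nrm C (T (y n))" for n
  proof -
    have "nrm C (T (y n)) = t n * nrm C (T (x n))"
      using lin x(1) pos_in_carr Tpos C.pos_in_carr t[of n] C.nrm_scale[of "of_real (t n)" "T (x n)"]
      by (auto simp: y_def linear_over_def image_subset_iff)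
    moreover have "t n * (4 ^ n * nrm B (x n)) = 2 ^ n"
      using xn[of n] by (simp add: t_def field_simps flip: power_mult_distrib)
    ultimately show ?thesis using x(2)[of n] t[of n] by (metis mult_strict_left_mono)
  qed
  define s where "s n = (\<Sum>k<n. y k)" for n
  have sc: "s n \<in> carr B" for n using y pos_in_carr by (auto simp: s_def intro!: carr_sum)
  have diff: "nrm B (s m - s n) \<le> 2 * (1/2) ^ n" if "n \<le> m" for m n
  proof -
    have "s m - s n = (\<Sum>k\<in>{n..<m}. y k)"
      using that by (simp add: s_def sum_diff_nat_ivl lessThan_atLeast0)
    then have "nrm B (s m - s n) \<le> (\<Sum>k\<in>{n..<m}. (1/2) ^ k)"
      using nrm_sum[of "{n..<m}" y] y pos_in_carr ny by simp
    also have "\<dots> \<le> 2 * (1/2) ^ n"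
      using that by (simp add: sum_gp0 sum_gp_multiplied atLeast0LessThan geometric_sum sum_power2 
        atLeastLessThanSuc_atLeastAtMost sum_gp_strict flip: sum_diff_nat_ivl[of 0 n m])
    finally show ?thesis .
  qed
  have "\<exists>z. tends_in B s z"
  proof (rule complete)
    fix e :: real assume "e > 0"
    then obtain N where N: "(1/2) ^ N < e / 4" using real_arch_pow_inv[of "e/4" "1/2"] by auto
    have "nrm B (s m - s n) < e" if "N \<le> m" "N \<le> n" for m n
    proof -
      have "nrm B (s m - s n) \<le> nrm B (s m - s N) + nrm B (s n - s N)"
        using nrm_triangle_diff[of "s m - s N" "s n - s N"] sc carr_diff by simp
      also have "\<dots> < e" using diff[OF that(1)] diff[OF that(2)] N by simp
      finally show ?thesis .
    qed
    then show "\<exists>N. \<forall>m\<ge>N. \<forall>n\<ge>N. nrm B (s m - s n) < e" by blast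
  qed (use sc in auto)
  then obtain z where z: "tends_in B s z" by blast
  have "z - y n \<in> pos B" for n
  proof (rule pos_closed)
    \<comment> \<open>From index \<open>Suc n\<close> on, the partial sums contain the summand
      \<open>y n\<close>.\<close>
    show "tends_in B (\<lambda>m. s (m + Suc n) - y n) (z - y n)"
      using LIMSEQ_ignore_initial_segment[of "\<lambda>m. nrm B (z - s m)" 0 "Suc n"] z y pos_in_carr carr_diff
      by (auto simp: tends_in_def)
    show "s (m + Suc n) - y n \<in> pos B" for m
    proof -
      have "s (m + Suc n) = y n + sum y ({..<m + Suc n} - {n})"
        unfolding s_def by (rule sum.remove) auto
      then show ?thesis using y by (auto intro!: pos_sum)
    qed
  qed
  then have "nrm C (T (y n)) \<le> nrm C (T z)" for n
  proof -
    have "T (z - y n) = T z - T (y n)"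
      using linear_over_diff[OF carr_sub lin, of z "y n"] z y pos_in_carr by (simp add: tends_in_def)
    then show ?thesis
      using C.nrm_mono[of "T (y n)" "T z"] Tpos y \<open>\<And>n. z - y n \<in> pos B\<close>[of n] by force
  qed
  then have le: "2 ^ n \<le> nrm C (T z)" for n using Ty[of n] by (meson less_imp_le order_trans)
  obtain n where "nrm C (T z) < 2 ^ n" using real_arch_pow[of 2 "nrm C (T z)"] by auto
  with le[of n] show False by simp
qed

text \<open>The factor 4 is the maximal number of positive parts of \<open>x\<close>, each of norm
  at most that of \<open>x\<close>. The target is just a Banach space, since the lemma is also
  applied to the complex plane.\<close>

lemma bounded_from_pos:
  assumes C: "banach_space K C" and lin: "linear_over K (carr B) T" and TC: "T ` carr B \<subseteq> carr C"
    and c: "0 \<le> c" "\<And>x. x \<in> pos B \<Longrightarrow> nrm C (T x) \<le> c * nrm B x"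
    and S: "riesz_subspace K B S" and x: "x \<in> S"
  shows "nrm C (T x) \<le> 4 * c * nrm B x"
proof -
  have x': "x \<in> carr B" using S x by (auto simp: riesz_subspace_def)
  obtain p where p: "\<And>k. k < units \<Longrightarrow> p k \<in> pos B \<inter> S" "x = (\<Sum>k<units. cunit k *\<^sub>C p k)"
    "\<And>k. k < units \<Longrightarrow> nrm B (p k) \<le> nrm B x"
    using positive_parts[OF S x] by blast
  have tri: "nrm C (\<Sum>k\<in>I. f k) \<le> (\<Sum>k\<in>I. nrm C (f k))" 
    if "finite I" "\<And>k. k \<in> I \<Longrightarrow> f k \<in> carr C" for f and I :: "nat set"
    using that
  proof (induction I rule: finite_induct)
    case empty
    have "0 \<in> carr C" using C by (simp add: banach_space_def ksubspace_def)
    then have "nrm C 0 = 0" using C unfolding banach_space_def by blast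
    then show ?case by simp
  next
    case (insert i I)
    have "f i \<in> carr C" "sum f I \<in> carr C" using insert C by (auto simp: banach_space_def intro: ksubspace_sum)
    then have "nrm C (f i + sum f I) \<le> nrm C (f i) + nrm C (sum f I)" using C unfolding banach_space_def by blast
    then show ?case using insert by simp
  qed
  have "T x = (\<Sum>k<units. cunit k *\<^sub>C T (p k))"
    using linear_over_sum[OF carr_sub lin, of "{..<units}" cunit p] p(1) pos_in_carr unfolding p(2)[symmetric] by auto
  moreover have Tp: "T (p k) \<in> carr C" if "k < units" for k
    using TC p(1)[OF that] pos_in_carr by blast
  moreover have "cunit k *\<^sub>C T (p k) \<in> carr C" if "k < units" for k
    using Tp[OF that] C unfolding banach_space_def ksubspace_def by simp
  ultimately have "nrm C (T x) \<le> (\<Sum>k<units. nrm C (cunit k *\<^sub>C T (p k)))"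
    by (auto intro!: tri)
  also have "\<dots> = (\<Sum>k<units. nrm C (T (p k)))"
    using Tp C by (intro sum.cong) (auto simp: banach_space_def)
  also have "\<dots> \<le> (\<Sum>k<units. c * nrm B x)"
    using p c by (intro sum_mono) (meson IntD1 lessThan_iff mult_left_mono order_trans)
  also have "\<dots> = units * (c * nrm B x)" by simp
  also have "\<dots> \<le> 4 * (c * nrm B x)"
    using c nrm_nonneg[OF x'] by (intro mult_right_mono) (auto simp: units_def)
  finally show ?thesis by simp
qed

lemma positive_bounded:
  fixes T :: "'a \<Rightarrow> 'b::complex_vector" and C :: "'b onspace"
  assumes C: "banach_lattice K C" and T: "positive_map K B C T"
  shows "bounded_map K B C T"
proof -
  obtain c where "0 \<le> c" "\<forall>x\<in>pos B. nrm C (T x) \<le> c * nrm B x"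
    using positive_bounded_pos[OF assms] by blast
  then have "nrm C (T x) \<le> 4 * c * nrm B x" if "x \<in> carr B" for x
    using bounded_from_pos[of C T c, OF _ _ _ _ _ riesz_carr that] T C
    by (auto simp: positive_map_def linear_map_def banach_lattice_def)
  then show ?thesis using T by (auto simp: bounded_map_def positive_map_def)
qed

end


section \<open>Dual lattices and regular norms\<close>

text \<open>Both iterated limits of an array increasing in each index are its supremum.\<close>

lemma double_limit_interchange:
  fixes a :: "nat \<Rightarrow> nat \<Rightarrow> real"
  assumes mono1: "\<And>n n' m. n \<le> n' \<Longrightarrow> a n m \<le> a n' m"
    and mono2: "\<And>n m m'. m \<le> m' \<Longrightarrow> a n m \<le> a n m'"
    and lim2: "\<And>n. (\<lambda>m. a n m) \<longlonglongrightarrow> \<alpha> n" and lim1: "\<And>m. (\<lambda>n. a n m) \<longlonglongrightarrow> \<beta> m"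
    and lim: "\<beta> \<longlonglongrightarrow> b"
  shows "\<alpha> \<longlonglongrightarrow> b"
proof -
  have \<alpha>: "a n m \<le> \<alpha> n" for n m
    using LIMSEQ_le_const[OF lim2] mono2 by blast
  have \<beta>: "a n m \<le> \<beta> m" for n m
    using LIMSEQ_le_const[OF lim1] mono1 by blast
  have "\<beta> m \<le> \<beta> m'" if "m \<le> m'" for m m'
    using LIMSEQ_le[OF lim1 lim1] mono2[OF that] by blast
  then have \<beta>b: "\<beta> m \<le> b" for m
    using LIMSEQ_le_const[OF lim] by blast
  have "a n m \<le> b" for n m
    using \<beta>[of n m] \<beta>b[of m] by simp
  then have upper: "\<alpha> n \<le> b" for n
    using LIMSEQ_le_const2[OF lim2] by blast
  show ?thesis
  proof (rule order_tendstoI)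
    fix e assume "e < b"
    then obtain m where m: "e < \<beta> m" 
      using eventually_happens[OF order_tendstoD(1)[OF lim \<open>e < b\<close>]] by auto
    then obtain N where "e < a N m"
      using eventually_happens[OF order_tendstoD(1)[OF lim1 m]] by auto
    then have "e < \<alpha> n" if "N \<le> n" for n
      using mono1[OF that] \<alpha> by (meson less_le_trans)
    then show "eventually (\<lambda>n. e < \<alpha> n) sequentially"
      by (auto simp: eventually_sequentially)
  next
    fix e assume "b < e"
    then show "eventually (\<lambda>n. \<alpha> n < e) sequentially"
      using upper by (auto intro!: always_eventually intro: le_less_trans)
  qed
qed

lemma nrm_regular_ops:
  "nrm (regular_ops K B) T = Inf {op_norm B B S | S. bounded_map K B B S \<and>
     (\<forall>x\<in>carr B. le_in B (modulus K B (T x)) (S (modulus K B x)))}"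
  by (simp add: regular_ops_def)

context blattice
begin

text \<open>Let \<open>m\<close> be the modulus of \<open>x\<close> and \<open>u\<close> real with
  \<open>- m \<le> u \<le> m\<close>. The sum of \<open>(S - T) (m + u)\<close> and
  \<open>(S + T) (m - u)\<close> is twice \<open>S m - T u\<close>, so \<open>T u \<le> S m\<close>.
  The modulus of \<open>T x\<close> is the supremum of such \<open>T u\<close>, where
  \<open>u\<close> is the real part of \<open>c x\<close> with
  \<open>\<bar>c\<bar> = 1\<close>.\<close>

lemma modulus_dominated:
  assumes S: "linear_map K B B S" and T: "linear_map K B B T"
    and dom: "\<And>u. u \<in> pos B \<Longrightarrow> S u - T u \<in> pos B" "\<And>u. u \<in> pos B \<Longrightarrow> S u + T u \<in> pos B"
    and x: "x \<in> carr B"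
  shows "le_in B (modulus K B (T x)) (S (modulus K B x))"
proof -
  have linS: "linear_over K (carr B) S" and linT: "linear_over K (carr B) T"
    and SB: "\<And>u. u \<in> carr B \<Longrightarrow> S u \<in> carr B" and TB: "\<And>u. u \<in> carr B \<Longrightarrow> T u \<in> carr B"
    using S T by (auto simp: linear_map_def)
  let ?m = "modulus K B x"
  have mp: "?m \<in> pos B" by (rule modulus_pos[OF x])
  have Spos: "S u \<in> pos B" if "u \<in> pos B" for u
    using pos_add[OF dom(1)[OF that] dom(2)[OF that]] by (rule_tac pos_half) simp
  have Treal: "T u \<in> real_part B" if u: "u \<in> real_part B" for u
  proof -
    obtain p q where pq: "u = p - q" "p \<in> pos B" "q \<in> pos B" using u unfolding real_part_def by blast
    have "T p \<in> real_part B" if "p \<in> pos B" for p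
      using real_diff[OF pos_real[OF dom(2)[OF that]] pos_real[OF Spos[OF that]]] by simp
    then show ?thesis using pq linear_over_diff[OF carr_sub linT K_neg1] pos_in_carr real_diff by auto
  qed
  have key: "S ?m - T u \<in> pos B" if u: "?m - u \<in> pos B" "?m + u \<in> pos B" "u \<in> carr B" for u
  proof -
    have mc: "?m \<in> carr B" using mp pos_in_carr by blast
    have "(S (?m + u) - T (?m + u)) + (S (?m - u) + T (?m - u)) \<in> pos B"
      using u by (intro pos_add[OF dom(1) dom(2)])
    also have "(S (?m + u) - T (?m + u)) + (S (?m - u) + T (?m - u)) = (S ?m - T u) + (S ?m - T u)"
      using linear_over_diff[OF carr_sub linS K_neg1 mc u(3)] linear_over_diff[OF carr_sub linT K_neg1 mc u(3)]
        linS linT mc u(3) by (simp add: linear_over_def)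
    finally show ?thesis by (rule pos_half)
  qed
  have "S ?m - r \<in> pos B"
    if r: "r \<in> real_part B" "c \<in> K" "cmod c = 1" "y \<in> imag_part K B" "c *\<^sub>C T x = r + \<i> *\<^sub>C y" for r c y
  proof -
    have cx: "c *\<^sub>C x \<in> carr B" using r x carr_scale by blast
    obtain u v where uv: "u \<in> real_part B" "v \<in> imag_part K B" "c *\<^sub>C x = u + \<i> *\<^sub>C v"
      using decomp[OF cx] by blast
    have Tv: "T v \<in> imag_part K B" "T (\<i> *\<^sub>C v) = \<i> *\<^sub>C T v"
      using uv(2) Treal linear_over_0[OF carr_sub linT] linT scalars real_carr[of v] imag_real[of v]
      by (auto simp: imag_part_def linear_over_def split: if_splits)
    have "c *\<^sub>C T x = T (c *\<^sub>C x)" using linT r x by (simp add: linear_over_def)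
    also have "\<dots> = T u + \<i> *\<^sub>C T v"
      using uv linT real_carr i_imag_carr Tv by (simp add: linear_over_def)
    finally have "r = T u" using r Tv Treal uv decomp_unique by metis
    moreover have "?m - u \<in> pos B"
      using modulus(1)[OF x] uv r by (auto simp: is_modulus_def is_sup_in_def le_in_def)
    moreover have "?m - (- u) \<in> pos B"
    proof -
      have "(- c) *\<^sub>C x = - u + \<i> *\<^sub>C (- v)" using uv by (simp add: cv.scale_right_distrib)
      moreover have "- u \<in> real_part B" "- v \<in> imag_part K B" "- c \<in> K" "cmod (- c) = 1"
        using uv r real_minus imag_minus K_minus by auto
      ultimately show ?thesis
        using modulus(1)[OF x] unfolding is_modulus_def is_sup_in_def le_in_def by blast
    qed
    ultimately show ?thesis using key real_carr uv(1) by auto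
  qed
  then show ?thesis
    using modulus(1)[OF TB[OF x]] SB[OF pos_in_carr[OF mp]]
    by (auto simp: is_modulus_def is_sup_in_def le_in_def)
qed

lemma regular_norm_le:
  assumes S: "linear_map K B B S" and T: "linear_map K B B T"
    and dom: "\<And>u. u \<in> pos B \<Longrightarrow> S u - T u \<in> pos B" "\<And>u. u \<in> pos B \<Longrightarrow> S u + T u \<in> pos B"
    and c: "0 \<le> c" "\<And>x. x \<in> pos B \<Longrightarrow> nrm B (S x) \<le> c * nrm B x"
  shows "nrm (regular_ops K B) T \<le> 4 * c"
proof -
  have bd: "nrm B (S x) \<le> 4 * c * nrm B x" if "x \<in> carr B" for x
    using bounded_from_pos[OF banach _ _ c riesz_carr that] S by (auto simp: linear_map_def)
  have "bounded_map K B B S" using S bd by (auto simp: bounded_map_def)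
  then have "nrm (regular_ops K B) T \<le> op_norm B B S"
    unfolding nrm_regular_ops using modulus_dominated[OF S T dom]
    by (intro cInf_lower) (auto intro!: bdd_belowI[of _ 0] op_norm_nonneg nrm_nonneg simp: bounded_map_def)
  also have "\<dots> \<le> 4 * c" using c bd by (intro op_norm_le) auto
  finally show ?thesis .
qed

lemma regular_norm_bound:
  assumes T: "positive_map K B B T" and x: "x \<in> carr B"
  shows "nrm B (T x) \<le> nrm (regular_ops K B) T * nrm B x" 
proof (cases "x = 0")
  case True
  then show ?thesis
    using T linear_over_0[OF carr_sub, of T] by (simp add: positive_map_def linear_map_def)
next
  case False
  then have nx: "0 < nrm B x" using nrm_nonneg nrm_0_iff x by (metis order_le_less)
  have lin: "linear_map K B B T" and Tpos: "\<And>u. u \<in> pos B \<Longrightarrow> T u \<in> pos B" using T by (auto simp: positive_map_def)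
  have TT: "le_in B (modulus K B (T x)) (T (modulus K B x))" if "x \<in> carr B" for x
    using that Tpos by (intro modulus_dominated[OF lin lin]) (auto intro: pos_add)
  have Tb: "bounded_map K B B T" using positive_bounded[OF lattice T] .
  have "nrm B (T x) / nrm B x \<le> nrm (regular_ops K B) T"
    unfolding nrm_regular_ops
  proof (rule cInf_greatest)
    show "{op_norm B B S |S. bounded_map K B B S \<and> (\<forall>x\<in>carr B. le_in B (modulus K B (T x)) (S (modulus K B x)))} \<noteq> {}"
      using TT Tb by blast
  next
    fix c assume "c \<in> {op_norm B B S |S. bounded_map K B B S \<and> (\<forall>x\<in>carr B. le_in B (modulus K B (T x)) (S (modulus K B x)))}"
    then obtain S where S: "c = op_norm B B S" "bounded_map K B B S" "\<forall>x\<in>carr B. le_in B (modulus K B (T x)) (S (modulus K B x))" by blast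
    have mc: "modulus K B x \<in> carr B" using modulus_pos x pos_in_carr by blast
    have Tx: "T x \<in> carr B" using lin x by (auto simp: linear_map_def)
    have "nrm B (T x) = nrm B (modulus K B (T x))" using modulus(2)[OF Tx] by simp
    also have "\<dots> \<le> nrm B (S (modulus K B x))"
      using S(3) x by (intro nrm_mono modulus_pos Tx) (auto simp: le_in_def)
    also have "\<dots> \<le> c * nrm B (modulus K B x)"
      unfolding S(1) using S(2) by (intro op_norm_bound mc nrm_nonneg) (auto simp: bounded_map_def)
    also have "\<dots> = c * nrm B x" using modulus(2)[OF x] by simp
    finally show "nrm B (T x) / nrm B x \<le> c" using nx by (simp add: field_simps)
  qed
  then show ?thesis using nx by (simp add: field_simps)
qed

lemma dual_iff:
  "f \<in> carr (dual K B) \<longleftrightarrow> linear_over K (carr B) f \<and> (\<forall>x\<in>carr B. f x \<in> K) \<and>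
    (\<exists>c\<ge>0. \<forall>x\<in>carr B. cmod (f x) \<le> c * nrm B x) \<and> (\<forall>x. x \<notin> carr B \<longrightarrow> f x = 0)"
proof -
  have "(\<exists>c. \<forall>x\<in>carr B. cmod (f x) \<le> c * nrm B x) \<longleftrightarrow> (\<exists>c\<ge>0. \<forall>x\<in>carr B. cmod (f x) \<le> c * nrm B x)"
    (is "?L = ?R")
  proof
    assume ?L
    then obtain c where c: "\<forall>x\<in>carr B. cmod (f x) \<le> c * nrm B x" by blast
    then have "\<forall>x\<in>carr B. cmod (f x) \<le> max 0 c * nrm B x"
      using nrm_nonneg by (meson max.cobounded2 mult_right_mono order_trans)
    then show ?R by (meson max.cobounded1)
  qed blast
  then show ?thesis
    unfolding dual_def scalar_space_def bounded_map_def linear_map_def supported_def 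
    by (auto simp: image_subset_iff)
qed

lemma pos_dual_iff:
  "f \<in> pos (dual K B) \<longleftrightarrow> f \<in> carr (dual K B) \<and> (\<forall>x\<in>pos B. f x \<in> \<real>\<^sub>\<ge>\<^sub>0)"
  by (auto simp: dual_def)

lemma dual_nrm_bound: "f \<in> carr (dual K B) \<Longrightarrow> x \<in> carr B \<Longrightarrow> cmod (f x) \<le> nrm (dual K B) f * nrm B x"
  using op_norm_bound[of B "scalar_space K" f x] nrm_nonneg
  by (auto simp: dual_def bounded_map_def scalar_space_def)

lemma dual_nrm_nonneg: "f \<in> carr (dual K B) \<Longrightarrow> 0 \<le> nrm (dual K B) f"
  using op_norm_nonneg[of B "scalar_space K" f] nrm_nonneg
  by (auto simp: dual_def bounded_map_def scalar_space_def)

lemma dual_nrm_le: "0 \<le> c \<Longrightarrow> (\<And>x. x \<in> carr B \<Longrightarrow> cmod (f x) \<le> c * nrm B x) \<Longrightarrow> nrm (dual K B) f \<le> c"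
  using op_norm_le[of c B "scalar_space K" f] by (simp add: dual_def scalar_space_def)

lemma dual_add: "f \<in> carr (dual K B) \<Longrightarrow> x \<in> carr B \<Longrightarrow> y \<in> carr B \<Longrightarrow> f (x + y) = f x + f y"
  and dual_scale: "f \<in> carr (dual K B) \<Longrightarrow> c \<in> K \<Longrightarrow> x \<in> carr B \<Longrightarrow> f (c *\<^sub>C x) = c * f x"
  and dual_K: "f \<in> carr (dual K B) \<Longrightarrow> x \<in> carr B \<Longrightarrow> f x \<in> K"
  by (auto simp: dual_iff linear_over_def)

lemma dual_diff: "f \<in> carr (dual K B) \<Longrightarrow> x \<in> carr B \<Longrightarrow> y \<in> carr B \<Longrightarrow> f (x - y) = f x - f y"
  using linear_over_diff[OF carr_sub _ K_neg1, of f] by (simp add: dual_iff)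

lemma dual_0: "f \<in> carr (dual K B) \<Longrightarrow> f 0 = 0"
  using linear_over_0[OF carr_sub, of f] by (simp add: dual_iff)

lemma dual_sum: "f \<in> carr (dual K B) \<Longrightarrow> (\<And>i. i \<in> I \<Longrightarrow> x i \<in> carr B) \<Longrightarrow> f (\<Sum>i\<in>I. x i) = (\<Sum>i\<in>I. f (x i))"
  by (induction I rule: infinite_finite_induct) (auto simp: dual_0 dual_add carr_sum)

lemma ksubspace_dual: "ksubspace K (carr (dual K B))"
proof -
  have "0 \<in> carr (dual K B)" by (auto simp: dual_iff linear_over_def intro!: exI[of _ 0])
  moreover have "f + g \<in> carr (dual K B)" if fg: "f \<in> carr (dual K B)" "g \<in> carr (dual K B)" for f g
  proof -
    from fg obtain c c' where c: "0 \<le> c" "\<forall>x\<in>carr B. cmod (f x) \<le> c * nrm B x"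
      "0 \<le> c'" "\<forall>x\<in>carr B. cmod (g x) \<le> c' * nrm B x" by (auto simp: dual_iff)
    have "cmod (f x + g x) \<le> (c + c') * nrm B x" if "x \<in> carr B" for x
      using norm_triangle_ineq[of "f x" "g x"] c that by (simp add: algebra_simps) force
    then have "\<exists>b\<ge>0. \<forall>x\<in>carr B. cmod (f x + g x) \<le> b * nrm B x" using c by (intro exI[of _ "c + c'"]) auto
    then show ?thesis using fg by (auto simp: dual_iff linear_over_def K_add algebra_simps)
  qed
  moreover have "a *\<^sub>C f \<in> carr (dual K B)" if f: "a \<in> K" "f \<in> carr (dual K B)" for a f
  proof -
    from f obtain c where c: "0 \<le> c" "\<forall>x\<in>carr B. cmod (f x) \<le> c * nrm B x" by (auto simp: dual_iff)
    have "cmod (a * f x) \<le> (cmod a * c) * nrm B x" if "x \<in> carr B" for x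
      using c that by (simp add: norm_mult mult.assoc mult_left_mono)
    then have "\<exists>b\<ge>0. \<forall>x\<in>carr B. cmod (a * f x) \<le> b * nrm B x" using c by (intro exI[of _ "cmod a * c"]) auto
    then show ?thesis using f by (auto simp: dual_iff linear_over_def K_mult algebra_simps)
  qed
  ultimately show ?thesis by (simp add: ksubspace_def)
qed

lemma dual_from_pos:
  fixes \<phi> :: "'a \<Rightarrow> real"
  assumes add: "\<And>x y. x \<in> pos B \<Longrightarrow> y \<in> pos B \<Longrightarrow> \<phi> (x + y) = \<phi> x + \<phi> y"
    and scale: "\<And>t x. 0 \<le> t \<Longrightarrow> x \<in> pos B \<Longrightarrow> \<phi> (of_real t *\<^sub>C x) = t * \<phi> x"
    and nonneg: "\<And>x. x \<in> pos B \<Longrightarrow> 0 \<le> \<phi> x"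
    and c: "0 \<le> c" "\<And>x. x \<in> pos B \<Longrightarrow> \<phi> x \<le> c * nrm B x"
  obtains f where "f \<in> pos (dual K B)" "\<And>x. x \<in> pos B \<Longrightarrow> f x = of_real (\<phi> x)" 
proof -
  obtain f where f: "linear_over K (carr B) f" "\<And>x. x \<in> pos B \<Longrightarrow> f x = complex_of_real (\<phi> x)"
    "\<And>x. x \<notin> carr B \<Longrightarrow> f x = 0"
    by (rule linear_extension[of "\<lambda>x. complex_of_real (\<phi> x)"]) (use add scale in simp_all)
  have fK: "f x \<in> K" if x: "x \<in> carr B" for x
  proof -
    obtain p where p: "\<And>k. k < units \<Longrightarrow> p k \<in> pos B" "x = (\<Sum>k<units. cunit k *\<^sub>C p k)"
      using positive_parts[OF riesz_carr x] by (metis IntD1)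
    have "f x = (\<Sum>k<units. cunit k *\<^sub>C f (p k))"
      unfolding p(2) using linear_over_sum[OF carr_sub f(1), of "{..<units}" cunit p] p(1) pos_in_carr by auto
    then show ?thesis using p f by (auto intro!: K_sum K_mult)
  qed
  have "cmod (f x) \<le> 4 * c * nrm B x" if "x \<in> carr B" for x
  proof -
    \<comment> \<open>The complex plane as a space of the present kind, so that the bound on the
      cone can be extended by \<open>bounded_from_pos\<close>.\<close>
    have "banach_space UNIV (\<lparr>carr = UNIV, nrm = cmod\<rparr>)"
      unfolding banach_space_def tends_in_def
    proof (intro conjI allI impI)
      fix u :: "nat \<Rightarrow> complex"
      assume "range u \<subseteq> carr \<lparr>carr = UNIV, nrm = cmod\<rparr> \<and>
        (\<forall>\<epsilon>>0. \<exists>N. \<forall>m\<ge>N. \<forall>n\<ge>N. nrm \<lparr>carr = UNIV, nrm = cmod\<rparr> (u m - u n) < \<epsilon>)"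
      then have "Cauchy u" by (simp add: Cauchy_def dist_norm)
      then obtain y where "u \<longlonglongrightarrow> y" using convergent_eq_Cauchy[of u] by (auto simp: convergent_def)
      then have "(\<lambda>n. cmod (u n - y)) \<longlonglongrightarrow> 0" using Lim_null tendsto_norm_zero by fastforce
      then show "\<exists>y. y \<in> carr \<lparr>carr = UNIV, nrm = cmod\<rparr> \<and> (\<lambda>n. nrm \<lparr>carr = UNIV, nrm = cmod\<rparr> (y - u n)) \<longlonglongrightarrow> 0"
        by (auto simp: norm_minus_commute)
    qed (auto simp: ksubspace_def norm_mult norm_triangle_ineq)
    then have "banach_space K (\<lparr>carr = UNIV, nrm = cmod\<rparr>)"
      by (auto simp: banach_space_def ksubspace_def)
    from bounded_from_pos[OF this f(1) _ c(1) _ riesz_carr that]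
    show ?thesis using c f nonneg by auto
  qed
  then have "f \<in> carr (dual K B)" using f fK c by (auto simp: dual_iff intro!: exI[of _ "4 * c"])
  then show thesis using that[of f] f nonneg by (auto simp: pos_dual_iff)
qed

text \<open>The positive part of \<open>Re f\<close>, by the Riesz-Kantorovich formula, on the positive cone.\<close>

definition ppart :: "('a \<Rightarrow> complex) \<Rightarrow> 'a \<Rightarrow> real" where
  "ppart f z = (SUP u\<in>{u \<in> pos B. z - u \<in> pos B}. Re (f u))"

text \<open>The positive part of \<open>Re f\<close> seen in the direction \<open>cunit k\<close>.
  For complex scalars and \<open>k = 0, 1, 2, 3\<close> these are the positive parts of
  \<open>Re f\<close>, \<open>Im f\<close>, \<open>- Re f\<close>, \<open>- Im f\<close>, so that
  their combination with coefficients \<open>cunit k\<close> is \<open>f\<close> on the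
  cone.\<close>

definition fpart :: "('a \<Rightarrow> complex) \<Rightarrow> nat \<Rightarrow> 'a \<Rightarrow> real" where
  "fpart f k = ppart (cnj (cunit k) *\<^sub>C f)"

lemma cnj_cunit_K: "cnj (cunit k) \<in> K"
  using scalars by (auto simp: cunit_def)

context
  fixes f assumes f: "f \<in> carr (dual K B)"
begin

lemma ppart_bound_aux: "u \<in> pos B \<Longrightarrow> z - u \<in> pos B \<Longrightarrow> Re (f u) \<le> nrm (dual K B) f * nrm B z"
  using complex_Re_le_cmod[of "f u"] dual_nrm_bound[OF f, of u] nrm_mono[of u z] dual_nrm_nonneg[OF f] pos_in_carr
  by (meson mult_left_mono order_trans)

lemma ppart_upper: "u \<in> pos B \<Longrightarrow> z - u \<in> pos B \<Longrightarrow> Re (f u) \<le> ppart f z"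
  unfolding ppart_def using ppart_bound_aux by (intro cSUP_upper) (auto intro!: bdd_aboveI2)

lemma ppart_least:
  "z \<in> pos B \<Longrightarrow> (\<And>u. u \<in> pos B \<Longrightarrow> z - u \<in> pos B \<Longrightarrow> Re (f u) \<le> b) \<Longrightarrow> ppart f z \<le> b"
  unfolding ppart_def by (intro cSUP_least) auto

lemma ppart_nonneg: "z \<in> pos B \<Longrightarrow> 0 \<le> ppart f z"
  using ppart_upper[of 0 z] dual_0[OF f] by simp

lemma ppart_bound: "z \<in> pos B \<Longrightarrow> ppart f z \<le> nrm (dual K B) f * nrm B z"
  by (rule ppart_least) (auto intro: ppart_bound_aux)

text \<open>Subadditivity splits an element below \<open>z1 + z2\<close> by the Riesz decomposition
  property; the converse adds elements below \<open>z1\<close> and \<open>z2\<close>, taking the two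
  suprema one after the other.\<close>

lemma ppart_add:
  assumes z: "z1 \<in> pos B" "z2 \<in> pos B"
  shows "ppart f (z1 + z2) = ppart f z1 + ppart f z2"
proof (rule antisym)
  show "ppart f (z1 + z2) \<le> ppart f z1 + ppart f z2"
  proof (rule ppart_least)
    fix u assume u: "u \<in> pos B" "z1 + z2 - u \<in> pos B"
    then obtain u1 u2 where *: "u1 \<in> pos B" "u2 \<in> pos B" "u = u1 + u2" "z1 - u1 \<in> pos B" "z2 - u2 \<in> pos B"
      using riesz_property[OF riesz_carr pos_in_carr[OF u(1)] pos_in_carr[OF z(1)] u(1) z u(2)] by metis
    then have "Re (f u) = Re (f u1) + Re (f u2)" using dual_add[OF f] pos_in_carr by simp
    then show "Re (f u) \<le> ppart f z1 + ppart f z2" using * ppart_upper add_mono by metis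
  qed (use z pos_add in blast)
  have "Re (f u1) + Re (f u2) \<le> ppart f (z1 + z2)"
    if "u1 \<in> pos B" "z1 - u1 \<in> pos B" "u2 \<in> pos B" "z2 - u2 \<in> pos B" for u1 u2
  proof -
    have "z1 + z2 - (u1 + u2) \<in> pos B"
      using pos_add[OF that(2,4)] by (simp add: algebra_simps)
    then show ?thesis
      using ppart_upper[of "u1 + u2" "z1 + z2"] that pos_add dual_add[OF f] pos_in_carr by simp
  qed
  then have "ppart f z1 \<le> ppart f (z1 + z2) - Re (f u2)" if "u2 \<in> pos B" "z2 - u2 \<in> pos B" for u2
    using that z by (intro ppart_least) (auto simp: algebra_simps)
  then have "ppart f z2 \<le> ppart f (z1 + z2) - ppart f z1"
    using z by (intro ppart_least) (auto simp: algebra_simps)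
  then show "ppart f z1 + ppart f z2 \<le> ppart f (z1 + z2)" by simp
qed

lemma ppart_scale:
  assumes t: "0 \<le> t" and z: "z \<in> pos B"
  shows "ppart f (of_real t *\<^sub>C z) = t * ppart f z"
proof (cases "t = 0")
  case True
  have "ppart f 0 = 0" using ppart_add[of 0 0] by simp
  then show ?thesis using True by simp
next
  case False
  have le: "t * ppart f z \<le> ppart f (of_real t *\<^sub>C z)" if "0 < t" "z \<in> pos B" for t z
  proof -
    have "ppart f z \<le> ppart f (of_real t *\<^sub>C z) / t"
    proof (rule ppart_least[OF that(2)])
      fix u assume u: "u \<in> pos B" "z - u \<in> pos B"
      have "Re (f (of_real t *\<^sub>C u)) \<le> ppart f (of_real t *\<^sub>C z)"
        using u that by (intro ppart_upper) (auto intro!: pos_scale simp flip: cv.scale_right_diff_distrib)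
      then show "Re (f u) \<le> ppart f (of_real t *\<^sub>C z) / t"
        using dual_scale[OF f K_of_real] u pos_in_carr that by (simp add: field_simps)
    qed
    then show ?thesis using that by (simp add: field_simps)
  qed
  have "ppart f (of_real t *\<^sub>C z) \<le> t * ppart f z"
    using le[of "1/t" "of_real t *\<^sub>C z"] t z False pos_scale by (auto simp: field_simps)
  with le[of t z] t z False show ?thesis by simp
qed

text \<open>The substitution of \<open>z - u\<close> for \<open>u\<close> exchanges the suprema for
  \<open>f\<close> and \<open>- f\<close> up to the constant \<open>Re (f z)\<close>.\<close>

lemma ppart_minus:
  assumes z: "z \<in> pos B"
  shows "ppart f z - ppart (- f) z = Re (f z)"
proof -
  have g: "- f \<in> carr (dual K B)"
    using ksubspace_diff[OF ksubspace_dual K_neg1 _ f, of 0] ksubspace_dual by (simp add: ksubspace_def)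
  have le: "ppart h z \<le> Re (h z) + ppart (- h) z" if h: "h \<in> carr (dual K B)" "- h \<in> carr (dual K B)" for h
  proof -
    have "Re (h u) \<le> Re (h z) + ppart (- h) z" if u: "u \<in> pos B" "z - u \<in> pos B" for u
      using blattice.ppart_upper[OF blattice_axioms h(2), of "z - u" z] u dual_diff[OF h(1), of z u] z pos_in_carr
      by simp
    then show ?thesis using blattice.ppart_least[OF blattice_axioms h(1) z] by blast
  qed
  from le[of f] le[of "- f"] f g show ?thesis by simp
qed

end

lemma scaled_dual: "c \<in> K \<Longrightarrow> f \<in> carr (dual K B) \<Longrightarrow> c *\<^sub>C f \<in> carr (dual K B)"
  using ksubspace_dual by (simp add: ksubspace_def)

lemma fpart_dual: "f \<in> carr (dual K B) \<Longrightarrow> cnj (cunit k) *\<^sub>C f \<in> carr (dual K B)"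
  by (intro scaled_dual cnj_cunit_K)

lemma nrm_dual_scale_le:
  assumes f: "f \<in> carr (dual K B)" and c: "c \<in> K" "cmod c = 1"
  shows "nrm (dual K B) (c *\<^sub>C f) \<le> nrm (dual K B) f"
  using dual_nrm_bound[OF f] dual_nrm_nonneg[OF f] c by (intro dual_nrm_le) (simp_all add: norm_mult)

lemma fpart_nonneg: "f \<in> carr (dual K B) \<Longrightarrow> z \<in> pos B \<Longrightarrow> 0 \<le> fpart f k z"
  and fpart_add: "f \<in> carr (dual K B) \<Longrightarrow> z \<in> pos B \<Longrightarrow> z' \<in> pos B \<Longrightarrow> fpart f k (z + z') = fpart f k z + fpart f k z'"
  and fpart_scale: "f \<in> carr (dual K B) \<Longrightarrow> 0 \<le> t \<Longrightarrow> z \<in> pos B \<Longrightarrow> fpart f k (of_real t *\<^sub>C z) = t * fpart f k z"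
  unfolding fpart_def by (simp_all only: ppart_nonneg ppart_add ppart_scale fpart_dual)

lemma fpart_bound:
  assumes f: "f \<in> carr (dual K B)" and z: "z \<in> pos B"
  shows "fpart f k z \<le> nrm (dual K B) f * nrm B z"
proof -
  have "nrm (dual K B) (cnj (cunit k) *\<^sub>C f) \<le> nrm (dual K B) f"
    by (rule nrm_dual_scale_le[OF f cnj_cunit_K]) simp
  then show ?thesis
    using ppart_bound[OF fpart_dual[OF f] z, of k] mult_right_mono[OF _ nrm_nonneg[OF pos_in_carr[OF z]]]
    unfolding fpart_def by (meson order_trans)
qed

lemma fpart_sum:
  assumes f: "f \<in> carr (dual K B)" and z: "z \<in> pos B"
  shows "(\<Sum>k<units. cunit k * of_real (fpart f k z)) = f z"
proof -
  have *: "ppart f z - ppart (- f) z = Re (f z)" by (rule ppart_minus[OF f z])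
  have eq: "(\<Sum>k<units. cunit k *\<^sub>C complex_of_real (fpart f k z)) = f z"
  proof (cases "K = \<real>")
    case True
    have "f z \<in> \<real>" using dual_K[OF f pos_in_carr[OF z]] True by simp
    moreover have "cnj (cunit 0) *\<^sub>C f = f" "cnj (cunit (Suc 0)) *\<^sub>C f = - f"
      unfolding cunit_def if_P[OF True] by (simp_all add: fun_eq_iff)
    ultimately show ?thesis
      unfolding sum_cunit if_P[OF True] fpart_def using * by (simp flip: of_real_diff)
  next
    case False
    have i: "\<i> *\<^sub>C f \<in> carr (dual K B)" "(-\<i>) *\<^sub>C f \<in> carr (dual K B)"
      by (intro scaled_dual f; use not_real[OF False] in simp)+
    have "- ((-\<i>) *\<^sub>C f) = \<i> *\<^sub>C f" by (simp add: fun_eq_iff)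
    then have "ppart ((-\<i>) *\<^sub>C f) z - ppart (\<i> *\<^sub>C f) z = Im (f z)"
      using ppart_minus[OF i(2) z] by simp
    moreover have c: "cunit 0 = 1" "cunit (Suc 0) = \<i>" "cunit 2 = -1" "cunit 3 = -\<i>"
      unfolding cunit_def if_not_P[OF False] by (simp_all add: power3_eq_cube)
    ultimately show ?thesis
      unfolding sum_cunit if_not_P[OF False] fpart_def c using *
      by (simp add: complex_eq_iff)
  qed
  then show ?thesis by simp
qed

text \<open>Turns the order suprema in (d) into weak* limits. On the cone the pointwise limit of the
  increasing sequence is additive and bounded by \<open>s\<close>, so it comes from a positive
  functional. That functional is an upper bound, hence dominates \<open>s\<close>, and the two
  agree.\<close>

lemma dual_sup_tendsto:
  assumes g: "\<And>n. g n \<in> pos (dual K B)" and mono: "\<And>n x. x \<in> pos B \<Longrightarrow> g (Suc n) x - g n x \<in> \<real>\<^sub>\<ge>\<^sub>0"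
    and s: "is_sup_in (dual K B) (range g) s" and z: "z \<in> carr B"
  shows "(\<lambda>n. g n z) \<longlonglongrightarrow> s z"
proof -
  have gd: "g n \<in> carr (dual K B)" for n using g by (simp add: pos_dual_iff)
  have sd: "s \<in> carr (dual K B)" and sg: "s - g n \<in> pos (dual K B)" for n
    using s by (auto simp: is_sup_in_def le_in_def)
  have gr: "g n x = of_real (Re (g n x))" "0 \<le> Re (g n x)" if "x \<in> pos B" for n x
    using g[of n] that by (auto simp: pos_dual_iff nonneg_Reals_def)
  have sgr: "s x - g n x \<in> \<real>\<^sub>\<ge>\<^sub>0" if "x \<in> pos B" for x n
    using sg[of n] that by (auto simp: pos_dual_iff)
  have sge: "Re (g n x) \<le> Re (s x)" and sr: "s x = of_real (Re (s x))" if "x \<in> pos B" for x n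
    using sgr[OF that, of n] sgr[OF that, of 0] gr[OF that] 
    by (auto simp: complex_nonneg_Reals_iff complex_eq_iff)
  define \<phi> where "\<phi> x = (SUP n. Re (g n x))" for x
  have lim: "(\<lambda>n. Re (g n x)) \<longlonglongrightarrow> \<phi> x" if "x \<in> pos B" for x
    unfolding \<phi>_def
  proof (rule LIMSEQ_incseq_SUP)
    show "bdd_above (range (\<lambda>n. Re (g n x)))" using sge[OF that] by (auto intro!: bdd_aboveI2)
    show "incseq (\<lambda>n. Re (g n x))"
      using mono[OF that] by (intro incseq_SucI) (auto simp: complex_nonneg_Reals_iff)
  qed
  have le_s: "\<phi> x \<le> Re (s x)" if "x \<in> pos B" for x
    using LIMSEQ_le_const2[OF lim[OF that]] sge[OF that] by blast
  have ge_g: "Re (g n x) \<le> \<phi> x" if "x \<in> pos B" for x n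
    unfolding \<phi>_def using sge[OF that] by (intro cSUP_upper) (auto intro!: bdd_aboveI2)
  obtain f where f: "f \<in> pos (dual K B)" "\<And>x. x \<in> pos B \<Longrightarrow> f x = of_real (\<phi> x)"
  proof (rule dual_from_pos[of \<phi> "nrm (dual K B) s"])
    fix x y assume xy: "x \<in> pos B" "y \<in> pos B"
    have "(\<lambda>n. Re (g n (x + y))) \<longlonglongrightarrow> \<phi> x + \<phi> y"
      using tendsto_add[OF lim[OF xy(1)] lim[OF xy(2)]] dual_add[OF gd] xy pos_in_carr by simp
    then show "\<phi> (x + y) = \<phi> x + \<phi> y"
      using lim[OF pos_add[OF xy]] LIMSEQ_unique by blast
  next
    fix t :: real and x assume x: "0 \<le> t" "x \<in> pos B"
    have "(\<lambda>n. Re (g n (of_real t *\<^sub>C x))) \<longlonglongrightarrow> t * \<phi> x"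
      using tendsto_mult_left[OF lim[OF x(2)]] dual_scale[OF gd K_of_real] x pos_in_carr by simp
    then show "\<phi> (of_real t *\<^sub>C x) = t * \<phi> x"
      using lim[OF pos_scale[OF x]] LIMSEQ_unique by blast
  next
    fix x assume x: "x \<in> pos B"
    show "0 \<le> \<phi> x" using ge_g[OF x, of 0] gr[OF x, of 0] by simp
    show "\<phi> x \<le> nrm (dual K B) s * nrm B x"
      using le_s[OF x] complex_Re_le_cmod[of "s x"] dual_nrm_bound[OF sd, of x] x pos_in_carr by force
  qed (use dual_nrm_nonneg[OF sd] in auto)
  have fd: "f \<in> carr (dual K B)" using f by (simp add: pos_dual_iff)
  have diffd: "a - b \<in> carr (dual K B)" if "a \<in> carr (dual K B)" "b \<in> carr (dual K B)" for a b
    using ksubspace_diff[OF ksubspace_dual K_neg1] that by blast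
  have "f - g n \<in> pos (dual K B)" for n
    unfolding pos_dual_iff
  proof (intro conjI ballI diffd fd gd)
    fix x assume x: "x \<in> pos B"
    show "(f - g n) x \<in> \<real>\<^sub>\<ge>\<^sub>0"
      using gr(1)[OF x, of n] ge_g[OF x, of n] f(2)[OF x] by (simp add: complex_nonneg_Reals_iff complex_eq_iff)
  qed
  then have "f - s \<in> pos (dual K B)"
    using s fd by (auto simp: is_sup_in_def le_in_def)
  then have "Re (s x) \<le> \<phi> x" if "x \<in> pos B" for x
    using that f(2)[OF that] by (auto simp: pos_dual_iff complex_nonneg_Reals_iff)
  then have s_eq: "s x = of_real (\<phi> x)" if "x \<in> pos B" for x
    using that le_s sr by (metis antisym)
  have lim_pos: "(\<lambda>n. g n x) \<longlonglongrightarrow> s x" if "x \<in> pos B" for x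
  proof -
    have "(\<lambda>n. complex_of_real (Re (g n x))) \<longlonglongrightarrow> complex_of_real (\<phi> x)"
      by (rule tendsto_of_real[OF lim[OF that]])
    then show ?thesis by (simp only: gr(1)[OF that, symmetric] s_eq[OF that])
  qed
  obtain p where p: "\<And>k. k < units \<Longrightarrow> p k \<in> pos B" "z = (\<Sum>k<units. cunit k *\<^sub>C p k)"
    using positive_parts[OF riesz_carr z] by (metis IntD1)
  have h: "h z = (\<Sum>k<units. cunit k * h (p k))" if "h \<in> carr (dual K B)" for h
    using linear_over_sum[OF carr_sub, of h "{..<units}" cunit p] that p(1) pos_in_carr
    unfolding p(2)[symmetric] by (auto simp: dual_iff)
  show ?thesis
    unfolding h[OF sd] h[OF gd] using p by (intro tendsto_sum tendsto_mult_left lim_pos) auto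
qed

end


section \<open>Derivations on algebras of matrices\<close>

text \<open>Averaging over all signs removes the off-diagonal terms. The induction averages over one
  sign at a time: as a function of the sign \<open>e\<close> of the new index the expression is
  \<open>u + e v\<close>, and
  \<open>2 \<bar>u\<bar> \<le> \<bar>u + v\<bar> + \<bar>u - v\<bar>\<close>. The summand
  \<open>x\<close> collects the diagonal terms already treated.\<close>

lemma sign_average:
  fixes b :: "'i \<Rightarrow> 'i \<Rightarrow> complex"
  assumes "finite I" "\<And>s. (\<And>i. s i = 1 \<or> s i = -1) \<Longrightarrow> cmod (x + (\<Sum>i\<in>I. \<Sum>j\<in>I. s i * s j * b i j)) \<le> r"
  shows "cmod (x + (\<Sum>i\<in>I. b i i)) \<le> r"
  using assms
proof (induction I arbitrary: x rule: finite_induct)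
  case empty
  then show ?case using empty.prems[of "\<lambda>_. 1"] by simp
next
  case (insert k I)
  have "cmod ((x + b k k) + (\<Sum>i\<in>I. \<Sum>j\<in>I. s i * s j * b i j)) \<le> r" if s: "\<And>i. s i = 1 \<or> s i = -1" for s
  proof -
    define u where "u = (x + b k k) + (\<Sum>i\<in>I. \<Sum>j\<in>I. s i * s j * b i j)"
    define v where "v = (\<Sum>j\<in>I. s j * b k j) + (\<Sum>i\<in>I. s i * b i k)"
    have "cmod (u + e * v) \<le> r" if e: "e = 1 \<or> e = -1" for e
    proof -
      obtain s' where s': "s' k = e" "\<And>i. i \<in> I \<Longrightarrow> s' i = s i" "\<And>i. s' i = 1 \<or> s' i = -1"
        using insert.hyps e s by (intro that[of "s(k := e)"]) auto
      have "(\<Sum>i\<in>insert k I. \<Sum>j\<in>insert k I. s' i * s' j * b i j)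
        = e * e * b k k + (\<Sum>j\<in>I. e * s j * b k j) + ((\<Sum>i\<in>I. s i * e * b i k) + (\<Sum>i\<in>I. \<Sum>j\<in>I. s i * s j * b i j))"
        using insert.hyps by (simp add: s' sum.distrib cong: sum.cong)
      moreover have "e * e = 1" using e by auto
      ultimately have "x + (\<Sum>i\<in>insert k I. \<Sum>j\<in>insert k I. s' i * s' j * b i j) = u + e * v"
        by (simp add: u_def v_def sum_distrib_left algebra_simps)
      then show ?thesis using insert.prems[of s'] s'(3) by auto
    qed
    from this[of 1] this[of "-1"] have "cmod (u + v) + cmod (u - v) \<le> 2 * r" by simp
    moreover have "2 * u = (u + v) + (u - v)" by simp
    then have "2 * cmod u \<le> cmod (u + v) + cmod (u - v)"
      using norm_triangle_ineq[of "u + v" "u - v"] by (metis norm_mult norm_numeral)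
    ultimately show ?thesis by (simp add: u_def)
  qed
  from insert.IH[OF this] show ?case using insert.hyps by (simp add: add.assoc)
qed

text \<open>The bound of the approximations \<open>wapprox\<close>. The first summand estimates
  \<open>D (P n)\<close> at \<open>z - lm (P n) z\<close>, the second the sign average of
  \<open>D g (lm g z)\<close>; \<open>D\<close> contributes \<open>c\<close>, the module action
  \<open>C\<close>, and a sign matrix \<open>c0\<close>.\<close>

definition diagonal_const :: "real \<Rightarrow> real \<Rightarrow> real \<Rightarrow> real" where
  "diagonal_const C c c0 = c * c0 * (1 + C * c0) + c * c0 * (C * c0)"

lemma diagonal_const_nonneg: "0 \<le> C \<Longrightarrow> 0 \<le> c \<Longrightarrow> 0 \<le> c0 \<Longrightarrow> 0 \<le> diagonal_const C c c0"
  by (simp add: diagonal_const_def)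

text \<open>What the matrix argument takes from the algebra of one projection. \<open>A\<close> is
  the algebra and \<open>Ap\<close> its cone; \<open>\<nu>\<close> is the size in which the actions
  and \<open>D\<close> are bounded, later the absolute value of the regular norm; \<open>N\<close>
  bounds \<open>\<nu>\<close> on an element and all its compressions at once, later four times the
  operator norm. \<open>left_approx\<close> concerns rows, \<open>right_approx\<close> columns, and
  the weak limits are condition (d) evaluated at a point of \<open>M\<close>.\<close>

locale matrix_module = blattice K M for K and M :: "'m::complex_vector onspace" +
  fixes A Ap :: "('x \<Rightarrow> 'x::complex_vector) set"
    and lm :: "('x, 'm) left_action" and rm :: "('x, 'm) right_action"
    and \<nu> N :: "('x \<Rightarrow> 'x) \<Rightarrow> real"
    and E :: "nat \<Rightarrow> nat \<Rightarrow> 'x \<Rightarrow> 'x"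
    and coef :: "nat \<Rightarrow> nat \<Rightarrow> ('x \<Rightarrow> 'x) \<Rightarrow> real"
    and D :: "('x \<Rightarrow> 'x) \<Rightarrow> 'm \<Rightarrow> complex"
    and C c c0 :: real
  assumes A_sub: "ksubspace K A"
    and A_comp: "a \<in> A \<Longrightarrow> b \<in> A \<Longrightarrow> a \<circ> b \<in> A"
    and Ap_sub: "Ap \<subseteq> A"
    and Ap_add: "a \<in> Ap \<Longrightarrow> b \<in> Ap \<Longrightarrow> a + b \<in> Ap"
    and Ap_scale: "0 \<le> t \<Longrightarrow> a \<in> Ap \<Longrightarrow> of_real t *\<^sub>C a \<in> Ap"
    and A_parts: "a \<in> A \<Longrightarrow> \<exists>p. (\<forall>k<units. p k \<in> Ap) \<and> a = (\<Sum>k<units. cunit k *\<^sub>C p k)"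
    and lm_linear: "a \<in> A \<Longrightarrow> linear_map K M M (lm a)"
    and rm_linear: "a \<in> A \<Longrightarrow> linear_map K M M (\<lambda>z. rm z a)"
    and lm_linear2: "z \<in> carr M \<Longrightarrow> linear_over K A (\<lambda>a. lm a z)"
    and rm_linear2: "z \<in> carr M \<Longrightarrow> linear_over K A (rm z)"
    and lm_comp: "a \<in> A \<Longrightarrow> b \<in> A \<Longrightarrow> z \<in> carr M \<Longrightarrow> lm (a \<circ> b) z = lm a (lm b z)"
    and rm_comp: "a \<in> A \<Longrightarrow> b \<in> A \<Longrightarrow> z \<in> carr M \<Longrightarrow> rm z (a \<circ> b) = rm (rm z a) b"
    and rm_lm: "a \<in> A \<Longrightarrow> b \<in> A \<Longrightarrow> z \<in> carr M \<Longrightarrow> rm (lm a z) b = lm a (rm z b)"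
    and lm_pos: "a \<in> Ap \<Longrightarrow> z \<in> pos M \<Longrightarrow> lm a z \<in> pos M"
    and rm_pos: "a \<in> Ap \<Longrightarrow> z \<in> pos M \<Longrightarrow> rm z a \<in> pos M"
    and C_nonneg: "0 \<le> C"
    and lm_bound: "a \<in> A \<Longrightarrow> z \<in> carr M \<Longrightarrow> nrm M (lm a z) \<le> C * \<nu> a * nrm M z"
    and rm_bound: "a \<in> A \<Longrightarrow> z \<in> carr M \<Longrightarrow> nrm M (rm z a) \<le> C * \<nu> a * nrm M z"
    and D_dual: "a \<in> A \<Longrightarrow> D a \<in> carr (dual K M)"
    and D_linear: "linear_over K A D"
    and D_derivation: "a \<in> A \<Longrightarrow> b \<in> A \<Longrightarrow> z \<in> carr M \<Longrightarrow> D (a \<circ> b) z = D b (rm z a) + D a (lm b z)"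
    and c_nonneg: "0 \<le> c"
    and D_bound: "a \<in> A \<Longrightarrow> z \<in> carr M \<Longrightarrow> cmod (D a z) \<le> c * \<nu> a * nrm M z"
    and E_Ap: "E i j \<in> Ap"
    and E_comp: "E i j \<circ> E k l = (if j = k then E i l else 0)"
    and c0_nonneg: "0 \<le> c0"
    and signs: "(\<And>i. s i = 1 \<or> s i = -1) \<Longrightarrow> \<nu> (\<Sum>i\<le>n. s i *\<^sub>C E i i) \<le> c0"
    and coef_nonneg: "a \<in> Ap \<Longrightarrow> 0 \<le> coef i j a"
    and coef_add: "a \<in> Ap \<Longrightarrow> b \<in> Ap \<Longrightarrow> coef i j (a + b) = coef i j a + coef i j b"
    and coef_scale: "0 \<le> t \<Longrightarrow> a \<in> Ap \<Longrightarrow> coef i j (of_real t *\<^sub>C a) = t * coef i j a"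
    and coef_E: "a \<in> Ap \<Longrightarrow> (\<Sum>i\<le>n. E i i) \<circ> a \<circ> (\<Sum>j\<le>m. E j j) = (\<Sum>i\<le>n. \<Sum>j\<le>m. of_real (coef i j a) *\<^sub>C E i j)"
    and left_approx: "a \<in> Ap \<Longrightarrow> (\<lambda>m. \<nu> ((E i i \<circ> a) - (E i i \<circ> a \<circ> (\<Sum>j\<le>m. E j j)))) \<longlonglongrightarrow> 0"
    and right_approx: "a \<in> Ap \<Longrightarrow> (\<lambda>n. \<nu> ((a \<circ> E j j) - ((\<Sum>i\<le>n. E i i) \<circ> a \<circ> E j j))) \<longlonglongrightarrow> 0"
    and weak_right: "a \<in> Ap \<Longrightarrow> f \<in> pos (dual K M) \<Longrightarrow> z \<in> carr M \<Longrightarrow>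
          (\<lambda>n. f (rm (rm z (\<Sum>i\<le>n. E i i)) a)) \<longlonglongrightarrow> f (rm z a)"
    and weak_left: "a \<in> Ap \<Longrightarrow> f \<in> pos (dual K M) \<Longrightarrow> z \<in> carr M \<Longrightarrow>
          (\<lambda>n. f (lm a (lm (\<Sum>i\<le>n. E i i) z))) \<longlonglongrightarrow> f (lm a z)"
    and N_bound: "a \<in> Ap \<Longrightarrow> \<nu> a \<le> N a" 
      "a \<in> Ap \<Longrightarrow> \<nu> ((\<Sum>i\<le>n. E i i) \<circ> a \<circ> (\<Sum>j\<le>m. E j j)) \<le> N a"
    and N_nonneg: "a \<in> Ap \<Longrightarrow> 0 \<le> N a"
    and factorization: "a \<in> Ap \<Longrightarrow> \<exists>s\<in>A. \<exists>t\<in>A. a = s \<circ> t"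
begin

abbreviation q :: "nat \<Rightarrow> 'x \<Rightarrow> 'x" where "q i \<equiv> E i i"

abbreviation P :: "nat \<Rightarrow> 'x \<Rightarrow> 'x" where "P n \<equiv> \<Sum>i\<le>n. E i i"

lemma Ap_A: "a \<in> Ap \<Longrightarrow> a \<in> A"
  using Ap_sub by blast

lemma E_A: "E i j \<in> A"
  by (rule Ap_A[OF E_Ap])

lemma A_0: "0 \<in> A"
  and A_scale: "t \<in> K \<Longrightarrow> a \<in> A \<Longrightarrow> t *\<^sub>C a \<in> A"
  using A_sub by (auto simp: ksubspace_def)

lemma A_diff: "a \<in> A \<Longrightarrow> b \<in> A \<Longrightarrow> a - b \<in> A"
  by (rule ksubspace_diff[OF A_sub K_neg1])

lemma A_sum: "(\<And>i. i \<in> I \<Longrightarrow> f i \<in> A) \<Longrightarrow> sum f I \<in> A"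
  by (rule ksubspace_sum[OF A_sub])

lemma P_Ap: "P n \<in> Ap"
proof (induction n)
  case (Suc n)
  then show ?case by (simp only: sum.atMost_Suc Ap_add E_Ap)
qed (simp add: E_Ap)

lemma P_A: "P n \<in> A"
  by (rule Ap_A[OF P_Ap])

lemma lm_carr: "a \<in> A \<Longrightarrow> z \<in> carr M \<Longrightarrow> lm a z \<in> carr M"
  and rm_carr: "a \<in> A \<Longrightarrow> z \<in> carr M \<Longrightarrow> rm z a \<in> carr M"
  using lm_linear[of a] rm_linear[of a] by (auto simp: linear_map_def image_subset_iff)

lemma lm_add: "a \<in> A \<Longrightarrow> z \<in> carr M \<Longrightarrow> z' \<in> carr M \<Longrightarrow> lm a (z + z') = lm a z + lm a z'"
  and rm_add: "a \<in> A \<Longrightarrow> z \<in> carr M \<Longrightarrow> z' \<in> carr M \<Longrightarrow> rm (z + z') a = rm z a + rm z' a"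
  and lm_scale: "a \<in> A \<Longrightarrow> t \<in> K \<Longrightarrow> z \<in> carr M \<Longrightarrow> lm a (t *\<^sub>C z) = t *\<^sub>C lm a z"
  and rm_scale: "a \<in> A \<Longrightarrow> t \<in> K \<Longrightarrow> z \<in> carr M \<Longrightarrow> rm (t *\<^sub>C z) a = t *\<^sub>C rm z a"
  using lm_linear rm_linear by (auto simp: linear_map_def linear_over_def)

lemma lm_diff: "a \<in> A \<Longrightarrow> z \<in> carr M \<Longrightarrow> z' \<in> carr M \<Longrightarrow> lm a (z - z') = lm a z - lm a z'"
  and rm_diff: "a \<in> A \<Longrightarrow> z \<in> carr M \<Longrightarrow> z' \<in> carr M \<Longrightarrow> rm (z - z') a = rm z a - rm z' a"
  using lm_linear rm_linear linear_over_diff[OF carr_sub _ K_neg1, of "lm a"]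
   linear_over_diff[OF carr_sub _ K_neg1, of "\<lambda>z. rm z a"] by (auto simp: linear_map_def)

lemma lm_0 [simp]: "a \<in> A \<Longrightarrow> lm a 0 = 0" and rm_0 [simp]: "a \<in> A \<Longrightarrow> rm 0 a = 0"
  using lm_diff[of a 0 0] rm_diff[of a 0 0] by simp_all

lemma lm_add2: "a \<in> A \<Longrightarrow> b \<in> A \<Longrightarrow> z \<in> carr M \<Longrightarrow> lm (a + b) z = lm a z + lm b z"
  and rm_add2: "a \<in> A \<Longrightarrow> b \<in> A \<Longrightarrow> z \<in> carr M \<Longrightarrow> rm z (a + b) = rm z a + rm z b"
  and lm_scale2: "a \<in> A \<Longrightarrow> t \<in> K \<Longrightarrow> z \<in> carr M \<Longrightarrow> lm (t *\<^sub>C a) z = t *\<^sub>C lm a z"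
  and rm_scale2: "a \<in> A \<Longrightarrow> t \<in> K \<Longrightarrow> z \<in> carr M \<Longrightarrow> rm z (t *\<^sub>C a) = t *\<^sub>C rm z a"
  using lm_linear2 rm_linear2 by (auto simp: linear_over_def)

lemma lm_zero [simp]: "z \<in> carr M \<Longrightarrow> lm 0 z = 0" and rm_zero [simp]: "z \<in> carr M \<Longrightarrow> rm z 0 = 0"
  using lm_add2[of 0 0 z] rm_add2[of 0 0 z] A_0 by simp_all

lemma D_add: "a \<in> A \<Longrightarrow> b \<in> A \<Longrightarrow> D (a + b) = D a + D b"
  and D_scale: "a \<in> A \<Longrightarrow> t \<in> K \<Longrightarrow> D (t *\<^sub>C a) = t *\<^sub>C D a"
  using D_linear by (auto simp: linear_over_def)

lemma D_0: "D 0 = 0"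
  by (rule linear_over_0[OF A_sub D_linear])

lemma lm_sum2: "(\<And>i. i \<in> I \<Longrightarrow> a i \<in> A) \<Longrightarrow> z \<in> carr M \<Longrightarrow> lm (\<Sum>i\<in>I. a i) z = (\<Sum>i\<in>I. lm (a i) z)"
  by (induction I rule: infinite_finite_induct) (auto simp: lm_add2 A_sum)

lemma rm_sum2: "(\<And>i. i \<in> I \<Longrightarrow> a i \<in> A) \<Longrightarrow> z \<in> carr M \<Longrightarrow> rm z (\<Sum>i\<in>I. a i) = (\<Sum>i\<in>I. rm z (a i))"
  by (induction I rule: infinite_finite_induct) (auto simp: rm_add2 A_sum)

lemma D_sum: "(\<And>i. i \<in> I \<Longrightarrow> a i \<in> A) \<Longrightarrow> D (\<Sum>i\<in>I. a i) = (\<Sum>i\<in>I. D (a i))"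
  by (induction I rule: infinite_finite_induct) (auto simp: D_add D_0 A_sum)

lemma lm_q_q: "z \<in> carr M \<Longrightarrow> lm (q i) (lm (q j) z) = (if i = j then lm (q i) z else 0)"
  using lm_comp[OF E_A E_A, of z i i j j] by (auto simp: E_comp)

lemma lm_P: "z \<in> carr M \<Longrightarrow> lm (P n) z = (\<Sum>i\<le>n. lm (q i) z)"
  and rm_P: "z \<in> carr M \<Longrightarrow> rm z (P n) = (\<Sum>i\<le>n. rm z (q i))"
  by (simp_all add: lm_sum2 rm_sum2 E_A)

lemma lm_sum: "a \<in> A \<Longrightarrow> (\<And>i. i \<in> I \<Longrightarrow> z i \<in> carr M) \<Longrightarrow> lm a (\<Sum>i\<in>I. z i) = (\<Sum>i\<in>I. lm a (z i))"
  by (induction I rule: infinite_finite_induct) (auto simp: lm_add carr_sum)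

lemma lm_q_P: "z \<in> carr M \<Longrightarrow> j \<le> n \<Longrightarrow> lm (q j) (lm (P n) z) = lm (q j) z"
  by (simp add: lm_P lm_sum E_A lm_carr lm_q_q)

lemma lm_P_q: "z \<in> carr M \<Longrightarrow> j \<le> n \<Longrightarrow> lm (P n) (lm (q j) z) = lm (q j) z"
  by (simp add: lm_P E_A lm_carr lm_q_q)

lemma \<nu>_P: "\<nu> (P n) \<le> c0"
  using signs[of "\<lambda>_. 1" n] by simp

lemma lm_P_bound: "z \<in> carr M \<Longrightarrow> nrm M (lm (P n) z) \<le> C * c0 * nrm M z"
  and rm_P_bound: "z \<in> carr M \<Longrightarrow> nrm M (rm z (P n)) \<le> C * c0 * nrm M z"
  using lm_bound[OF P_A, of z n] rm_bound[OF P_A, of z n] C_nonneg \<nu>_P[of n] nrm_nonneg[of z]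
  by (meson mult_left_mono mult_right_mono order_trans)+

text \<open>The Leibniz rule for the product \<open>q j \<circ> q i = 0\<close>.\<close>

lemma D_swap: 
  assumes "i \<noteq> j" "z \<in> carr M"
  shows "D (q i) (rm z (q j)) = - D (q j) (lm (q i) z)"
  using D_derivation[OF E_A E_A assms(2), of j j i i] assms(1) by (simp add: E_comp D_0 eq_neg_iff_add_eq_0)

lemma D_idem: "z \<in> carr M \<Longrightarrow> D (q j) z = D (q j) (rm z (q j)) + D (q j) (lm (q j) z)"
  using D_derivation[OF E_A E_A, of z j j j j] by (simp add: E_comp)

text \<open>Approximations to a functional implementing \<open>D\<close> on the diagonal.\<close>

definition wapprox :: "nat \<Rightarrow> 'm \<Rightarrow> complex" where
  "wapprox n z = D (P n) (z - lm (P n) z) - (\<Sum>i\<le>n. D (q i) (lm (q i) z))"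

text \<open>The sum in \<open>wapprox\<close> is the average of \<open>D g (lm g z)\<close> over the
  sign matrices \<open>g\<close>; the first term takes care of the part of \<open>z\<close> outside
  the range of \<open>P n\<close>. At \<open>rm z (q j)\<close>, \<open>D_swap\<close> moves all
  terms to \<open>D (q j)\<close>, the two occurrences of \<open>D (q j) (lm (P n) z)\<close>
  cancel, and \<open>D (q j) z - D (q j) (lm (q j) z)\<close> is left. At \<open>lm (q j) z\<close>
  the first term vanishes and only \<open>- D (q j) (lm (q j) z)\<close> remains.\<close>

lemma wapprox_implements:
  assumes z: "z \<in> carr M" and j: "j \<le> n"
  shows "wapprox n (rm z (q j)) - wapprox n (lm (q j) z) = D (q j) z"
proof -
  note dl = D_dual[OF E_A]
  have lz: "lm (q i) z \<in> carr M" "rm z (q i) \<in> carr M" for i using z by (auto intro: lm_carr rm_carr E_A)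
  define y where "y = z - lm (P n) z"
  have Pz: "lm (P n) z \<in> carr M" and y: "y \<in> carr M" using z by (auto simp: y_def intro: lm_carr P_A carr_diff)
  have qy: "lm (q i) y = 0" if "i \<le> n" for i
    using that z Pz by (simp add: y_def lm_diff E_A lm_q_P)
  have split: "{..n} = insert j ({..n} - {j})" using j by auto
  have "rm z (q j) - lm (P n) (rm z (q j)) = rm y (q j)"
    using z Pz by (simp add: y_def rm_diff E_A rm_lm P_A)
  then have "D (P n) (rm z (q j) - lm (P n) (rm z (q j))) = (\<Sum>i\<le>n. D (q i) (rm y (q j)))"
    by (simp add: D_sum E_A sum_fun_apply)
  also have "\<dots> = D (q j) (rm y (q j)) + (\<Sum>i\<in>{..n} - {j}. D (q i) (rm y (q j)))"
    using j by (intro sum.remove) auto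
  also have "(\<Sum>i\<in>{..n} - {j}. D (q i) (rm y (q j))) = 0"
    using y dual_0[OF dl] qy by (intro sum.neutral) (auto simp: D_swap)
  also have "D (q j) (rm y (q j)) = D (q j) y"
    using D_idem[OF y, of j] qy[OF j] dual_0[OF dl] by simp
  also have "D (q j) y = D (q j) z - D (q j) (lm (P n) z)"
    using z Pz dual_diff[OF dl] by (simp add: y_def)
  finally have 1: "D (P n) (rm z (q j) - lm (P n) (rm z (q j))) = D (q j) z - D (q j) (lm (P n) z)" by simp
  have jj: "D (q j) (rm (lm (q j) z) (q j)) = 0"
    using D_idem[OF lz(1), of j j] z by (simp add: lm_q_q)
  have "(\<Sum>i\<le>n. D (q i) (lm (q i) (rm z (q j)))) = (\<Sum>i\<le>n. D (q i) (rm (lm (q i) z) (q j)))"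
    using z by (simp add: rm_lm E_A)
  also have "\<dots> = D (q j) (rm (lm (q j) z) (q j)) + (\<Sum>i\<in>{..n} - {j}. D (q i) (rm (lm (q i) z) (q j)))"
    using j by (intro sum.remove) auto
  also have "\<dots> = (\<Sum>i\<in>{..n} - {j}. - D (q j) (lm (q i) z))"
    using z lz jj by (auto simp: D_swap lm_q_q intro!: sum.cong)
  also have "\<dots> = D (q j) (lm (q j) z) - (\<Sum>i\<le>n. D (q j) (lm (q i) z))"
    using j by (subst (2) sum.remove[of _ j]) (auto simp: sum_negf)
  also have "(\<Sum>i\<le>n. D (q j) (lm (q i) z)) = D (q j) (lm (P n) z)"
    using z lz by (simp add: lm_P dual_sum[OF dl])
  finally have 2: "(\<Sum>i\<le>n. D (q i) (lm (q i) (rm z (q j)))) = D (q j) (lm (q j) z) - D (q j) (lm (P n) z)" .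
  have 3: "D (P n) (lm (q j) z - lm (P n) (lm (q j) z)) = 0"
    using z j by (simp add: lm_P_q dual_0 D_dual P_A)
  have "(\<Sum>i\<le>n. D (q i) (lm (q i) (lm (q j) z))) = D (q j) (lm (q j) (lm (q j) z)) + (\<Sum>i\<in>{..n} - {j}. D (q i) (lm (q i) (lm (q j) z)))"
    using j by (intro sum.remove) auto
  also have "\<dots> = D (q j) (lm (q j) z)"
    using z dual_0[OF dl] by (simp add: lm_q_q)
  finally show ?thesis unfolding wapprox_def 1 2 3 by simp
qed

abbreviation cw :: real where "cw \<equiv> diagonal_const C c c0"

lemma cw_nonneg: "0 \<le> cw"
  by (intro diagonal_const_nonneg C_nonneg c_nonneg c0_nonneg)

text \<open>Estimating the sum term by term would give a bound growing with \<open>n\<close>. It is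
  the diagonal of a matrix, so sign averaging bounds it by the largest value of
  \<open>D g (lm g z)\<close>.\<close>

lemma wapprox_bound:
  assumes z: "z \<in> carr M"
  shows "cmod (wapprox n z) \<le> cw * nrm M z"
proof -
  have D_b: "cmod (D a u) \<le> c * c0 * b" if "a \<in> A" "u \<in> carr M" "\<nu> a \<le> c0" "nrm M u \<le> b" for a u b
  proof -
    have "cmod (D a u) \<le> c * \<nu> a * nrm M u" using D_bound that by blast
    also have "\<dots> \<le> c * c0 * nrm M u"
      using that c_nonneg nrm_nonneg by (simp add: mult_left_mono mult_right_mono)
    also have "\<dots> \<le> c * c0 * b" using that c_nonneg c0_nonneg by (simp add: mult_left_mono)
    finally show ?thesis .
  qed
  have "cmod (D (P n) (z - lm (P n) z)) \<le> c * c0 * (nrm M z + C * c0 * nrm M z)"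
    using nrm_triangle_diff[OF z lm_carr[OF P_A z], of n] lm_P_bound[OF z, of n] z
    by (intro D_b) (auto intro: \<nu>_P P_A carr_diff lm_carr)
  moreover have "cmod (0 + (\<Sum>i\<le>n. D (q i) (lm (q i) z))) \<le> c * c0 * (C * c0 * nrm M z)"
  \<comment> \<open>For this matrix the full signed double sum is \<open>D g (lm g z)\<close> with
    \<open>g\<close> the diagonal matrix of the signs.\<close>
  proof (rule sign_average[where b = "\<lambda>i j. D (q i) (lm (q j) z)"])
    fix s :: "nat \<Rightarrow> complex" assume s: "\<And>i. s i = 1 \<or> s i = -1"
    let ?g = "\<Sum>i\<le>n. s i *\<^sub>C q i"
    have sK: "s i \<in> K" for i using s[of i] by auto
    have g: "?g \<in> A" "\<nu> ?g \<le> c0" using s sK by (auto intro!: A_sum A_scale E_A signs)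
    have lz: "lm (q i) z \<in> carr M" for i using z by (auto intro: lm_carr E_A)
    have "D ?g (lm ?g z) = (\<Sum>i\<le>n. \<Sum>j\<le>n. s i * s j * D (q i) (lm (q j) z))"
    proof -
      have "lm ?g z = (\<Sum>j\<le>n. s j *\<^sub>C lm (q j) z)"
        using z sK by (simp add: lm_sum2 A_scale E_A lm_scale2)
      moreover have "D ?g = (\<Sum>i\<le>n. s i *\<^sub>C D (q i))"
        using sK by (simp add: D_sum A_scale E_A D_scale)
      ultimately show ?thesis
        using lz sK by (simp add: sum_fun_apply dual_sum[OF D_dual[OF E_A]] carr_scale dual_scale[OF D_dual[OF E_A]] 
          sum_distrib_left mult.assoc)
    qed
    moreover have "nrm M (lm ?g z) \<le> C * c0 * nrm M z"
      using lm_bound[OF g(1) z] C_nonneg g(2) nrm_nonneg[OF z] by (meson mult_left_mono mult_right_mono order_trans)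
    then have "cmod (D ?g (lm ?g z)) \<le> c * c0 * (C * c0 * nrm M z)"
      using g z by (intro D_b lm_carr)
    ultimately show "cmod (0 + (\<Sum>i\<le>n. \<Sum>j\<le>n. s i * s j * D (q i) (lm (q j) z))) \<le> c * c0 * (C * c0 * nrm M z)"
      by simp
  qed simp
  ultimately show ?thesis
    unfolding wapprox_def diagonal_const_def
    using norm_triangle_ineq4[of "D (P n) (z - lm (P n) z)" "\<Sum>i\<le>n. D (q i) (lm (q i) z)"]
    by (simp add: algebra_simps)
qed

lemma wapprox_parts: 
  "z \<in> carr M \<Longrightarrow> lm (q i) z \<in> carr M" "z \<in> carr M \<Longrightarrow> z - lm (P n) z \<in> carr M"
  by (auto intro: lm_carr carr_diff E_A P_A)

lemma wapprox_K: "z \<in> carr M \<Longrightarrow> wapprox n z \<in> K"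
  using wapprox_parts dual_K[OF D_dual[OF E_A]] dual_K[OF D_dual[OF P_A]] 
    K_add[OF _ K_minus, of "D (P n) (z - lm (P n) z)"] K_sum[of "{..n}" "\<lambda>i. D (q i) (lm (q i) z)"]
  unfolding wapprox_def by simp

lemma wapprox_scale: 
  assumes z: "z \<in> carr M" and t: "t \<in> K" 
  shows "wapprox n (t *\<^sub>C z) = t * wapprox n z"
proof -
  have "t *\<^sub>C z - lm (P n) (t *\<^sub>C z) = t *\<^sub>C (z - lm (P n) z)"
    using t z by (simp add: lm_scale P_A cv.scale_right_diff_distrib)
  then show ?thesis
    unfolding wapprox_def using t z wapprox_parts
    by (simp add: lm_scale E_A dual_scale[OF D_dual[OF E_A]] dual_scale[OF D_dual[OF P_A]] 
      right_diff_distrib sum_distrib_left)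
qed

lemma wapprox_add:
  assumes z: "z \<in> carr M" "z' \<in> carr M" 
  shows "wapprox n (z + z') = wapprox n z + wapprox n z'"
proof -
  have "(z + z') - lm (P n) (z + z') = (z - lm (P n) z) + (z' - lm (P n) z')"
    using z by (simp add: lm_add P_A)
  then show ?thesis
    unfolding wapprox_def \<open>(z + z') - _ = _\<close> using z wapprox_parts
    by (simp add: lm_add E_A dual_add[OF D_dual[OF E_A]] dual_add[OF D_dual[OF P_A]] sum.distrib)
qed

end

section \<open>Limits of biadditive functions on cones\<close>

lemma tendsto_Lim_ex:
  fixes h :: "'a \<Rightarrow> 'b::t2_space"
  assumes "G \<noteq> bot" "\<exists>l. (h \<longlongrightarrow> l) G"
  shows "(h \<longlongrightarrow> Lim G h) G"
proof -
  from assms(2) obtain l where "(h \<longlongrightarrow> l) G" by blast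
  with tendsto_Lim[OF assms(1) this] show ?thesis by simp
qed

lemma universal_limits:
  fixes F :: "'a filter"
  assumes "F \<noteq> bot"
  obtains G where "G \<le> F" "G \<noteq> bot" 
    "\<And>h::'a \<Rightarrow> complex. Bfun h F \<Longrightarrow> (h \<longlongrightarrow> Lim G h) G"
    "\<And>h::'a \<Rightarrow> real. Bfun h F \<Longrightarrow> (h \<longlongrightarrow> Lim G h) G"
proof -
  obtain G where G: "G \<le> F" "G \<noteq> bot" "\<And>h::'a \<Rightarrow> complex. Bfun h F \<Longrightarrow> \<exists>l. (h \<longlongrightarrow> l) G"
    using universal_subfilter[OF assms] by metis
  have "\<exists>l. (h \<longlongrightarrow> l) G" if "Bfun h F" for h :: "'a \<Rightarrow> real"
  proof -
    have "Bfun (\<lambda>x. complex_of_real (h x)) F" using that by (simp add: Bfun_def)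
    then obtain l where "((\<lambda>x. complex_of_real (h x)) \<longlongrightarrow> l) G" using G(3) by blast
    then have "(h \<longlongrightarrow> Re l) G" using tendsto_Re by fastforce
    then show ?thesis by blast
  qed
  with G show thesis
    by (intro that[of G] tendsto_Lim_ex[OF G(2)])
qed

text \<open>The bound \<open>b\<close> belongs to the notion because it makes limits along a
  universal subfilter exist. Families sharing one \<open>b\<close> can therefore be passed to the
  limit pointwise.\<close>

definition bipositive ::
  "'b::complex_vector set \<Rightarrow> 'a::complex_vector onspace \<Rightarrow> ('b \<Rightarrow> real) \<Rightarrow> ('b \<Rightarrow> 'a \<Rightarrow> real) \<Rightarrow> bool" where
  "bipositive S B b \<alpha> \<longleftrightarrow>
     (\<forall>a\<in>S. \<forall>z\<in>pos B. 0 \<le> \<alpha> a z \<and> \<alpha> a z \<le> b a * nrm B z) \<and>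
     (\<forall>a\<in>S. \<forall>a'\<in>S. \<forall>z\<in>pos B. \<alpha> (a + a') z = \<alpha> a z + \<alpha> a' z) \<and>
     (\<forall>a\<in>S. \<forall>z\<in>pos B. \<forall>z'\<in>pos B. \<alpha> a (z + z') = \<alpha> a z + \<alpha> a z') \<and>
     (\<forall>t\<ge>0. \<forall>a\<in>S. \<forall>z\<in>pos B. \<alpha> (of_real t *\<^sub>C a) z = t * \<alpha> a z \<and> \<alpha> a (of_real t *\<^sub>C z) = t * \<alpha> a z)"

lemma bipositiveD:
  assumes "bipositive S B b \<alpha>" "a \<in> S" "z \<in> pos B"
  shows "0 \<le> \<alpha> a z" "\<alpha> a z \<le> b a * nrm B z"
    "a' \<in> S \<Longrightarrow> \<alpha> (a + a') z = \<alpha> a z + \<alpha> a' z"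
    "z' \<in> pos B \<Longrightarrow> \<alpha> a (z + z') = \<alpha> a z + \<alpha> a z'"
    "0 \<le> t \<Longrightarrow> \<alpha> (of_real t *\<^sub>C a) z = t * \<alpha> a z"
    "0 \<le> t \<Longrightarrow> \<alpha> a (of_real t *\<^sub>C z) = t * \<alpha> a z"
  using assms unfolding bipositive_def by blast+

lemma bipositive_add:
  "bipositive S B b \<alpha> \<Longrightarrow> bipositive S B b' \<beta> \<Longrightarrow> bipositive S B (\<lambda>a. b a + b' a) (\<lambda>a z. \<alpha> a z + \<beta> a z)"
  unfolding bipositive_def by (simp add: algebra_simps add_mono)

text \<open>Every clause of \<open>bipositive\<close> is preserved by pointwise limits. The closure
  assumptions on the cones ensure that sums and multiples are again points at which the limit
  exists.\<close>

lemma bipositive_Lim: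
  fixes F :: "'i filter"
  assumes \<alpha>: "eventually (\<lambda>i. bipositive S B b (\<alpha> i)) F"
    and G: "G \<le> F" "G \<noteq> bot" "\<And>h::'i \<Rightarrow> real. Bfun h F \<Longrightarrow> (h \<longlongrightarrow> Lim G h) G"
    and cone: "\<And>a a'. a \<in> S \<Longrightarrow> a' \<in> S \<Longrightarrow> a + a' \<in> S" 
      "\<And>t a. 0 \<le> t \<Longrightarrow> a \<in> S \<Longrightarrow> of_real t *\<^sub>C a \<in> S"
      "\<And>z z'. z \<in> pos B \<Longrightarrow> z' \<in> pos B \<Longrightarrow> z + z' \<in> pos B" 
      "\<And>t z. 0 \<le> t \<Longrightarrow> z \<in> pos B \<Longrightarrow> of_real t *\<^sub>C z \<in> pos B"
  shows "bipositive S B b (\<lambda>a z. Lim G (\<lambda>i. \<alpha> i a z))"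
    and "a \<in> S \<Longrightarrow> z \<in> pos B \<Longrightarrow> ((\<lambda>i. \<alpha> i a z) \<longlongrightarrow> Lim G (\<lambda>i. \<alpha> i a z)) G"
proof -
  have \<alpha>G: "eventually (\<lambda>i. bipositive S B b (\<alpha> i)) G"
    using \<alpha> G(1) by (simp add: le_filter_def)
  have lim: "((\<lambda>i. \<alpha> i a z) \<longlongrightarrow> Lim G (\<lambda>i. \<alpha> i a z)) G" if "a \<in> S" "z \<in> pos B" for a z
  proof (rule G(3), rule BfunI)
    show "eventually (\<lambda>i. norm (\<alpha> i a z) \<le> b a * nrm B z) F"
      using \<alpha> by eventually_elim (use bipositiveD(1,2) that in fastforce)
  qed
  then show "a \<in> S \<Longrightarrow> z \<in> pos B \<Longrightarrow> ((\<lambda>i. \<alpha> i a z) \<longlongrightarrow> Lim G (\<lambda>i. \<alpha> i a z)) G" by blast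
  have LimI: "Lim G h = l" if "(h' \<longlongrightarrow> l) G" "eventually (\<lambda>i. h' i = h i) G" for h h' :: "'i \<Rightarrow> real" and l
    using Lim_transform_eventually[OF that] tendsto_Lim[OF G(2)] by blast
  show "bipositive S B b (\<lambda>a z. Lim G (\<lambda>i. \<alpha> i a z))"
    unfolding bipositive_def
  proof (intro conjI ballI allI impI)
    fix a z assume az: "a \<in> S" "z \<in> pos B"
    show "0 \<le> Lim G (\<lambda>i. \<alpha> i a z)"
      by (rule tendsto_lowerbound[OF lim[OF az] _ G(2)])
        (use \<alpha>G in eventually_elim, use bipositiveD(1) az in blast)
    show "Lim G (\<lambda>i. \<alpha> i a z) \<le> b a * nrm B z"
      by (rule tendsto_upperbound[OF lim[OF az] _ G(2)])
        (use \<alpha>G in eventually_elim, use bipositiveD(2) az in blast)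
    fix a' assume a': "a' \<in> S"
    show "Lim G (\<lambda>i. \<alpha> i (a + a') z) = Lim G (\<lambda>i. \<alpha> i a z) + Lim G (\<lambda>i. \<alpha> i a' z)"
      by (rule LimI[OF tendsto_add[OF lim[OF az] lim[OF a' az(2)]]])
        (use \<alpha>G in eventually_elim, use bipositiveD(3) az a' in metis)
  next
    fix a z z' assume az: "a \<in> S" "z \<in> pos B" and z': "z' \<in> pos B"
    show "Lim G (\<lambda>i. \<alpha> i a (z + z')) = Lim G (\<lambda>i. \<alpha> i a z) + Lim G (\<lambda>i. \<alpha> i a z')"
      by (rule LimI[OF tendsto_add[OF lim[OF az] lim[OF az(1) z']]])
        (use \<alpha>G in eventually_elim, use bipositiveD(4) az z' in metis)
  next
    fix t :: real and a z assume az: "a \<in> S" "z \<in> pos B" and t: "0 \<le> t"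
    show "Lim G (\<lambda>i. \<alpha> i (of_real t *\<^sub>C a) z) = t * Lim G (\<lambda>i. \<alpha> i a z)"
      by (rule LimI[OF tendsto_mult_left[OF lim[OF az]]])
        (use \<alpha>G in eventually_elim, use bipositiveD(5) az t in metis)
    show "Lim G (\<lambda>i. \<alpha> i a (of_real t *\<^sub>C z)) = t * Lim G (\<lambda>i. \<alpha> i a z)"
      by (rule LimI[OF tendsto_mult_left[OF lim[OF az]]])
        (use \<alpha>G in eventually_elim, use bipositiveD(6) az t in metis)
  qed
qed

context blattice
begin

lemma linear_parts:
  assumes p: "\<And>k. k < units \<Longrightarrow> p k \<in> carr B" and f: "f \<in> carr (dual K B)"
  shows "f (\<Sum>k<units. cunit k *\<^sub>C p k) = (\<Sum>k<units. cunit k * f (p k))"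
  using linear_over_sum[OF carr_sub, of f "{..<units}" cunit p] p f by (auto simp: dual_iff)

text \<open>Extends the weak limits, available for positive functionals, to arbitrary ones.\<close>

lemma dual_parts:
  assumes f: "f \<in> carr (dual K B)"
  obtains g where "\<And>k. g k \<in> pos (dual K B)" "\<And>z. z \<in> carr B \<Longrightarrow> f z = (\<Sum>k<units. cunit k * g k z)"
proof -
  have "\<exists>g. g \<in> pos (dual K B) \<and> (\<forall>z\<in>pos B. g z = of_real (fpart f k z))" for k
    by (rule dual_from_pos[of "fpart f k" "nrm (dual K B) f"])
      (auto simp: fpart_nonneg[OF f] fpart_add[OF f] fpart_scale[OF f] fpart_bound[OF f] dual_nrm_nonneg[OF f])
  then obtain g where g: "\<And>k. g k \<in> pos (dual K B)" "\<And>k z. z \<in> pos B \<Longrightarrow> g k z = of_real (fpart f k z)" by metis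
  have gd: "g k \<in> carr (dual K B)" for k using g(1) by (simp add: pos_dual_iff)
  have "f z = (\<Sum>k<units. cunit k * g k z)" if z: "z \<in> carr B" for z
  proof -
    obtain p where p: "\<And>k. k < units \<Longrightarrow> p k \<in> pos B" "z = (\<Sum>k<units. cunit k *\<^sub>C p k)"
      using positive_parts[OF riesz_carr z] by (metis IntD1)
    have pc: "p k \<in> carr B" if "k < units" for k using p(1)[OF that] pos_in_carr by blast
    have "f z = (\<Sum>l<units. cunit l * f (p l))"
      using linear_parts[OF pc f] p(2) by simp
    also have "\<dots> = (\<Sum>l<units. cunit l * (\<Sum>k<units. cunit k * g k (p l)))"
      by (intro sum.cong refl arg_cong2[where f="(*)"]) (simp add: fpart_sum[OF f p(1), symmetric] g(2) p(1))
    also have "\<dots> = (\<Sum>k<units. cunit k * (\<Sum>l<units. cunit l * g k (p l)))"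
      unfolding sum_distrib_left by (subst sum.swap) (simp add: mult.left_commute)
    also have "\<dots> = (\<Sum>k<units. cunit k * g k z)"
      using linear_parts[OF pc gd] p(2) by simp
    finally show ?thesis .
  qed
  with g show thesis using that by blast
qed

end

context matrix_module
begin

text \<open>A weak* cluster point of the uniformly bounded functionals \<open>wapprox n\<close>
  works, because for fixed \<open>j\<close> the identity holds for all
  \<open>n \<ge> j\<close>.\<close>

lemma implementing_functional:
  obtains w where "w \<in> carr (dual K M)" "nrm (dual K M) w \<le> cw"
    "\<And>j z. z \<in> carr M \<Longrightarrow> w (rm z (q j)) - w (lm (q j) z) = D (q j) z"
proof -
  obtain G where G: "G \<le> sequentially" "G \<noteq> bot"
    "\<And>h::nat \<Rightarrow> complex. Bfun h sequentially \<Longrightarrow> (h \<longlongrightarrow> Lim G h) G"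
    using universal_limits[of sequentially] by (metis trivial_limit_sequentially)
  define w where "w z = (if z \<in> carr M then Lim G (\<lambda>n. wapprox n z) else 0)" for z
  have lim: "((\<lambda>n. wapprox n z) \<longlongrightarrow> w z) G" if "z \<in> carr M" for z
    unfolding w_def using that wapprox_bound[OF that] by (auto intro!: G(3) BfunI[of _ "cw * nrm M z"] always_eventually)
  have uniq: "(h \<longlongrightarrow> l) G \<Longrightarrow> (h \<longlongrightarrow> l') G \<Longrightarrow> l = l'" for h :: "nat \<Rightarrow> complex" and l l'
    using tendsto_unique[OF G(2)] by blast
  have bound: "cmod (w z) \<le> cw * nrm M z" if z: "z \<in> carr M" for z
    by (rule tendsto_upperbound[OF tendsto_norm[OF lim[OF z]] _ G(2)]) (use wapprox_bound[OF z] in simp)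
  have "closed K" using scalars closed_complex_Reals by auto
  then have wK: "w z \<in> K" if z: "z \<in> carr M" for z
    using Lim_in_closed_set[OF _ _ G(2) lim[OF z]] wapprox_K[OF z] by simp
  have "w (z + z') = w z + w z'" if z: "z \<in> carr M" "z' \<in> carr M" for z z'
    using uniq[OF lim[OF carr_add[OF z]]] tendsto_add[OF lim[OF z(1)] lim[OF z(2)]] by (simp add: wapprox_add[OF z])
  moreover have "w (t *\<^sub>C z) = t * w z" if z: "z \<in> carr M" "t \<in> K" for t z
    using uniq[OF lim[OF carr_scale[OF z(2,1)]]] tendsto_mult_left[OF lim[OF z(1)], of t] by (simp add: wapprox_scale[OF z])
  ultimately have w: "w \<in> carr (dual K M)"
    using wK bound cw_nonneg by (auto simp: dual_iff linear_over_def w_def[of "_ :: 'm"] intro!: exI[of _ cw])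
  show thesis
  proof (rule that[OF w dual_nrm_le[OF cw_nonneg bound]])
    fix j z assume z: "z \<in> carr M"
    have "((\<lambda>n. wapprox n (rm z (q j)) - wapprox n (lm (q j) z)) \<longlongrightarrow> w (rm z (q j)) - w (lm (q j) z)) G"
      using z by (intro tendsto_diff lim rm_carr lm_carr E_A)
    moreover have "eventually (\<lambda>n. wapprox n (rm z (q j)) - wapprox n (lm (q j) z) = D (q j) z) sequentially"
      by (rule eventually_mono[OF eventually_ge_at_top[of j]]) (rule wapprox_implements[OF z])
    then have "eventually (\<lambda>n. wapprox n (rm z (q j)) - wapprox n (lm (q j) z) = D (q j) z) G"
      using G(1) by (simp add: le_filter_def)
    ultimately have "((\<lambda>n. D (q j) z) \<longlongrightarrow> w (rm z (q j)) - w (lm (q j) z)) G"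
      by (rule Lim_transform_eventually)
    then show "w (rm z (q j)) - w (lm (q j) z) = D (q j) z"
      using uniq tendsto_const by blast
  qed
qed

lemma dual_lm:
  assumes f: "f \<in> carr (dual K M)" and a: "a \<in> A"
  shows "(\<lambda>z. if z \<in> carr M then f (lm a z) else 0) \<in> carr (dual K M)" (is "?g \<in> _")
proof -
  \<comment> \<open>The maximum supplies the nonnegative constant that \<open>dual_iff\<close> asks
    for, as the sign of \<open>\<nu> a\<close> is left open.\<close>
  have "cmod (f (lm a z)) \<le> max 0 (nrm (dual K M) f * (C * \<nu> a)) * nrm M z" if z: "z \<in> carr M" for z
  proof -
    have "cmod (f (lm a z)) \<le> nrm (dual K M) f * (C * \<nu> a * nrm M z)"
      using dual_nrm_bound[OF f lm_carr[OF a z]] lm_bound[OF a z] dual_nrm_nonneg[OF f]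
      by (meson mult_left_mono order_trans)
    also have "\<dots> = (nrm (dual K M) f * (C * \<nu> a)) * nrm M z" by simp
    also have "\<dots> \<le> max 0 (nrm (dual K M) f * (C * \<nu> a)) * nrm M z"
      using nrm_nonneg[OF z] by (intro mult_right_mono) auto
    finally show ?thesis .
  qed
  then have "\<exists>b\<ge>0. \<forall>z\<in>carr M. cmod (?g z) \<le> b * nrm M z"
    by (intro exI[of _ "max 0 (nrm (dual K M) f * (C * \<nu> a))"]) auto
  then show ?thesis
    unfolding dual_iff using f a
    by (auto simp: linear_over_def carr_add carr_scale lm_add lm_scale lm_carr dual_add dual_scale dual_K)
qed

lemma dual_rm:
  assumes f: "f \<in> carr (dual K M)" and a: "a \<in> A"
  shows "(\<lambda>z. if z \<in> carr M then f (rm z a) else 0) \<in> carr (dual K M)" (is "?g \<in> _")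
proof -
  have "cmod (f (rm z a)) \<le> max 0 (nrm (dual K M) f * (C * \<nu> a)) * nrm M z" if z: "z \<in> carr M" for z
  proof -
    have "cmod (f (rm z a)) \<le> nrm (dual K M) f * (C * \<nu> a * nrm M z)"
      using dual_nrm_bound[OF f rm_carr[OF a z]] rm_bound[OF a z] dual_nrm_nonneg[OF f]
      by (meson mult_left_mono order_trans)
    also have "\<dots> = (nrm (dual K M) f * (C * \<nu> a)) * nrm M z" by simp
    also have "\<dots> \<le> max 0 (nrm (dual K M) f * (C * \<nu> a)) * nrm M z"
      using nrm_nonneg[OF z] by (intro mult_right_mono) auto
    finally show ?thesis .
  qed
  then have "\<exists>b\<ge>0. \<forall>z\<in>carr M. cmod (?g z) \<le> b * nrm M z"
    by (intro exI[of _ "max 0 (nrm (dual K M) f * (C * \<nu> a))"]) auto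
  then show ?thesis
    unfolding dual_iff using f a
    by (auto simp: linear_over_def carr_add carr_scale rm_add rm_scale rm_carr dual_add dual_scale dual_K)
qed

lemma weak_right_dual:
  assumes a: "a \<in> A" and f: "f \<in> carr (dual K M)" and z: "z \<in> carr M"
  shows "(\<lambda>n. f (rm (rm z (P n)) a)) \<longlonglongrightarrow> f (rm z a)"
proof -
  obtain g where g: "\<And>k. g k \<in> pos (dual K M)" "\<And>z. z \<in> carr M \<Longrightarrow> f z = (\<Sum>k<units. cunit k * g k z)"
    using dual_parts[OF f] by blast
  obtain p where p: "\<And>k. k < units \<Longrightarrow> p k \<in> Ap" "a = (\<Sum>k<units. cunit k *\<^sub>C p k)"
    using A_parts[OF a] by blast
  have pA: "k < units \<Longrightarrow> p k \<in> A" for k using p(1) Ap_A by blast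
  have rma: "rm y a = (\<Sum>k<units. cunit k *\<^sub>C rm y (p k))" if y: "y \<in> carr M" for y
    unfolding p(2) using y pA by (subst rm_sum2) (auto simp: rm_scale2 A_scale)
  have gd: "g k \<in> carr (dual K M)" for k using g(1) by (simp add: pos_dual_iff)
  have eq: "f (rm y a) = (\<Sum>k<units. cunit k * (\<Sum>l<units. cunit l * g k (rm y (p l))))" if y: "y \<in> carr M" for y
    using rm_carr[OF a y] rma[OF y] linear_parts[OF _ gd, of "\<lambda>l. rm y (p l)"] pA rm_carr y g(2) by simp
  show ?thesis
    unfolding eq[OF z] eq[OF rm_carr[OF P_A z]]
    using p(1) g(1) z by (intro tendsto_sum tendsto_mult_left weak_right) auto
qed

lemma weak_left_dual:
  assumes a: "a \<in> A" and f: "f \<in> carr (dual K M)" and z: "z \<in> carr M"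
  shows "(\<lambda>n. f (lm a (lm (P n) z))) \<longlonglongrightarrow> f (lm a z)"
proof -
  obtain g where g: "\<And>k. g k \<in> pos (dual K M)" "\<And>z. z \<in> carr M \<Longrightarrow> f z = (\<Sum>k<units. cunit k * g k z)"
    using dual_parts[OF f] by blast
  obtain p where p: "\<And>k. k < units \<Longrightarrow> p k \<in> Ap" "a = (\<Sum>k<units. cunit k *\<^sub>C p k)"
    using A_parts[OF a] by blast
  have pA: "k < units \<Longrightarrow> p k \<in> A" for k using p(1) Ap_A by blast
  have lma: "lm a y = (\<Sum>k<units. cunit k *\<^sub>C lm (p k) y)" if y: "y \<in> carr M" for y
    unfolding p(2) using y pA by (subst lm_sum2) (auto simp: lm_scale2 A_scale)
  have gd: "g k \<in> carr (dual K M)" for k using g(1) by (simp add: pos_dual_iff)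
  have eq: "f (lm a y) = (\<Sum>k<units. cunit k * (\<Sum>l<units. cunit l * g k (lm (p l) y)))" if y: "y \<in> carr M" for y
    using lm_carr[OF a y] lma[OF y] linear_parts[OF _ gd, of "\<lambda>l. lm (p l) y"] pA lm_carr y g(2) by simp
  show ?thesis
    unfolding eq[OF z] eq[OF lm_carr[OF P_A z]]
    using p(1) g(1) z by (intro tendsto_sum tendsto_mult_left weak_left) auto
qed

lemma lm_P_mono: "m \<le> m' \<Longrightarrow> z \<in> pos M \<Longrightarrow> lm (P m') z - lm (P m) z \<in> pos M"
  and rm_P_mono: "m \<le> m' \<Longrightarrow> z \<in> pos M \<Longrightarrow> rm z (P m') - rm z (P m) \<in> pos M"
proof -
  assume *: "m \<le> m'" "z \<in> pos M"
  have split: "sum f {..m'} = sum f {..m} + sum f {m<..m'}" for f :: "nat \<Rightarrow> 'm"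
  proof -
    have "{..m'} = {..m} \<union> {m<..m'}" using * by auto
    moreover have "{..m} \<inter> {m<..m'} = {}" by (simp add: disjoint_iff)
    ultimately show ?thesis using sum.union_disjoint[of "{..m}" "{m<..m'}" f] by simp
  qed
  have "lm (P m') z - lm (P m) z = (\<Sum>i\<in>{m<..m'}. lm (q i) z)"
    unfolding lm_P[OF pos_in_carr[OF *(2)]] split by simp
  then show "lm (P m') z - lm (P m) z \<in> pos M" using * by (auto intro!: pos_sum lm_pos E_Ap)
  have "rm z (P m') - rm z (P m) = (\<Sum>i\<in>{m<..m'}. rm z (q i))"
    unfolding rm_P[OF pos_in_carr[OF *(2)]] split by simp
  then show "rm z (P m') - rm z (P m) \<in> pos M" using * by (auto intro!: pos_sum rm_pos E_Ap)
qed

text \<open>For positive \<open>z\<close> the elements \<open>lm (P m) (rm z (P n))\<close> increase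
  in both indices, so a positive functional gives a doubly monotone bounded array. A general
  \<open>g\<close> is a combination of such functionals, and uniqueness of limits identifies the
  given iterated limits with combinations of theirs.\<close>

lemma weak_interchange:
  assumes g: "g \<in> carr (dual K M)" and z: "z \<in> pos M"
    and \<alpha>: "\<And>n. (\<lambda>m. g (lm (P m) (rm z (P n)))) \<longlonglongrightarrow> \<alpha> n"
    and \<beta>: "\<And>m. (\<lambda>n. g (lm (P m) (rm z (P n)))) \<longlonglongrightarrow> \<beta> m"
    and b: "\<beta> \<longlonglongrightarrow> b"
  shows "\<alpha> \<longlonglongrightarrow> b"
proof -
  obtain h where h: "\<And>k. h k \<in> pos (dual K M)" "\<And>z. z \<in> carr M \<Longrightarrow> g z = (\<Sum>k<units. cunit k * h k z)"
    using dual_parts[OF g] by blast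
  have hd: "h k \<in> carr (dual K M)" for k using h(1) by (simp add: pos_dual_iff)
  have zc: "z \<in> carr M" using z pos_in_carr by blast
  define y where "y n m = lm (P m) (rm z (P n))" for n m
  have ypos: "y n m \<in> pos M" for n m unfolding y_def by (intro lm_pos rm_pos P_Ap z)
  then have yc: "y n m \<in> carr M" for n m using pos_in_carr by blast
  define a where "a k n m = Re (h k (y n m))" for k n m
  have hr: "h k u = of_real (Re (h k u)) \<and> 0 \<le> Re (h k u)" if "u \<in> pos M" for k u
    using h(1)[of k] that by (auto simp: pos_dual_iff complex_nonneg_Reals_iff complex_eq_iff)
  have hmono: "Re (h k u) \<le> Re (h k v)" if "u \<in> pos M" "v - u \<in> pos M" for k u v
  proof -
    have "v \<in> pos M" using pos_add[OF that] by simp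
    then have "h k (v - u) = h k v - h k u" using that pos_in_carr by (intro dual_diff[OF hd]) auto
    then show ?thesis using hr[OF that(2), of k] by simp
  qed
  have mono1: "a k n m \<le> a k n' m" if "n \<le> n'" for k n n' m
  proof -
    have "y n' m - y n m = lm (P m) (rm z (P n') - rm z (P n))"
      unfolding y_def using zc by (intro lm_diff[symmetric] P_A rm_carr)
    also have "\<dots> \<in> pos M" by (intro lm_pos P_Ap rm_P_mono that z)
    finally show ?thesis unfolding a_def by (intro hmono ypos)
  qed
  have mono2: "a k n m \<le> a k n m'" if "m \<le> m'" for k n m m'
    unfolding a_def y_def by (intro hmono lm_P_mono lm_pos rm_pos P_Ap that z)
  have ybound: "nrm M (y n m) \<le> C * c0 * (C * c0 * nrm M z)" for n m
    unfolding y_def using lm_P_bound[OF rm_carr[OF P_A zc], of m n] rm_P_bound[OF zc, of n] C_nonneg c0_nonneg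
    by (meson mult_left_mono mult_nonneg_nonneg order_trans)
  have abound: "a k n m \<le> nrm (dual K M) (h k) * (C * c0 * (C * c0 * nrm M z))" for k n m
    unfolding a_def using complex_Re_le_cmod[of "h k (y n m)"] dual_nrm_bound[OF hd yc, of k n m] ybound[of n m]
      dual_nrm_nonneg[OF hd, of k] by (meson mult_left_mono order_trans)
  have conv: "\<exists>l. u \<longlonglongrightarrow> l \<and> (l \<le> r)" if u: "\<And>n m. n \<le> m \<Longrightarrow> u n \<le> u m" "\<And>n. u n \<le> r" for u :: "nat \<Rightarrow> real" and r
  proof -
    have "incseq u" using u(1) by (simp add: incseq_def)
    then obtain l where l: "u \<longlonglongrightarrow> l" using incseq_convergent[of u r] u(2) by metis
    then show ?thesis using LIMSEQ_le_const2[OF l] u(2) by blast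
  qed
  let ?r = "\<lambda>k. nrm (dual K M) (h k) * (C * c0 * (C * c0 * nrm M z))"
  have "\<exists>l. (\<lambda>m. a k n m) \<longlonglongrightarrow> l" for k n
    using conv[of "a k n"] mono2 abound by metis
  then obtain \<alpha>' where \<alpha>': "\<And>k n. (\<lambda>m. a k n m) \<longlonglongrightarrow> \<alpha>' k n" by metis
  have "\<exists>l. (\<lambda>n. a k n m) \<longlonglongrightarrow> l \<and> l \<le> ?r k" for k m
    using conv[of "\<lambda>n. a k n m"] mono1 abound by metis
  then obtain \<beta>' where \<beta>': "\<And>k m. (\<lambda>n. a k n m) \<longlonglongrightarrow> \<beta>' k m" "\<And>k m. \<beta>' k m \<le> ?r k" by metis
  have "\<beta>' k m \<le> \<beta>' k m'" if "m \<le> m'" for k m m'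
    using LIMSEQ_le[OF \<beta>'(1) \<beta>'(1)] mono2[OF that] by blast
  then have "\<exists>l. \<beta>' k \<longlonglongrightarrow> l" for k using conv[of "\<beta>' k"] \<beta>'(2) by metis
  then obtain b' where b': "\<And>k. \<beta>' k \<longlonglongrightarrow> b' k" by metis
  have ab: "\<alpha>' k \<longlonglongrightarrow> b' k" for k
    by (rule double_limit_interchange[of "a k" "\<alpha>' k" "\<beta>' k" "b' k"]) (fact mono1 mono2 \<alpha>' \<beta>'(1) b')+
  have geq: "g (lm (P m) (rm z (P n))) = (\<Sum>k<units. cunit k * of_real (a k n m))" for n m
  proof -
    have "g (y n m) = (\<Sum>k<units. cunit k * h k (y n m))" by (rule h(2)[OF yc])
    also have "\<dots> = (\<Sum>k<units. cunit k * of_real (a k n m))"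
      using hr[OF ypos[of n m]] by (intro sum.cong refl) (simp add: a_def)
    finally show ?thesis by (simp add: y_def)
  qed
  have 1: "\<alpha> n = (\<Sum>k<units. cunit k * of_real (\<alpha>' k n))" for n
    using \<alpha>[of n] unfolding geq by (rule LIMSEQ_unique) (intro tendsto_sum tendsto_mult_left tendsto_of_real \<alpha>')
  have 2: "\<beta> m = (\<Sum>k<units. cunit k * of_real (\<beta>' k m))" for m
    using \<beta>[of m] unfolding geq by (rule LIMSEQ_unique) (intro tendsto_sum tendsto_mult_left tendsto_of_real \<beta>')
  have 3: "b = (\<Sum>k<units. cunit k * of_real (b' k))"
    using b unfolding 2 by (rule LIMSEQ_unique) (intro tendsto_sum tendsto_mult_left tendsto_of_real b')
  show ?thesis unfolding 1 3 by (intro tendsto_sum tendsto_mult_left tendsto_of_real ab)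
qed

end

section \<open>Derivations vanishing on the diagonal\<close>

lemma LIMSEQ_from_diff:
  fixes f :: "nat \<Rightarrow> complex"
  assumes "(\<lambda>m. l - f m) \<longlonglongrightarrow> 0"
  shows "f \<longlonglongrightarrow> l"
  using tendsto_diff[OF tendsto_const assms, of l] by simp

lemma Lim_null_comparison_seq:
  fixes f :: "nat \<Rightarrow> complex"
  assumes "\<And>m. cmod (f m) \<le> g m" "g \<longlonglongrightarrow> 0"
  shows "f \<longlonglongrightarrow> 0"
  using assms by (intro Lim_null_comparison[of f g]) (auto intro!: always_eventually)

locale diagonal_free = matrix_module +
  assumes D_q: "D (E i i) = 0"
begin

lemma D_P: "D (P n) = 0"
  by (simp add: D_sum E_A D_q)

text \<open>When \<open>D\<close> vanishes on the diagonal projections, the Leibniz rule makes it a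
  bimodule map over them.\<close>

lemma D_q_left: "a \<in> A \<Longrightarrow> z \<in> carr M \<Longrightarrow> D (q i \<circ> a) z = D a (rm z (q i))"
  and D_q_right: "a \<in> A \<Longrightarrow> z \<in> carr M \<Longrightarrow> D (a \<circ> q i) z = D a (lm (q i) z)"
  and D_P_left: "a \<in> A \<Longrightarrow> z \<in> carr M \<Longrightarrow> D (P n \<circ> a) z = D a (rm z (P n))"
  and D_P_right: "a \<in> A \<Longrightarrow> z \<in> carr M \<Longrightarrow> D (a \<circ> P n) z = D a (lm (P n) z)"
  by (simp_all add: D_derivation E_A P_A D_q D_P)

text \<open>Each row \<open>q i \<circ> a\<close> is the limit in \<open>\<nu>\<close> of its
  truncations, where the bound of \<open>D\<close> applies; \<open>rm z (P n)\<close> involves only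
  finitely many rows.\<close>

lemma D_left_limit:
  assumes a: "a \<in> Ap" and z: "z \<in> carr M"
  shows "(\<lambda>m. D a (lm (P m) (rm z (P n)))) \<longlonglongrightarrow> D a (rm z (P n))"
proof -
  have aA: "a \<in> A" using a Ap_A by blast
  have "(\<lambda>m. D a (lm (P m) (rm z (q i)))) \<longlonglongrightarrow> D a (rm z (q i))" for i
  proof -
    have qa: "q i \<circ> a \<in> A" "q i \<circ> a \<circ> P m \<in> A" for m using aA by (auto intro: A_comp E_A P_A)
    have "D ((q i \<circ> a) - (q i \<circ> a \<circ> P m)) = D (q i \<circ> a) - D (q i \<circ> a \<circ> P m)" for m
      by (rule linear_over_diff[OF A_sub D_linear K_neg1 qa(1) qa(2)])
    then have "D (q i \<circ> a) z - D (q i \<circ> a \<circ> P m) z = D ((q i \<circ> a) - (q i \<circ> a \<circ> P m)) z" for m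
      by simp
    then have "cmod (D (q i \<circ> a) z - D (q i \<circ> a \<circ> P m) z) \<le> c * \<nu> ((q i \<circ> a) - (q i \<circ> a \<circ> P m)) * nrm M z" for m
      using D_bound[OF A_diff[OF qa(1) qa(2)[of m]] z] by simp
    moreover have "(\<lambda>m. c * \<nu> ((q i \<circ> a) - (q i \<circ> a \<circ> P m)) * nrm M z) \<longlonglongrightarrow> c * 0 * nrm M z"
      by (intro tendsto_intros left_approx a)
    ultimately have "(\<lambda>m. D (q i \<circ> a) z - D (q i \<circ> a \<circ> P m) z) \<longlonglongrightarrow> 0"
      by (rule Lim_null_comparison_seq[OF _ back_subst[where P = "\<lambda>l. _ \<longlonglongrightarrow> l"]]) simp
    then have "(\<lambda>m. D (q i \<circ> a \<circ> P m) z) \<longlonglongrightarrow> D (q i \<circ> a) z"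
      by (rule LIMSEQ_from_diff)
    moreover have "D (q i \<circ> a \<circ> P m) z = D a (lm (P m) (rm z (q i)))" for m
      unfolding D_P_right[OF qa(1) z] D_q_left[OF aA lm_carr[OF P_A z]] rm_lm[OF P_A E_A z] ..
    ultimately show ?thesis by (simp only: D_q_left[OF aA z])
  qed
  then have "(\<lambda>m. \<Sum>i\<le>n. D a (lm (P m) (rm z (q i)))) \<longlonglongrightarrow> (\<Sum>i\<le>n. D a (rm z (q i)))"
    by (intro tendsto_sum)
  moreover have "lm (P m) (rm z (P n)) = (\<Sum>i\<le>n. lm (P m) (rm z (q i)))" for m
    using z by (simp add: rm_P lm_sum P_A rm_carr E_A)
  ultimately show ?thesis
    using z by (simp add: rm_P dual_sum[OF D_dual[OF aA]] lm_carr rm_carr P_A E_A)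
qed

text \<open>The same argument with columns \<open>a \<circ> q j\<close> instead of rows.\<close>

lemma D_right_limit:
  assumes a: "a \<in> Ap" and z: "z \<in> carr M"
  shows "(\<lambda>n. D a (lm (P m) (rm z (P n)))) \<longlonglongrightarrow> D a (lm (P m) z)"
proof -
  have aA: "a \<in> A" using a Ap_A by blast
  have "(\<lambda>n. D a (lm (q j) (rm z (P n)))) \<longlonglongrightarrow> D a (lm (q j) z)" for j
  proof -
    have qa: "a \<circ> q j \<in> A" "P n \<circ> a \<circ> q j \<in> A" for n using aA by (auto intro: A_comp E_A P_A)
    have "D ((a \<circ> q j) - (P n \<circ> a \<circ> q j)) = D (a \<circ> q j) - D (P n \<circ> a \<circ> q j)" for n
      by (rule linear_over_diff[OF A_sub D_linear K_neg1 qa(1) qa(2)])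
    then have "D (a \<circ> q j) z - D (P n \<circ> a \<circ> q j) z = D ((a \<circ> q j) - (P n \<circ> a \<circ> q j)) z" for n
      by simp
    then have "cmod (D (a \<circ> q j) z - D (P n \<circ> a \<circ> q j) z) \<le> c * \<nu> ((a \<circ> q j) - (P n \<circ> a \<circ> q j)) * nrm M z" for n
      using D_bound[OF A_diff[OF qa(1) qa(2)[of n]] z] by simp
    moreover have "(\<lambda>n. c * \<nu> ((a \<circ> q j) - (P n \<circ> a \<circ> q j)) * nrm M z) \<longlonglongrightarrow> c * 0 * nrm M z"
      by (intro tendsto_intros right_approx a)
    ultimately have "(\<lambda>n. D (a \<circ> q j) z - D (P n \<circ> a \<circ> q j) z) \<longlonglongrightarrow> 0"
      by (rule Lim_null_comparison_seq[OF _ back_subst[where P = "\<lambda>l. _ \<longlonglongrightarrow> l"]]) simp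
    then have "(\<lambda>n. D (P n \<circ> a \<circ> q j) z) \<longlonglongrightarrow> D (a \<circ> q j) z"
      by (rule LIMSEQ_from_diff)
    moreover have "D (P n \<circ> a \<circ> q j) z = D a (lm (q j) (rm z (P n)))" for n
      unfolding comp_assoc D_P_left[OF qa(1) z] D_q_right[OF aA rm_carr[OF P_A z]] ..
    ultimately show ?thesis by (simp only: D_q_right[OF aA z])
  qed
  then have "(\<lambda>n. \<Sum>j\<le>m. D a (lm (q j) (rm z (P n)))) \<longlonglongrightarrow> (\<Sum>j\<le>m. D a (lm (q j) z))"
    by (intro tendsto_sum)
  then show ?thesis
    using z by (simp add: lm_P[of "rm z (P n)" m for n] lm_P[OF z] dual_sum[OF D_dual[OF aA]] lm_carr rm_carr P_A E_A)
qed

text \<open>Boundedness of \<open>D\<close> cannot give this, as \<open>P n \<circ> a\<close> need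
  not converge to \<open>a\<close> in \<open>\<nu>\<close>. With \<open>a = s \<circ> t\<close> the
  Leibniz rule writes \<open>D a\<close> as \<open>D t (rm z s)\<close> plus \<open>g\<close>, where
  \<open>g z = D s (lm t z)\<close>. The first summand converges by the weak right limit. For
  \<open>g\<close> the weak left limit is at hand, and after truncation on the left by
  \<open>P m\<close> the right limit follows from \<open>D_right_limit\<close> by subtracting the
  first summand; interchanging the limits finishes.\<close>

lemma D_limit:
  assumes a: "a \<in> Ap" and z: "z \<in> pos M"
  shows "(\<lambda>n. D a (rm z (P n))) \<longlonglongrightarrow> D a z"
proof -
  obtain s t where st: "s \<in> A" "t \<in> A" "a = s \<circ> t" using factorization[OF a] by blast
  have zc: "z \<in> carr M" using z pos_in_carr by blast
  define g where "g y = (if y \<in> carr M then D s (lm t y) else 0)" for y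
  have g: "g \<in> carr (dual K M)" unfolding g_def[abs_def] by (rule dual_lm[OF D_dual[OF st(1)] st(2)])
  have Da: "D a y = D t (rm y s) + g y" if "y \<in> carr M" for y
    using D_derivation[OF st(1,2) that] that by (simp add: st(3) g_def)
  have yc: "rm z (P n) \<in> carr M" "lm (P m) z \<in> carr M" "lm (P m) (rm z (P n)) \<in> carr M" for n m
    using zc by (auto intro: rm_carr lm_carr P_A)
  have "(\<lambda>n. g (rm z (P n))) \<longlonglongrightarrow> g z"
  proof (rule weak_interchange[OF g z])
    show "(\<lambda>m. g (lm (P m) (rm z (P n)))) \<longlonglongrightarrow> g (rm z (P n))" for n
      using weak_left_dual[OF st(2) D_dual[OF st(1)] yc(1), of n] yc by (simp add: g_def)
    show "(\<lambda>m. g (lm (P m) z)) \<longlonglongrightarrow> g z"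
      using weak_left_dual[OF st(2) D_dual[OF st(1)] zc] yc zc by (simp add: g_def)
    show "(\<lambda>n. g (lm (P m) (rm z (P n)))) \<longlonglongrightarrow> g (lm (P m) z)" for m
    proof -
      have "g (lm (P m) (rm z (P n))) = D a (lm (P m) (rm z (P n))) - D t (rm (rm (lm (P m) z) (P n)) s)" for n
        using Da[OF yc(3)] zc by (simp add: rm_lm P_A)
      moreover have "(\<lambda>n. D a (lm (P m) (rm z (P n))) - D t (rm (rm (lm (P m) z) (P n)) s)) \<longlonglongrightarrow>
          D a (lm (P m) z) - D t (rm (lm (P m) z) s)"
        by (intro tendsto_diff D_right_limit a zc weak_right_dual st D_dual yc)
      ultimately show ?thesis using Da[OF yc(2)] by simp
    qed
  qed
  then have "(\<lambda>n. D t (rm (rm z (P n)) s) + g (rm z (P n))) \<longlonglongrightarrow> D t (rm z s) + g z"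
    by (intro tendsto_add weak_right_dual st D_dual zc)
  then show ?thesis using Da yc zc by simp
qed

text \<open>Follows from \<open>E i j = q i \<circ> E i j \<circ> q j\<close>; the indices appear
  reversed because the actions on the dual are transposed.\<close>

lemma D_E_corner: 
  assumes z: "z \<in> carr M" 
  shows "D (E i j) (lm (q j) (rm z (q i))) = D (E i j) z"
proof -
  have "D (E i j) y = D (E i j) (rm y (q i))" if "y \<in> carr M" for y
    using D_q_left[OF E_A that, of i i j] by (simp add: E_comp)
  moreover have "D (E i j) y = D (E i j) (lm (q j) y)" if "y \<in> carr M" for y
    using D_q_right[OF E_A that, of i j j] by (simp add: E_comp)
  ultimately show ?thesis using z rm_carr[OF E_A z] by metis
qed

lemma rm_q_q: "z \<in> carr M \<Longrightarrow> rm (rm z (q i)) (q j) = (if i = j then rm z (q i) else 0)"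
  using rm_comp[OF E_A E_A, of z i i j j] by (auto simp: E_comp)

lemma D_E_off_corner:
  assumes z: "z \<in> carr M" and ne: "(i', j') \<noteq> (i, j)"
  shows "D (E i' j') (lm (q j) (rm z (q i))) = 0"
proof -
  have c: "rm z (q i) \<in> carr M" "lm (q j) (rm z (q i)) \<in> carr M" using z by (auto intro: lm_carr rm_carr E_A)
  have "lm (q j') (rm (lm (q j) (rm z (q i))) (q i')) = 0"
    using z c ne by (cases "i' = i") (auto simp: rm_lm E_A rm_q_q lm_q_q)
  then show ?thesis using D_E_corner[OF c(2), of i' j'] dual_0[OF D_dual[OF E_A]] by simp
qed

text \<open>Applying \<open>fpart\<close> to the functional
  \<open>D (P n \<circ> a \<circ> P m)\<close> as a whole would not be additive in \<open>a\<close>.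
  Taken entry by entry it is: the parts of \<open>D (E i j)\<close> do not depend on
  \<open>a\<close>, and the coefficients are additive and nonnegative on \<open>Ap\<close>.\<close>

definition corner_part :: "nat \<Rightarrow> nat \<Rightarrow> nat \<Rightarrow> ('b \<Rightarrow> 'b) \<Rightarrow> 'a \<Rightarrow> real" where
  "corner_part k n m a z = (\<Sum>i\<le>n. \<Sum>j\<le>m. coef i j a * fpart (D (E i j)) k (lm (q j) (rm z (q i))))"

lemma corner_pos: "z \<in> pos M \<Longrightarrow> lm (q j) (rm z (q i)) \<in> pos M"
  by (intro lm_pos rm_pos E_Ap)

lemma corner_part_sum:
  assumes a: "a \<in> Ap" and z: "z \<in> pos M"
  shows "(\<Sum>k<units. cunit k * of_real (corner_part k n m a z)) = D a (lm (P m) (rm z (P n)))"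
proof -
  have aA: "a \<in> A" and zc: "z \<in> carr M" using a z Ap_A pos_in_carr by auto
  have "(\<Sum>k<units. cunit k * of_real (corner_part k n m a z)) = 
    (\<Sum>i\<le>n. \<Sum>j\<le>m. of_real (coef i j a) * (\<Sum>k<units. cunit k * of_real (fpart (D (E i j)) k (lm (q j) (rm z (q i))))))"
    unfolding corner_part_def of_real_sum sum_distrib_left
    by (subst sum.swap, rule sum.cong[OF refl], subst sum.swap) (simp add: mult.left_commute)
  also have "\<dots> = (\<Sum>i\<le>n. \<Sum>j\<le>m. of_real (coef i j a) * D (E i j) z)"
    by (simp add: fpart_sum[OF D_dual[OF E_A] corner_pos[OF z]] D_E_corner[OF zc])
  also have "\<dots> = D (\<Sum>i\<le>n. \<Sum>j\<le>m. of_real (coef i j a) *\<^sub>C E i j) z"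
    by (simp add: D_sum D_scale A_sum A_scale E_A sum_fun_apply)
  also have "\<dots> = D (P n \<circ> a \<circ> P m) z"
    by (simp only: coef_E[OF a])
  also have "\<dots> = D a (lm (P m) (rm z (P n)))"
    using aA zc by (simp add: D_P_right D_P_left A_comp P_A lm_carr rm_lm)
  finally show ?thesis .
qed

text \<open>The corners of an element of \<open>pos M\<close> are disjoint, so the positive parts of the corners of
  \<open>D b\<close>, where \<open>b\<close> is the compression of \<open>a\<close>, are dominated by the positive part of \<open>D b\<close>.\<close>

lemma corner_part_bound:
  assumes a: "a \<in> Ap" and z: "z \<in> pos M"
  shows "corner_part k n m a z \<le> c * N a * (C * c0 * (C * c0 * nrm M z))"
proof -
  have aA: "a \<in> A" and zc: "z \<in> carr M" using a z Ap_A pos_in_carr by auto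
  define B where "B = D (P n \<circ> a \<circ> P m)"
  have bA: "P n \<circ> a \<circ> P m \<in> A" using aA by (intro A_comp P_A)
  have Bd: "B \<in> carr (dual K M)" unfolding B_def by (rule D_dual[OF bA])
  have Bcorner: "B (lm (q j) (rm y (q i))) = of_real (coef i j a) * D (E i j) y"
    if "i \<le> n" "j \<le> m" "y \<in> carr M" for i j y
  proof -
    have "B (lm (q j) (rm y (q i))) = (\<Sum>i'\<le>n. \<Sum>j'\<le>m. of_real (coef i' j' a) * D (E i' j') (lm (q j) (rm y (q i))))"
      unfolding B_def coef_E[OF a] by (simp add: D_sum D_scale A_sum A_scale E_A sum_fun_apply)
    also have "\<dots> = (\<Sum>(i', j')\<in>{..n} \<times> {..m}. of_real (coef i' j' a) * D (E i' j') (lm (q j) (rm y (q i))))"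
      by (simp add: sum.cartesian_product)
    also have "\<dots> = (\<Sum>(i', j')\<in>{(i, j)}. of_real (coef i' j' a) * D (E i' j') (lm (q j) (rm y (q i))))"
    proof (rule sum.mono_neutral_right)
      show "\<forall>p\<in>{..n} \<times> {..m} - {(i, j)}. (case p of (i', j') \<Rightarrow> of_real (coef i' j' a) * D (E i' j') (lm (q j) (rm y (q i)))) = 0"
      proof
        fix p assume "p \<in> {..n} \<times> {..m} - {(i, j)}"
        then show "(case p of (i', j') \<Rightarrow> of_real (coef i' j' a) * D (E i' j') (lm (q j) (rm y (q i)))) = 0"
          using D_E_off_corner[OF that(3), of "fst p" "snd p" i j] by (cases p) simp
      qed
    qed (use that in auto)
    also have "\<dots> = of_real (coef i j a) * D (E i j) y"
      using that by (simp add: D_E_corner)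
    finally show ?thesis .
  qed
  have dom: "coef i j a * fpart (D (E i j)) k (lm (q j) (rm z (q i))) \<le> fpart B k (lm (q j) (rm z (q i)))"
    if ij: "i \<le> n" "j \<le> m" for i j
  proof (cases "coef i j a = 0")
    case True
    then show ?thesis using fpart_nonneg[OF Bd corner_pos[OF z]] by simp
  next
    case False
    then have pos: "0 < coef i j a" using coef_nonneg[OF a, of i j] by simp
    let ?v = "lm (q j) (rm z (q i))"
    have vp: "?v \<in> pos M" by (rule corner_pos[OF z])
    have idem: "lm (q j) (rm ?v (q i)) = ?v"
      using zc by (simp add: rm_lm rm_carr E_A rm_q_q lm_q_q)
    have "fpart (D (E i j)) k ?v \<le> fpart B k ?v / coef i j a"
      unfolding fpart_def
    proof (rule ppart_least[OF fpart_dual[OF D_dual[OF E_A]] vp])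
      fix u assume u: "u \<in> pos M" "?v - u \<in> pos M"
      have uc: "u \<in> carr M" using u pos_in_carr by blast
      \<comment> \<open>\<open>D (E i j)\<close> sees only the corner of \<open>u\<close>, and on
        corners \<open>B\<close> is \<open>coef i j a\<close> times \<open>D (E i j)\<close>. The
        corner of \<open>u\<close> is still below \<open>?v\<close>, because \<open>?v\<close> is
        its own corner.\<close>
      let ?u = "lm (q j) (rm u (q i))"
      have "?v - ?u = lm (q j) (rm (?v - u) (q i))"
        using uc vp[THEN pos_in_carr] by (simp add: rm_diff lm_diff rm_carr E_A idem)
      then have "?v - ?u \<in> pos M" using corner_pos[OF u(2)] by simp
      then have "Re ((cnj (cunit k) *\<^sub>C B) ?u) \<le> ppart (cnj (cunit k) *\<^sub>C B) ?v"
        using corner_pos[OF u(1)] by (intro ppart_upper fpart_dual[OF Bd])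
      moreover have "Re ((cnj (cunit k) *\<^sub>C B) ?u) = coef i j a * Re ((cnj (cunit k) *\<^sub>C D (E i j)) u)"
        by (simp add: Bcorner[OF ij uc] algebra_simps)
      ultimately show "Re ((cnj (cunit k) *\<^sub>C D (E i j)) u) \<le> ppart (cnj (cunit k) *\<^sub>C B) ?v / coef i j a"
        using pos by (simp add: field_simps)
    qed
    then show ?thesis using pos by (simp add: field_simps)
  qed
  have fpart_sum2: "fpart B k (\<Sum>i\<in>I. y i) = (\<Sum>i\<in>I. fpart B k (y i))" 
    if "\<And>i. i \<in> I \<Longrightarrow> y i \<in> pos M" "finite I" for I and y :: "nat \<Rightarrow> 'a"
    using that(2,1)
  proof (induction I rule: finite_induct)
    case empty
    then show ?case using fpart_add[OF Bd pos_0 pos_0, of k] by simp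
  next
    case (insert i I)
    then show ?case by (simp add: fpart_add[OF Bd] pos_sum)
  qed
  have "corner_part k n m a z \<le> (\<Sum>i\<le>n. \<Sum>j\<le>m. fpart B k (lm (q j) (rm z (q i))))"
    unfolding corner_part_def by (intro sum_mono dom) auto
  also have "\<dots> = fpart B k (\<Sum>i\<le>n. \<Sum>j\<le>m. lm (q j) (rm z (q i)))"
    using corner_pos[OF z] by (simp add: fpart_sum2 pos_sum)
  also have "(\<Sum>i\<le>n. \<Sum>j\<le>m. lm (q j) (rm z (q i))) = lm (P m) (rm z (P n))"
    using zc by (simp add: rm_P lm_P lm_sum P_A E_A rm_carr)
  also have "fpart B k (lm (P m) (rm z (P n))) \<le> nrm (dual K M) B * nrm M (lm (P m) (rm z (P n)))"
    by (intro fpart_bound Bd lm_pos rm_pos P_Ap z)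
  also have "\<dots> \<le> (c * N a) * (C * c0 * (C * c0 * nrm M z))"
  proof (rule mult_mono)
    have "cmod (B y) \<le> c * N a * nrm M y" if "y \<in> carr M" for y
    proof -
      have "cmod (B y) \<le> c * \<nu> (P n \<circ> a \<circ> P m) * nrm M y" unfolding B_def by (rule D_bound[OF bA that])
      also have "\<dots> \<le> c * N a * nrm M y"
        using N_bound(2)[OF a, of n m] c_nonneg nrm_nonneg[OF that] by (intro mult_right_mono mult_left_mono)
      finally show ?thesis .
    qed
    then show "nrm (dual K M) B \<le> c * N a" using c_nonneg N_nonneg[OF a] by (intro dual_nrm_le) auto
    show "nrm M (lm (P m) (rm z (P n))) \<le> C * c0 * (C * c0 * nrm M z)"
      using lm_P_bound[OF rm_carr[OF P_A zc], of m n] rm_P_bound[OF zc, of n] C_nonneg c0_nonneg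
      by (meson mult_left_mono mult_nonneg_nonneg order_trans)
  qed (use c_nonneg N_nonneg[OF a] zc in \<open>auto intro!: nrm_nonneg lm_carr rm_carr P_A\<close>)
  finally show ?thesis .
qed

lemma corner_part_bipositive:
  "bipositive Ap M (\<lambda>a. c * (C * c0)\<^sup>2 * N a) (corner_part k n m)"
  unfolding bipositive_def
proof (intro conjI ballI allI impI)
  fix a z assume a: "a \<in> Ap" and z: "z \<in> pos M"
  note fp = fpart_nonneg[OF D_dual[OF E_A] corner_pos[OF z]]
  have zc: "z \<in> carr M" using z pos_in_carr by blast
  show "0 \<le> corner_part k n m a z"
    unfolding corner_part_def by (intro sum_nonneg mult_nonneg_nonneg fp coef_nonneg a)
  show "corner_part k n m a z \<le> c * (C * c0)\<^sup>2 * N a * nrm M z"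
    using corner_part_bound[OF a z, of k n m] by (simp add: power2_eq_square algebra_simps)
  show "corner_part k n m (a + a') z = corner_part k n m a z + corner_part k n m a' z" if "a' \<in> Ap" for a'
    unfolding corner_part_def using a that by (simp add: coef_add distrib_right sum.distrib)
  show "corner_part k n m a (z + z') = corner_part k n m a z + corner_part k n m a z'" if "z' \<in> pos M" for z'
  proof -
    have z'c: "z' \<in> carr M" using that pos_in_carr by blast
    have "lm (q j) (rm (z + z') (q i)) = lm (q j) (rm z (q i)) + lm (q j) (rm z' (q i))" for i j
      using zc z'c by (simp add: rm_add lm_add E_A rm_carr)
    then show ?thesis
      unfolding corner_part_def using z that 
      by (simp add: fpart_add[OF D_dual[OF E_A]] corner_pos distrib_left sum.distrib)
  qed
  show "corner_part k n m (of_real t *\<^sub>C a) z = t * corner_part k n m a z" if "0 \<le> t" for t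
    unfolding corner_part_def using a that by (simp add: coef_scale sum_distrib_left mult.assoc)
  show "corner_part k n m a (of_real t *\<^sub>C z) = t * corner_part k n m a z" if "0 \<le> t" for t
  proof -
    have "lm (q j) (rm (of_real t *\<^sub>C z) (q i)) = of_real t *\<^sub>C lm (q j) (rm z (q i))" for i j
      using zc by (simp add: rm_scale lm_scale E_A rm_carr)
    then show ?thesis
      unfolding corner_part_def using z that
      by (simp add: fpart_scale[OF D_dual[OF E_A]] corner_pos sum_distrib_left mult.left_commute)
  qed
qed

text \<open>The limit in \<open>m\<close> is taken before the limit in \<open>n\<close>, in the
  order in which \<open>D a\<close> is recovered from its compressions. The bound of
  \<open>corner_part\<close> is independent of both indices, so the limits exist along one universal
  subfilter.\<close>

lemma diagonal_free_decomposition: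
  obtains \<tau> where "\<And>k. bipositive Ap M (\<lambda>a. c * (C * c0)\<^sup>2 * N a) (\<tau> k)"
    "\<And>a z. a \<in> Ap \<Longrightarrow> z \<in> pos M \<Longrightarrow> D a z = (\<Sum>k<units. cunit k * of_real (\<tau> k a z))"
proof -
  obtain G where G: "G \<le> sequentially" "G \<noteq> bot"
    "\<And>h::nat \<Rightarrow> real. Bfun h sequentially \<Longrightarrow> (h \<longlongrightarrow> Lim G h) G"
    using universal_limits[of sequentially] by (metis trivial_limit_sequentially)
  define \<rho> where "\<rho> k n a z = Lim G (\<lambda>m. corner_part k n m a z)" for k n a z
  define \<tau> where "\<tau> k a z = Lim G (\<lambda>n. \<rho> k n a z)" for k a z
  let ?b = "\<lambda>a. c * (C * c0)\<^sup>2 * N a"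
  have \<rho>: "bipositive Ap M ?b (\<rho> k n)"
    and \<rho>_lim: "a \<in> Ap \<Longrightarrow> z \<in> pos M \<Longrightarrow> ((\<lambda>m. corner_part k n m a z) \<longlongrightarrow> \<rho> k n a z) G" for k n a z
    unfolding \<rho>_def[abs_def]
    using bipositive_Lim[OF always_eventually G, of Ap M ?b "corner_part k n"] corner_part_bipositive
      Ap_add Ap_scale pos_add pos_scale by blast+
  have \<tau>: "bipositive Ap M ?b (\<tau> k)"
    and \<tau>_lim: "a \<in> Ap \<Longrightarrow> z \<in> pos M \<Longrightarrow> ((\<lambda>n. \<rho> k n a z) \<longlongrightarrow> \<tau> k a z) G" for k a z
    unfolding \<tau>_def[abs_def]
    using bipositive_Lim[OF always_eventually G, of Ap M ?b "\<rho> k"] \<rho>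
      Ap_add Ap_scale pos_add pos_scale by blast+
  have "D a z = (\<Sum>k<units. cunit k * of_real (\<tau> k a z))" if a: "a \<in> Ap" and z: "z \<in> pos M" for a z
  proof -
    have zc: "z \<in> carr M" using z pos_in_carr by blast
    have "D a (rm z (P n)) = (\<Sum>k<units. cunit k * of_real (\<rho> k n a z))" for n
    proof -
      have "((\<lambda>m. \<Sum>k<units. cunit k * of_real (corner_part k n m a z)) \<longlongrightarrow> (\<Sum>k<units. cunit k * of_real (\<rho> k n a z))) G"
        by (intro tendsto_sum tendsto_mult_left tendsto_of_real \<rho>_lim a z)
      moreover have "((\<lambda>m. D a (lm (P m) (rm z (P n)))) \<longlongrightarrow> D a (rm z (P n))) G"
        using tendsto_mono[OF G(1) D_left_limit[OF a zc]] .
      ultimately show ?thesis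
        unfolding corner_part_sum[OF a z] using tendsto_unique[OF G(2)] by blast
    qed
    moreover have "((\<lambda>n. \<Sum>k<units. cunit k * of_real (\<rho> k n a z)) \<longlongrightarrow> (\<Sum>k<units. cunit k * of_real (\<tau> k a z))) G"
      by (intro tendsto_sum tendsto_mult_left tendsto_of_real \<tau>_lim a z)
    moreover have "((\<lambda>n. D a (rm z (P n))) \<longlongrightarrow> D a z) G"
      using tendsto_mono[OF G(1) D_limit[OF a z]] .
    ultimately show ?thesis using tendsto_unique[OF G(2)] by simp
  qed
  with \<tau> show thesis using that by blast
qed

end

text \<open>With \<open>w\<close> of norm at most \<open>diagonal_const C c c0\<close>, subtracting
  the inner derivation enlarges the bound \<open>c\<close> by
  \<open>2 * diagonal_const C c c0 * C\<close>. Compressing an element of the module on both sides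
  costs \<open>(C * c0)\<^sup>2\<close>, and the last summand bounds one half of the inner
  derivation.\<close>

definition decomposition_const :: "real \<Rightarrow> real \<Rightarrow> real \<Rightarrow> real" where
  "decomposition_const C c c0 = (c + 2 * diagonal_const C c c0 * C) * (C * c0)\<^sup>2 + diagonal_const C c c0 * C"

lemma decomposition_const_nonneg: "0 \<le> C \<Longrightarrow> 0 \<le> c \<Longrightarrow> 0 \<le> c0 \<Longrightarrow> 0 \<le> decomposition_const C c c0"
  by (simp add: decomposition_const_def diagonal_const_nonneg)

context matrix_module
begin

abbreviation cd :: real where "cd \<equiv> decomposition_const C c c0"

text \<open>\<open>d\<close> is \<open>D\<close> minus the inner derivation of the implementing
  functional \<open>w\<close>, so it vanishes on the diagonal. The inner derivation is decomposed
  directly: its two terms are parts of \<open>w\<close> composed with the right and the left action,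
  which preserve positivity. The right one is added to the parts of \<open>d\<close>; the left one
  carries the minus sign and becomes \<open>\<beta>\<close>.\<close>

lemma matrix_decomposition:
  obtains \<alpha> \<beta> where "\<And>k. bipositive Ap M (\<lambda>a. cd * N a) (\<alpha> k)" "\<And>k. bipositive Ap M (\<lambda>a. cd * N a) (\<beta> k)"
    "\<And>a z. a \<in> Ap \<Longrightarrow> z \<in> pos M \<Longrightarrow> 
      D a z = (\<Sum>k<units. cunit k * of_real (\<alpha> k a z)) - (\<Sum>k<units. cunit k * of_real (\<beta> k a z))"
proof -
  obtain w where w: "w \<in> carr (dual K M)" "nrm (dual K M) w \<le> cw"
    "\<And>j z. z \<in> carr M \<Longrightarrow> w (rm z (q j)) - w (lm (q j) z) = D (q j) z"
    using implementing_functional by blast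
  define d where "d a = (\<lambda>z. if z \<in> carr M then D a z - (w (rm z a) - w (lm a z)) else 0)" for a
  have wl: "cmod (w (lm a z)) \<le> cw * C * \<nu> a * nrm M z" and wr: "cmod (w (rm z a)) \<le> cw * C * \<nu> a * nrm M z"
    if "a \<in> A" "z \<in> carr M" for a z
  proof -
    have wb: "cmod (w y) \<le> cw * (C * \<nu> a * nrm M z)" if "y \<in> carr M" "nrm M y \<le> C * \<nu> a * nrm M z" for y
      using dual_nrm_bound[OF w(1) that(1)] mult_mono[OF w(2) that(2) cw_nonneg nrm_nonneg[OF that(1)]] by linarith
    show "cmod (w (lm a z)) \<le> cw * C * \<nu> a * nrm M z" 
      using wb[OF lm_carr[OF that] lm_bound[OF that]] by (simp add: mult.assoc)
    show "cmod (w (rm z a)) \<le> cw * C * \<nu> a * nrm M z"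
      using wb[OF rm_carr[OF that] rm_bound[OF that]] by (simp add: mult.assoc)
  qed
  interpret d: diagonal_free K M A Ap lm rm \<nu> N E coef d C "c + 2 * cw * C" c0
  proof unfold_locales
    fix a assume a: "a \<in> A"
    let ?r = "\<lambda>z. if z \<in> carr M then w (rm z a) else 0" and ?l = "\<lambda>z. if z \<in> carr M then w (lm a z) else 0"
    have "D a z = 0" if "z \<notin> carr M" for z using D_dual[OF a] that by (simp add: dual_iff)
    then have "d a = D a - (?r - ?l)" by (auto simp: d_def fun_eq_iff)
    moreover have "D a - (?r - ?l) \<in> carr (dual K M)"
      by (intro ksubspace_diff[OF ksubspace_dual K_neg1] D_dual[OF a] dual_rm[OF w(1) a] dual_lm[OF w(1) a])
    ultimately show "d a \<in> carr (dual K M)" by simp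
    fix z assume z: "z \<in> carr M"
    have "cmod (d a z) \<le> cmod (D a z) + (cmod (w (rm z a)) + cmod (w (lm a z)))"
      using z norm_triangle_ineq4[of "D a z" "w (rm z a) - w (lm a z)"] norm_triangle_ineq4[of "w (rm z a)" "w (lm a z)"]
      by (simp add: d_def)
    also have "\<dots> \<le> (c + 2 * cw * C) * \<nu> a * nrm M z"
      using D_bound[OF a z] wl[OF a z] wr[OF a z] by (simp add: algebra_simps)
    finally show "cmod (d a z) \<le> (c + 2 * cw * C) * \<nu> a * nrm M z" .
    fix b assume b: "b \<in> A"
    show "d (a \<circ> b) z = d b (rm z a) + d a (lm b z)"
      using a b z by (simp add: d_def D_derivation rm_comp lm_comp rm_carr lm_carr rm_lm)
  next
    show "linear_over K A d"
      unfolding linear_over_def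
    proof (intro conjI ballI ext)
      fix a b z assume "a \<in> A" "b \<in> A"
      then show "d (a + b) z = (d a + d b) z"
        by (simp add: d_def D_add rm_add2 lm_add2 dual_add[OF w(1)] rm_carr lm_carr)
    next
      fix t a z assume "t \<in> K" "a \<in> A"
      then show "d (t *\<^sub>C a) z = (t *\<^sub>C d a) z"
        by (simp add: d_def D_scale rm_scale2 lm_scale2 dual_scale[OF w(1)] rm_carr lm_carr right_diff_distrib)
    qed
  next
    show "0 \<le> c + 2 * cw * C" using c_nonneg cw_nonneg C_nonneg by simp
  next
    fix i
    have "d (q i) z = 0" for z using w(3)[of z i] by (simp add: d_def)
    then show "d (q i) = 0" by (simp add: fun_eq_iff)
  qed (fact A_sub A_comp Ap_sub Ap_add Ap_scale A_parts lm_linear rm_linear lm_linear2 rm_linear2 lm_comp rm_comp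
      rm_lm lm_pos rm_pos C_nonneg lm_bound rm_bound E_Ap E_comp c0_nonneg signs coef_nonneg coef_add coef_scale 
      coef_E left_approx right_approx weak_right weak_left N_bound N_nonneg factorization)+
  obtain \<tau> where \<tau>: "\<And>k. bipositive Ap M (\<lambda>a. (c + 2 * cw * C) * (C * c0)\<^sup>2 * N a) (\<tau> k)"
    "\<And>a z. a \<in> Ap \<Longrightarrow> z \<in> pos M \<Longrightarrow> d a z = (\<Sum>k<units. cunit k * of_real (\<tau> k a z))"
    using d.diagonal_free_decomposition by blast
  have bound: "fpart w k y \<le> cw * C * N a * nrm M z" if "a \<in> Ap" "z \<in> pos M" "y \<in> pos M" "nrm M y \<le> C * \<nu> a * nrm M z"
    for k y a z
  proof -
    have "fpart w k y \<le> cw * (C * \<nu> a * nrm M z)"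
      using fpart_bound[OF w(1) that(3), of k] mult_mono[OF w(2) that(4) cw_nonneg nrm_nonneg[OF pos_in_carr[OF that(3)]]]
      by linarith
    also have "\<dots> \<le> cw * (C * N a * nrm M z)"
      using N_bound(1)[OF that(1)] cw_nonneg C_nonneg nrm_nonneg[OF pos_in_carr[OF that(2)]]
      by (intro mult_left_mono mult_right_mono)
    finally show ?thesis by (simp add: mult.assoc)
  qed
  have right: "bipositive Ap M (\<lambda>a. cw * C * N a) (\<lambda>a z. fpart w k (rm z a))" for k
    unfolding bipositive_def
    by (auto simp: rm_add rm_add2 rm_scale rm_scale2 Ap_A pos_in_carr fpart_add[OF w(1)] fpart_scale[OF w(1)] 
      rm_pos rm_bound intro!: fpart_nonneg[OF w(1)] bound)
  have left: "bipositive Ap M (\<lambda>a. cw * C * N a) (\<lambda>a z. fpart w k (lm a z))" for k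
    unfolding bipositive_def
    by (auto simp: lm_add lm_add2 lm_scale lm_scale2 Ap_A pos_in_carr fpart_add[OF w(1)] fpart_scale[OF w(1)] 
      lm_pos lm_bound intro!: fpart_nonneg[OF w(1)] bound)
  have mono: "bipositive Ap M b' \<alpha>" if "bipositive Ap M b \<alpha>" "\<And>a. a \<in> Ap \<Longrightarrow> b a \<le> b' a" for b b' \<alpha>
    using that nrm_nonneg pos_in_carr mult_right_mono[of "b _" "b' _" "nrm M _"] unfolding bipositive_def 
    by (meson order_trans)
  show thesis
  proof (rule that[of "\<lambda>k a z. \<tau> k a z + fpart w k (rm z a)" "\<lambda>k a z. fpart w k (lm a z)"])
    show "bipositive Ap M (\<lambda>a. cd * N a) (\<lambda>a z. \<tau> k a z + fpart w k (rm z a))" for k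
      by (rule mono[OF bipositive_add[OF \<tau>(1) right]]) (simp add: decomposition_const_def algebra_simps)
    show "bipositive Ap M (\<lambda>a. cd * N a) (\<lambda>a z. fpart w k (lm a z))" for k
      by (rule mono[OF left]) (use N_nonneg c_nonneg cw_nonneg C_nonneg in \<open>auto simp: decomposition_const_def intro!: mult_right_mono\<close>)
    fix a z assume a: "a \<in> Ap" and z: "z \<in> pos M"
    have zc: "z \<in> carr M" using z pos_in_carr by blast
    have "D a z = d a z + w (rm z a) - w (lm a z)" using zc by (simp add: d_def)
    also have "w (rm z a) = (\<Sum>k<units. cunit k * of_real (fpart w k (rm z a)))"
      using fpart_sum[OF w(1) rm_pos[OF a z]] by simp
    also have "w (lm a z) = (\<Sum>k<units. cunit k * of_real (fpart w k (lm a z)))"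
      using fpart_sum[OF w(1) lm_pos[OF a z]] by simp
    finally show "D a z = (\<Sum>k<units. cunit k * of_real (\<tau> k a z + fpart w k (rm z a)))
        - (\<Sum>k<units. cunit k * of_real (fpart w k (lm a z)))"
      using \<tau>(2)[OF a z] by (simp add: sum.distrib distrib_left)
  qed
qed

end


section \<open>Projections onto atomic sublattices\<close>

lemma LIMSEQ_squeeze0:
  fixes f g :: "nat \<Rightarrow> real"
  assumes "\<And>n. 0 \<le> f n" "\<And>n. f n \<le> g n" "g \<longlonglongrightarrow> 0"
  shows "f \<longlonglongrightarrow> 0"
  using assms by (intro tendsto_sandwich[of "\<lambda>_. 0" f _ g]) (auto intro!: always_eventually)

locale atomic_projection = blattice K X for K and X :: "'x::complex_vector onspace" +
  fixes \<sigma> :: "'x \<Rightarrow> 'x" and x :: "nat \<Rightarrow> 'x"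
  assumes \<sigma>: "positive_map K X X \<sigma>" and \<sigma>_supp: "supported X \<sigma>" and \<sigma>_idem: "\<sigma> \<circ> \<sigma> = \<sigma>"
    and range_riesz: "riesz_subspace K X (\<sigma> ` carr X)"
    and basis: "schauder_basis K (range_lattice X \<sigma>) UNIV x"
    and atoms: "atom (range_lattice X \<sigma>) (x i)"
begin

abbreviation S :: "'x set" where "S \<equiv> \<sigma> ` carr X"

abbreviation Y :: "'x onspace" where "Y \<equiv> range_lattice X \<sigma>"

lemma Y_simps [simp]: "carr Y = S" "nrm Y = nrm X" "pos Y = pos X \<inter> S"
  by (simp_all add: range_lattice_def sub_def)

lemma S_sub: "ksubspace K S" and S_carr: "y \<in> S \<Longrightarrow> y \<in> carr X"
  using range_riesz by (auto simp: riesz_subspace_def)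

lemma S_add: "y \<in> S \<Longrightarrow> y' \<in> S \<Longrightarrow> y + y' \<in> S" and S_scale: "t \<in> K \<Longrightarrow> y \<in> S \<Longrightarrow> t *\<^sub>C y \<in> S"
  and S_0: "0 \<in> S"
  using S_sub unfolding ksubspace_def by blast+

lemma S_diff: "y \<in> S \<Longrightarrow> y' \<in> S \<Longrightarrow> y - y' \<in> S"
  by (rule ksubspace_diff[OF S_sub K_neg1])

lemma S_sum: "(\<And>i. i \<in> I \<Longrightarrow> f i \<in> S) \<Longrightarrow> sum f I \<in> S"
  by (rule ksubspace_sum[OF S_sub])

lemma \<sigma>_fix: "y \<in> S \<Longrightarrow> \<sigma> y = y"
  using \<sigma>_idem by (metis comp_apply image_iff)

lemma \<sigma>_S: "v \<in> carr X \<Longrightarrow> \<sigma> v \<in> S" and \<sigma>_pos: "v \<in> pos X \<Longrightarrow> \<sigma> v \<in> pos X"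
  and \<sigma>_linear: "linear_over K (carr X) \<sigma>"
  using \<sigma> by (auto simp: positive_map_def linear_map_def)

lemma \<sigma>_add: "v \<in> carr X \<Longrightarrow> v' \<in> carr X \<Longrightarrow> \<sigma> (v + v') = \<sigma> v + \<sigma> v'"
  and \<sigma>_scale: "t \<in> K \<Longrightarrow> v \<in> carr X \<Longrightarrow> \<sigma> (t *\<^sub>C v) = t *\<^sub>C \<sigma> v"
  using \<sigma>_linear by (auto simp: linear_over_def)

lemma \<sigma>_out: "v \<notin> carr X \<Longrightarrow> \<sigma> v = 0"
  using \<sigma>_supp by (simp add: supported_def)

lemma x_S: "x i \<in> S" and x_pos: "x i \<in> pos X" and x_nonzero: "x i \<noteq> 0"
  using atoms[of i] by (auto simp: atom_def)

lemma x_carr: "x i \<in> carr X"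
  by (rule S_carr[OF x_S])

lemma below_atom:
  assumes w: "w \<in> pos X" "w \<in> S" and b: "0 \<le> b" "of_real b *\<^sub>C x i - w \<in> pos X"
  obtains t where "w = of_real t *\<^sub>C x i"
proof (cases "b = 0")
  case True
  then show ?thesis using that[of 0] pos_antisym[OF w(1)] b by simp
next
  case False
  let ?w = "of_real (1/b) *\<^sub>C w"
  have "?w \<in> pos X" using pos_scale[of "1/b" w] w b by simp
  moreover have wS: "?w \<in> S" using S_scale[OF K_of_real w(2)] .
  moreover have "of_real (1/b) *\<^sub>C (of_real b *\<^sub>C x i - w) \<in> pos X" using b by (intro pos_scale) auto
  then have "x i - ?w \<in> pos X" using False by (simp add: cv.scale_right_diff_distrib)
  moreover have "x i - ?w \<in> S" using S_diff[OF x_S wS] .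
  ultimately obtain t where "?w = of_real t *\<^sub>C x i" using atoms[of i] by (auto simp: atom_def le_in_def)
  then have "of_real b *\<^sub>C ?w = of_real (b * t) *\<^sub>C x i" by simp
  then show ?thesis using that[of "b * t"] False by simp
qed

text \<open>The Riesz decomposition property splits off the piece of \<open>w\<close> below one atom
  at a time; each such piece is a multiple of that atom.\<close>

lemma below_atoms:
  assumes "finite I" and w: "w \<in> pos X" "w \<in> S" and b: "\<And>i. 0 \<le> b i" 
    and le: "(\<Sum>i\<in>I. of_real (b i) *\<^sub>C x i) - w \<in> pos X"
  obtains t where "w = (\<Sum>i\<in>I. of_real (t i) *\<^sub>C x i)"
proof -
  have "\<exists>t. w = (\<Sum>i\<in>I. of_real (t i) *\<^sub>C x i)"
    using assms(1) w le
  proof (induction I arbitrary: w rule: finite_induct)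
    case empty
    then show ?case using pos_antisym[of w] by simp
  next
    case (insert i I)
    let ?z = "of_real (b i) *\<^sub>C x i" and ?z' = "\<Sum>i\<in>I. of_real (b i) *\<^sub>C x i"
    have z: "?z \<in> pos X" "?z \<in> S" "?z' \<in> pos X"
      using b x_pos x_S by (auto intro!: pos_scale pos_sum S_scale)
    have zw: "?z + ?z' - w \<in> pos X" using insert by simp
    obtain u1 u2 where u: "u1 \<in> pos X" "u2 \<in> pos X" "u1 \<in> S" "u2 \<in> S" "w = u1 + u2" "?z - u1 \<in> pos X" "?z' - u2 \<in> pos X"
      using riesz_property[OF range_riesz insert.prems(2) z(2) insert.prems(1) z(1,3) zw] by blast
    obtain s where s: "u1 = of_real s *\<^sub>C x i" using below_atom[OF u(1,3) b u(6)] by blast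
    obtain t where t: "u2 = (\<Sum>i\<in>I. of_real (t i) *\<^sub>C x i)" using insert.IH[OF u(2,4,7)] by blast
    have "w = (\<Sum>k\<in>insert i I. of_real ((t(i := s)) k) *\<^sub>C x k)"
      using insert.hyps u(5) s t by (auto intro!: sum.cong)
    then show ?case by blast
  qed
  then show thesis using that by blast
qed

lemma tends_Y: "tends_in Y u y \<longleftrightarrow> y \<in> S \<and> tends_in X u y"
  using S_carr by (auto simp: tends_in_def)

lemma expansion_iff:
  "is_expansion K Y UNIV x y \<alpha> \<longleftrightarrow> range \<alpha> \<subseteq> K \<and> y \<in> S \<and> tends_in X (\<lambda>n. \<Sum>i<n. \<alpha> i *\<^sub>C x i) y"
  by (simp add: is_expansion_def tends_Y)

abbreviation coord :: "nat \<Rightarrow> 'x \<Rightarrow> complex" where "coord i \<equiv> biorth K Y x i"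

lemma expansion_coord: "is_expansion K Y UNIV x y (\<lambda>i. coord i y)"
  and coord_unique: "is_expansion K Y UNIV x y \<alpha> \<Longrightarrow> coord i y = \<alpha> i" if y: "y \<in> S"
proof -
  have ex: "\<exists>!\<alpha>. is_expansion K Y UNIV x y \<alpha>" using basis y unfolding schauder_basis_def Y_simps by blast
  have eq: "(\<lambda>i. coord i y) = (THE \<alpha>. is_expansion K Y UNIV x y \<alpha>)" using y by (auto simp: biorth_def)
  show "is_expansion K Y UNIV x y (\<lambda>i. coord i y)" unfolding eq using ex by (rule theI')
  then show "is_expansion K Y UNIV x y \<alpha> \<Longrightarrow> coord i y = \<alpha> i" using ex by (metis (mono_tags))
qed

lemma coord_out: "y \<notin> S \<Longrightarrow> coord i y = 0"
  by (simp add: biorth_def)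

lemma coord_K: "coord i y \<in> K"
  using expansion_coord[of y] coord_out[of y i] by (cases "y \<in> S") (auto simp: expansion_iff)

lemma coord_tends: "y \<in> S \<Longrightarrow> tends_in X (\<lambda>n. \<Sum>i<n. coord i y *\<^sub>C x i) y"
  using expansion_coord by (simp add: expansion_iff)

lemma partial_S: "(\<And>i. i \<in> I \<Longrightarrow> \<alpha> i \<in> K) \<Longrightarrow> (\<Sum>i\<in>I. \<alpha> i *\<^sub>C x i) \<in> S"
  by (intro S_sum S_scale x_S)

text \<open>Expansions may be added termwise, so their uniqueness makes the coordinates
  additive.\<close>

lemma coord_add: 
  assumes "y \<in> S" "y' \<in> S" shows "coord i (y + y') = coord i y + coord i y'"
proof -
  let ?s = "\<lambda>y n. \<Sum>i<n. coord i y *\<^sub>C x i"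
  have sS: "?s y n \<in> carr X" for y n using partial_S[of "{..<n}" "\<lambda>i. coord i y"] coord_K S_carr by blast
  have "0 \<le> nrm X (y + y' - (?s y n + ?s y' n))" for n
    using sS assms S_carr by (intro nrm_nonneg carr_diff carr_add) auto
  moreover have "nrm X (y + y' - (?s y n + ?s y' n)) \<le> nrm X (y - ?s y n) + nrm X (y' - ?s y' n)" for n
    using nrm_triangle[of "y - ?s y n" "y' - ?s y' n"] sS assms S_carr carr_diff by (simp add: algebra_simps)
  moreover have "(\<lambda>n. nrm X (y - ?s y n) + nrm X (y' - ?s y' n)) \<longlonglongrightarrow> 0"
    using coord_tends[OF assms(1)] coord_tends[OF assms(2)] by (intro tendsto_add_zero) (auto simp: tends_in_def)
  ultimately have "(\<lambda>n. nrm X (y + y' - (?s y n + ?s y' n))) \<longlonglongrightarrow> 0"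
    by (rule LIMSEQ_squeeze0)
  then have "is_expansion K Y UNIV x (y + y') (\<lambda>i. coord i y + coord i y')"
    using assms S_add S_carr coord_K K_add
    by (auto simp: expansion_iff tends_in_def cv.scale_left_distrib sum.distrib)
  then show ?thesis using coord_unique[OF S_add[OF assms]] by blast
qed

lemma coord_scale:
  assumes "y \<in> S" "t \<in> K" shows "coord i (t *\<^sub>C y) = t * coord i y"
proof -
  let ?s = "\<lambda>n. \<Sum>i<n. coord i y *\<^sub>C x i"
  have sS: "?s n \<in> carr X" for n using partial_S[of "{..<n}" "\<lambda>i. coord i y"] coord_K S_carr by blast
  have eq: "t *\<^sub>C y - (\<Sum>i<n. (t * coord i y) *\<^sub>C x i) = t *\<^sub>C (y - ?s n)" for n
    by (simp add: cv.scale_right_diff_distrib cv.scale_sum_right)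
  have "nrm X (t *\<^sub>C y - (\<Sum>i<n. (t * coord i y) *\<^sub>C x i)) = cmod t * nrm X (y - ?s n)" for n
    unfolding eq by (intro nrm_scale assms carr_diff S_carr sS)
  moreover have "(\<lambda>n. cmod t * nrm X (y - ?s n)) \<longlonglongrightarrow> cmod t * 0"
    using coord_tends[OF assms(1)] by (intro tendsto_mult_left) (auto simp: tends_in_def)
  ultimately have "is_expansion K Y UNIV x (t *\<^sub>C y) (\<lambda>i. t * coord i y)"
    using assms S_scale[OF assms(2,1)] S_carr coord_K K_mult by (auto simp: expansion_iff tends_in_def)
  then show ?thesis using coord_unique[OF S_scale[OF assms(2,1)]] by blast
qed

lemma coord_linear: "linear_over K S (coord i)"
  by (simp add: linear_over_def coord_add coord_scale)

lemma coord_sum: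
  "finite I \<Longrightarrow> (\<And>k. k \<in> I \<Longrightarrow> \<alpha> k \<in> K \<and> y k \<in> S) \<Longrightarrow> coord i (\<Sum>k\<in>I. \<alpha> k *\<^sub>C y k) = (\<Sum>k\<in>I. \<alpha> k * coord i (y k))"
  using linear_over_sum[OF S_sub coord_linear, of I \<alpha> y i] by simp

lemma coord_diff: "y \<in> S \<Longrightarrow> y' \<in> S \<Longrightarrow> coord i (y - y') = coord i y - coord i y'"
  by (rule linear_over_diff[OF S_sub coord_linear K_neg1])

lemma coord_x: "coord i (x j) = (if i = j then 1 else 0)"
proof -
  have "(\<Sum>k<n. (if k = j then 1 else 0) *\<^sub>C x k) = (if j < n then x j else 0)" for n
    using sum.delta[of "{..<n}" j x] by (simp add: if_distrib[of "\<lambda>c. c *\<^sub>C _"] cong: if_cong)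
  moreover have "(\<lambda>n. nrm X (x j - (if j < n then x j else 0))) \<longlonglongrightarrow> 0"
    by (rule tendsto_eventually) (rule eventually_mono[OF eventually_gt_at_top[of j]], simp)
  ultimately have "is_expansion K Y UNIV x (x j) (\<lambda>k. if k = j then 1 else 0)"
    using x_S x_carr by (auto simp: expansion_iff tends_in_def)
  then show ?thesis using coord_unique[OF x_S] by blast
qed

lemma coord_partial:
  "finite I \<Longrightarrow> (\<And>k. k \<in> I \<Longrightarrow> \<alpha> k \<in> K) \<Longrightarrow> coord i (\<Sum>k\<in>I. \<alpha> k *\<^sub>C x k) = (if i \<in> I then \<alpha> i else 0)"
  by (subst coord_sum) (auto simp: x_S coord_x if_distrib sum.delta cong: if_cong)

text \<open>Replacing the coefficients by their real parts does not increase the distance of the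
  partial sums to the real element \<open>y\<close>. The new series therefore also converges to
  \<open>y\<close>, and expansions are unique.\<close>

lemma coord_of_real:
  assumes y: "y \<in> S" "y \<in> pos X"
  shows "coord i y = of_real (Re (coord i y))"
proof (cases "K = \<real>")
  case True
  then show ?thesis using coord_K[of i y] by (metis of_real_Re)
next
  case False
  let ?r = "\<lambda>n. \<Sum>i<n. of_real (Re (coord i y)) *\<^sub>C x i" and ?m = "\<lambda>n. \<Sum>i<n. of_real (Im (coord i y)) *\<^sub>C x i"
  have re: "?r n \<in> real_part X" "?m n \<in> real_part X" for n
    by (induction n) (auto intro: real_add real_scale pos_real x_pos)
  have eq: "y - (\<Sum>i<n. coord i y *\<^sub>C x i) = (y - ?r n) + \<i> *\<^sub>C (- ?m n)" for n
  proof -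
    have "coord i y *\<^sub>C x i = of_real (Re (coord i y)) *\<^sub>C x i + \<i> *\<^sub>C of_real (Im (coord i y)) *\<^sub>C x i" for i
      by (simp flip: cv.scale_left_distrib complex_eq)
    then show ?thesis by (simp add: sum.distrib cv.scale_sum_right sum_negf cv.scale_minus_right)
  qed
  have "y - ?r n \<in> real_part X" "- ?m n \<in> imag_part K X" for n
    using re y pos_real real_diff real_minus False by (auto simp: imag_part_def)
  then have le: "nrm X (y - ?r n) \<le> nrm X (y - (\<Sum>i<n. coord i y *\<^sub>C x i))" for n
    unfolding eq by (rule nrm_parts_le(1))
  have rS: "?r n \<in> carr X" for n using re real_carr by blast
  have "(\<lambda>n. nrm X (y - ?r n)) \<longlonglongrightarrow> 0"
    using nrm_nonneg[OF carr_diff[OF S_carr[OF y(1)] rS]] le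
    by (rule LIMSEQ_squeeze0) (use coord_tends[OF y(1)] in \<open>simp add: tends_in_def\<close>)
  then have "is_expansion K Y UNIV x y (\<lambda>i. of_real (Re (coord i y)))"
    using y S_carr by (auto simp: expansion_iff tends_in_def)
  then show ?thesis using coord_unique[OF y(1)] by blast
qed

text \<open>The positive part of a partial sum \<open>t\<close> of \<open>y \<ge> 0\<close> is the partial sum over the nonnegative
  coefficients; since taking positive parts is a contraction, the latter sums also converge to \<open>y\<close>.\<close>

lemma coord_nonneg:
  assumes y: "y \<in> S" "y \<in> pos X"
  shows "0 \<le> Re (coord i y)"
proof -
  define a where "a i = Re (coord i y)" for i
  have cy: "coord i y = of_real (a i)" for i unfolding a_def by (rule coord_of_real[OF y])
  define t where "t n = (\<Sum>i<n. coord i y *\<^sub>C x i)" for n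
  define u where "u n = (\<Sum>i<n. of_real (max (a i) 0) *\<^sub>C x i)" for n
  define v where "v n = (\<Sum>i<n. of_real (max (- a i) 0) *\<^sub>C x i)" for n
  have tuv: "t n = u n - v n" for n
  proof -
    have "of_real (a i) *\<^sub>C x i = of_real (max (a i) 0) *\<^sub>C x i - of_real (max (- a i) 0) *\<^sub>C x i" for i
      by (auto simp: max_def simp flip: cv.scale_left_diff_distrib)
    then show ?thesis by (simp add: t_def u_def v_def cy sum_subtractf)
  qed
  have up: "u n \<in> pos X" and vp: "v n \<in> pos X" for n
    unfolding u_def v_def by (auto intro!: pos_sum pos_scale x_pos)
  have uS: "u n \<in> S" and vS: "v n \<in> S" for n unfolding u_def v_def by (auto intro!: partial_S)
  have tS: "t n \<in> S" for n unfolding tuv by (intro S_diff uS vS)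
  have tr: "t n \<in> real_part X" for n unfolding tuv by (intro real_partI up vp)
  \<comment> \<open>With \<open>s\<close> the positive part of \<open>t n\<close>, the difference
    \<open>w = u n - s\<close> lies below both \<open>u n\<close> and \<open>v n\<close>. It is thus
    a combination of the atoms with nonnegative coefficient and also of those with negative
    coefficient, hence 0, and \<open>u n = s\<close>.\<close>
  have least: "r - u n \<in> pos X" if r: "r \<in> pos X" "r - t n \<in> pos X" for r n
  proof -
    obtain s where s: "s \<in> pos X" "s \<in> S" "s - t n \<in> pos X" "\<And>u. u \<in> pos X \<Longrightarrow> u - t n \<in> pos X \<Longrightarrow> u - s \<in> pos X"
      using pos_part[OF range_riesz tr tS] by metis
    define w where "w = u n - s"
    have w: "w \<in> pos X" unfolding w_def using s(4)[OF up] vp tuv by simp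
    have wS: "w \<in> S" unfolding w_def by (intro S_diff uS s(2))
    have "u n - w \<in> pos X" using s by (simp add: w_def)
    then have "(\<Sum>i<n. of_real (max (a i) 0) *\<^sub>C x i) - w \<in> pos X" by (simp add: u_def)
    moreover have "(\<Sum>i<n. of_real (max (a i) 0) *\<^sub>C x i) = (\<Sum>i\<in>{i. i < n \<and> 0 \<le> a i}. of_real (max (a i) 0) *\<^sub>C x i)"
      by (rule sum.mono_neutral_right) (auto simp: max_def)
    ultimately obtain \<beta> where \<beta>: "w = (\<Sum>i\<in>{i. i < n \<and> 0 \<le> a i}. of_real (\<beta> i) *\<^sub>C x i)"
      using below_atoms[OF _ w wS, of "{i. i < n \<and> 0 \<le> a i}" "\<lambda>i. max (a i) 0"] by auto
    have "v n - w \<in> pos X" using s(3) by (simp add: w_def tuv algebra_simps)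
    then have "(\<Sum>i<n. of_real (max (- a i) 0) *\<^sub>C x i) - w \<in> pos X" by (simp add: v_def)
    moreover have "(\<Sum>i<n. of_real (max (- a i) 0) *\<^sub>C x i) = (\<Sum>i\<in>{i. i < n \<and> a i < 0}. of_real (max (- a i) 0) *\<^sub>C x i)"
      by (rule sum.mono_neutral_right) (auto simp: max_def)
    ultimately obtain \<gamma> where \<gamma>: "w = (\<Sum>i\<in>{i. i < n \<and> a i < 0}. of_real (\<gamma> i) *\<^sub>C x i)"
      using below_atoms[OF _ w wS, of "{i. i < n \<and> a i < 0}" "\<lambda>i. max (- a i) 0"] by auto
    have "of_real (\<beta> i) = (0::complex)" if "i < n" "0 \<le> a i" for i
    proof -
      have "coord i w = of_real (\<beta> i)" unfolding \<beta> using that by (subst coord_partial) auto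
      moreover have "coord i w = 0" unfolding \<gamma> using that by (subst coord_partial) auto
      ultimately show ?thesis by simp
    qed
    then have "w = 0" unfolding \<beta> by (intro sum.neutral) auto
    then show ?thesis using s(4)[OF r] by (simp add: w_def)
  qed
  have le: "nrm X (y - u n) \<le> nrm X (y - t n)" for n
  proof -
    have yt: "y - t n \<in> real_part X" "y - u n \<in> real_part X" using y tr real_diff pos_real up by auto
    let ?m = "modulus K X (y - t n)"
    have m: "?m - (y - t n) \<in> pos X" "?m + (y - t n) \<in> pos X" "?m \<in> pos X"
      using modulus_bounds(1,2)[OF yt(1) imag_0] modulus_pos[OF real_carr[OF yt(1)]] by simp_all
    have "?m - (y - u n) \<in> pos X" using pos_add[OF m(1) vp[of n]] by (simp add: tuv algebra_simps)
    \<comment> \<open>\<open>?m + y\<close> dominates 0 and \<open>t n\<close>, hence also the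
      positive part \<open>u n\<close> of \<open>t n\<close>.\<close>
    moreover have "?m + y - u n \<in> pos X" 
      by (rule least) (use m y in \<open>auto intro: pos_add simp: algebra_simps\<close>)
    then have "?m + (y - u n) \<in> pos X" by (simp add: algebra_simps)
    ultimately have "?m - modulus K X (y - u n) \<in> pos X"
      using modulus_real_least[OF yt(2)] m(3) pos_in_carr by blast
    then show ?thesis
      using nrm_mono[OF modulus_pos[OF real_carr[OF yt(2)]]] modulus(2) yt real_carr by metis
  qed
  have "(\<lambda>n. nrm X (y - u n)) \<longlonglongrightarrow> 0"
    using nrm_nonneg[OF carr_diff[OF S_carr[OF y(1)] pos_in_carr[OF up]]] le
    by (rule LIMSEQ_squeeze0) (use coord_tends[OF y(1)] in \<open>simp add: tends_in_def t_def\<close>)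
  then have "is_expansion K Y UNIV x y (\<lambda>i. of_real (max (a i) 0))"
    using y S_carr by (auto simp: expansion_iff tends_in_def u_def)
  then have "coord i y = of_real (max (a i) 0)" using coord_unique[OF y(1)] by blast
  then show ?thesis by simp
qed

text \<open>The terms of the expansion are positive, so the difference is a limit of positive
  elements.\<close>

lemma partial_below:
  assumes y: "y \<in> S" "y \<in> pos X"
  shows "y - (\<Sum>i<n. coord i y *\<^sub>C x i) \<in> pos X"
proof (rule pos_closed)
  have term_pos: "coord i y *\<^sub>C x i \<in> pos X" for i
    using pos_scale[OF coord_nonneg[OF y] x_pos, of i i] coord_of_real[OF y, of i] by simp
  show "(\<Sum>i<m + n. coord i y *\<^sub>C x i) - (\<Sum>i<n. coord i y *\<^sub>C x i) \<in> pos X" for m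
  proof -
    have "{..<m + n} = {..<n} \<union> {n..<m + n}" "{..<n} \<inter> {n..<m + n} = {}" by auto
    then have "(\<Sum>i<m + n. coord i y *\<^sub>C x i) = (\<Sum>i<n. coord i y *\<^sub>C x i) + (\<Sum>i\<in>{n..<m + n}. coord i y *\<^sub>C x i)"
      by (simp add: sum.union_disjoint)
    then show ?thesis by (simp add: pos_sum term_pos)
  qed
  have "(\<Sum>i<n. coord i y *\<^sub>C x i) \<in> carr X" using partial_S[of "{..<n}" "\<lambda>i. coord i y"] coord_K S_carr by blast
  then show "tends_in X (\<lambda>m. (\<Sum>i<m + n. coord i y *\<^sub>C x i) - (\<Sum>i<n. coord i y *\<^sub>C x i)) (y - (\<Sum>i<n. coord i y *\<^sub>C x i))"
    using LIMSEQ_ignore_initial_segment[of "\<lambda>m. nrm X (y - (\<Sum>i<m. coord i y *\<^sub>C x i))" 0 n] coord_tends[OF y(1)] carr_diff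
    by (auto simp: tends_in_def)
qed

lemma coord_bound_pos:
  assumes y: "y \<in> S" "y \<in> pos X"
  shows "Re (coord i y) \<le> (1 / nrm X (x i)) * nrm X y" "0 < nrm X (x i)"
proof -
  have nx: "0 < nrm X (x i)" using x_nonzero[of i] nrm_nonneg nrm_0_iff x_carr by (metis order_le_less)
  let ?p = "\<Sum>k<i. coord k y *\<^sub>C x k"
  have term_pos: "coord i y *\<^sub>C x i \<in> pos X" for i
    using pos_scale[OF coord_nonneg[OF y] x_pos, of i i] coord_of_real[OF y, of i] by simp
  have "y - (?p + coord i y *\<^sub>C x i) \<in> pos X" using partial_below[OF y, of "Suc i"] by simp
  moreover have "?p \<in> pos X" by (intro pos_sum term_pos)
  ultimately have "y - coord i y *\<^sub>C x i \<in> pos X" using pos_add[of "y - (?p + coord i y *\<^sub>C x i)" ?p] by (simp add: algebra_simps)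
  then have "nrm X (coord i y *\<^sub>C x i) \<le> nrm X y" by (rule nrm_mono[OF term_pos])
  moreover have "nrm X (coord i y *\<^sub>C x i) = Re (coord i y) * nrm X (x i)"
    using nrm_scale[OF coord_K x_carr] coord_of_real[OF y, of i] coord_nonneg[OF y, of i] by (metis abs_of_nonneg norm_of_real)
  ultimately show "Re (coord i y) \<le> (1 / nrm X (x i)) * nrm X y" using nx by (simp add: field_simps)
  show "0 < nrm X (x i)" by fact
qed

end

section \<open>Positive and regular operators as an ordered space\<close>

lemma linear_map_comp: "linear_map K B C f \<Longrightarrow> linear_map K C D g \<Longrightarrow> linear_map K B D (g \<circ> f)"
  unfolding linear_map_def linear_over_def by (auto simp: image_subset_iff)

lemma linear_map_add: "ksubspace K (carr C) \<Longrightarrow> linear_map K B C f \<Longrightarrow> linear_map K B C g \<Longrightarrow> linear_map K B C (f + g)"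
  unfolding linear_map_def linear_over_def ksubspace_def by (auto simp: image_subset_iff cv.scale_right_distrib)

lemma linear_map_0: "ksubspace K (carr C) \<Longrightarrow> linear_map K B C 0"
  unfolding linear_map_def linear_over_def ksubspace_def by auto

lemma linear_map_scale: "ksubspace K (carr C) \<Longrightarrow> linear_map K B C f \<Longrightarrow> c \<in> K \<Longrightarrow> linear_map K B C (c *\<^sub>C f)"
  unfolding linear_map_def linear_over_def ksubspace_def 
  by (auto simp: image_subset_iff cv.scale_right_distrib mult.commute)

lemma linear_map_sum:
  "ksubspace K (carr C) \<Longrightarrow> (\<And>i. i \<in> I \<Longrightarrow> linear_map K B C (f i)) \<Longrightarrow> linear_map K B C (\<Sum>i\<in>I. f i)"
  by (induction I rule: infinite_finite_induct) (simp_all add: linear_map_0 linear_map_add del: plus_fun_apply)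

lemma positive_map_comp: "positive_map K B C f \<Longrightarrow> positive_map K C D g \<Longrightarrow> positive_map K B D (g \<circ> f)"
  unfolding positive_map_def using linear_map_comp by (auto simp: image_subset_iff)

lemma supported_comp: "supported B f \<Longrightarrow> g 0 = 0 \<Longrightarrow> supported B (g \<circ> f)"
  by (simp add: supported_def)

context blattice
begin

lemma positive_mapD:
  assumes "positive_map K B B T"
  shows "linear_map K B B T" "linear_over K (carr B) T" "v \<in> carr B \<Longrightarrow> T v \<in> carr B" "v \<in> pos B \<Longrightarrow> T v \<in> pos B" "T 0 = 0"
  using assms linear_over_0[OF carr_sub, of T] by (auto simp: positive_map_def linear_map_def)

lemma positive_map_add: "positive_map K B B f \<Longrightarrow> positive_map K B B g \<Longrightarrow> positive_map K B B (f + g)"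
  unfolding positive_map_def using linear_map_add[OF carr_sub, of B f g] by (auto simp: image_subset_iff intro!: pos_add)

lemma positive_map_scale: "positive_map K B B f \<Longrightarrow> 0 \<le> t \<Longrightarrow> positive_map K B B (of_real t *\<^sub>C f)"
  unfolding positive_map_def using linear_map_scale[OF carr_sub _ K_of_real, of B f t] 
  by (auto simp: image_subset_iff intro!: pos_scale)

lemma positive_map_0: "positive_map K B B 0"
  unfolding positive_map_def using linear_map_0[OF carr_sub] by auto

lemma pos_regular_iff: "T \<in> pos (regular_ops K B) \<longleftrightarrow> positive_map K B B T \<and> supported B T"
  by (simp add: regular_ops_def)

lemma carr_regular_iff: "T \<in> carr (regular_ops K B) \<longleftrightarrow> regular_map K B B T \<and> supported B T"
  by (simp add: regular_ops_def)

lemma regular_norm_nonneg: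
  assumes S: "positive_map K B B S" and T: "linear_map K B B T"
    and dom: "\<And>u. u \<in> pos B \<Longrightarrow> S u - T u \<in> pos B" "\<And>u. u \<in> pos B \<Longrightarrow> S u + T u \<in> pos B"
  shows "0 \<le> nrm (regular_ops K B) T"
  unfolding nrm_regular_ops
proof (rule cInf_greatest)
  show "{op_norm B B S |S. bounded_map K B B S \<and> (\<forall>x\<in>carr B. le_in B (modulus K B (T x)) (S (modulus K B x)))} \<noteq> {}"
    using modulus_dominated[OF positive_mapD(1)[OF S] T dom] positive_bounded[OF lattice S] by blast
qed (auto intro!: op_norm_nonneg nrm_nonneg simp: bounded_map_def)

lemma regular_map_sum:
  assumes "finite I" "\<And>i. i \<in> I \<Longrightarrow> c i \<in> K \<and> positive_map K B B (T i)" 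
    "\<And>v. v \<in> carr B \<Longrightarrow> f v = (\<Sum>i\<in>I. c i *\<^sub>C T i v)"
  shows "regular_map K B B f"
proof -
  obtain h where h: "bij_betw h {..<card I} I" using assms(1) ex_bij_betw_nat_finite lessThan_atLeast0 by metis
  have "f v = (\<Sum>j<card I. c (h j) *\<^sub>C T (h j) v)" if "v \<in> carr B" for v
    using assms(3)[OF that] sum.reindex_bij_betw[OF h, of "\<lambda>i. c i *\<^sub>C T i v"] by simp
  moreover have "h j \<in> I" if "j < card I" for j using h that by (auto simp: bij_betw_def)
  ultimately show ?thesis
    unfolding regular_map_def using assms(2) by (intro exI[of _ "card I"] exI[of _ "\<lambda>j. c (h j)"] exI[of _ "\<lambda>j. T (h j)"]) auto
qed

lemma pos_regular: "T \<in> pos (regular_ops K B) \<Longrightarrow> T \<in> carr (regular_ops K B)"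
  using regular_map_sum[of "{0::nat}" "\<lambda>_. 1" "\<lambda>_. T" T] by (simp add: pos_regular_iff carr_regular_iff)

lemma regular_parts:
  assumes T: "T \<in> carr (regular_ops K B)"
  obtains n :: nat and c R where "\<And>j. j < n \<Longrightarrow> c j \<in> K" "\<And>j. j < n \<Longrightarrow> R j \<in> pos (regular_ops K B)" 
    "T = (\<Sum>j<n. c j *\<^sub>C R j)"
proof -
  obtain n :: nat and c R where *: "\<And>j. j < n \<Longrightarrow> c j \<in> K \<and> positive_map K B B (R j)"
    "\<And>v. v \<in> carr B \<Longrightarrow> T v = (\<Sum>j<n. c j *\<^sub>C R j v)"
    using T unfolding carr_regular_iff regular_map_def by blast
  \<comment> \<open>A regular representation constrains its positive maps on \<open>carr B\<close>
    only; cut off outside, they become members of the cone of regular operators.\<close>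
  define R' where "R' j = (\<lambda>v. if v \<in> carr B then R j v else 0)" for j
  have "R' j \<in> pos (regular_ops K B)" if "j < n" for j
    using *(1)[OF that] carr_add carr_scale pos_in_carr
    unfolding pos_regular_iff positive_map_def linear_map_def linear_over_def supported_def R'_def by auto
  moreover have "T = (\<Sum>j<n. c j *\<^sub>C R' j)"
  proof (rule ext)
    fix v
    show "T v = (\<Sum>j<n. c j *\<^sub>C R' j) v"
      using *(2) T by (cases "v \<in> carr B") (simp_all add: sum_fun_apply R'_def carr_regular_iff supported_def)
  qed
  ultimately show thesis using that * by blast
qed

lemma regular_ksubspace: "ksubspace K (carr (regular_ops K B))"
  unfolding ksubspace_def
proof (intro conjI ballI)
  show "0 \<in> carr (regular_ops K B)"
    by (rule pos_regular) (simp add: pos_regular_iff positive_map_0 supported_def)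
next
  fix S T assume S: "S \<in> carr (regular_ops K B)" and T: "T \<in> carr (regular_ops K B)"
  obtain n :: nat and c R where R: "\<And>j. j < n \<Longrightarrow> c j \<in> K" "\<And>j. j < n \<Longrightarrow> R j \<in> pos (regular_ops K B)" 
    "S = (\<Sum>j<n. c j *\<^sub>C R j)" using regular_parts[OF S] by blast
  obtain n' :: nat and c' R' where R': "\<And>j. j < n' \<Longrightarrow> c' j \<in> K" "\<And>j. j < n' \<Longrightarrow> R' j \<in> pos (regular_ops K B)" 
    "T = (\<Sum>j<n'. c' j *\<^sub>C R' j)" using regular_parts[OF T] by blast
  have "regular_map K B B (S + T)"
  proof (rule regular_map_sum[of "{..<n} <+> {..<n'}" "case_sum c c'" "case_sum R R'"])
    show "(S + T) v = (\<Sum>i\<in>{..<n} <+> {..<n'}. case_sum c c' i *\<^sub>C case_sum R R' i v)" for v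
      by (simp add: sum.Plus R(3) R'(3) sum_fun_apply)
  qed (use R R' in \<open>auto simp: pos_regular_iff\<close>)
  then show "S + T \<in> carr (regular_ops K B)"
    using S T by (simp add: carr_regular_iff supported_def)
next
  fix a T assume a: "a \<in> K" and T: "T \<in> carr (regular_ops K B)"
  obtain n :: nat and c R where R: "\<And>j. j < n \<Longrightarrow> c j \<in> K" "\<And>j. j < n \<Longrightarrow> R j \<in> pos (regular_ops K B)" 
    "T = (\<Sum>j<n. c j *\<^sub>C R j)" using regular_parts[OF T] by blast
  have "regular_map K B B (a *\<^sub>C T)"
    by (rule regular_map_sum[of "{..<n}" "\<lambda>j. a * c j" R])
      (use R a in \<open>auto simp: pos_regular_iff K_mult sum_fun_apply cv.scale_sum_right\<close>)
  then show "a *\<^sub>C T \<in> carr (regular_ops K B)"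
    using T by (simp add: carr_regular_iff supported_def)
qed

text \<open>Existence comes from splitting the coefficients into real and imaginary parts. For
  uniqueness, evaluation at a positive vector reduces to the decomposition in \<open>B\<close>, and
  the cone spans.\<close>

lemma complexified_regular: "complexified_space K (regular_ops K B)"
proof -
  interpret R: ordered_space K "regular_ops K B"
  proof
    show "ksubspace K (carr (regular_ops K B))" by (rule regular_ksubspace)
    show "pos (regular_ops K B) \<subseteq> carr (regular_ops K B)" using pos_regular by blast
    show "0 \<in> pos (regular_ops K B)" by (simp add: pos_regular_iff positive_map_0 supported_def)
    show "S + T \<in> pos (regular_ops K B)" if "S \<in> pos (regular_ops K B)" "T \<in> pos (regular_ops K B)" for S T
      using that positive_map_add[of S T] by (simp add: pos_regular_iff supported_def)
    show "of_real t *\<^sub>C T \<in> pos (regular_ops K B)" if "0 \<le> t" "T \<in> pos (regular_ops K B)" for t T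
      using that positive_map_scale[of T t] by (simp add: pos_regular_iff supported_def)
  qed
  show ?thesis
  proof
    fix T assume T: "T \<in> carr (regular_ops K B)"
    obtain n :: nat and c R where R: "\<And>j. j < n \<Longrightarrow> c j \<in> K" "\<And>j. j < n \<Longrightarrow> R j \<in> pos (regular_ops K B)" 
      "T = (\<Sum>j<n. c j *\<^sub>C R j)" using regular_parts[OF T] by blast
    define a where "a = (\<Sum>j<n. of_real (Re (c j)) *\<^sub>C R j)"
    define b where "b = (\<Sum>j<n. of_real (Im (c j)) *\<^sub>C R j)"
    have real_sum: "(\<Sum>j<m. of_real (t j) *\<^sub>C R j) \<in> real_part (regular_ops K B)" if "m \<le> n" for t m
      using that
    proof (induction m)
      case (Suc m)
      then show ?case
        unfolding sum.lessThan_Suc by (intro R.real_add[OF Suc.IH R.real_scale[OF R.pos_real[OF R(2)]]]) auto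
    qed simp
    have "a \<in> real_part (regular_ops K B)" unfolding a_def by (rule real_sum) simp
    moreover have "b \<in> imag_part K (regular_ops K B)"
    proof (cases "K = \<real>")
      case True
      then have "Im (c j) = 0" if "j < n" for j using R(1)[OF that] by (simp add: complex_is_Real_iff)
      then have "b = 0" unfolding b_def by (intro sum.neutral) auto
      then show ?thesis by simp
    next
      case False
      then show ?thesis unfolding b_def imag_part_def using real_sum by simp
    qed
    moreover have "T = a + \<i> *\<^sub>C b"
    proof -
      have "c j *\<^sub>C R j = of_real (Re (c j)) *\<^sub>C R j + \<i> *\<^sub>C of_real (Im (c j)) *\<^sub>C R j" for j
        by (simp only: cv.scale_scale flip: cv.scale_left_distrib complex_eq)
      then show ?thesis unfolding R(3) a_def b_def by (simp only: sum.distrib cv.scale_sum_right)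
    qed
    ultimately show "\<exists>a\<in>real_part (regular_ops K B). \<exists>b\<in>imag_part K (regular_ops K B). T = a + \<i> *\<^sub>C b" by blast
  next
    fix a b assume a: "a \<in> real_part (regular_ops K B)" and b: "b \<in> imag_part K (regular_ops K B)" 
      and ab: "a + \<i> *\<^sub>C b = 0"
    have real: "T v \<in> real_part B \<and> T 0 = 0" if T: "T \<in> real_part (regular_ops K B)" "v \<in> pos B" for T v
    proof -
      obtain p r where "T = p - r" "p \<in> pos (regular_ops K B)" "r \<in> pos (regular_ops K B)"
        using T(1) unfolding real_part_def by blast
      then show ?thesis using positive_mapD(4,5)[of p] positive_mapD(4,5)[of r] T(2) by (simp add: pos_regular_iff real_partI)
    qed
    have imag: "b v \<in> imag_part K B" if "v \<in> pos B" for v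
      using b real[of b v] that by (auto simp: imag_part_def split: if_splits)
    have "a v = 0 \<and> b v = 0" if "v \<in> pos B" for v
    proof (rule decomp_0)
      show "a v + \<i> *\<^sub>C b v = 0" using fun_cong[OF ab, of v] by simp
    qed (use real[OF a that] imag[OF that] in auto)
    moreover have "T = 0" if T: "T \<in> carr (regular_ops K B)" "\<And>v. v \<in> pos B \<Longrightarrow> T v = 0" for T
    proof (rule ext)
      fix v
      show "T v = 0 v"
      proof (cases "v \<in> carr B")
        case True
        obtain n :: nat and c R where R: "\<And>j. j < n \<Longrightarrow> c j \<in> K" "\<And>j. j < n \<Longrightarrow> R j \<in> pos (regular_ops K B)" 
          "T = (\<Sum>j<n. c j *\<^sub>C R j)" using regular_parts[OF T(1)] by blast
        have "linear_map K B B T" unfolding R(3)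
          using R by (intro linear_map_sum linear_map_scale carr_sub) (auto simp: pos_regular_iff positive_map_def)
        then have lin: "linear_over K (carr B) T" by (simp add: linear_map_def)
        obtain p where p: "\<And>k. k < units \<Longrightarrow> p k \<in> pos B" "v = (\<Sum>k<units. cunit k *\<^sub>C p k)"
          using positive_parts[OF riesz_carr True] by (metis IntD1)
        have "T v = (\<Sum>k<units. cunit k *\<^sub>C T (p k))"
          unfolding p(2) using p(1) pos_in_carr by (intro linear_over_sum[OF carr_sub lin]) auto
        then show ?thesis using p(1) T(2) by simp
      next
        case False
        then show ?thesis using T(1) by (simp add: carr_regular_iff supported_def)
      qed
    qed
    moreover have "a \<in> carr (regular_ops K B)" "b \<in> carr (regular_ops K B)"
      using a b R.real_carr R.imag_real by auto
    ultimately show "a = 0 \<and> b = 0" by blast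
  qed
qed

end

section \<open>Matrix units, sign matrices and compressions\<close>

context atomic_projection
begin

text \<open>Composition with \<open>\<sigma>\<close> makes the matrix units operators on
  \<open>X\<close>, so that they can be members of the ideal; they correspond to the local matrix
  units on the range.\<close>

definition E :: "nat \<Rightarrow> nat \<Rightarrow> 'x \<Rightarrow> 'x" where
  "E i j = rank_one (coord j) (x i) \<circ> \<sigma>"

abbreviation P :: "nat \<Rightarrow> 'x \<Rightarrow> 'x" where "P n \<equiv> \<Sum>i\<le>n. E i i"

abbreviation \<nu> :: "('x \<Rightarrow> 'x) \<Rightarrow> real" where "\<nu> \<equiv> nrm (regular_ops K X)"

lemma E_apply: "E i j v = coord j (\<sigma> v) *\<^sub>C x i"
  by (simp add: E_def rank_one_def)

lemma P_apply: "P n v = (\<Sum>i<Suc n. coord i (\<sigma> v) *\<^sub>C x i)"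
  by (simp add: sum_fun_apply E_apply lessThan_Suc_atMost)

lemma natural_proj_comp: "natural_proj K Y x n \<circ> \<sigma> = P n"
  by (rule ext) (simp add: natural_proj_def coord_proj_def sum_fun_apply E_apply rank_one_def)

lemma coord_pos: "y \<in> pos X \<Longrightarrow> y \<in> S \<Longrightarrow> coord i y *\<^sub>C x k \<in> pos X"
  using pos_scale[OF coord_nonneg x_pos, of y i k] coord_of_real[of y i] by simp

lemma rank_one_positive: 
  assumes \<xi>: "\<xi> \<in> pos X"
  shows "positive_map K X X (\<lambda>v. coord j (\<sigma> v) *\<^sub>C \<xi>)" "supported X (\<lambda>v. coord j (\<sigma> v) *\<^sub>C \<xi>)"
proof -
  have "coord j (\<sigma> v) *\<^sub>C \<xi> \<in> pos X" if v: "v \<in> pos X" for v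
    using pos_scale[OF coord_nonneg \<xi>, of "\<sigma> v" j] coord_of_real[of "\<sigma> v" j] \<sigma>_pos[OF v] \<sigma>_S[OF pos_in_carr[OF v]] by simp
  then show "positive_map K X X (\<lambda>v. coord j (\<sigma> v) *\<^sub>C \<xi>)"
    using \<xi> coord_K by (auto simp: positive_map_def linear_map_def linear_over_def \<sigma>_add \<sigma>_scale coord_add coord_scale \<sigma>_S
      cv.scale_left_distrib carr_scale pos_in_carr)
  have "coord j 0 = 0" using coord_diff[OF S_0 S_0, of j] by simp
  then show "supported X (\<lambda>v. coord j (\<sigma> v) *\<^sub>C \<xi>)" by (simp add: supported_def \<sigma>_out)
qed

lemma E_positive: "positive_map K X X (E i j)" and E_supp: "supported X (E i j)"
  using rank_one_positive[OF x_pos, of j i] by (simp_all add: E_apply[abs_def])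

lemma E_comp: "E i j \<circ> E k l = (if j = k then E i l else 0)"
proof (rule ext)
  fix v
  have "coord j (\<sigma> (coord l (\<sigma> v) *\<^sub>C x k)) = coord l (\<sigma> v) * (if j = k then 1 else 0)"
    by (simp only: \<sigma>_fix[OF S_scale[OF coord_K x_S]] coord_scale[OF x_S coord_K] coord_x)
  then show "(E i j \<circ> E k l) v = (if j = k then E i l else 0) v" by (simp add: E_apply)
qed

lemma P_S: "P n v \<in> S"
  unfolding P_apply by (intro partial_S coord_K)

lemma P_below: "v \<in> pos X \<Longrightarrow> \<sigma> v - P n v \<in> pos X"
  unfolding P_apply by (intro partial_below \<sigma>_S \<sigma>_pos pos_in_carr)

lemma P_positive: "positive_map K X X (P n)"
proof (induction n)
  case (Suc n)
  then show ?case by (simp only: sum.atMost_Suc positive_map_add E_positive)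
qed (simp add: E_positive)

lemma P_on_S: "y \<in> S \<Longrightarrow> P n y = (\<Sum>i<Suc n. coord i y *\<^sub>C x i)"
  unfolding P_apply by (simp only: \<sigma>_fix)

lemma P_tends: 
  assumes y: "y \<in> S" shows "(\<lambda>n. nrm X (y - P n y)) \<longlonglongrightarrow> 0"
proof -
  have "(\<lambda>n. nrm X (y - (\<Sum>i<n. coord i y *\<^sub>C x i))) \<longlonglongrightarrow> 0"
    using coord_tends[OF y] by (simp only: tends_in_def)
  from LIMSEQ_Suc[OF this] show ?thesis by (simp only: P_on_S[OF y])
qed

lemma coord_P: 
  assumes "i \<le> n" and y: "y \<in> S" 
  shows "coord i (y - P n y) = 0"
proof -
  have "coord i (P n y) = coord i y"
    unfolding P_on_S[OF y] using assms(1) by (subst coord_partial) (auto intro: coord_K)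
  then show ?thesis using coord_diff[OF y P_S, of i n] by (simp del: sum.atMost_Suc)
qed

text \<open>The factors \<open>1 - s i\<close> and \<open>1 + s i\<close> are 0 or 2, so a sign
  matrix lies between \<open>- P n\<close> and \<open>P n\<close>, and
  \<open>P n \<le> \<sigma>\<close> on the cone.\<close>

lemma sign_dominated:
  assumes s: "\<And>i. s i = 1 \<or> s i = -1"
  shows "linear_map K X X (\<Sum>i\<le>n. s i *\<^sub>C E i i)" 
    "v \<in> pos X \<Longrightarrow> \<sigma> v - (\<Sum>i\<le>n. s i *\<^sub>C E i i) v \<in> pos X"
    "v \<in> pos X \<Longrightarrow> \<sigma> v + (\<Sum>i\<le>n. s i *\<^sub>C E i i) v \<in> pos X"
proof -
  have sK: "s i \<in> K" for i using s[of i] by auto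
  show "linear_map K X X (\<Sum>i\<le>n. s i *\<^sub>C E i i)"
    using sK by (intro linear_map_sum linear_map_scale carr_sub positive_mapD(1) E_positive)
  assume v: "v \<in> pos X"
  have \<sigma>v: "\<sigma> v \<in> pos X" "\<sigma> v \<in> S" using \<sigma>_pos[OF v] \<sigma>_S[OF pos_in_carr[OF v]] by auto
  let ?t = "\<Sum>i\<le>n. s i *\<^sub>C E i i"
  have dbl: "c *\<^sub>C E i i v \<in> pos X" if "c = 0 \<or> c = 2" for c i
    using that coord_pos[OF \<sigma>v, of i i] pos_scale[of 2 "E i i v"] by (auto simp: E_apply simp del: cv.scale_scale)
  have "P n v - ?t v = (\<Sum>i\<le>n. (1 - s i) *\<^sub>C E i i v)"
    by (simp add: sum_fun_apply cv.scale_left_diff_distrib sum_subtractf)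
  moreover have "\<dots> \<in> pos X" by (intro pos_sum dbl) (use s in force)
  ultimately have "P n v - ?t v \<in> pos X" by (simp only:)
  from pos_add[OF P_below[OF v, of n] this] show "\<sigma> v - ?t v \<in> pos X" by simp
  have "P n v + ?t v = (\<Sum>i\<le>n. (1 + s i) *\<^sub>C E i i v)"
    by (simp add: sum_fun_apply cv.scale_left_distrib sum.distrib)
  moreover have "\<dots> \<in> pos X" by (intro pos_sum dbl) (use s in force)
  ultimately have "P n v + ?t v \<in> pos X" by (simp only:)
  from pos_add[OF P_below[OF v, of n] this] show "\<sigma> v + ?t v \<in> pos X" by (simp add: add.assoc[symmetric])
qed

text \<open>Domination by \<open>\<sigma>\<close> makes the bound independent of \<open>n\<close>
  and of the basis. This is the source of the constant \<open>c0\<close> of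
  \<open>matrix_module\<close>.\<close>

lemma sign_bound:
  assumes b: "0 \<le> b" "\<And>v. v \<in> pos X \<Longrightarrow> nrm X (\<sigma> v) \<le> b * nrm X v" and s: "\<And>i. s i = 1 \<or> s i = -1"
  shows "\<bar>\<nu> (\<Sum>i\<le>n. s i *\<^sub>C E i i)\<bar> \<le> 4 * b"
  using regular_norm_le[OF positive_mapD(1)[OF \<sigma>] sign_dominated[OF s] b]
    regular_norm_nonneg[OF \<sigma> sign_dominated[OF s]] by simp

lemma positive_regular_norm_le:
  assumes "positive_map K X X T" "0 \<le> b" "\<And>v. v \<in> pos X \<Longrightarrow> nrm X (T v) \<le> b * nrm X v"
  shows "\<nu> T \<le> 4 * b"
  using assms by (intro regular_norm_le[of T T b]) (auto simp: positive_mapD intro!: pos_add)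

lemma \<nu>_nonneg:
  assumes T: "positive_map K X X T" shows "0 \<le> \<nu> T"
proof -
  have "0 < nrm X (x 0)" using coord_bound_pos(2)[OF S_0 pos_0] .
  moreover have "0 \<le> \<nu> T * nrm X (x 0)"
    using regular_norm_bound[OF T x_carr, of 0] nrm_nonneg[OF positive_mapD(3)[OF T x_carr]] by (rule order_trans[rotated])
  ultimately show ?thesis by (simp add: zero_le_mult_iff)
qed

lemma positive_map_diff:
  assumes f: "positive_map K X X f" and g: "positive_map K X X g" and pos: "\<And>v. v \<in> pos X \<Longrightarrow> f v - g v \<in> pos X"
  shows "positive_map K X X (f - g)"
proof -
  have "linear_map K X X (f + (-1) *\<^sub>C g)"
    by (intro linear_map_add linear_map_scale carr_sub positive_mapD(1) f g K_neg1)
  then have "linear_map K X X (f - g)" by simp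
  then show ?thesis using pos by (auto simp: positive_map_def)
qed

text \<open>The coordinate \<open>i\<close> is read off from \<open>E i i\<close>, and positive
  operators are bounded.\<close>

lemma coord_bounded: "\<exists>b\<ge>0. \<forall>y\<in>S. cmod (coord i y) \<le> b * nrm X y"
proof -
  have nx: "0 < nrm X (x i)" using coord_bound_pos(2)[OF S_0 pos_0] .
  have bm: "bounded_map K X X (E i i)" by (rule positive_bounded[OF lattice E_positive])
  let ?b = "op_norm X X (E i i)"
  have b: "0 \<le> ?b" "\<And>v. v \<in> carr X \<Longrightarrow> nrm X (E i i v) \<le> ?b * nrm X v"
    using bm nrm_nonneg by (auto simp: bounded_map_def intro!: op_norm_bound op_norm_nonneg)
  have "cmod (coord i y) \<le> ?b / nrm X (x i) * nrm X y" if y: "y \<in> S" for y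
  proof -
    have "cmod (coord i y) * nrm X (x i) \<le> ?b * nrm X y"
      using b(2)[OF S_carr[OF y]] nrm_scale[OF coord_K x_carr] by (simp add: E_apply \<sigma>_fix[OF y])
    then show ?thesis using nx by (simp add: field_simps)
  qed
  moreover have "0 \<le> ?b / nrm X (x i)" using b nx by simp
  ultimately show ?thesis by blast
qed

context
  fixes U assumes U: "positive_map K X X U" and \<sigma>U: "\<sigma> \<circ> U = U" and U\<sigma>: "U \<circ> \<sigma> = U"
begin

lemma U_S: "v \<in> carr X \<Longrightarrow> U v \<in> S"
  using \<sigma>U positive_mapD(3)[OF U] by (metis comp_apply imageI)

lemma U_\<sigma>: "U (\<sigma> v) = U v"
  using U\<sigma> by (metis comp_apply)

lemma U_bound: "v \<in> carr X \<Longrightarrow> nrm X (U v) \<le> op_norm X X U * nrm X v" and U_norm_nonneg: "0 \<le> op_norm X X U"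
  using positive_bounded[OF lattice U] nrm_nonneg op_norm_bound[of X X U v] op_norm_nonneg[of X X U]
  by (auto simp: bounded_map_def)

lemma \<nu>_U: "\<nu> U \<le> 4 * op_norm X X U"
  by (rule positive_regular_norm_le[OF U U_norm_nonneg]) (rule U_bound[OF pos_in_carr])

lemma U_diff: "v \<in> carr X \<Longrightarrow> v' \<in> carr X \<Longrightarrow> U (v - v') = U v - U v'"
  by (rule linear_over_diff[OF carr_sub positive_mapD(2)[OF U] K_neg1])

lemma U_residual: "v \<in> pos X \<Longrightarrow> U v - U (P n v) \<in> pos X"
  using positive_mapD(4)[OF U P_below, of v n] U_diff[of "\<sigma> v" "P n v"] U_\<sigma>[of v] \<sigma>_S[of v] S_carr P_S pos_in_carr
  by simp

lemma compress_positive: "positive_map K X X (P n \<circ> U \<circ> P m)"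
  by (intro positive_map_comp[OF P_positive] positive_map_comp[OF U P_positive, simplified comp_assoc] positive_map_comp U P_positive)

text \<open>On the cone \<open>0 \<le> P n \<circ> U \<circ> P m \<le> U\<close>: first
  \<open>P m\<close> is removed by monotonicity of \<open>U\<close>, then \<open>P n\<close> by
  positivity of the residual.\<close>

lemma \<nu>_compress: "\<nu> (P n \<circ> U \<circ> P m) \<le> 4 * op_norm X X U"
proof (rule positive_regular_norm_le[OF compress_positive U_norm_nonneg])
  fix v assume v: "v \<in> pos X"
  let ?w = "U (P m v)"
  have Pv: "P m v \<in> pos X" by (rule positive_mapD(4)[OF P_positive v])
  have w: "?w \<in> pos X" by (rule positive_mapD(4)[OF U Pv])
  have "\<sigma> ?w = ?w" by (rule \<sigma>_fix[OF U_S[OF pos_in_carr[OF Pv]]])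
  then have "?w - P n ?w \<in> pos X" using P_below[OF w, of n] by simp
  then have "U v - P n ?w \<in> pos X" using pos_trans U_residual[OF v] by blast
  then have "nrm X (P n ?w) \<le> nrm X (U v)" by (intro nrm_mono positive_mapD(4)[OF P_positive w])
  also have "\<dots> \<le> op_norm X X U * nrm X v" by (rule U_bound[OF pos_in_carr[OF v]])
  finally show "nrm X ((P n \<circ> U \<circ> P m) v) \<le> op_norm X X U * nrm X v" by simp
qed

lemma compress_E: "P n \<circ> U \<circ> P m = (\<Sum>i\<le>n. \<Sum>j\<le>m. of_real (Re (coord i (U (x j)))) *\<^sub>C E i j)"
proof (rule ext)
  fix v
  have "U (P m v) = (\<Sum>j\<le>m. coord j (\<sigma> v) *\<^sub>C U (x j))"
    unfolding P_apply lessThan_Suc_atMost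
    using coord_K x_carr by (intro linear_over_sum[OF carr_sub positive_mapD(2)[OF U]]) auto
  moreover have "U (x j) \<in> S" "U (x j) \<in> pos X" for j using U_S[OF x_carr] positive_mapD(4)[OF U x_pos] by auto
  ultimately have "coord i (\<sigma> (U (P m v))) = (\<Sum>j\<le>m. coord j (\<sigma> v) * of_real (Re (coord i (U (x j)))))" for i
    using coord_K by (subst \<sigma>_fix) (auto intro!: S_sum S_scale simp: coord_sum coord_of_real[symmetric])
  then have "P n (U (P m v)) = (\<Sum>i\<le>n. (\<Sum>j\<le>m. coord j (\<sigma> v) * of_real (Re (coord i (U (x j))))) *\<^sub>C x i)"
    unfolding P_apply[of n] lessThan_Suc_atMost by simp
  then show "(P n \<circ> U \<circ> P m) v = (\<Sum>i\<le>n. \<Sum>j\<le>m. of_real (Re (coord i (U (x j)))) *\<^sub>C E i j) v"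
    by (simp add: sum_fun_apply E_apply cv.scale_sum_left mult.commute)
qed

text \<open>The difference has rank one, with the fixed functional
  \<open>coord j \<circ> \<sigma>\<close> and the vector \<open>U (x j) - P n (U (x j))\<close>,
  which tends to 0 in norm.\<close>

lemma right_approx: "(\<lambda>n. \<nu> ((U \<circ> E j j) - (P n \<circ> U \<circ> E j j))) \<longlonglongrightarrow> 0"
proof -
  let ?y = "U (x j)"
  have yS: "?y \<in> S" and yp: "?y \<in> pos X" using U_S[OF x_carr] positive_mapD(4)[OF U x_pos] by auto
  obtain b where b: "0 \<le> b" "\<And>v. v \<in> pos X \<Longrightarrow> nrm X (E j j v) \<le> b * nrm X v"
    using positive_bounded_pos[OF lattice E_positive] by blast
  have nx: "0 < nrm X (x j)" using coord_bound_pos(2)[OF S_0 pos_0] .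
  have eq: "(U \<circ> E j j) - (P n \<circ> U \<circ> E j j) = (\<lambda>v. coord j (\<sigma> v) *\<^sub>C (?y - P n ?y))" for n
  proof (rule ext)
    fix v
    have "U (coord j (\<sigma> v) *\<^sub>C x j) = coord j (\<sigma> v) *\<^sub>C ?y"
      using positive_mapD(2)[OF U] coord_K x_carr by (simp add: linear_over_def)
    moreover have "P n (coord j (\<sigma> v) *\<^sub>C ?y) = coord j (\<sigma> v) *\<^sub>C P n ?y"
      using positive_mapD(2)[OF P_positive] coord_K S_carr[OF yS] unfolding linear_over_def by blast
    ultimately show "((U \<circ> E j j) - (P n \<circ> U \<circ> E j j)) v = coord j (\<sigma> v) *\<^sub>C (?y - P n ?y)"
      by (simp add: E_apply cv.scale_right_diff_distrib del: sum.atMost_Suc)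
  qed
  have res: "?y - P n ?y \<in> pos X" for n using P_below[OF yp, of n] \<sigma>_fix[OF yS] by simp
  have "\<nu> ((U \<circ> E j j) - (P n \<circ> U \<circ> E j j)) \<le> 4 * (b / nrm X (x j) * nrm X (?y - P n ?y))" for n
    unfolding eq
  proof (rule positive_regular_norm_le[OF rank_one_positive(1)[OF res]])
    show "0 \<le> b / nrm X (x j) * nrm X (?y - P n ?y)" using b nx nrm_nonneg[OF pos_in_carr[OF res]] by simp
    fix v assume v: "v \<in> pos X"
    have "cmod (coord j (\<sigma> v)) * nrm X (x j) \<le> b * nrm X v"
      using b(2)[OF v] nrm_scale[OF coord_K x_carr] by (simp add: E_apply)
    then have "cmod (coord j (\<sigma> v)) \<le> b / nrm X (x j) * nrm X v" using nx by (simp add: field_simps)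
    then have "cmod (coord j (\<sigma> v)) * nrm X (?y - P n ?y) \<le> b / nrm X (x j) * nrm X v * nrm X (?y - P n ?y)"
      by (rule mult_right_mono[OF _ nrm_nonneg[OF pos_in_carr[OF res]]])
    then show "nrm X (coord j (\<sigma> v) *\<^sub>C (?y - P n ?y)) \<le> b / nrm X (x j) * nrm X (?y - P n ?y) * nrm X v"
      unfolding nrm_scale[OF coord_K pos_in_carr[OF res]] by (simp only: mult.assoc mult.commute[of "nrm X v"])
  qed
  moreover have "(\<lambda>n. 4 * (b / nrm X (x j) * nrm X (?y - P n ?y))) \<longlonglongrightarrow> 4 * (b / nrm X (x j) * 0)"
    by (intro tendsto_mult_left P_tends yS)
  then have "(\<lambda>n. 4 * (b / nrm X (x j) * nrm X (?y - P n ?y))) \<longlonglongrightarrow> 0" by (simp only: mult_zero_right)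
  moreover have "0 \<le> \<nu> ((U \<circ> E j j) - (P n \<circ> U \<circ> E j j))" for n
    unfolding eq by (rule \<nu>_nonneg[OF rank_one_positive(1)[OF res]])
  ultimately show ?thesis by (rule_tac LIMSEQ_squeeze0)
qed

text \<open>The difference sends \<open>v\<close> to \<open>f r\<close> times \<open>x i\<close>,
  where \<open>f = coord i \<circ> U\<close> on the range and \<open>r = \<sigma> v - P m v\<close>.
  A shrinking basis lets \<open>f\<close> be approximated in the dual norm by a combination
  \<open>g\<close> of finitely many coordinates, and \<open>g\<close> vanishes on \<open>r\<close>
  once \<open>m\<close> exceeds all of them.\<close>

lemma left_approx: 
  assumes shr: "shrinking K Y x"
  shows "(\<lambda>m. \<nu> ((E i i \<circ> U) - (E i i \<circ> U \<circ> P m))) \<longlonglongrightarrow> 0"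
proof -
  let ?T = "\<lambda>m. (E i i \<circ> U) - (E i i \<circ> U \<circ> P m)"
  define f where "f y = (if y \<in> S then coord i (U y) else 0)" for y
  obtain bi where bi: "0 \<le> bi" "\<And>y. y \<in> S \<Longrightarrow> cmod (coord i y) \<le> bi * nrm X y" using coord_bounded by blast
  have fb: "cmod (f y) \<le> bi * op_norm X X U * nrm X y" if "y \<in> S" for y
  proof -
    have "cmod (f y) \<le> bi * nrm X (U y)" using bi(2)[OF U_S[OF S_carr[OF that]]] that by (simp add: f_def)
    also have "\<dots> \<le> bi * (op_norm X X U * nrm X y)" using U_bound[OF S_carr[OF that]] bi(1) by (rule mult_left_mono)
    finally show ?thesis by simp
  qed
  have "linear_over K S f"
    unfolding linear_over_def f_def using positive_mapD(2)[OF U] unfolding linear_over_def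
    by (simp add: S_add S_scale S_carr coord_add[OF U_S U_S] coord_scale[OF U_S] del: image_iff)
  then have "f \<in> carr (dual K Y)"
    using fb coord_K K_0 unfolding dual_def bounded_map_def linear_map_def supported_def scalar_space_def
    by (auto simp: f_def)
  then have fcl: "f \<in> nclosure (dual K Y) (kspan K (range (biorth K Y x)))"
    using shr unfolding shrinking_def by blast
  obtain bs where bs: "0 \<le> bs" "\<And>v. v \<in> pos X \<Longrightarrow> nrm X (\<sigma> v) \<le> bs * nrm X v"
    using positive_bounded_pos[OF lattice \<sigma>] by blast
  have Tpos: "positive_map K X X (?T m)" for m
  proof (rule positive_map_diff)
    show "positive_map K X X (E i i \<circ> U)" by (intro positive_map_comp[OF U E_positive])
    show "positive_map K X X (E i i \<circ> U \<circ> P m)" 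
      by (rule positive_map_comp[OF P_positive positive_map_comp[OF U E_positive]])
    fix v assume v: "v \<in> pos X"
    have c: "U v \<in> carr X" "U (P m v) \<in> carr X"
      using positive_mapD(3)[OF U] pos_in_carr[OF v] S_carr[OF P_S] by blast+
    have "E i i (U v - U (P m v)) \<in> pos X"
      by (rule positive_mapD(4)[OF E_positive U_residual[OF v]])
    then show "(E i i \<circ> U) v - (E i i \<circ> U \<circ> P m) v \<in> pos X"
      using linear_over_diff[OF carr_sub positive_mapD(2)[OF E_positive] K_neg1 c] by simp
  qed
  have nx: "0 < nrm X (x i)" using coord_bound_pos(2)[OF S_0 pos_0] .
  have step: "\<exists>m0. \<forall>m\<ge>m0. \<nu> (?T m) \<le> 4 * (\<epsilon> * bs * nrm X (x i))" if "0 < \<epsilon>" for \<epsilon>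
  proof -
    obtain g where g: "g \<in> kspan K (range (biorth K Y x))" "nrm (dual K Y) (f - g) < \<epsilon>"
      using fcl \<open>0 < \<epsilon>\<close> unfolding nclosure_def by blast
    obtain F c where F: "finite F" "F \<subseteq> range (biorth K Y x)" "g = (\<Sum>b\<in>F. c b *\<^sub>C b)" "range c \<subseteq> K"
      using g(1) unfolding kspan_def by blast
    obtain J where J: "finite J" "F = biorth K Y x ` J" using finite_subset_image[OF F(1,2)] by blast
    have g_apply: "g y = (\<Sum>b\<in>F. c b * b y)" for y by (simp add: F(3) sum_fun_apply)
    have "\<exists>B. \<forall>y\<in>S. cmod (b y) \<le> B * nrm X y" if "b \<in> F" for b
      using that J coord_bounded by blast
    then obtain B where B: "\<And>b y. b \<in> F \<Longrightarrow> y \<in> S \<Longrightarrow> cmod (b y) \<le> B b * nrm X y" by metis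
    have gb: "cmod (g y) \<le> (\<Sum>b\<in>F. cmod (c b) * B b) * nrm X y" if "y \<in> S" for y
    proof -
      have "cmod (g y) \<le> (\<Sum>b\<in>F. cmod (c b) * cmod (b y))"
        unfolding g_apply using norm_sum[of "\<lambda>b. c b * b y" F] by (simp add: norm_mult)
      also have "\<dots> \<le> (\<Sum>b\<in>F. cmod (c b) * (B b * nrm X y))"
        using B that by (intro sum_mono mult_left_mono) auto
      finally show ?thesis by (simp add: sum_distrib_right mult.assoc)
    qed
    have fg: "cmod (f y - g y) \<le> \<epsilon> * nrm X y" if y: "y \<in> S" for y
    proof -
      have "\<exists>r. \<forall>y\<in>carr Y. nrm (scalar_space K) ((f - g) y) \<le> r * nrm Y y"
      proof (intro exI ballI)
        fix y assume "y \<in> carr Y"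
        then show "nrm (scalar_space K) ((f - g) y) \<le> (bi * op_norm X X U + (\<Sum>b\<in>F. cmod (c b) * B b)) * nrm Y y"
          using norm_triangle_ineq4[of "f y" "g y"] fb[of y] gb[of y] by (simp add: scalar_space_def distrib_right)
      qed
      then have "nrm (scalar_space K) ((f - g) y) \<le> op_norm Y (scalar_space K) (f - g) * nrm Y y"
        by (rule op_norm_bound) (use y nrm_nonneg S_carr in auto)
      also have "\<dots> \<le> \<epsilon> * nrm X y"
        using g(2) nrm_nonneg[OF S_carr[OF y]] unfolding Y_simps by (intro mult_right_mono) (auto simp: dual_def)
      finally show ?thesis by (simp add: scalar_space_def)
    qed
    obtain m0 where m0: "\<And>j. j \<in> J \<Longrightarrow> j \<le> m0" using J(1) by (meson finite_nat_set_iff_bounded_le)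
    have "\<nu> (?T m) \<le> 4 * (\<epsilon> * bs * nrm X (x i))" if m: "m0 \<le> m" for m
    proof (rule positive_regular_norm_le[OF Tpos])
      show "0 \<le> \<epsilon> * bs * nrm X (x i)" using \<open>0 < \<epsilon>\<close> bs nx by simp
      fix v assume v: "v \<in> pos X"
      have \<sigma>v: "\<sigma> v \<in> S" "\<sigma> v \<in> pos X" using \<sigma>_S[OF pos_in_carr[OF v]] \<sigma>_pos[OF v] by auto
      have Pv: "P m (\<sigma> v) = P m v" unfolding P_apply using \<sigma>_fix[OF \<sigma>v(1)] by simp
      define r where "r = \<sigma> v - P m v"
      have r: "r \<in> S" "r \<in> pos X" unfolding r_def using S_diff[OF \<sigma>v(1) P_S] P_below[OF v] by auto
      have "g r = 0"
        unfolding g_apply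
      proof (intro sum.neutral ballI)
        fix b assume "b \<in> F"
        then obtain j where j: "j \<in> J" "b = coord j" using J by blast
        have "coord j (\<sigma> v - P m (\<sigma> v)) = 0" using m0[OF j(1)] m by (intro coord_P \<sigma>v) simp
        then show "c b * b r = 0" by (simp add: j(2) r_def Pv)
      qed
      then have 1: "cmod (f r) \<le> \<epsilon> * nrm X r" using fg[OF r(1)] by simp
      have "P m v \<in> pos X" by (rule positive_mapD(4)[OF P_positive v])
      then have "nrm X r \<le> nrm X (\<sigma> v)" by (intro nrm_mono r) (simp add: r_def)
      then have 2: "nrm X r \<le> bs * nrm X v" using bs(2)[OF v] by simp
      have c: "U v \<in> S" "U (P m v) \<in> S" using U_S pos_in_carr[OF v] S_carr[OF P_S] by blast+
      have "U r = U v - U (P m v)"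
        unfolding r_def U_diff[OF S_carr[OF \<sigma>v(1)] S_carr[OF P_S]] U_\<sigma> ..
      then have fr: "f r = coord i (U v) - coord i (U (P m v))"
        unfolding f_def if_P[OF r(1)] by (simp only: coord_diff[OF c])
      have "?T m v = f r *\<^sub>C x i"
        unfolding fr minus_apply comp_apply E_apply \<sigma>_fix[OF c(1)] \<sigma>_fix[OF c(2)]
        by (simp only: cv.scale_left_diff_distrib)
      moreover have "nrm X (f r *\<^sub>C x i) = cmod (f r) * nrm X (x i)"
        using coord_K K_0 by (intro nrm_scale x_carr) (simp add: f_def)
      ultimately have "nrm X (?T m v) = cmod (f r) * nrm X (x i)" by simp
      also have "\<dots> \<le> (\<epsilon> * (bs * nrm X v)) * nrm X (x i)"
        using order_trans[OF 1 mult_left_mono[OF 2]] \<open>0 < \<epsilon>\<close> nx by (intro mult_right_mono) auto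
      finally show "nrm X (?T m v) \<le> \<epsilon> * bs * nrm X (x i) * nrm X v" by (simp add: mult.assoc mult.left_commute mult.commute)
    qed
    then show ?thesis by blast
  qed
  show ?thesis
  proof (rule LIMSEQ_I)
    fix e :: real assume e: "0 < e"
    \<comment> \<open>\<open>bs + 1\<close> replaces \<open>bs\<close> in the denominator because
      \<open>bs\<close> may be 0.\<close>
    define \<epsilon> where "\<epsilon> = e / (8 * ((bs + 1) * nrm X (x i)))"
    have \<epsilon>: "0 < \<epsilon>" using e nx bs(1) by (simp add: \<epsilon>_def)
    have "\<epsilon> * bs * nrm X (x i) \<le> \<epsilon> * ((bs + 1) * nrm X (x i))"
      using \<epsilon> nx by (simp add: mult.assoc mult_left_mono)
    also have "\<dots> = e / 8" using nx bs(1) by (simp add: \<epsilon>_def)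
    finally have "4 * (\<epsilon> * bs * nrm X (x i)) < e" using e by simp
    moreover obtain m0 where "\<forall>m\<ge>m0. \<nu> (?T m) \<le> 4 * (\<epsilon> * bs * nrm X (x i))" using step[OF \<epsilon>] by blast
    ultimately have "\<forall>m\<ge>m0. norm (\<nu> (?T m) - 0) < e" using \<nu>_nonneg[OF Tpos] by fastforce
    then show "\<exists>m0. \<forall>m\<ge>m0. norm (\<nu> (?T m) - 0) < e" by blast
  qed
qed

end

text \<open>A nonzero compression \<open>\<sigma> \<circ> a \<circ> \<sigma>\<close> has a positive
  \<open>y\<close> in the range with some coordinate \<open>k\<close> of
  \<open>\<sigma> (a y)\<close> nonzero. Multiplying \<open>a\<close> on the right by the rank one
  operator with functional \<open>coord j \<circ> \<sigma>\<close> and vector \<open>y\<close>, and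
  on the left by \<open>E i k\<close>, gives a nonzero multiple of \<open>E i j\<close>.\<close>

lemma E_in_ideal:
  assumes ideal: "\<And>a t. a \<in> \<A> \<Longrightarrow> t \<in> carr (regular_ops K X) \<Longrightarrow> a \<circ> t \<in> \<A> \<and> t \<circ> a \<in> \<A>"
    and scale: "\<And>a t. a \<in> \<A> \<Longrightarrow> t \<in> K \<Longrightarrow> t *\<^sub>C a \<in> \<A>"
    and a: "a \<in> \<A>" "a \<in> pos (regular_ops K X)" "\<sigma> \<circ> a \<circ> \<sigma> \<noteq> 0"
  shows "E i j \<in> \<A>"
proof -
  have ap: "positive_map K X X a" using a(2) by (simp add: pos_regular_iff)
  have comp: "positive_map K X X (\<sigma> \<circ> a \<circ> \<sigma>)"
    by (intro positive_map_comp[OF \<sigma> positive_map_comp[OF ap \<sigma>]])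
  have "\<exists>v\<in>pos X. (\<sigma> \<circ> a \<circ> \<sigma>) v \<noteq> 0"
  proof (rule ccontr)
    assume "\<not> ?thesis"
    then have 0: "(\<sigma> \<circ> a \<circ> \<sigma>) v = 0" if "v \<in> pos X" for v using that by blast
    have "(\<sigma> \<circ> a \<circ> \<sigma>) v = 0" for v
    proof (cases "v \<in> carr X")
      case True
      obtain p where p: "\<And>k. k < units \<Longrightarrow> p k \<in> pos X" "v = (\<Sum>k<units. cunit k *\<^sub>C p k)"
        using positive_parts[OF riesz_carr True] by (metis IntD1)
      have "(\<sigma> \<circ> a \<circ> \<sigma>) v = (\<Sum>k<units. cunit k *\<^sub>C (\<sigma> \<circ> a \<circ> \<sigma>) (p k))"
        unfolding p(2) using p(1) pos_in_carr by (intro linear_over_sum[OF carr_sub positive_mapD(2)[OF comp]]) auto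
      then show ?thesis using 0[OF p(1)] by simp
    next
      case False
      then show ?thesis using positive_mapD(5)[OF ap] positive_mapD(5)[OF \<sigma>] by (simp add: \<sigma>_out)
    qed
    then show False using a(3) by (simp add: fun_eq_iff)
  qed
  then obtain v where v: "v \<in> pos X" "\<sigma> (a (\<sigma> v)) \<noteq> 0" by auto
  define y where "y = \<sigma> v"
  have y: "y \<in> pos X" "y \<in> carr X" unfolding y_def using \<sigma>_pos[OF v(1)] pos_in_carr by auto
  let ?z = "\<sigma> (a y)"
  have ay: "a y \<in> carr X" by (rule positive_mapD(3)[OF ap y(2)])
  have z: "?z \<in> S" by (rule \<sigma>_S[OF ay])
  have "\<exists>k. coord k ?z \<noteq> 0"
  proof (rule ccontr)
    assume "\<not> ?thesis"
    then have "tends_in X (\<lambda>n. 0) ?z" using coord_tends[OF z] by simp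
    moreover have "tends_in X (\<lambda>n. 0) 0" by (simp add: tends_in_def)
    ultimately have "?z = 0" by (intro tends_in_unique[of "\<lambda>_. 0"]) auto
    then show False using v(2) y_def by simp
  qed
  then obtain k where k: "coord k ?z \<noteq> 0" by blast
  let ?L = "E i k" and ?R = "\<lambda>u. coord j (\<sigma> u) *\<^sub>C y"
  have L: "?L \<in> carr (regular_ops K X)" and R: "?R \<in> carr (regular_ops K X)"
    using E_positive E_supp rank_one_positive[OF y(1)] by (auto intro!: pos_regular simp: pos_regular_iff)
  have LaR: "?L \<circ> a \<circ> ?R \<in> \<A>" using ideal[OF a(1) L] ideal[of "?L \<circ> a" ?R] R by blast
  have "E i j = inverse (coord k ?z) *\<^sub>C (?L \<circ> a \<circ> ?R)"
  proof (rule ext)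
    fix u
    have "a (coord j (\<sigma> u) *\<^sub>C y) = coord j (\<sigma> u) *\<^sub>C a y"
      using positive_mapD(2)[OF ap] coord_K y(2) by (simp add: linear_over_def)
    moreover have "\<sigma> (coord j (\<sigma> u) *\<^sub>C a y) = coord j (\<sigma> u) *\<^sub>C ?z" by (rule \<sigma>_scale[OF coord_K ay])
    ultimately show "E i j u = (inverse (coord k ?z) *\<^sub>C (?L \<circ> a \<circ> ?R)) u"
      using k by (simp add: E_apply coord_scale[OF z coord_K] mult.commute)
  qed
  moreover have "inverse (coord k ?z) \<in> K" using coord_K[of k ?z] scalars by (auto simp: Reals_inverse)
  ultimately show ?thesis using scale[OF LaR] by simp
qed

end


section \<open>Localization\<close>

context blattice
begin

lemma dual_eqI:
  assumes "f \<in> carr (dual K B)" "g \<in> carr (dual K B)" "\<And>z. z \<in> pos B \<Longrightarrow> f z = g z"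
  shows "f = g"
proof (rule ext)
  fix z
  show "f z = g z"
  proof (cases "z \<in> carr B")
    case True
    obtain p where p: "\<And>k. k < units \<Longrightarrow> p k \<in> pos B" "z = (\<Sum>k<units. cunit k *\<^sub>C p k)"
      using positive_parts[OF riesz_carr True] by (metis IntD1)
    then show ?thesis using linear_parts[OF _ assms(1), of p] linear_parts[OF _ assms(2), of p] assms(3) pos_in_carr by simp
  qed (use assms in \<open>simp add: dual_iff\<close>)
qed

end

text \<open>The bounds use the absolute value of the regular norm so that the constants can be made
  nonnegative without knowing the sign of this infimum.\<close>

locale derivation_setting = X: blattice K X + M: blattice K M 
  for K and X :: "'x::complex_vector onspace" and M :: "'m::complex_vector onspace" +
  fixes \<A> :: "('x \<Rightarrow> 'x) set" and lm :: "('x, 'm) left_action" and rm :: "('x, 'm) right_action"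
    and D :: "('x \<Rightarrow> 'x) \<Rightarrow> 'm \<Rightarrow> complex" and C c :: real
  assumes ideal: "closed_riesz_algebra_ideal K X \<A>"
    and module: "banach_lattice_module K (sub (regular_ops K X) \<A>) M lm rm"
    and derivation: "bounded_derivation K (sub (regular_ops K X) \<A>) M lm rm D"
    and C_nonneg: "0 \<le> C" and c_nonneg: "0 \<le> c"
    and module_bound: "a \<in> \<A> \<Longrightarrow> z \<in> carr M \<Longrightarrow> nrm M (lm a z) \<le> C * \<bar>nrm (regular_ops K X) a\<bar> * nrm M z \<and>
         nrm M (rm z a) \<le> C * \<bar>nrm (regular_ops K X) a\<bar> * nrm M z"
    and derivation_bound: "a \<in> \<A> \<Longrightarrow> z \<in> carr M \<Longrightarrow> cmod (D a z) \<le> c * \<bar>nrm (regular_ops K X) a\<bar> * nrm M z"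
begin

abbreviation R :: "('x \<Rightarrow> 'x) onspace" where "R \<equiv> regular_ops K X"

lemma sub_simps [simp]: "carr (sub R \<A>) = \<A>" "nrm (sub R \<A>) = nrm R" "pos (sub R \<A>) = pos R \<inter> \<A>"
  by (simp_all add: sub_def)

lemma riesz_ideal: "riesz_subspace K R \<A>" and ideal_comp: "a \<in> \<A> \<Longrightarrow> t \<in> carr R \<Longrightarrow> a \<circ> t \<in> \<A> \<and> t \<circ> a \<in> \<A>"
  using ideal by (auto simp: closed_riesz_algebra_ideal_def)

lemma \<A>_sub: "ksubspace K \<A>" and \<A>_carr: "a \<in> \<A> \<Longrightarrow> a \<in> carr R"
  using riesz_ideal by (auto simp: riesz_subspace_def)

lemma \<A>_comp: "a \<in> \<A> \<Longrightarrow> b \<in> \<A> \<Longrightarrow> a \<circ> b \<in> \<A>"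
  using ideal_comp \<A>_carr by blast

lemma \<A>_add: "a \<in> \<A> \<Longrightarrow> b \<in> \<A> \<Longrightarrow> a + b \<in> \<A>" and \<A>_scale: "t \<in> K \<Longrightarrow> a \<in> \<A> \<Longrightarrow> t *\<^sub>C a \<in> \<A>" and \<A>_0: "0 \<in> \<A>"
  using \<A>_sub unfolding ksubspace_def by blast+

lemma lm_linear: "a \<in> \<A> \<Longrightarrow> linear_map K M M (lm a)" and rm_linear: "a \<in> \<A> \<Longrightarrow> linear_map K M M (\<lambda>z. rm z a)"
  and lm_linear2: "z \<in> carr M \<Longrightarrow> linear_over K \<A> (\<lambda>a. lm a z)" and rm_linear2: "z \<in> carr M \<Longrightarrow> linear_over K \<A> (rm z)"
  and lm_comp: "a \<in> \<A> \<Longrightarrow> b \<in> \<A> \<Longrightarrow> z \<in> carr M \<Longrightarrow> lm (a \<circ> b) z = lm a (lm b z)"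
  and rm_comp: "a \<in> \<A> \<Longrightarrow> b \<in> \<A> \<Longrightarrow> z \<in> carr M \<Longrightarrow> rm z (a \<circ> b) = rm (rm z a) b"
  and rm_lm: "a \<in> \<A> \<Longrightarrow> b \<in> \<A> \<Longrightarrow> z \<in> carr M \<Longrightarrow> rm (lm a z) b = lm a (rm z b)"
  and lm_pos: "a \<in> pos R \<inter> \<A> \<Longrightarrow> z \<in> pos M \<Longrightarrow> lm a z \<in> pos M"
  and rm_pos: "a \<in> pos R \<inter> \<A> \<Longrightarrow> z \<in> pos M \<Longrightarrow> rm z a \<in> pos M"
  using module unfolding banach_lattice_module_def sub_simps by blast+

lemma lm_carr: "a \<in> \<A> \<Longrightarrow> z \<in> carr M \<Longrightarrow> lm a z \<in> carr M" and rm_carr: "a \<in> \<A> \<Longrightarrow> z \<in> carr M \<Longrightarrow> rm z a \<in> carr M"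
  using lm_linear[of a] rm_linear[of a] by (auto simp: linear_map_def image_subset_iff)

lemma D_dual: "a \<in> \<A> \<Longrightarrow> D a \<in> carr (dual K M)" and D_linear: "linear_over K \<A> D"
  using derivation by (auto simp: bounded_derivation_def bounded_map_def linear_map_def)

lemma D_derivation: "a \<in> \<A> \<Longrightarrow> b \<in> \<A> \<Longrightarrow> z \<in> carr M \<Longrightarrow> D (a \<circ> b) z = D b (rm z a) + D a (lm b z)"
  using derivation by (auto simp: bounded_derivation_def dual_left_def dual_right_def)

lemma pos_dual_rm: 
  assumes a: "a \<in> pos R \<inter> \<A>" and f: "f \<in> pos (dual K M)"
  shows "(\<lambda>z. if z \<in> carr M then f (rm z a) else 0) \<in> pos (dual K M)" (is "?g \<in> _")
    and "(\<lambda>z. if z \<in> carr M then f (lm a z) else 0) \<in> pos (dual K M)" (is "?h \<in> _")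
proof -
  have fd: "f \<in> carr (dual K M)" using f by (simp add: M.pos_dual_iff)
  have aA: "a \<in> \<A>" using a by blast
  let ?b = "nrm (dual K M) f * (C * \<bar>nrm R a\<bar>)"
  have b: "0 \<le> ?b" using M.dual_nrm_nonneg[OF fd] C_nonneg by simp
  have fb: "cmod (f y) \<le> ?b * nrm M z" if "y \<in> carr M" "nrm M y \<le> C * \<bar>nrm R a\<bar> * nrm M z" for y z
  proof -
    have "cmod (f y) \<le> nrm (dual K M) f * nrm M y" by (rule M.dual_nrm_bound[OF fd that(1)])
    also have "\<dots> \<le> nrm (dual K M) f * (C * \<bar>nrm R a\<bar> * nrm M z)" by (rule mult_left_mono[OF that(2) M.dual_nrm_nonneg[OF fd]])
    finally show ?thesis by (simp add: mult.assoc)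
  qed
  have "linear_over K (carr M) (\<lambda>z. rm z a)" "linear_over K (carr M) (lm a)"
    using rm_linear[OF aA] lm_linear[OF aA] by (simp_all add: linear_map_def)
  then have "linear_over K (carr M) ?g" "linear_over K (carr M) ?h"
    using aA by (auto simp: linear_over_def M.carr_add M.carr_scale M.dual_add[OF fd] M.dual_scale[OF fd] rm_carr lm_carr)
  moreover have "\<exists>b\<ge>0. \<forall>z\<in>carr M. cmod (?g z) \<le> b * nrm M z" "\<exists>b\<ge>0. \<forall>z\<in>carr M. cmod (?h z) \<le> b * nrm M z"
    using b fb rm_carr[OF aA] lm_carr[OF aA] module_bound[OF aA] by (auto intro!: exI[of _ ?b])
  ultimately have "?g \<in> carr (dual K M)" "?h \<in> carr (dual K M)"
    using aA by (auto simp: M.dual_iff rm_carr lm_carr M.dual_K[OF fd])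
  then show "?g \<in> pos (dual K M)" "?h \<in> pos (dual K M)"
    using f rm_pos[OF a] lm_pos[OF a] M.pos_in_carr by (auto simp: M.pos_dual_iff)
qed

sublocale R: complexified_space K R
  by (rule X.complexified_regular)

text \<open>The regular operators need not be a lattice; the moduli used here exist because the
  ideal is a Riesz subspace.\<close>

lemma ideal_parts:
  assumes "a \<in> \<A>"
  shows "\<exists>p. (\<forall>k<X.units. p k \<in> pos R \<inter> \<A>) \<and> a = (\<Sum>k<X.units. X.cunit k *\<^sub>C p k)"
proof -
  obtain u v where uv: "u \<in> real_part R" "v \<in> imag_part K R" "a = u + \<i> *\<^sub>C v"
    using R.decomp[OF \<A>_carr[OF assms]] by blast
  show ?thesis
    using R.riesz_decomposition[OF riesz_ideal assms uv(3,1,2)] by metis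
qed

text \<open>Here \<open>b\<close> bounds the projection. It enters as \<open>c0 = 4 * b\<close>
  through the sign matrices, and as \<open>4 * (b * b)\<close> through \<open>N\<close>, which is 4
  times the operator norm of \<open>\<sigma> \<circ> a \<circ> \<sigma>\<close>.\<close>

definition kappa :: "real \<Rightarrow> real" where
  "kappa b = decomposition_const C c (4 * b) * (4 * (b * b))"

end

section \<open>The local algebra of one projection\<close>

locale local_setting = derivation_setting +
  fixes \<sigma> :: "'a \<Rightarrow> 'a" and x :: "nat \<Rightarrow> 'a" and bs :: real
  assumes atomic: "atomic_projection K X \<sigma> x"
    and shrinking: "shrinking K (range_lattice X \<sigma>) x"
    and bs: "0 \<le> bs" "\<And>v. v \<in> carr X \<Longrightarrow> nrm X (\<sigma> v) \<le> bs * nrm X v"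
    and square: "{s \<circ> t | s t. s \<in> local_ideal K X \<A> \<sigma> \<and> t \<in> local_ideal K X \<A> \<sigma>} = local_ideal K X \<A> \<sigma>"
    and order_continuous: "\<And>a f. a \<in> local_ideal K X \<A> \<sigma> \<inter> pos (regular_ops K (range_lattice X \<sigma>)) \<Longrightarrow> f \<in> pos (dual K M) \<Longrightarrow>
              is_sup_in (dual K M)
                (range (\<lambda>n. local_dual_left M rm \<sigma> (natural_proj K (range_lattice X \<sigma>) x n)
                  (local_dual_left M rm \<sigma> a f)))
                (local_dual_left M rm \<sigma> a f) \<and>
              is_sup_in (dual K M)
                (range (\<lambda>n. local_dual_right M lm \<sigma> (local_dual_right M lm \<sigma> f a)
                  (natural_proj K (range_lattice X \<sigma>) x n)))
                (local_dual_right M lm \<sigma> f a)"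
begin

sublocale atomic_projection K X \<sigma> x
  by (rule atomic)

text \<open>The local ideal realized inside \<open>\<A>\<close>: an operator \<open>s\<close> on the
  range corresponds to \<open>s \<circ> \<sigma>\<close>, and \<open>restr\<close> is the inverse.
  Thus the given actions and \<open>D\<close> apply without change.\<close>

definition A :: "('a \<Rightarrow> 'a) set" where "A = {U \<in> \<A>. \<sigma> \<circ> U = U \<and> U \<circ> \<sigma> = U}"

definition Ap :: "('a \<Rightarrow> 'a) set" where "Ap = A \<inter> pos R"

lemma ApD: 
  assumes "U \<in> Ap"
  shows "U \<in> \<A>" "U \<in> pos R" "U \<in> pos R \<inter> \<A>" "positive_map K X X U" "supported X U" "\<sigma> \<circ> U = U" "U \<circ> \<sigma> = U"
  using assms by (auto simp: Ap_def A_def X.pos_regular_iff)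

lemma A_\<A>: "U \<in> A \<Longrightarrow> U \<in> \<A>"
  by (simp add: A_def)

definition restr :: "('a \<Rightarrow> 'a) \<Rightarrow> 'a \<Rightarrow> 'a" where
  "restr U y = (if y \<in> S then U y else 0)"

lemma restr_comp: 
  assumes "U \<in> \<A>" "U \<circ> \<sigma> = U"
  shows "restr U \<circ> \<sigma> = U"
proof (rule ext)
  fix v
  have "\<sigma> v \<in> S"
    using \<sigma>_S \<sigma>_out S_0 by (cases "v \<in> carr X") auto
  then show "(restr U \<circ> \<sigma>) v = U v" using fun_cong[OF assms(2), of v] by (simp add: restr_def)
qed

lemma compress_Ap:
  assumes a: "a \<in> pos R \<inter> \<A>"
  shows "\<sigma> \<circ> a \<circ> \<sigma> \<in> Ap"
proof -
  have \<sigma>R: "\<sigma> \<in> carr R" "\<sigma> \<in> pos R" using \<sigma> \<sigma>_supp X.pos_regular by (auto simp: X.pos_regular_iff)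
  have "\<sigma> \<circ> a \<circ> \<sigma> \<in> \<A>" using ideal_comp[OF _ \<sigma>R(1)] a by blast
  moreover have "\<sigma> \<circ> (\<sigma> \<circ> a \<circ> \<sigma>) = \<sigma> \<circ> a \<circ> \<sigma>" "\<sigma> \<circ> a \<circ> \<sigma> \<circ> \<sigma> = \<sigma> \<circ> a \<circ> \<sigma>"
    using \<sigma>_idem by (simp_all add: comp_assoc) (simp_all flip: comp_assoc)
  moreover have ap: "positive_map K X X a" using a by (simp add: X.pos_regular_iff)
  then have "positive_map K X X (\<sigma> \<circ> a \<circ> \<sigma>)" by (intro positive_map_comp[OF \<sigma> positive_map_comp[OF ap \<sigma>]])
  moreover have "supported X (\<sigma> \<circ> a \<circ> \<sigma>)" 
    using X.positive_mapD(5)[OF ap] X.positive_mapD(5)[OF \<sigma>] by (intro supported_comp[OF \<sigma>_supp]) simp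
  ultimately show ?thesis by (simp add: Ap_def A_def X.pos_regular_iff)
qed

lemma A_sub: "ksubspace K A"
  unfolding ksubspace_def
proof (intro conjI ballI)
  show "0 \<in> A" using \<A>_0 X.positive_mapD(5)[OF \<sigma>] by (auto simp: A_def fun_eq_iff)
next
  have carr: "U v \<in> carr X" if "U \<in> A" for U v
  proof -
    have "U \<circ> \<sigma> = U" using that by (simp add: A_def)
    moreover have "\<sigma> \<circ> U = U" using that by (simp add: A_def)
    moreover have "U (\<sigma> v) \<in> carr X \<or> \<sigma> (U v) = 0" using \<sigma>_out[of "U v"] by (metis comp_apply calculation(1))
    ultimately show ?thesis using X.carr_0 by (metis comp_apply)
  qed
  fix U V assume UV: "U \<in> A" "V \<in> A"
  have "\<sigma> (U v + V v) = U v + V v" for v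
    using \<sigma>_add[OF carr[OF UV(1)] carr[OF UV(2)]] UV by (simp add: A_def fun_eq_iff)
  then show "U + V \<in> A" using UV \<A>_add by (auto simp: A_def fun_eq_iff)
  fix t U assume tU: "t \<in> K" "U \<in> A"
  have "\<sigma> (t *\<^sub>C U v) = t *\<^sub>C U v" for v
    using \<sigma>_scale[OF tU(1) carr[OF tU(2)]] tU by (simp add: A_def fun_eq_iff)
  then show "t *\<^sub>C U \<in> A" using tU \<A>_scale by (auto simp: A_def fun_eq_iff)
qed

text \<open>The parts found in \<open>\<A>\<close> need not live on the range, but compressing them
  by \<open>\<sigma>\<close> leaves \<open>U\<close> unchanged.\<close>

lemma A_parts:
  assumes U: "U \<in> A"
  shows "\<exists>p. (\<forall>k<X.units. p k \<in> Ap) \<and> U = (\<Sum>k<X.units. X.cunit k *\<^sub>C p k)"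
proof -
  obtain p where p: "\<And>k. k < X.units \<Longrightarrow> p k \<in> pos R \<inter> \<A>" "U = (\<Sum>k<X.units. X.cunit k *\<^sub>C p k)"
    using ideal_parts[OF A_\<A>[OF U]] by blast
  have "U = \<sigma> \<circ> U \<circ> \<sigma>" using U by (simp add: A_def)
  also have "\<dots> = (\<Sum>k<X.units. X.cunit k *\<^sub>C (\<sigma> \<circ> p k \<circ> \<sigma>))"
  proof (rule ext)
    fix v
    have "\<sigma> v \<in> carr X" by (cases "v \<in> carr X") (auto simp: \<sigma>_out intro: S_carr)
    then have "p k (\<sigma> v) \<in> carr X" if "k < X.units" for k
      using p(1)[OF that] X.positive_mapD(3)[of "p k"] by (simp add: X.pos_regular_iff)
    then have "\<sigma> (\<Sum>k<X.units. X.cunit k *\<^sub>C p k (\<sigma> v)) = (\<Sum>k<X.units. X.cunit k *\<^sub>C \<sigma> (p k (\<sigma> v)))"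
      by (intro linear_over_sum[OF X.carr_sub \<sigma>_linear]) auto
    then show "(\<sigma> \<circ> U \<circ> \<sigma>) v = (\<Sum>k<X.units. X.cunit k *\<^sub>C (\<sigma> \<circ> p k \<circ> \<sigma>)) v"
      by (simp add: p(2) sum_fun_apply)
  qed
  finally have "U = (\<Sum>k<X.units. X.cunit k *\<^sub>C (\<sigma> \<circ> p k \<circ> \<sigma>))" .
  moreover have "\<forall>k<X.units. \<sigma> \<circ> p k \<circ> \<sigma> \<in> Ap" using compress_Ap[OF p(1)] by blast
  ultimately show ?thesis by (intro exI[of _ "\<lambda>k. \<sigma> \<circ> p k \<circ> \<sigma>"] conjI)
qed

lemma restr_positive:
  assumes U: "U \<in> Ap"
  shows "positive_map K Y Y (restr U)" "supported Y (restr U)"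
proof -
  have US: "U y \<in> S" if "y \<in> carr X" for y by (rule U_S[OF ApD(4,6,7)[OF U] that])
  show "positive_map K Y Y (restr U)"
    using X.positive_mapD(2,4)[OF ApD(4)[OF U]] US S_carr S_add S_scale
    by (auto simp: positive_map_def linear_map_def linear_over_def restr_def)
  show "supported Y (restr U)" by (simp add: supported_def restr_def)
qed

lemma restr_local:
  assumes U: "U \<in> A"
  shows "restr U \<in> local_ideal K X \<A> \<sigma>"
proof -
  obtain p where p: "\<And>k. k < X.units \<Longrightarrow> p k \<in> Ap" "U = (\<Sum>k<X.units. X.cunit k *\<^sub>C p k)"
    using A_parts[OF U] by blast
  have "regular_map K Y Y (restr U)"
    unfolding regular_map_def
    by (rule exI[of _ X.units], rule exI[of _ X.cunit], rule exI[of _ "\<lambda>k. restr (p k)"])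
      (use p restr_positive(1) in \<open>auto simp: restr_def sum_fun_apply\<close>)
  moreover have "supported Y (restr U)" by (simp add: supported_def restr_def)
  moreover have "restr U \<circ> \<sigma> \<in> \<A>" using restr_comp[of U] U by (simp add: A_def)
  ultimately show ?thesis by (simp add: local_ideal_def regular_ops_def)
qed

lemma local_A:
  assumes s: "s \<in> local_ideal K X \<A> \<sigma>"
  shows "s \<circ> \<sigma> \<in> A" "y \<in> S \<Longrightarrow> s y \<in> S"
proof -
  have reg: "regular_map K Y Y s" and sA: "s \<circ> \<sigma> \<in> \<A>"
    using s by (auto simp: local_ideal_def regular_ops_def)
  show sS: "s y \<in> S" if y: "y \<in> S" for y
  proof -
    obtain n :: nat and c T where T: "\<forall>j<n. c j \<in> K \<and> positive_map K Y Y (T j)" "\<forall>x\<in>carr Y. s x = (\<Sum>j<n. c j *\<^sub>C T j x)"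
      using reg unfolding regular_map_def by blast
    have "T j ` S \<subseteq> S" if "j < n" for j using T(1) that by (auto simp: positive_map_def linear_map_def)
    then have "T j y \<in> S" if "j < n" for j using y that by blast
    then show ?thesis using T y by (auto intro!: S_sum S_scale)
  qed
  have \<sigma>S: "\<sigma> v \<in> S" for v
    using \<sigma>_S \<sigma>_out S_0 by (cases "v \<in> carr X") auto
  have "\<sigma> \<circ> (s \<circ> \<sigma>) = s \<circ> \<sigma>" using \<sigma>_fix[OF sS[OF \<sigma>S]] by (auto simp: fun_eq_iff)
  then show "s \<circ> \<sigma> \<in> A" using sA \<sigma>_idem by (simp add: A_def comp_assoc)
qed

text \<open>Condition (b) transported to \<open>X\<close>. The extra \<open>\<sigma>\<close> between
  the two factors is harmless because \<open>t\<close> takes its values in the range.\<close>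

lemma factorization:
  assumes U: "U \<in> A"
  shows "\<exists>s\<in>A. \<exists>t\<in>A. U = s \<circ> t"
proof -
  obtain s t where st: "s \<in> local_ideal K X \<A> \<sigma>" "t \<in> local_ideal K X \<A> \<sigma>" "restr U = s \<circ> t"
    using restr_local[OF U] square by blast
  have \<sigma>S: "\<sigma> v \<in> S" for v
    using \<sigma>_S \<sigma>_out S_0 by (cases "v \<in> carr X") auto
  have "U = restr U \<circ> \<sigma>" using restr_comp[of U] U by (simp add: A_def)
  also have "\<dots> = (s \<circ> \<sigma>) \<circ> (t \<circ> \<sigma>)"
    using \<sigma>_fix[OF local_A(2)[OF st(2) \<sigma>S]] by (auto simp: st(3) fun_eq_iff)
  finally show ?thesis using local_A(1) st by blast
qed

end

context local_setting
begin

text \<open>The first half of (d) at \<open>restr a\<close>, evaluated at \<open>z\<close>: the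
  functionals involved are positive and increase with \<open>n\<close>, so their supremum is their
  pointwise limit.\<close>

lemma weak_right:
  assumes a: "a \<in> Ap" and f: "f \<in> pos (dual K M)" and z: "z \<in> carr M" and E\<A>: "\<And>i j. E i j \<in> pos R \<inter> \<A>"
  shows "(\<lambda>n. f (rm (rm z (P n)) a)) \<longlonglongrightarrow> f (rm z a)"
proof -
  have P\<A>: "P n \<in> pos R \<inter> \<A>" for n
  proof (induction n)
    case (Suc n)
    then show ?case unfolding sum.atMost_Suc using E\<A> \<A>_add R.pos_add by blast
  qed (use E\<A> in simp)
  let ?f = "\<lambda>u z. if z \<in> carr M then f (rm z u) else 0"
  let ?g = "\<lambda>n z. if z \<in> carr M then ?f a (rm z (P n)) else 0"
  have loc: "restr a \<in> local_ideal K X \<A> \<sigma> \<inter> pos (regular_ops K Y)"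
    using restr_local[of a] restr_positive[OF a] a by (auto simp: Ap_def regular_ops_def)
  have ra: "restr a \<circ> \<sigma> = a" using restr_comp ApD(1,7)[OF a] by blast
  have 1: "local_dual_left M rm \<sigma> (restr a) f = ?f a"
    by (simp add: fun_eq_iff local_dual_left_def dual_left_def local_right_def ra)
  have 2: "local_dual_left M rm \<sigma> (natural_proj K Y x n) h = (\<lambda>z. if z \<in> carr M then h (rm z (P n)) else 0)" for n h
    by (simp only: fun_eq_iff local_dual_left_def dual_left_def local_right_def natural_proj_comp simp_thms)
  have sup: "is_sup_in (dual K M) (range ?g) (?f a)"
    using order_continuous[OF loc f] unfolding 1 2 by blast
  have "(\<lambda>n. ?g n z) \<longlonglongrightarrow> ?f a z"
  proof (rule M.dual_sup_tendsto[OF _ _ sup z])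
    show "?g n \<in> pos (dual K M)" for n by (rule pos_dual_rm(1)[OF P\<A> pos_dual_rm(1)[OF ApD(3)[OF a] f]])
    fix n y assume y: "y \<in> pos M"
    have yc: "y \<in> carr M" using y M.pos_in_carr by blast
    have c: "rm y (P n) \<in> carr M" "rm y (E (Suc n) (Suc n)) \<in> carr M" using P\<A> E\<A> yc rm_carr by blast+
    have "rm y (P (Suc n)) = rm y (P n) + rm y (E (Suc n) (Suc n))"
      using rm_linear2[OF yc] P\<A>[of n] E\<A> unfolding linear_over_def sum.atMost_Suc by blast
    moreover have "rm (rm y (P n) + rm y (E (Suc n) (Suc n))) a = rm (rm y (P n)) a + rm (rm y (E (Suc n) (Suc n))) a"
      using rm_linear[OF ApD(1)[OF a]] c unfolding linear_map_def linear_over_def by blast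
    moreover have "f (rm (rm y (P n)) a + rm (rm y (E (Suc n) (Suc n))) a) = f (rm (rm y (P n)) a) + f (rm (rm y (E (Suc n) (Suc n))) a)"
      using f c ApD(1)[OF a] by (intro M.dual_add) (auto simp: M.pos_dual_iff intro: rm_carr)
    moreover have "f (rm (rm y (E (Suc n) (Suc n))) a) \<in> \<real>\<^sub>\<ge>\<^sub>0"
      using f rm_pos[OF ApD(3)[OF a] rm_pos[OF E\<A> y]] by (auto simp: M.pos_dual_iff)
    moreover have "rm y (P (Suc n)) \<in> carr M" using P\<A> yc rm_carr by blast
    ultimately show "?g (Suc n) y - ?g n y \<in> \<real>\<^sub>\<ge>\<^sub>0" using yc c by (simp del: sum.atMost_Suc)
  qed
  moreover have "rm z (P n) \<in> carr M" for n using P\<A> z rm_carr by blast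
  ultimately show ?thesis using z by (simp del: sum.atMost_Suc)
qed

text \<open>The second half of (d), by the same argument for the other action.\<close>

lemma weak_left:
  assumes a: "a \<in> Ap" and f: "f \<in> pos (dual K M)" and z: "z \<in> carr M" and E\<A>: "\<And>i j. E i j \<in> pos R \<inter> \<A>"
  shows "(\<lambda>n. f (lm a (lm (P n) z))) \<longlonglongrightarrow> f (lm a z)"
proof -
  have P\<A>: "P n \<in> pos R \<inter> \<A>" for n
  proof (induction n)
    case (Suc n)
    then show ?case unfolding sum.atMost_Suc using E\<A> \<A>_add R.pos_add by blast
  qed (use E\<A> in simp)
  let ?f = "\<lambda>u z. if z \<in> carr M then f (lm u z) else 0"
  let ?g = "\<lambda>n z. if z \<in> carr M then ?f a (lm (P n) z) else 0"
  have loc: "restr a \<in> local_ideal K X \<A> \<sigma> \<inter> pos (regular_ops K Y)"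
    using restr_local[of a] restr_positive[OF a] a by (auto simp: Ap_def regular_ops_def)
  have ra: "restr a \<circ> \<sigma> = a" using restr_comp ApD(1,7)[OF a] by blast
  have 1: "local_dual_right M lm \<sigma> f (restr a) = ?f a"
    by (simp add: fun_eq_iff local_dual_right_def dual_right_def local_left_def ra)
  have 2: "local_dual_right M lm \<sigma> h (natural_proj K Y x n) = (\<lambda>z. if z \<in> carr M then h (lm (P n) z) else 0)" for n h
    by (simp only: fun_eq_iff local_dual_right_def dual_right_def local_left_def natural_proj_comp simp_thms)
  have sup: "is_sup_in (dual K M) (range ?g) (?f a)"
    using order_continuous[OF loc f] unfolding 1 2 by blast
  have "(\<lambda>n. ?g n z) \<longlonglongrightarrow> ?f a z"
  proof (rule M.dual_sup_tendsto[OF _ _ sup z])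
    show "?g n \<in> pos (dual K M)" for n by (rule pos_dual_rm(2)[OF P\<A> pos_dual_rm(2)[OF ApD(3)[OF a] f]])
    fix n y assume y: "y \<in> pos M"
    have yc: "y \<in> carr M" using y M.pos_in_carr by blast
    have c: "lm (P n) y \<in> carr M" "lm (E (Suc n) (Suc n)) y \<in> carr M" using P\<A> E\<A> yc lm_carr by blast+
    have "lm (P (Suc n)) y = lm (P n) y + lm (E (Suc n) (Suc n)) y"
      using lm_linear2[OF yc] P\<A>[of n] E\<A> unfolding linear_over_def sum.atMost_Suc by blast
    moreover have "lm a (lm (P n) y + lm (E (Suc n) (Suc n)) y) = lm a (lm (P n) y) + lm a (lm (E (Suc n) (Suc n)) y)"
      using lm_linear[OF ApD(1)[OF a]] c unfolding linear_map_def linear_over_def by blast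
    moreover have "f (lm a (lm (P n) y) + lm a (lm (E (Suc n) (Suc n)) y)) = f (lm a (lm (P n) y)) + f (lm a (lm (E (Suc n) (Suc n)) y))"
      using f c ApD(1)[OF a] by (intro M.dual_add) (auto simp: M.pos_dual_iff intro: lm_carr)
    moreover have "f (lm a (lm (E (Suc n) (Suc n)) y)) \<in> \<real>\<^sub>\<ge>\<^sub>0"
      using f lm_pos[OF ApD(3)[OF a] lm_pos[OF E\<A> y]] by (auto simp: M.pos_dual_iff)
    moreover have "lm (P (Suc n)) y \<in> carr M" using P\<A> yc lm_carr by blast
    ultimately show "?g (Suc n) y - ?g n y \<in> \<real>\<^sub>\<ge>\<^sub>0" using yc c by (simp del: sum.atMost_Suc)
  qed
  moreover have "lm (P n) z \<in> carr M" for n using P\<A> z lm_carr by blast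
  ultimately show ?thesis using z by (simp del: sum.atMost_Suc)
qed

lemma matrix_module:
  assumes E\<A>: "\<And>i j. E i j \<in> pos R \<inter> \<A>"
  shows "matrix_module K M A Ap lm rm (\<lambda>a. \<bar>nrm R a\<bar>) (\<lambda>a. 4 * op_norm X X a) E 
    (\<lambda>i j a. Re (coord i (a (x j)))) D C c (4 * bs)"
proof unfold_locales
  show "ksubspace K A" by (rule A_sub)
  show ApA: "Ap \<subseteq> A" by (simp add: Ap_def)
  show "a \<circ> b \<in> A" if "a \<in> A" "b \<in> A" for a b
    using that \<A>_comp by (auto simp: A_def comp_assoc) (metis comp_assoc)
  show "a + b \<in> Ap" if "a \<in> Ap" "b \<in> Ap" for a b
    using that A_sub R.pos_add unfolding Ap_def ksubspace_def by blast
  show "of_real t *\<^sub>C a \<in> Ap" if "0 \<le> t" "a \<in> Ap" for t a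
    using that A_sub R.pos_scale X.K_of_real unfolding Ap_def ksubspace_def by blast
  show "\<exists>p. (\<forall>k<X.units. p k \<in> Ap) \<and> a = (\<Sum>k<X.units. X.cunit k *\<^sub>C p k)" if "a \<in> A" for a
    by (rule A_parts[OF that])
  show "linear_map K M M (lm a)" "linear_map K M M (\<lambda>z. rm z a)" if "a \<in> A" for a
    using lm_linear rm_linear A_\<A>[OF that] by auto
  show "linear_over K A (\<lambda>a. lm a z)" "linear_over K A (rm z)" if "z \<in> carr M" for z
    using lm_linear2[OF that] rm_linear2[OF that] A_\<A> by (auto simp: linear_over_def)
  show "linear_over K A D" using D_linear A_\<A> by (auto simp: linear_over_def)
  show "lm (a \<circ> b) z = lm a (lm b z)" "rm z (a \<circ> b) = rm (rm z a) b" "rm (lm a z) b = lm a (rm z b)"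
    "D (a \<circ> b) z = D b (rm z a) + D a (lm b z)" if "a \<in> A" "b \<in> A" "z \<in> carr M" for a b z
    using that A_\<A> lm_comp rm_comp rm_lm D_derivation by auto
  show "lm a z \<in> pos M" "rm z a \<in> pos M" if "a \<in> Ap" "z \<in> pos M" for a z
    using lm_pos rm_pos ApD(3) that by auto
  show "nrm M (lm a z) \<le> C * \<bar>nrm R a\<bar> * nrm M z" "nrm M (rm z a) \<le> C * \<bar>nrm R a\<bar> * nrm M z" 
    "cmod (D a z) \<le> c * \<bar>nrm R a\<bar> * nrm M z" if "a \<in> A" "z \<in> carr M" for a z
    using module_bound derivation_bound A_\<A> that by auto
  show "D a \<in> carr (dual K M)" if "a \<in> A" for a using D_dual A_\<A> that by blast
  show EA: "E i j \<in> Ap" for i j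
  proof -
    have "\<sigma> \<circ> E i j = E i j"
      by (rule ext) (simp only: comp_apply E_apply \<sigma>_fix[OF S_scale[OF coord_K x_S]])
    moreover have "E i j \<circ> \<sigma> = E i j" unfolding E_def comp_assoc \<sigma>_idem ..
    ultimately show ?thesis using E\<A>[of i j] by (simp add: Ap_def A_def)
  qed
  show "E i j \<circ> E k l = (if j = k then E i l else 0)" for i j k l by (rule E_comp)
  show "0 \<le> 4 * bs" using bs by simp
  show "\<bar>\<nu> (\<Sum>i\<le>n. s i *\<^sub>C E i i)\<bar> \<le> 4 * bs" if s: "\<And>i. s i = 1 \<or> s i = -1" for s n
    using bs X.pos_in_carr s by (intro sign_bound) auto
  show "0 \<le> Re (coord i (a (x j)))" if "a \<in> Ap" for a i j
    using coord_nonneg U_S[OF ApD(4,6,7)[OF that] x_carr] X.positive_mapD(4)[OF ApD(4)[OF that] x_pos] by blast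
  show "Re (coord i ((a + b) (x j))) = Re (coord i (a (x j))) + Re (coord i (b (x j)))" if "a \<in> Ap" "b \<in> Ap" for a b i j
    using coord_add[OF U_S[OF ApD(4,6,7)[OF that(1)] x_carr] U_S[OF ApD(4,6,7)[OF that(2)] x_carr]] by simp
  show "Re (coord i ((of_real t *\<^sub>C a) (x j))) = t * Re (coord i (a (x j)))" if "a \<in> Ap" for a t i j
    using coord_scale[OF U_S[OF ApD(4,6,7)[OF that] x_carr] X.K_of_real] by simp
  show "P n \<circ> a \<circ> P m = (\<Sum>i\<le>n. \<Sum>j\<le>m. of_real (Re (coord i (a (x j)))) *\<^sub>C E i j)" if "a \<in> Ap" for a n m
    by (rule compress_E[OF ApD(4,6,7)[OF that]])
  show "(\<lambda>m. \<bar>\<nu> ((E i i \<circ> a) - (E i i \<circ> a \<circ> P m))\<bar>) \<longlonglongrightarrow> 0" if "a \<in> Ap" for a i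
    by (rule tendsto_rabs_zero[OF left_approx[OF ApD(4,6,7)[OF that] shrinking]])
  show "(\<lambda>n. \<bar>\<nu> ((a \<circ> E j j) - (P n \<circ> a \<circ> E j j))\<bar>) \<longlonglongrightarrow> 0" if "a \<in> Ap" for a j
    by (rule tendsto_rabs_zero[OF right_approx[OF ApD(4,6,7)[OF that]]])
  show "(\<lambda>n. f (rm (rm z (P n)) a)) \<longlonglongrightarrow> f (rm z a)" "(\<lambda>n. f (lm a (lm (P n) z))) \<longlonglongrightarrow> f (lm a z)"
    if "a \<in> Ap" "f \<in> pos (dual K M)" "z \<in> carr M" for a f z
    using weak_right weak_left that E\<A> by auto
  show "\<bar>\<nu> a\<bar> \<le> 4 * op_norm X X a" if "a \<in> Ap" for a
    using \<nu>_U[OF ApD(4,6,7)[OF that]] \<nu>_nonneg[OF ApD(4)[OF that]] by simp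
  show "\<bar>\<nu> (P n \<circ> a \<circ> P m)\<bar> \<le> 4 * op_norm X X a" if "a \<in> Ap" for a n m
    using \<nu>_compress[OF ApD(4,6,7)[OF that]] \<nu>_nonneg[OF compress_positive[OF ApD(4,6,7)[OF that]]] by simp
  show "0 \<le> 4 * op_norm X X a" if "a \<in> Ap" for a
    using U_norm_nonneg[OF ApD(4,6,7)[OF that]] by simp
  show "\<exists>s\<in>A. \<exists>t\<in>A. a = s \<circ> t" if "a \<in> Ap" for a
    using factorization that ApA by blast
qed (use C_nonneg c_nonneg in auto)

text \<open>The decomposition on \<open>Ap\<close> is pulled back along the compression of
  \<open>a\<close> to \<open>\<sigma> \<circ> a \<circ> \<sigma>\<close>. The resulting functions
  live on the cone of \<open>\<A>\<close>, which is the same for all projections, so limits over the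
  system make sense. If no positive element has a nonzero compression, the zero functions serve;
  otherwise the matrix units belong to the ideal.\<close>

lemma local_decomposition:
  obtains \<alpha> \<beta> where "\<And>k. bipositive (pos R \<inter> \<A>) M (\<lambda>a. kappa bs * op_norm X X a) (\<alpha> k)"
    "\<And>k. bipositive (pos R \<inter> \<A>) M (\<lambda>a. kappa bs * op_norm X X a) (\<beta> k)"
    "\<And>a z. a \<in> pos R \<inter> \<A> \<Longrightarrow> z \<in> pos M \<Longrightarrow> D (\<sigma> \<circ> a \<circ> \<sigma>) z = 
      (\<Sum>k<X.units. X.cunit k * of_real (\<alpha> k a z)) - (\<Sum>k<X.units. X.cunit k * of_real (\<beta> k a z))"
proof -
  have op_nonneg: "0 \<le> op_norm X X a" if "a \<in> pos R \<inter> \<A>" for a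
    using that X.positive_bounded[OF X.lattice, of a] X.nrm_nonneg
    by (intro op_norm_nonneg) (auto simp: X.pos_regular_iff bounded_map_def)
  have kappa_nonneg: "0 \<le> kappa bs"
    using decomposition_const_nonneg[of C c "4 * bs"] C_nonneg c_nonneg bs(1) by (simp add: kappa_def)
  show thesis
  proof (cases "\<exists>a\<in>pos R \<inter> \<A>. \<sigma> \<circ> a \<circ> \<sigma> \<noteq> 0")
    case False
    have D0: "D 0 = 0" by (rule linear_over_0[OF \<A>_sub D_linear])
    show thesis
    proof (rule that[of "\<lambda>_ _ _. 0" "\<lambda>_ _ _. 0"])
      show "bipositive (pos R \<inter> \<A>) M (\<lambda>a. kappa bs * op_norm X X a) (\<lambda>_ _. 0)"
        using kappa_nonneg op_nonneg M.nrm_nonneg M.pos_in_carr by (simp add: bipositive_def)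
      then show "bipositive (pos R \<inter> \<A>) M (\<lambda>a. kappa bs * op_norm X X a) (\<lambda>_ _. 0)" .
    qed (use False D0 in simp)
  next
    case True
    then obtain a0 where a0: "a0 \<in> \<A>" "a0 \<in> pos R" "\<sigma> \<circ> a0 \<circ> \<sigma> \<noteq> 0" by blast
    have "E i j \<in> pos R \<inter> \<A>" for i j
      using E_in_ideal[OF ideal_comp \<A>_scale a0] E_positive E_supp by (auto simp: X.pos_regular_iff)
    then interpret mm: matrix_module K M A Ap lm rm "\<lambda>a. \<bar>nrm R a\<bar>" "\<lambda>a. 4 * op_norm X X a" E 
      "\<lambda>i j a. Re (coord i (a (x j)))" D C c "4 * bs" by (rule matrix_module)
    obtain \<alpha> \<beta> where \<alpha>\<beta>: "\<And>k. bipositive Ap M (\<lambda>a. mm.cd * (4 * op_norm X X a)) (\<alpha> k)" 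
      "\<And>k. bipositive Ap M (\<lambda>a. mm.cd * (4 * op_norm X X a)) (\<beta> k)"
      "\<And>a z. a \<in> Ap \<Longrightarrow> z \<in> pos M \<Longrightarrow> 
        D a z = (\<Sum>k<X.units. X.cunit k * of_real (\<alpha> k a z)) - (\<Sum>k<X.units. X.cunit k * of_real (\<beta> k a z))"
      using mm.matrix_decomposition by blast
    have lift: "bipositive (pos R \<inter> \<A>) M (\<lambda>a. kappa bs * op_norm X X a) (\<lambda>a z. \<tau> (\<sigma> \<circ> a \<circ> \<sigma>) z)"
      if \<tau>: "bipositive Ap M (\<lambda>a. mm.cd * (4 * op_norm X X a)) \<tau>" for \<tau>
      unfolding bipositive_def
    proof (intro conjI ballI allI impI)
      fix a z assume a: "a \<in> pos R \<inter> \<A>" and z: "z \<in> pos M"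
      note U = compress_Ap[OF a]
      have ap: "positive_map K X X a" using a by (simp add: X.pos_regular_iff)
      have ab: "nrm X (a v) \<le> op_norm X X a * nrm X v" if "v \<in> carr X" for v
        using X.positive_bounded[OF X.lattice ap] X.nrm_nonneg that by (intro op_norm_bound) (auto simp: bounded_map_def)
      show "0 \<le> \<tau> (\<sigma> \<circ> a \<circ> \<sigma>) z" by (rule bipositiveD(1)[OF \<tau> U z])
      have "op_norm X X (\<sigma> \<circ> a \<circ> \<sigma>) \<le> bs * bs * op_norm X X a"
      proof (rule op_norm_le)
        show "0 \<le> bs * bs * op_norm X X a" using bs op_nonneg[OF a] by simp
        fix v assume v: "v \<in> carr X"
        have \<sigma>v: "\<sigma> v \<in> carr X" "a (\<sigma> v) \<in> carr X" using S_carr[OF \<sigma>_S[OF v]] X.positive_mapD(3)[OF ap] by auto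
        have "nrm X (\<sigma> (a (\<sigma> v))) \<le> bs * nrm X (a (\<sigma> v))" by (rule bs(2)[OF \<sigma>v(2)])
        also have "\<dots> \<le> bs * (op_norm X X a * nrm X (\<sigma> v))" by (intro mult_left_mono ab \<sigma>v bs)
        also have "\<dots> \<le> bs * (op_norm X X a * (bs * nrm X v))" by (intro mult_left_mono bs v op_nonneg a)
        finally show "nrm X ((\<sigma> \<circ> a \<circ> \<sigma>) v) \<le> bs * bs * op_norm X X a * nrm X v" by (simp add: algebra_simps)
      qed
      moreover have "0 \<le> mm.cd" using C_nonneg c_nonneg bs(1) by (intro decomposition_const_nonneg) auto
      ultimately have "mm.cd * (4 * op_norm X X (\<sigma> \<circ> a \<circ> \<sigma>)) * nrm M z \<le> mm.cd * (4 * (bs * bs * op_norm X X a)) * nrm M z"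
        using M.nrm_nonneg[OF M.pos_in_carr[OF z]] by (intro mult_right_mono mult_left_mono) auto
      then show "\<tau> (\<sigma> \<circ> a \<circ> \<sigma>) z \<le> kappa bs * op_norm X X a * nrm M z"
        using bipositiveD(2)[OF \<tau> U z] by (simp add: kappa_def algebra_simps)
      show "\<tau> (\<sigma> \<circ> a \<circ> \<sigma>) (z + z') = \<tau> (\<sigma> \<circ> a \<circ> \<sigma>) z + \<tau> (\<sigma> \<circ> a \<circ> \<sigma>) z'" if "z' \<in> pos M" for z'
        by (rule bipositiveD(4)[OF \<tau> U z that])
      show "\<tau> (\<sigma> \<circ> a \<circ> \<sigma>) (of_real t *\<^sub>C z) = t * \<tau> (\<sigma> \<circ> a \<circ> \<sigma>) z" if "0 \<le> t" for t
        by (rule bipositiveD(6)[OF \<tau> U z that])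
      have \<sigma>c: "\<sigma> v \<in> carr X" for v by (cases "v \<in> carr X") (auto simp: \<sigma>_out intro: S_carr)
      have ac: "a (\<sigma> v) \<in> carr X" for v by (rule X.positive_mapD(3)[OF ap \<sigma>c])
      show "\<tau> (\<sigma> \<circ> (a + a') \<circ> \<sigma>) z = \<tau> (\<sigma> \<circ> a \<circ> \<sigma>) z + \<tau> (\<sigma> \<circ> a' \<circ> \<sigma>) z" if a': "a' \<in> pos R \<inter> \<A>" for a'
      proof -
        have "a' (\<sigma> v) \<in> carr X" for v using a' X.positive_mapD(3)[OF _ \<sigma>c, of a'] by (simp add: X.pos_regular_iff)
        then have "\<sigma> \<circ> (a + a') \<circ> \<sigma> = (\<sigma> \<circ> a \<circ> \<sigma>) + (\<sigma> \<circ> a' \<circ> \<sigma>)" using ac by (auto simp: fun_eq_iff \<sigma>_add)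
        then show ?thesis using bipositiveD(3)[OF \<tau> U z compress_Ap[OF a']] by simp
      qed
      show "\<tau> (\<sigma> \<circ> (of_real t *\<^sub>C a) \<circ> \<sigma>) z = t * \<tau> (\<sigma> \<circ> a \<circ> \<sigma>) z" if "0 \<le> t" for t
      proof -
        have "\<sigma> \<circ> (of_real t *\<^sub>C a) \<circ> \<sigma> = of_real t *\<^sub>C (\<sigma> \<circ> a \<circ> \<sigma>)" using ac by (auto simp: fun_eq_iff \<sigma>_scale)
        then show ?thesis using bipositiveD(5)[OF \<tau> U z that] by simp
      qed
    qed
    show thesis
      by (rule that[of "\<lambda>k a z. \<alpha> k (\<sigma> \<circ> a \<circ> \<sigma>) z" "\<lambda>k a z. \<beta> k (\<sigma> \<circ> a \<circ> \<sigma>) z"])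
        (fact lift[OF \<alpha>\<beta>(1)] lift[OF \<alpha>\<beta>(2)] \<alpha>\<beta>(3)[OF compress_Ap])+
  qed
qed

end


section \<open>Passage to the limit\<close>

lemma sum_lessThan_add: "(\<Sum>j<m + n. g j) = (\<Sum>j<m. g j) + (\<Sum>j<n. g (m + j))"
  for g :: "nat \<Rightarrow> 'a::comm_monoid_add"
  by (induction n) (simp_all add: add.assoc)

lemma linear_over_combination:
  "(\<And>i. i \<in> I \<Longrightarrow> linear_over K S (f i)) \<Longrightarrow> linear_over K S (\<lambda>a. \<Sum>i\<in>I. c i *\<^sub>C f i a)"
  unfolding linear_over_def by (simp add: sum.distrib cv.scale_right_distrib cv.scale_sum_right mult.commute)

lemma linear_over_plus: 
  "linear_over K S f \<Longrightarrow> linear_over K S g \<Longrightarrow> linear_over K S (\<lambda>a. f a + g a)"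
  unfolding linear_over_def by (simp add: cv.scale_right_distrib add_ac)

context derivation_setting
begin

lemma complexified_ideal: "complexified_space K (sub R \<A>)"
proof -
  have real: "real_part (sub R \<A>) \<subseteq> real_part R" by (auto simp: real_part_def)
  then have imag: "imag_part K (sub R \<A>) \<subseteq> imag_part K R" by (auto simp: imag_part_def)
  show ?thesis
  proof
    show "ksubspace K (carr (sub R \<A>))" using \<A>_sub by simp
    show "pos (sub R \<A>) \<subseteq> carr (sub R \<A>)" "0 \<in> pos (sub R \<A>)" using \<A>_0 by auto
    show "a + b \<in> pos (sub R \<A>)" if "a \<in> pos (sub R \<A>)" "b \<in> pos (sub R \<A>)" for a b
      using that R.pos_add \<A>_add by auto
    show "of_real t *\<^sub>C a \<in> pos (sub R \<A>)" if "0 \<le> t" "a \<in> pos (sub R \<A>)" for t a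
      using that R.pos_scale \<A>_scale X.K_of_real by auto
    show "a = 0 \<and> b = 0" if "a \<in> real_part (sub R \<A>)" "b \<in> imag_part K (sub R \<A>)" "a + \<i> *\<^sub>C b = 0" for a b
      using R.decomp_0 that real imag by blast
    fix a assume "a \<in> carr (sub R \<A>)"
    then obtain p where p: "\<forall>k<X.units. p k \<in> pos R \<inter> \<A>" "a = (\<Sum>k<X.units. X.cunit k *\<^sub>C p k)"
      using ideal_parts by auto
    show "\<exists>u\<in>real_part (sub R \<A>). \<exists>v\<in>imag_part K (sub R \<A>). a = u + \<i> *\<^sub>C v"
    proof (cases "K = \<real>")
      case True
      have "X.units = 2" unfolding X.units_def if_P[OF True] ..
      then have "p 0 \<in> pos R \<inter> \<A>" "p (Suc 0) \<in> pos R \<inter> \<A>" using p(1) by auto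
      then have "p 0 - p (Suc 0) \<in> real_part (sub R \<A>)" unfolding real_part_def sub_simps by blast
      moreover have "a = (p 0 - p (Suc 0)) + \<i> *\<^sub>C 0" unfolding p(2) X.sum_cunit if_P[OF True] by simp
      moreover have "0 \<in> imag_part K (sub R \<A>)" unfolding imag_part_def if_P[OF True] by simp
      ultimately show ?thesis by blast
    next
      case False
      have "X.units = 4" unfolding X.units_def if_not_P[OF False] ..
      then have "p 0 \<in> pos R \<inter> \<A>" "p (Suc 0) \<in> pos R \<inter> \<A>" "p 2 \<in> pos R \<inter> \<A>" "p 3 \<in> pos R \<inter> \<A>" using p(1) by auto
      then have "p 0 - p 2 \<in> real_part (sub R \<A>)" "p (Suc 0) - p 3 \<in> real_part (sub R \<A>)" 
        unfolding real_part_def sub_simps by blast+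
      moreover have "a = (p 0 - p 2) + \<i> *\<^sub>C (p (Suc 0) - p 3)" unfolding p(2) X.sum_cunit if_not_P[OF False] ..
      ultimately show ?thesis unfolding imag_part_def if_not_P[OF False] by blast
    qed
  qed
qed

text \<open>The extension by linearity announced for the end: first in \<open>z\<close> for each
  positive \<open>a\<close>, giving a positive functional, then in \<open>a\<close>, using that
  functionals agreeing on the cone of \<open>M\<close> are equal.\<close>

lemma operator_extension:
  assumes \<tau>: "bipositive (pos R \<inter> \<A>) M b \<tau>"
  obtains T where "positive_map K (sub R \<A>) (dual K M) T" 
    "\<And>a z. a \<in> pos R \<inter> \<A> \<Longrightarrow> z \<in> pos M \<Longrightarrow> T a z = of_real (\<tau> a z)"
proof -
  interpret S: complexified_space K "sub R \<A>" by (rule complexified_ideal)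
  have "\<exists>f. f \<in> pos (dual K M) \<and> (\<forall>z\<in>pos M. f z = of_real (\<tau> a z))" if a: "a \<in> pos R \<inter> \<A>" for a
  proof (rule M.dual_from_pos[of "\<tau> a" "\<bar>b a\<bar>"])
    show "\<tau> a z \<le> \<bar>b a\<bar> * nrm M z" if z: "z \<in> pos M" for z
      using bipositiveD(2)[OF \<tau> a z] mult_right_mono[OF abs_ge_self M.nrm_nonneg[OF M.pos_in_carr[OF z]], of "b a"] by simp
  qed (use bipositiveD(1,4,6)[OF \<tau> a] in auto)
  then obtain \<phi> where \<phi>: "\<And>a. a \<in> pos R \<inter> \<A> \<Longrightarrow> \<phi> a \<in> pos (dual K M)"
    "\<And>a z. a \<in> pos R \<inter> \<A> \<Longrightarrow> z \<in> pos M \<Longrightarrow> \<phi> a z = of_real (\<tau> a z)" by metis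
  have \<phi>d: "\<phi> a \<in> carr (dual K M)" if "a \<in> pos R \<inter> \<A>" for a using \<phi>(1)[OF that] by (simp add: M.pos_dual_iff)
  note dsub = M.ksubspace_dual[unfolded ksubspace_def]
  obtain T where T: "linear_over K \<A> T" "\<And>a. a \<in> pos R \<inter> \<A> \<Longrightarrow> T a = \<phi> a"
  proof (rule S.linear_extension[of \<phi>])
    fix a a' assume a: "a \<in> pos (sub R \<A>)" "a' \<in> pos (sub R \<A>)"
    then have aa: "a + a' \<in> pos R \<inter> \<A>" using S.pos_add[OF a] by simp
    show "\<phi> (a + a') = \<phi> a + \<phi> a'"
    proof (rule M.dual_eqI[OF \<phi>d[OF aa]])
      show "\<phi> a + \<phi> a' \<in> carr (dual K M)" using dsub \<phi>d a by simp
      fix z assume "z \<in> pos M"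
      then show "\<phi> (a + a') z = (\<phi> a + \<phi> a') z"
        using \<phi>(2)[OF aa] \<phi>(2)[of a] \<phi>(2)[of a'] bipositiveD(3)[OF \<tau>, of a z a'] a by simp
    qed
  next
    fix t :: real and a assume t: "0 \<le> t" and a: "a \<in> pos (sub R \<A>)"
    then have aa: "of_real t *\<^sub>C a \<in> pos R \<inter> \<A>" using S.pos_scale[OF t a] by simp
    show "\<phi> (of_real t *\<^sub>C a) = of_real t *\<^sub>C \<phi> a"
    proof (rule M.dual_eqI[OF \<phi>d[OF aa]])
      show "of_real t *\<^sub>C \<phi> a \<in> carr (dual K M)" using dsub \<phi>d[of a] a X.K_of_real by simp
      fix z assume "z \<in> pos M"
      then show "\<phi> (of_real t *\<^sub>C a) z = (of_real t *\<^sub>C \<phi> a) z"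
        using \<phi>(2)[OF aa] \<phi>(2)[of a] bipositiveD(5)[OF \<tau>, of a z t] a t by simp
    qed
  qed (use that in simp)
  have "T a \<in> carr (dual K M)" if a: "a \<in> \<A>" for a
  proof -
    obtain p where p: "\<And>k. k < X.units \<Longrightarrow> p k \<in> pos R \<inter> \<A>" "a = (\<Sum>k<X.units. X.cunit k *\<^sub>C p k)"
      using ideal_parts[OF a] by blast
    have "T a = (\<Sum>k<X.units. X.cunit k *\<^sub>C T (p k))"
      unfolding p(2) using p(1) by (intro linear_over_sum[OF \<A>_sub T(1)]) auto
    also have "\<dots> \<in> carr (dual K M)"
    proof (rule ksubspace_sum[OF M.ksubspace_dual])
      fix k assume "k \<in> {..<X.units}"
      then have "T (p k) \<in> carr (dual K M)" using T(2) \<phi>d p(1) by simp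
      then show "X.cunit k *\<^sub>C T (p k) \<in> carr (dual K M)" using dsub X.cunit_K by blast
    qed
    finally show ?thesis .
  qed
  then have "positive_map K (sub R \<A>) (dual K M) T"
    using T \<phi>(1) by (auto simp: positive_map_def linear_map_def)
  then show thesis using that[of T] T(2) \<phi>(2) by simp
qed

lemma regular_of_bipositive:
  assumes \<alpha>: "\<And>k. bipositive (pos R \<inter> \<A>) M b (\<alpha> k)" and \<beta>: "\<And>k. bipositive (pos R \<inter> \<A>) M b (\<beta> k)"
    and D: "\<And>a z. a \<in> pos R \<inter> \<A> \<Longrightarrow> z \<in> pos M \<Longrightarrow> 
      D a z = (\<Sum>k<X.units. X.cunit k * of_real (\<alpha> k a z)) - (\<Sum>k<X.units. X.cunit k * of_real (\<beta> k a z))"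
  shows "regular_map K (sub R \<A>) (dual K M) D"
proof -
  have "\<exists>T. positive_map K (sub R \<A>) (dual K M) T \<and> (\<forall>a\<in>pos R \<inter> \<A>. \<forall>z\<in>pos M. T a z = of_real (\<alpha> k a z))" for k
    using operator_extension[OF \<alpha>] by metis
  then obtain T where T: "\<And>k. positive_map K (sub R \<A>) (dual K M) (T k)" 
    "\<And>k a z. a \<in> pos R \<inter> \<A> \<Longrightarrow> z \<in> pos M \<Longrightarrow> T k a z = of_real (\<alpha> k a z)" by metis
  have "\<exists>T. positive_map K (sub R \<A>) (dual K M) T \<and> (\<forall>a\<in>pos R \<inter> \<A>. \<forall>z\<in>pos M. T a z = of_real (\<beta> k a z))" for k
    using operator_extension[OF \<beta>] by metis
  then obtain U where U: "\<And>k. positive_map K (sub R \<A>) (dual K M) (U k)" 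
    "\<And>k a z. a \<in> pos R \<inter> \<A> \<Longrightarrow> z \<in> pos M \<Longrightarrow> U k a z = of_real (\<beta> k a z)" by metis
  let ?F = "\<lambda>a. (\<Sum>k<X.units. X.cunit k *\<^sub>C T k a) + (\<Sum>k<X.units. (- X.cunit k) *\<^sub>C U k a)"
  have lin: "linear_over K \<A> (T k)" "linear_over K \<A> (U k)" and car: "a \<in> \<A> \<Longrightarrow> T k a \<in> carr (dual K M)" 
    "a \<in> \<A> \<Longrightarrow> U k a \<in> carr (dual K M)" for k a
    using T(1)[of k] U(1)[of k] by (auto simp: positive_map_def linear_map_def)
  have Fcar: "?F a \<in> carr (dual K M)" if "a \<in> \<A>" for a
  proof -
    have "(\<Sum>k<X.units. X.cunit k *\<^sub>C T k a) \<in> carr (dual K M)" "(\<Sum>k<X.units. (- X.cunit k) *\<^sub>C U k a) \<in> carr (dual K M)"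
      by (intro ksubspace_sum[OF M.ksubspace_dual] M.scaled_dual X.cunit_K X.K_minus car that)+
    then show ?thesis using M.ksubspace_dual unfolding ksubspace_def by blast
  qed
  have Fpos: "D a = ?F a" if a: "a \<in> pos R \<inter> \<A>" for a
  proof (rule M.dual_eqI)
    show "D a \<in> carr (dual K M)" using D_dual a by blast
    show "?F a \<in> carr (dual K M)" using Fcar a by blast
    fix z assume z: "z \<in> pos M"
    show "D a z = ?F a z"
      using D[OF a z] T(2)[OF a z] U(2)[OF a z] by (simp add: sum_fun_apply sum_negf)
  qed
  have "D a = ?F a" if a: "a \<in> \<A>" for a
  proof -
    obtain p where p: "\<And>k. k < X.units \<Longrightarrow> p k \<in> pos R \<inter> \<A>" "a = (\<Sum>k<X.units. X.cunit k *\<^sub>C p k)"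
      using ideal_parts[OF a] by blast
    have lin_a: "L a = (\<Sum>k<X.units. X.cunit k *\<^sub>C L (p k))" if "linear_over K \<A> L" for L :: "('x \<Rightarrow> 'x) \<Rightarrow> 'm \<Rightarrow> complex"
      unfolding p(2) using p(1) by (intro linear_over_sum[OF \<A>_sub that]) auto
    have "linear_over K \<A> ?F"
      by (intro linear_over_plus linear_over_combination lin)
    from lin_a[OF this] have "?F a = (\<Sum>k<X.units. X.cunit k *\<^sub>C ?F (p k))" .
    also have "\<dots> = (\<Sum>k<X.units. X.cunit k *\<^sub>C D (p k))"
      by (intro sum.cong refl arg_cong2[where f = scaleC] Fpos[symmetric] p(1)) simp
    also have "\<dots> = D a" by (rule lin_a[OF D_linear, symmetric])
    finally show ?thesis by simp
  qed
  then show ?thesis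
    unfolding regular_map_def
    \<comment> \<open>The \<open>T\<close> with coefficients \<open>cunit\<close> are followed by
      the \<open>U\<close> with the negated coefficients in one enumeration of length
      \<open>units + units\<close>.\<close>
    by (intro exI[of _ "X.units + X.units"] exI[of _ "\<lambda>j. if j < X.units then X.cunit j else - X.cunit (j - X.units)"]
        exI[of _ "\<lambda>j. if j < X.units then T j else U (j - X.units)"])
      (auto simp: T(1) U(1) X.K_minus sum_lessThan_add)
qed

text \<open>The bound \<open>b\<close> does not depend on the projection, so chosen local
  decompositions converge pointwise along a universal subfilter of \<open>F\<close>. Along it
  \<open>D (\<sigma> \<circ> a \<circ> \<sigma>)\<close> tends to \<open>D a\<close>, and uniqueness
  of limits gives a decomposition of \<open>D\<close>.\<close>

lemma regular_of_local:
  fixes F :: "('x \<Rightarrow> 'x) filter"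
  assumes F: "F \<noteq> bot"
    and local: "eventually (\<lambda>\<sigma>. \<exists>\<alpha> \<beta>. (\<forall>k. bipositive (pos R \<inter> \<A>) M b (\<alpha> k)) \<and> (\<forall>k. bipositive (pos R \<inter> \<A>) M b (\<beta> k)) \<and>
      (\<forall>a\<in>pos R \<inter> \<A>. \<forall>z\<in>pos M. D (\<sigma> \<circ> a \<circ> \<sigma>) z = 
         (\<Sum>k<X.units. X.cunit k * of_real (\<alpha> k a z)) - (\<Sum>k<X.units. X.cunit k * of_real (\<beta> k a z)))) F"
    and lim: "\<And>a. a \<in> \<A> \<Longrightarrow> ((\<lambda>\<sigma>. D (\<sigma> \<circ> a \<circ> \<sigma>)) \<longlongrightarrow> D a) F"
  shows "regular_map K (sub R \<A>) (dual K M) D"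
proof -
  define Q where "Q \<sigma> \<alpha> \<beta> \<longleftrightarrow> (\<forall>k. bipositive (pos R \<inter> \<A>) M b (\<alpha> k)) \<and> (\<forall>k. bipositive (pos R \<inter> \<A>) M b (\<beta> k)) \<and>
      (\<forall>a\<in>pos R \<inter> \<A>. \<forall>z\<in>pos M. D (\<sigma> \<circ> a \<circ> \<sigma>) z = 
         (\<Sum>k<X.units. X.cunit k * of_real (\<alpha> k a z)) - (\<Sum>k<X.units. X.cunit k * of_real (\<beta> k a z)))" for \<sigma> \<alpha> \<beta>
  define \<alpha> where "\<alpha> \<sigma> = (SOME \<alpha>. \<exists>\<beta>. Q \<sigma> \<alpha> \<beta>)" for \<sigma>
  define \<beta> where "\<beta> \<sigma> = (SOME \<beta>. Q \<sigma> (\<alpha> \<sigma>) \<beta>)" for \<sigma>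
  have Q: "eventually (\<lambda>\<sigma>. Q \<sigma> (\<alpha> \<sigma>) (\<beta> \<sigma>)) F"
    using local
  proof eventually_elim
    case (elim \<sigma>)
    then have "\<exists>\<alpha> \<beta>. Q \<sigma> \<alpha> \<beta>" by (simp only: Q_def)
    then have "\<exists>\<beta>. Q \<sigma> (\<alpha> \<sigma>) \<beta>" unfolding \<alpha>_def by (rule someI_ex)
    then show ?case unfolding \<beta>_def by (rule someI_ex)
  qed
  obtain G where G: "G \<le> F" "G \<noteq> bot" "\<And>h::('x \<Rightarrow> 'x) \<Rightarrow> real. Bfun h F \<Longrightarrow> (h \<longlongrightarrow> Lim G h) G"
    using universal_limits[OF F] by metis
  have \<alpha>F: "eventually (\<lambda>\<sigma>. bipositive (pos R \<inter> \<A>) M b (\<alpha> \<sigma> k)) F" 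
    and \<beta>F: "eventually (\<lambda>\<sigma>. bipositive (pos R \<inter> \<A>) M b (\<beta> \<sigma> k)) F" for k
    using Q by (auto simp: Q_def elim: eventually_mono)
  have cone: "a + a' \<in> pos R \<inter> \<A>" "0 \<le> t \<Longrightarrow> of_real t *\<^sub>C a \<in> pos R \<inter> \<A>" 
    if "a \<in> pos R \<inter> \<A>" "a' \<in> pos R \<inter> \<A>" for a a' t
    using that R.pos_add R.pos_scale \<A>_add \<A>_scale X.K_of_real by auto
  note limits = bipositive_Lim[OF _ G cone(1) cone(2) M.pos_add M.pos_scale]
  show ?thesis
  proof (rule regular_of_bipositive)
    show "bipositive (pos R \<inter> \<A>) M b (\<lambda>a z. Lim G (\<lambda>\<sigma>. \<alpha> \<sigma> k a z))" for k
      by (rule limits(1)[OF \<alpha>F])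
    show "bipositive (pos R \<inter> \<A>) M b (\<lambda>a z. Lim G (\<lambda>\<sigma>. \<beta> \<sigma> k a z))" for k
      by (rule limits(1)[OF \<beta>F])
    fix a z assume a: "a \<in> pos R \<inter> \<A>" and z: "z \<in> pos M"
    have "((\<lambda>\<sigma>. D (\<sigma> \<circ> a \<circ> \<sigma>) z) \<longlongrightarrow> D a z) G"
      using tendsto_fun_apply[OF lim] tendsto_mono[OF G(1)] a by blast
    moreover have "eventually (\<lambda>\<sigma>. D (\<sigma> \<circ> a \<circ> \<sigma>) z = (\<Sum>k<X.units. X.cunit k * of_real (\<alpha> \<sigma> k a z)) - (\<Sum>k<X.units. X.cunit k * of_real (\<beta> \<sigma> k a z))) G"
      using filter_leD[OF G(1) Q] by eventually_elim (use a z in \<open>simp add: Q_def\<close>)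
    ultimately have "((\<lambda>\<sigma>. (\<Sum>k<X.units. X.cunit k * of_real (\<alpha> \<sigma> k a z)) - (\<Sum>k<X.units. X.cunit k * of_real (\<beta> \<sigma> k a z))) \<longlongrightarrow> D a z) G"
      by (rule Lim_transform_eventually)
    moreover have "((\<lambda>\<sigma>. (\<Sum>k<X.units. X.cunit k * of_real (\<alpha> \<sigma> k a z)) - (\<Sum>k<X.units. X.cunit k * of_real (\<beta> \<sigma> k a z))) \<longlongrightarrow>
        (\<Sum>k<X.units. X.cunit k * of_real (Lim G (\<lambda>\<sigma>. \<alpha> \<sigma> k a z))) - (\<Sum>k<X.units. X.cunit k * of_real (Lim G (\<lambda>\<sigma>. \<beta> \<sigma> k a z)))) G"
      by (intro tendsto_diff tendsto_sum tendsto_mult_left tendsto_of_real limits(2)[OF \<alpha>F] limits(2)[OF \<beta>F] a z)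
    ultimately show "D a z = (\<Sum>k<X.units. X.cunit k * of_real (Lim G (\<lambda>\<sigma>. \<alpha> \<sigma> k a z))) - (\<Sum>k<X.units. X.cunit k * of_real (Lim G (\<lambda>\<sigma>. \<beta> \<sigma> k a z)))"
      using tendsto_unique[OF G(2)] by blast
  qed
qed

end

text \<open>The image of \<open>x i\<close> is concentrated in one summand, where it is an atom. An
  element between 0 and this image vanishes in all other summands, since their cones are proper, and
  is a multiple of the atom in this one.\<close>

lemma star_basis_atom:
  assumes K: "scalar_field K" and Y: "ksubspace K (carr Y)" "pos Y \<subseteq> carr Y" and x: "star_basis K Y \<mu> x"
  shows "atom Y (x i)"
proof -
  interpret scalar_field K by (rule K)
  obtain m F E e f a \<phi> where star: "star_summands K \<mu> m (F :: nat \<Rightarrow> 'a onspace) (E :: (nat \<Rightarrow> complex) nspace) e" 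
    and iso: "isometric_lattice_iso K Y (direct_sum (index_set m) F E e) f"
    and arr: "\<forall>n\<in>index_set m. star_arrangement K (F n) \<mu> (a n)" 
    and \<phi>: "bij_betw \<phi> (index_set m \<times> UNIV) (UNIV :: nat set)"
    and fx: "\<forall>n\<in>index_set m. \<forall>k. f (x (\<phi> (n, k))) = (\<lambda>j. if j = n then a n k else 0)"
    using x unfolding star_basis_def by blast
  let ?S = "direct_sum (index_set m) F E e"
  have pos_S: "v \<in> pos ?S \<longleftrightarrow> v \<in> carr ?S \<and> (\<forall>j\<in>index_set m. v j \<in> pos (F j))" for v
    by (simp add: direct_sum_def Let_def)
  have carr_S: "v j = 0" if "v \<in> carr ?S" "j \<notin> index_set m" for v j
    using that by (simp add: direct_sum_def Let_def)
  have F: "banach_lattice K (F j)" if "j \<in> index_set m" for j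
    using star that by (auto simp: star_summands_def)
  have xY: "x i \<in> carr Y" using x by (auto simp: star_basis_def schauder_basis_def)
  obtain n k where nk: "n \<in> index_set m" "i = \<phi> (n, k)"
    using \<phi> unfolding bij_betw_def by (metis (no_types, lifting) UNIV_I imageE mem_Sigma_iff surj_pair)
  have fxi: "f (x i) = (\<lambda>j. if j = n then a n k else 0)" using fx nk by blast
  have "bij_betw (a n) UNIV {a. atom (F n) a \<and> nrm (F n) a = 1}"
    using arr nk(1) unfolding star_arrangement_def by blast
  then have an: "atom (F n) (a n k)" unfolding bij_betw_def by blast
  have flin: "linear_over K (carr Y) f" and fS: "\<And>y. y \<in> carr Y \<Longrightarrow> f y \<in> carr ?S" and finj: "inj_on f (carr Y)"
    and fpos: "\<And>y. y \<in> carr Y \<Longrightarrow> f y \<in> pos ?S \<longleftrightarrow> y \<in> pos Y"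
    using iso by (auto simp: isometric_lattice_iso_def bij_betw_def)
  have "f (x i) \<in> pos ?S"
    unfolding pos_S using fS[OF xY] F an by (auto simp: fxi atom_def banach_lattice_def)
  then have xp: "x i \<in> pos Y" using fpos[OF xY] by blast
  have xn: "x i \<noteq> 0"
  proof
    assume "x i = 0"
    then have "f (x i) = 0" using linear_over_0[OF Y(1) flin] by simp
    then have "a n k = 0" unfolding fxi by (auto simp: fun_eq_iff split: if_splits)
    then show False using an by (simp add: atom_def)
  qed
  have "\<exists>t. y = of_real t *\<^sub>C x i" if y: "y \<in> pos Y" "x i - y \<in> pos Y" for y
  proof -
    have yc: "y \<in> carr Y" "x i - y \<in> carr Y" using y Y(2) by auto
    have fy: "f y \<in> pos ?S" "f (x i) - f y \<in> pos ?S"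
      using fpos[OF yc(1)] fpos[OF yc(2)] y linear_over_diff[OF Y(1) flin K_neg1 xY yc(1)] by simp_all
    have off: "f y j = 0" if "j \<noteq> n" for j
    proof (cases "j \<in> index_set m")
      case True
      have "f y j \<in> pos (F j)" "f (x i) j - f y j \<in> pos (F j)" using fy True unfolding pos_S by auto
      then have "f y j \<in> pos (F j) \<and> - f y j \<in> pos (F j)" using that by (simp add: fxi)
      then show ?thesis using F[OF True] unfolding banach_lattice_def by blast
    next
      case False
      then show ?thesis using carr_S fS[OF yc(1)] by blast
    qed
    have "f y n \<in> pos (F n)" "f (x i) n - f y n \<in> pos (F n)" using fy nk(1) unfolding pos_S by auto
    then obtain t where t: "f y n = of_real t *\<^sub>C a n k" using an by (auto simp: atom_def le_in_def fxi)
    have "f y = of_real t *\<^sub>C f (x i)"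
    proof (rule ext)
      fix j show "f y j = (of_real t *\<^sub>C f (x i)) j"
        using off[of j] t by (cases "j = n") (simp_all add: fxi)
    qed
    also have "\<dots> = f (of_real t *\<^sub>C x i)" using flin xY K_of_real by (simp add: linear_over_def)
    finally have "y = of_real t *\<^sub>C x i"
      using finj yc(1) Y(1) xY K_of_real unfolding inj_on_def ksubspace_def by blast
    then show ?thesis by blast
  qed
  then show ?thesis using xp xn by (auto simp: atom_def le_in_def)
qed

text \<open>Directedness makes the sets of later projections a filter base, and each of them
  contains its own projection. The system is nonempty because the closure of the empty set is empty,
  while \<open>carr B\<close> contains 0.\<close>

lemma (in blattice) system_filter:
  assumes P: "directed_bounded_generating_system K B P"
  shows "system_filter B P \<noteq> bot" "eventually (\<lambda>\<sigma>. \<sigma> \<in> P) (system_filter B P)"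
proof -
  have "P \<noteq> {}"
  proof
    assume "P = {}"
    then have "nclosure B {} = carr B" using P by (simp add: directed_bounded_generating_system_def)
    moreover have "nclosure B {} = {}" unfolding nclosure_def using zero_less_one[where 'a = real] by blast
    ultimately show False using carr_0 by blast
  qed
  have ev: "eventually Q (system_filter B P) \<longleftrightarrow> (\<exists>\<sigma>\<in>P. eventually Q (principal {\<tau> \<in> P. \<sigma> ` carr B \<subseteq> \<tau> ` carr B}))" for Q
    unfolding system_filter_def
  proof (rule eventually_INF_base[OF \<open>P \<noteq> {}\<close>])
    fix \<sigma> \<tau> assume "\<sigma> \<in> P" "\<tau> \<in> P"
    then obtain \<rho> where "\<rho> \<in> P" "\<sigma> ` carr B \<subseteq> \<rho> ` carr B" "\<tau> ` carr B \<subseteq> \<rho> ` carr B"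
      using P unfolding directed_bounded_generating_system_def by blast
    then show "\<exists>\<rho>\<in>P. principal {\<pi> \<in> P. \<rho> ` carr B \<subseteq> \<pi> ` carr B} \<le>
        inf (principal {\<pi> \<in> P. \<sigma> ` carr B \<subseteq> \<pi> ` carr B}) (principal {\<pi> \<in> P. \<tau> ` carr B \<subseteq> \<pi> ` carr B})"
      by (intro bexI[of _ \<rho>] inf_greatest; simp only: principal_le_iff; blast)
  qed
  show "eventually (\<lambda>\<sigma>. \<sigma> \<in> P) (system_filter B P)"
    unfolding ev eventually_principal using \<open>P \<noteq> {}\<close> by auto
  show "system_filter B P \<noteq> bot"
    unfolding trivial_limit_def ev eventually_principal by auto
qed

theorem theorem4p1:
  fixes K :: "complex set"
    and X :: "'x::complex_vector onspace"
    and P :: "('x \<Rightarrow> 'x) set"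
    and \<mu> :: real
    and x :: "('x \<Rightarrow> 'x) \<Rightarrow> nat \<Rightarrow> 'x"
    and \<A> :: "('x \<Rightarrow> 'x) set"
    and M :: "'m::complex_vector onspace"
    and lm :: "('x \<Rightarrow> 'x) \<Rightarrow> 'm \<Rightarrow> 'm"
    and rm :: "'m \<Rightarrow> ('x \<Rightarrow> 'x) \<Rightarrow> 'm"
  assumes scalars: "K = \<real> \<or> K = UNIV"
    and X: "banach_lattice K X"
    and system: "directed_bounded_generating_system K X P"
    and \<mu>: "1 \<le> \<mu>"
    and members: "{\<sigma> ` carr X | \<sigma>. \<sigma> \<in> P} \<subseteq> star_sublattices K X \<mu>"
    and bases: "\<forall>\<sigma>\<in>P. star_basis K (range_lattice X \<sigma>) \<mu> (x \<sigma>)"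
    and ideal: "closed_riesz_algebra_ideal K X \<A>"
    and nonzero: "\<A> \<noteq> {0}"
    and M: "banach_lattice_module K (sub (regular_ops K X) \<A>) M lm rm"
    and a: "\<forall>\<sigma>\<in>P. shrinking K (range_lattice X \<sigma>) (x \<sigma>)"
    and b: "\<forall>\<sigma>\<in>P. {s \<circ> t | s t. s \<in> local_ideal K X \<A> \<sigma> \<and> t \<in> local_ideal K X \<A> \<sigma>} =
              local_ideal K X \<A> \<sigma>"
    and c: "\<forall>\<sigma>\<in>P.
              weak_star_closed K M (sup_map K (dual K M)
                (\<lambda>n f. local_dual_left M rm \<sigma> (natural_proj K (range_lattice X \<sigma>) (x \<sigma>) n) f) `
                carr (dual K M)) \<and>
              weak_star_closed K M (sup_map K (dual K M)
                (\<lambda>n f. local_dual_right M lm \<sigma> f (natural_proj K (range_lattice X \<sigma>) (x \<sigma>) n)) `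
                carr (dual K M))"
    and d: "\<forall>\<sigma>\<in>P. \<forall>a \<in> local_ideal K X \<A> \<sigma> \<inter> pos (regular_ops K (range_lattice X \<sigma>)).
            \<forall>f \<in> pos (dual K M).
              is_sup_in (dual K M)
                (range (\<lambda>n. local_dual_left M rm \<sigma> (natural_proj K (range_lattice X \<sigma>) (x \<sigma>) n)
                  (local_dual_left M rm \<sigma> a f)))
                (local_dual_left M rm \<sigma> a f) \<and>
              is_sup_in (dual K M)
                (range (\<lambda>n. local_dual_right M lm \<sigma> (local_dual_right M lm \<sigma> f a)
                  (natural_proj K (range_lattice X \<sigma>) (x \<sigma>) n)))
                (local_dual_right M lm \<sigma> f a)"
    and A_or_B:
      "(\<forall>\<sigma>\<in>P.
          no_c0_subsequences K M (local_dual_left M rm \<sigma>) (local_dual_right M lm \<sigma>)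
            (coord_proj K (range_lattice X \<sigma>) (x \<sigma>)) \<or>
          (reflexive K (range_lattice X \<sigma>) \<and>
           (\<exists>i j. finite_dim K
              (corner K M (local_dual_left M rm \<sigma>) (local_dual_right M lm \<sigma>)
                (coord_proj K (range_lattice X \<sigma>) (x \<sigma>) i)
                (coord_proj K (range_lattice X \<sigma>) (x \<sigma>) j))))) \<or>
       (\<forall>D. bounded_derivation K (sub (regular_ops K X) (approximable_ops K X)) M lm rm D \<longrightarrow>
          inner_derivation K (sub (regular_ops K X) (approximable_ops K X)) M lm rm D)"
  shows "\<forall>D. bounded_derivation K (sub (regular_ops K X) \<A>) M lm rm D \<and>
             (\<forall>a\<in>\<A>. ((\<lambda>\<sigma>. D (\<sigma> \<circ> a \<circ> \<sigma>)) \<longlongrightarrow> D a) (system_filter X P)) \<longrightarrow>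
           regular_map K (sub (regular_ops K X) \<A>) (dual K M) D"
proof (intro allI impI)
  fix D :: "('x \<Rightarrow> 'x) \<Rightarrow> 'm \<Rightarrow> complex"
  assume D: "bounded_derivation K (sub (regular_ops K X) \<A>) M lm rm D \<and>
    (\<forall>a\<in>\<A>. ((\<lambda>\<sigma>. D (\<sigma> \<circ> a \<circ> \<sigma>)) \<longlongrightarrow> D a) (system_filter X P))"
  have K: "scalar_field K" using scalars by unfold_locales
  have M_lattice: "banach_lattice K M" using M by (simp add: banach_lattice_module_def)
  interpret X: blattice K X using K X by (simp add: blattice_def blattice_axioms_def)
  interpret M: blattice K M using K M_lattice by (simp add: blattice_def blattice_axioms_def)
  obtain C where "\<forall>a\<in>\<A>. \<forall>z\<in>carr M. nrm M (lm a z) \<le> C * nrm (regular_ops K X) a * nrm M z \<and> 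
      nrm M (rm z a) \<le> C * nrm (regular_ops K X) a * nrm M z"
    using M unfolding banach_lattice_module_def sub_def by auto
  then have C: "nrm M (lm a z) \<le> C * nrm (regular_ops K X) a * nrm M z \<and> 
      nrm M (rm z a) \<le> C * nrm (regular_ops K X) a * nrm M z" if "a \<in> \<A>" "z \<in> carr M" for a z
    using that by blast
  obtain c where c: "\<And>a. a \<in> \<A> \<Longrightarrow> nrm (dual K M) (D a) \<le> c * nrm (regular_ops K X) a"
    using D by (auto simp: bounded_derivation_def bounded_map_def sub_def)
  have abs_le: "b * r * n \<le> \<bar>b\<bar> * \<bar>r\<bar> * n" if "0 \<le> n" for b r n :: real
    using mult_right_mono[OF abs_ge_self[of "b * r"] that] by (simp add: abs_mult)
  interpret derivation_setting K X M \<A> lm rm D "\<bar>C\<bar>" "\<bar>c\<bar>"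
  proof unfold_locales
    fix a z assume a: "a \<in> \<A>" and z: "z \<in> carr M"
    note n = abs_le[OF M.nrm_nonneg[OF z]]
    show "nrm M (lm a z) \<le> \<bar>C\<bar> * \<bar>nrm (regular_ops K X) a\<bar> * nrm M z \<and> 
      nrm M (rm z a) \<le> \<bar>C\<bar> * \<bar>nrm (regular_ops K X) a\<bar> * nrm M z"
      using C[OF a z] n[of C "nrm (regular_ops K X) a"] by linarith
    have "D a \<in> carr (dual K M)"
      using D a by (auto simp: bounded_derivation_def bounded_map_def linear_map_def sub_def)
    then have "cmod (D a z) \<le> nrm (dual K M) (D a) * nrm M z" by (rule M.dual_nrm_bound[OF _ z])
    also have "\<dots> \<le> c * nrm (regular_ops K X) a * nrm M z" by (intro mult_right_mono c a M.nrm_nonneg z)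
    also have "\<dots> \<le> \<bar>c\<bar> * \<bar>nrm (regular_ops K X) a\<bar> * nrm M z" by (rule n)
    finally show "cmod (D a z) \<le> \<bar>c\<bar> * \<bar>nrm (regular_ops K X) a\<bar> * nrm M z" .
  qed (use ideal M D in auto)
  from system have "\<exists>r. \<forall>\<sigma>\<in>P. nrm R \<sigma> \<le> r"
    by (simp only: directed_bounded_generating_system_def)
  then obtain r where r: "nrm R \<sigma> \<le> r" if "\<sigma> \<in> P" for \<sigma> by blast
  show "regular_map K (sub (regular_ops K X) \<A>) (dual K M) D"
  \<comment> \<open>Boundedness of the system enters here: \<open>r\<close> bounds the regular norms
    of all projections, so one constant \<open>kappa \<bar>r\<bar>\<close> works for every
    \<open>\<sigma>\<close>.\<close>
  proof (rule regular_of_local[where F = "system_filter X P" and b = "\<lambda>a. kappa \<bar>r\<bar> * op_norm X X a"])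
    show "system_filter X P \<noteq> bot" by (rule X.system_filter(1)[OF system])
    show "((\<lambda>\<sigma>. D (\<sigma> \<circ> a \<circ> \<sigma>)) \<longlongrightarrow> D a) (system_filter X P)" if "a \<in> \<A>" for a
      using D that by blast
    have "\<exists>\<alpha> \<beta>. (\<forall>k. bipositive (pos R \<inter> \<A>) M (\<lambda>a. kappa \<bar>r\<bar> * op_norm X X a) (\<alpha> k)) \<and>
        (\<forall>k. bipositive (pos R \<inter> \<A>) M (\<lambda>a. kappa \<bar>r\<bar> * op_norm X X a) (\<beta> k)) \<and>
        (\<forall>a\<in>pos R \<inter> \<A>. \<forall>z\<in>pos M. D (\<sigma> \<circ> a \<circ> \<sigma>) z =
          (\<Sum>k<X.units. X.cunit k * of_real (\<alpha> k a z)) - (\<Sum>k<X.units. X.cunit k * of_real (\<beta> k a z)))"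
      if \<sigma>: "\<sigma> \<in> P" for \<sigma>
    proof -
      have \<sigma>pos: "positive_map K X X \<sigma>" "supported X \<sigma>" and \<sigma>idem: "\<sigma> \<circ> \<sigma> = \<sigma>" 
        and riesz: "riesz_subspace K X (\<sigma> ` carr X)"
        using system \<sigma> by (auto simp: directed_bounded_generating_system_def X.pos_regular_iff)
      have Y: "ksubspace K (carr (range_lattice X \<sigma>))" "pos (range_lattice X \<sigma>) \<subseteq> carr (range_lattice X \<sigma>)"
        using riesz by (auto simp: riesz_subspace_def range_lattice_def sub_def)
      have star: "star_basis K (range_lattice X \<sigma>) \<mu> (x \<sigma>)" using bases \<sigma> by blast
      interpret local_setting K X M \<A> lm rm D "\<bar>C\<bar>" "\<bar>c\<bar>" \<sigma> "x \<sigma>" "\<bar>r\<bar>"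
      proof (intro local_setting.intro local_setting_axioms.intro)
        show "derivation_setting K X M \<A> lm rm D \<bar>C\<bar> \<bar>c\<bar>" by (rule derivation_setting_axioms)
        show "atomic_projection K X \<sigma> (x \<sigma>)"
          using \<sigma>pos \<sigma>idem riesz star star_basis_atom[OF K Y star]
          by unfold_locales (auto simp: star_basis_def)
        show "shrinking K (range_lattice X \<sigma>) (x \<sigma>)" using a \<sigma> by blast
        show "0 \<le> \<bar>r\<bar>" by simp
        show "nrm X (\<sigma> v) \<le> \<bar>r\<bar> * nrm X v" if v: "v \<in> carr X" for v
        proof -
          have "nrm R \<sigma> \<le> \<bar>r\<bar>" using r[OF \<sigma>] by linarith
          then show ?thesis
            using X.regular_norm_bound[OF \<sigma>pos(1) v] mult_right_mono[OF _ X.nrm_nonneg[OF v]] by (meson order_trans)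
        qed
        show "{s \<circ> t | s t. s \<in> local_ideal K X \<A> \<sigma> \<and> t \<in> local_ideal K X \<A> \<sigma>} = local_ideal K X \<A> \<sigma>"
          using b \<sigma> by (rule bspec)
        fix u f assume u: "u \<in> local_ideal K X \<A> \<sigma> \<inter> pos (regular_ops K (range_lattice X \<sigma>))" and f: "f \<in> pos (dual K M)"
        show "is_sup_in (dual K M)
            (range (\<lambda>n. local_dual_left M rm \<sigma> (natural_proj K (range_lattice X \<sigma>) (x \<sigma>) n) (local_dual_left M rm \<sigma> u f)))
            (local_dual_left M rm \<sigma> u f) \<and>
          is_sup_in (dual K M)
            (range (\<lambda>n. local_dual_right M lm \<sigma> (local_dual_right M lm \<sigma> f u) (natural_proj K (range_lattice X \<sigma>) (x \<sigma>) n)))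
            (local_dual_right M lm \<sigma> f u)"
          by (rule bspec[OF bspec[OF bspec[OF d \<sigma>] u] f])
      qed
      show ?thesis
        by (rule local_decomposition) blast
    qed
    then show "eventually (\<lambda>\<sigma>. \<exists>\<alpha> \<beta>. (\<forall>k. bipositive (pos R \<inter> \<A>) M (\<lambda>a. kappa \<bar>r\<bar> * op_norm X X a) (\<alpha> k)) \<and>
        (\<forall>k. bipositive (pos R \<inter> \<A>) M (\<lambda>a. kappa \<bar>r\<bar> * op_norm X X a) (\<beta> k)) \<and>
        (\<forall>a\<in>pos R \<inter> \<A>. \<forall>z\<in>pos M. D (\<sigma> \<circ> a \<circ> \<sigma>) z =
          (\<Sum>k<X.units. X.cunit k * of_real (\<alpha> k a z)) - (\<Sum>k<X.units. X.cunit k * of_real (\<beta> k a z)))) (system_filter X P)"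
      by (rule eventually_mono[OF X.system_filter(2)[OF system]])
  qed
qed

end
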